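(* Algorithm find-parameter-domains (specified in the context, with the tacit assumptions listed there) can be implemented to run in $O(m n_p n_e (n_p+n_e))$ time and $O(m n_p)$ space in the worst case, where $m$ is the number of constants in the problem specification, $n_p$ is the combined number of preconditions for all operators (and goals, if included), and $n_e$ is the combined number of operator effects (including those of $\ast\mathrm{start}\ast$).
   Context: **Operators.** Terms are constants or variables; distinct constants denote distinct entities. An atom is a predicate symbol applied to terms; a literal is an atom or a negated atom. A UCPOP-style operator has a finite list of parameters (the words "parameter" and "variable" are used interchangeably) and consists of one *primary* when-clause, whose preconditions must always be satisfied for the operator to be applied and whose effects are always asserted, and zero or more *secondary* when-clauses (conditional effects), whose preconditions may or may not be satisfied and whose effects are asserted when they are (in addition to the primary preconditions). Preconditions are literals or binding conditions $(\mathrm{EQ}\ u\ v)$, $(\mathrm{NEQ}\ u\ v)$ (identity, non-identity of terms); effects are literals. Operators contain no quantifiers, no disjunctive preconditions and no "facts" (conditions established by external functions). The input (problem specification) consists of a set of operators, initial conditions (positive predications with constant arguments) and goals (which may be omitted). The initial conditions are treated as an operator $\ast\mathrm{start}\ast$ with no preconditions, having the initial conditions as effects; the goals are treated as an operator $\ast\mathrm{end}\ast$ with no effects, having the goals as preconditions. Variables in goals are treated like operator parameters. **Domains.** For each precondition and each variable in it there is an *individual domain* of that variable (a set of constants) particular to that precondition. For each when-clause and each parameter of its operator there is an *intersected domain*, which is computed as the intersection of the individual domains of the parameter relative to the preconditions of that when-clause and the primary preconditions of the operator in which the parameter occurs. Individual domains are initially empty (nil). Intersected domains are initially either nil or $T$,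 where $T$ is the universal domain; the intersected domain of a parameter relative to a when-clause is $T$ just in case the parameter occurs neither in the preconditions of the when-clause nor in the primary preconditions. Negative conditions are ignored (neither matched nor propagated); EQ-conditions are used only in step 3, and NEQ-conditions are not used. **Algorithm find-parameter-domains(operators, inits, goals).** $W$ is a list of when-clauses whose effects are to be propagated. 1. Initialize $W$ to the initial conditions, so that it contains just the (primary) when-clause of $\ast\mathrm{start}\ast$. 2. Repeat steps (a)–(c) until $W=\mathrm{nil}$: (a) Unify the positive effects of all when-clauses in $W$ with all possible operator preconditions, and mark the preconditions successfully matched in this way as "matched" (this marking is permanent). Unification is as usual, except that when an effect variable $v$ is unified with a constant $c$ in a precondition, the unification succeeds, with unifier $v=c$, just in case $c$ is an element of the intersected domain of $v$ (for the relevant when-clause). Augment the individual domain of each matched precondition variable with a set $C$ of constants defined as follows: if the precondition variable was unified with a constant $c$, then $C=\{c\}$; if it was unified with an effect variable, then $C$ is the intersected domain of that effect variable (relative to the when-clause to which the effect belongs). (b) Mark those when-clauses as "propagation candidates" that have all their preconditions (including corresponding primary preconditions) marked as "matched" and that involve at least one variable for which some relevant individual domain was augmented in step (a). (c) Reset $W$ to nil. For all when-clauses that are propagation candidates, compute new intersected domains for their variables. If an intersected domain of a when-clause is thereby enlarged, and all intersected domains for the when-clause are now nonempty, then add the when-clause to $W$. 3. Further restrict intersected domains using equative preconditions of form $(\mathrm{EQ}\ u\ v)$: form a common intersected domain if both $u$ and $v$ are variables; if $u$ is a constant and $v$ a variable, reduce the intersected domain of $v$ by intersecting it with $\{u\}$;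 similarly if $u$ is a variable and $v$ a constant. If the equation belongs to a primary when-clause, use it to reduce the intersected domains of $u$ and $v$ (whichever are variables) in the secondary clauses as well. 4. Return the intersected domains as the parameter domains. **Tacit assumptions.** (i) The unification of any operator effect with any operator precondition requires constant time. (ii) There is a fixed upper bound on the number of arguments that a predicate (in a precondition or effect) can have; it follows that $O(n_e)$ is an upper bound on the total number of intersected domains (if a parameter appears in a precondition of a when-clause but in none of its effects, its intersected domain is not propagated, and the implementation can ignore such parameters). (iii) Individual and intersected domains are stored in hash tables indexed by the constants in the domain, so that checking whether an element belongs to a particular domain, and possibly adding it, takes essentially constant time; furthermore, for each individual and intersected domain, data structures keep track of the (possibly empty) set of new elements added to the domain in the last update attempt. *)

theory Defs
  imports Main "HOL-Library.While_Combinator"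
begin

section \<open>Operators and problem specifications\<close>

text \<open>
  Constants, variables and predicate symbols are named by natural numbers; different names
  denote different entities.  Terms are polymorphic in the variable names so that two
  function-free atoms can be renamed apart before they are unified.
\<close>

datatype 'v trm = Cst nat | Var 'v

datatype atom = Atom (pred: nat) (args: "nat trm list")

datatype literal = Pos atom | Neg atom

datatype condition = Lit literal | EQ "nat trm" "nat trm" | NEQ "nat trm" "nat trm"

datatype when_clause = When (pre: "condition list") (eff: "literal list")

datatype operator = Operator (params: "nat list") (primary: when_clause) (secondary: "when_clause list")

text \<open>An empty list of goals stands for omitted goals.\<close>

datatype problem = Problem (operators: "operator list") (inits: "atom list") (goals: "condition list")

fun trm_vars :: "'v trm \<Rightarrow> 'v list" where
  "trm_vars (Cst c) = []"
| "trm_vars (Var v) = [v]"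

fun trm_consts :: "'v trm \<Rightarrow> nat list" where
  "trm_consts (Cst c) = [c]"
| "trm_consts (Var v) = []"

fun lit_atom :: "literal \<Rightarrow> atom" where
  "lit_atom (Pos a) = a"
| "lit_atom (Neg a) = a"

fun cond_terms :: "condition \<Rightarrow> nat trm list" where
  "cond_terms (Lit l) = args (lit_atom l)"
| "cond_terms (EQ s t) = [s, t]"
| "cond_terms (NEQ s t) = [s, t]"

definition clause_terms :: "when_clause \<Rightarrow> nat trm list" where
  "clause_terms cl = concat (map cond_terms (pre cl)) @ concat (map (args \<circ> lit_atom) (eff cl))"

definition clauses :: "operator \<Rightarrow> when_clause list" where
  "clauses op = primary op # secondary op"

definition start_op :: "problem \<Rightarrow> operator" where
  "start_op P = Operator [] (When [] (map Pos (inits P))) []"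

definition end_op :: "problem \<Rightarrow> operator" where
  "end_op P = Operator (concat (map trm_vars (concat (map cond_terms (goals P)))))
                       (When (goals P) []) []"

definition all_ops :: "problem \<Rightarrow> operator list" where
  "all_ops P = start_op P # operators P @ [end_op P]"

definition all_clauses :: "problem \<Rightarrow> when_clause list" where
  "all_clauses P = concat (map clauses (all_ops P))"

definition consts_of :: "problem \<Rightarrow> nat set" where
  "consts_of P = (\<Union>cl \<in> set (all_clauses P). \<Union>t \<in> set (clause_terms cl). set (trm_consts t))"

definition num_consts :: "problem \<Rightarrow> nat" where
  "num_consts P = card (consts_of P)"

definition num_pre :: "problem \<Rightarrow> nat" where
  "num_pre P = sum_list (map (length \<circ> pre) (all_clauses P))"

definition num_eff :: "problem \<Rightarrow> nat" where
  "num_eff P = sum_list (map (length \<circ> eff) (all_clauses P))"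

definition wf_problem :: "problem \<Rightarrow> bool" where
  "wf_problem P \<longleftrightarrow>
     (\<forall>op \<in> set (operators P). \<forall>cl \<in> set (clauses op). \<forall>t \<in> set (clause_terms cl).
        set (trm_vars t) \<subseteq> set (params op)) \<and>
     (\<forall>a \<in> set (inits P). \<forall>t \<in> set (args a). trm_vars t = [])"

definition arity_bounded :: "nat \<Rightarrow> problem \<Rightarrow> bool" where
  "arity_bounded A P \<longleftrightarrow>
     (\<forall>cl \<in> set (all_clauses P).
        (\<forall>l. Lit l \<in> set (pre cl) \<longrightarrow> length (args (lit_atom l)) \<le> A) \<and>
        (\<forall>l \<in> set (eff cl). length (args (lit_atom l)) \<le> A))"


section \<open>Unification\<close>

fun subst :: "('v \<Rightarrow> 'w trm) \<Rightarrow> 'v trm \<Rightarrow> 'w trm" where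
  "subst \<sigma> (Cst c) = Cst c"
| "subst \<sigma> (Var v) = \<sigma> v"

definition is_unifier :: "('v \<Rightarrow> 'v trm) \<Rightarrow> 'v trm list \<Rightarrow> 'v trm list \<Rightarrow> bool" where
  "is_unifier \<sigma> ss ts \<longleftrightarrow> map (subst \<sigma>) ss = map (subst \<sigma>) ts"

definition is_mgu :: "('v \<Rightarrow> 'v trm) \<Rightarrow> 'v trm list \<Rightarrow> 'v trm list \<Rightarrow> bool" where
  "is_mgu \<sigma> ss ts \<longleftrightarrow> is_unifier \<sigma> ss ts \<and>
     (\<forall>\<tau>. is_unifier \<tau> ss ts \<longrightarrow> (\<exists>\<rho>. \<forall>v. \<tau> v = subst \<rho> (\<sigma> v)))"

definition mgu :: "'v trm list \<Rightarrow> 'v trm list \<Rightarrow> ('v \<Rightarrow> 'v trm) option" where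
  "mgu ss ts = (if \<exists>\<sigma>. is_mgu \<sigma> ss ts then Some (SOME \<sigma>. is_mgu \<sigma> ss ts) else None)"

text \<open>
  Renaming apart: \<open>Inl v\<close> is the effect variable \<open>v\<close>, \<open>Inr u\<close> the precondition variable \<open>u\<close>.
  The argument \<open>D\<close> gives the intersected domains of the effect variables relative to the
  when-clause of the effect; an effect variable may only be bound to a constant in its domain.
\<close>

definition unify :: "(nat \<Rightarrow> nat set) \<Rightarrow> atom \<Rightarrow> atom \<Rightarrow> (nat + nat \<Rightarrow> (nat + nat) trm) option" where
  "unify D e p =
     (if pred e \<noteq> pred p then None
      else case mgu (map (map_trm Inl) (args e)) (map (map_trm Inr) (args p)) of
        None \<Rightarrow> None
      | Some \<sigma> \<Rightarrow>
          if \<forall>v c. Var v \<in> set (args e) \<and> \<sigma> (Inl v) = Cst c \<longrightarrow> c \<in> D v then Some \<sigma> else None)"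

text \<open>
  The set by which the individual domain of the precondition variable \<open>u\<close> is augmented after a
  successful unification.  Normally \<open>u\<close> is unified with one effect variable; if repeated
  variables unify it with several ones, all their domains apply.
\<close>

definition contribution ::
    "(nat \<Rightarrow> nat set) \<Rightarrow> atom \<Rightarrow> (nat + nat \<Rightarrow> (nat + nat) trm) \<Rightarrow> nat \<Rightarrow> nat set" where
  "contribution D e \<sigma> u =
     (case \<sigma> (Inr u) of
        Cst c \<Rightarrow> {c}
      | Var _ \<Rightarrow> \<Inter>{D v |v. Var v \<in> set (args e) \<and> \<sigma> (Inl v) = \<sigma> (Inr u)})"


section \<open>The algorithm find-parameter-domains\<close>

text \<open>
  A when-clause is identified by the position \<open>i\<close> of its operator in \<^const>\<open>all_ops\<close> and its
  position \<open>j\<close> in that operator (\<open>0\<close> for the primary one); a precondition by \<open>i\<close>, \<open>j\<close> and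
  its position in the list of preconditions.
\<close>

type_synonym clause_id = "nat \<times> nat"
type_synonym pre_id = "nat \<times> nat \<times> nat"

definition the_op :: "problem \<Rightarrow> clause_id \<Rightarrow> operator" where
  "the_op P k = all_ops P ! fst k"

definition the_clause :: "problem \<Rightarrow> clause_id \<Rightarrow> when_clause" where
  "the_clause P k = clauses (the_op P k) ! snd k"

definition clause_ids :: "problem \<Rightarrow> clause_id set" where
  "clause_ids P = {(i, j). i < length (all_ops P) \<and> j < length (clauses (all_ops P ! i))}"

text \<open>
  Negative preconditions are ignored and (in)equations have no individual domains, so only
  positive predications are matched.
\<close>

definition pos_pre :: "problem \<Rightarrow> (pre_id \<times> atom) set" where
  "pos_pre P = {((i, j, l), a). (i, j) \<in> clause_ids P \<and> l < length (pre (the_clause P (i, j))) \<and>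
                                pre (the_clause P (i, j)) ! l = Lit (Pos a)}"

definition pos_eff :: "problem \<Rightarrow> clause_id \<Rightarrow> atom set" where
  "pos_eff P k = {a. Pos a \<in> set (eff (the_clause P k))}"

text \<open>The positive preconditions of a when-clause together with the primary ones of its operator.\<close>

definition relevant :: "problem \<Rightarrow> clause_id \<Rightarrow> (pre_id \<times> atom) set" where
  "relevant P k = {((i, j, l), a) \<in> pos_pre P. i = fst k \<and> (j = snd k \<or> j = 0)}"

text \<open>
  The universal domain is the set of all constants of the problem specification; it is the
  value below for a parameter without relevant preconditions.
\<close>

definition intersected :: "problem \<Rightarrow> (pre_id \<Rightarrow> nat \<Rightarrow> nat set) \<Rightarrow> clause_id \<Rightarrow> nat \<Rightarrow> nat set" where
  "intersected P ind k x =
     consts_of P \<inter> (\<Inter>(q, a) \<in> {(q, a) \<in> relevant P k. Var x \<in> set (args a)}. ind q x)"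

record fpd_state =
  individual :: "pre_id \<Rightarrow> nat \<Rightarrow> nat set"
  matched :: "pre_id set"
  inters :: "clause_id \<Rightarrow> nat \<Rightarrow> nat set"
  worklist :: "clause_id set"

definition fpd_init :: "problem \<Rightarrow> fpd_state" where
  "fpd_init P = \<lparr>individual = (\<lambda>q u. {}), matched = {},
                 inters = intersected P (\<lambda>q u. {}), worklist = {(0, 0)}\<rparr>"

text \<open>The successful unifications of step (a): the precondition \<open>q\<close> with atom \<open>p\<close>, the effect \<open>e\<close> of clause \<open>k\<close>, and the unifier.\<close>

definition matches ::
    "problem \<Rightarrow> fpd_state \<Rightarrow> (pre_id \<times> atom \<times> clause_id \<times> atom \<times> (nat + nat \<Rightarrow> (nat + nat) trm)) set" where
  "matches P s = {(q, p, k, e, \<sigma>). (q, p) \<in> pos_pre P \<and> k \<in> worklist s \<and> e \<in> pos_eff P k \<and>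
                                   unify (inters s k) e p = Some \<sigma>}"

definition matched_step :: "problem \<Rightarrow> fpd_state \<Rightarrow> pre_id set" where
  "matched_step P s = matched s \<union> {q. \<exists>p k e \<sigma>. (q, p, k, e, \<sigma>) \<in> matches P s}"

definition individual_step :: "problem \<Rightarrow> fpd_state \<Rightarrow> pre_id \<Rightarrow> nat \<Rightarrow> nat set" where
  "individual_step P s q u = individual s q u \<union>
     {c. \<exists>p k e \<sigma>. (q, p, k, e, \<sigma>) \<in> matches P s \<and> Var u \<in> set (args p) \<and>
                   c \<in> contribution (inters s k) e \<sigma> u}"

definition candidates :: "problem \<Rightarrow> fpd_state \<Rightarrow> clause_id set" where
  "candidates P s = {k \<in> clause_ids P.
     (\<forall>(q, a) \<in> relevant P k. q \<in> matched_step P s) \<and>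
     (\<exists>(q, a) \<in> relevant P k. \<exists>u. Var u \<in> set (args a) \<and>
        individual s q u \<subset> individual_step P s q u)}"

definition inters_step :: "problem \<Rightarrow> fpd_state \<Rightarrow> clause_id \<Rightarrow> nat \<Rightarrow> nat set" where
  "inters_step P s k = (if k \<in> candidates P s then intersected P (individual_step P s) k else inters s k)"

definition worklist_step :: "problem \<Rightarrow> fpd_state \<Rightarrow> clause_id set" where
  "worklist_step P s = {k \<in> candidates P s.
     (\<exists>x \<in> set (params (the_op P k)). inters s k x \<subset> inters_step P s k x) \<and>
     (\<forall>x \<in> set (params (the_op P k)). inters_step P s k x \<noteq> {})}"

definition fpd_step :: "problem \<Rightarrow> fpd_state \<Rightarrow> fpd_state" where
  "fpd_step P s = \<lparr>individual = individual_step P s, matched = matched_step P s,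
                   inters = inters_step P s, worklist = worklist_step P s\<rparr>"

text \<open>
  The final restriction by equations.  An equation between variables gives them a \<^emph>\<open>common\<close>
  domain, so a restriction of one of them affects all variables linked to it.
\<close>

definition equations :: "problem \<Rightarrow> clause_id \<Rightarrow> (nat trm \<times> nat trm) set" where
  "equations P k = {(s, t). EQ s t \<in> set (pre (the_clause P k)) \<or> EQ t s \<in> set (pre (the_clause P k)) \<or>
                            EQ s t \<in> set (pre (primary (the_op P k))) \<or> EQ t s \<in> set (pre (primary (the_op P k)))}"

definition linked :: "problem \<Rightarrow> clause_id \<Rightarrow> (nat \<times> nat) set" where
  "linked P k = {(x, y). (Var x, Var y) \<in> equations P k}\<^sup>*"

definition eq_restrict :: "problem \<Rightarrow> (clause_id \<Rightarrow> nat \<Rightarrow> nat set) \<Rightarrow> clause_id \<Rightarrow> nat \<Rightarrow> nat set" where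
  "eq_restrict P D k x =
     {c. \<forall>y. (x, y) \<in> linked P k \<longrightarrow>
           c \<in> D k y \<and> (\<forall>c'. (Var y, Cst c') \<in> equations P k \<longrightarrow> c = c')}"

text \<open>The result is \<^const>\<open>None\<close> if the main loop does not terminate.\<close>

definition find_parameter_domains :: "problem \<Rightarrow> (clause_id \<Rightarrow> nat \<Rightarrow> nat set) option" where
  "find_parameter_domains P =
     map_option (\<lambda>s. eq_restrict P (inters s))
       (while_option (\<lambda>s. worklist s \<noteq> {}) (fpd_step P) (fpd_init P))"


section \<open>Machine model\<close>

text \<open>
  A word machine whose memory consists of finitely many hash tables.  \<open>Get t [e1, ..., en]\<close> is
  the entry of table \<open>t\<close> under the key given by the values of \<open>e1, ..., en\<close>, and \<open>0\<close> if there is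
  no entry; tables with the empty key serve as registers.  \<open>In r c\<close> reads the word in
  row \<open>r\<close> and column \<open>c\<close> of the read-only input (\<open>0\<close> outside the input).  Sums are computed modulo
  the word size \<open>B\<close>, so large data cannot be packed into one word.

  Every assignment, test and \<open>Skip\<close> takes one time unit.  The expressions of a
  fixed program have bounded size, so charging for their evaluation would only change constants.
  Table entries are never removed: the number of entries in the final memory is the largest
  number of words ever in use.
\<close>

datatype exp =
    Const nat
  | In exp exp
  | Get nat "exp list"
  | Plus exp exp
  | Minus exp exp
  | Equal exp exp
  | Less exp exp

datatype com =
    Skip
  | Put nat "exp list" exp
  | Seq com com
  | Cond exp com com
  | Loop exp com

type_synonym input = "nat list list"
type_synonym mem = "nat \<times> nat list \<rightharpoonup> nat"

definition input_word :: "input \<Rightarrow> nat \<Rightarrow> nat \<Rightarrow> nat" where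
  "input_word I r c = (if r < length I \<and> c < length (I ! r) then I ! r ! c else 0)"

fun eval :: "nat \<Rightarrow> input \<Rightarrow> mem \<Rightarrow> exp \<Rightarrow> nat" where
  "eval B I M (Const n) = n"
| "eval B I M (In e f) = input_word I (eval B I M e) (eval B I M f)"
| "eval B I M (Get t es) = (case M (t, map (eval B I M) es) of None \<Rightarrow> 0 | Some n \<Rightarrow> n)"
| "eval B I M (Plus e f) = (eval B I M e + eval B I M f) mod B"
| "eval B I M (Minus e f) = eval B I M e - eval B I M f"
| "eval B I M (Equal e f) = (if eval B I M e = eval B I M f then 1 else 0)"
| "eval B I M (Less e f) = (if eval B I M e < eval B I M f then 1 else 0)"

text \<open>\<open>exec B I c M n M'\<close>: the command \<open>c\<close>, started in memory \<open>M\<close>, halts after \<open>n\<close> steps in memory \<open>M'\<close>.\<close>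

inductive exec :: "nat \<Rightarrow> input \<Rightarrow> com \<Rightarrow> mem \<Rightarrow> nat \<Rightarrow> mem \<Rightarrow> bool" for B :: nat and I :: input where
  Skip: "exec B I Skip M 1 M"
| Put: "exec B I (Put t es e) M 1 (M((t, map (eval B I M) es) \<mapsto> eval B I M e))"
| Seq: "exec B I c1 M n1 M1 \<Longrightarrow> exec B I c2 M1 n2 M2 \<Longrightarrow> exec B I (Seq c1 c2) M (n1 + n2) M2"
| CondTrue: "eval B I M e \<noteq> 0 \<Longrightarrow> exec B I c1 M n M1 \<Longrightarrow> exec B I (Cond e c1 c2) M (n + 1) M1"
| CondFalse: "eval B I M e = 0 \<Longrightarrow> exec B I c2 M n M1 \<Longrightarrow> exec B I (Cond e c1 c2) M (n + 1) M1"
| LoopFalse: "eval B I M e = 0 \<Longrightarrow> exec B I (Loop e c) M 1 M"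
| LoopTrue: "eval B I M e \<noteq> 0 \<Longrightarrow> exec B I c M n1 M1 \<Longrightarrow> exec B I (Loop e c) M1 n2 M2 \<Longrightarrow>
    exec B I (Loop e c) M (n1 + n2 + 1) M2"


section \<open>Problem specifications as input\<close>

text \<open>
  The input lists all preconditions and then all effects, one row each, together with
  the when-clause they belong to.  Parameter lists are not needed: a parameter
  that occurs in no precondition of its operator has the universal domain.
\<close>

fun enc_trm :: "nat trm \<Rightarrow> nat list" where
  "enc_trm (Cst c) = [0, c]"
| "enc_trm (Var x) = [1, x]"

fun enc_lit :: "literal \<Rightarrow> nat list" where
  "enc_lit (Pos a) = [0, pred a, length (args a)] @ concat (map enc_trm (args a))"
| "enc_lit (Neg a) = [1, pred a, length (args a)] @ concat (map enc_trm (args a))"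

fun enc_cond :: "condition \<Rightarrow> nat list" where
  "enc_cond (Lit l) = enc_lit l"
| "enc_cond (EQ s t) = [2, 0, 2] @ enc_trm s @ enc_trm t"
| "enc_cond (NEQ s t) = [3, 0, 2] @ enc_trm s @ enc_trm t"

definition pre_rows :: "problem \<Rightarrow> nat list list" where
  "pre_rows P = [[i, j] @ enc_cond b. (i, op) \<leftarrow> enumerate 0 (all_ops P),
                                      (j, cl) \<leftarrow> enumerate 0 (clauses op), b \<leftarrow> pre cl]"

definition eff_rows :: "problem \<Rightarrow> nat list list" where
  "eff_rows P = [[i, j] @ enc_lit l. (i, op) \<leftarrow> enumerate 0 (all_ops P),
                                     (j, cl) \<leftarrow> enumerate 0 (clauses op), l \<leftarrow> eff cl]"

definition encode :: "problem \<Rightarrow> input" where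
  "encode P = [num_pre P, num_eff P] # pre_rows P @ eff_rows P"

text \<open>
  Words have logarithmically many bits: the word size is a fixed power \<open>w\<close> of the problem size.
\<close>

definition word_size :: "nat \<Rightarrow> problem \<Rightarrow> nat" where
  "word_size w P = (num_consts P + num_pre P + num_eff P) ^ w"


section \<open>Implementations\<close>

text \<open>
  A memory represents a family of domains if a query program decides membership within \<open>T\<close> steps;
  the query is its input and the answer is left in register \<open>0\<close>.  This covers hash tables
  indexed by constants, and allows when-clauses to share a table.
\<close>

definition represents_domains ::
    "nat \<Rightarrow> problem \<Rightarrow> com \<Rightarrow> nat \<Rightarrow> mem \<Rightarrow> (clause_id \<Rightarrow> nat \<Rightarrow> nat set) \<Rightarrow> bool" where
  "represents_domains B P query T M D \<longleftrightarrow>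
     (\<forall>(i, j) \<in> clause_ids P. \<forall>x \<in> set (params (the_op P (i, j))). \<forall>c \<in> consts_of P.
        \<exists>n M'. exec B [[i, j, x, c]] query M n M' \<and> n \<le> T \<and>
               M' (0, []) = Some (if c \<in> D (i, j) x then 1 else 0))"

text \<open>
  \<open>prog\<close>, started with empty memory, computes the result of the algorithm within \<open>time\<close> steps,
  using at most \<open>space\<close> words of memory (including the words that store the result, but not
  the read-only input).
\<close>

definition implements_fpd ::
    "nat \<Rightarrow> com \<Rightarrow> com \<Rightarrow> nat \<Rightarrow> problem \<Rightarrow> nat \<Rightarrow> nat \<Rightarrow> bool" where
  "implements_fpd w prog query T P time space \<longleftrightarrow>
     (\<exists>D n M. find_parameter_domains P = Some D \<and>
        exec (word_size w P) (encode P) prog Map.empty n M \<and> n \<le> time \<and>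
        finite (dom M) \<and> card (dom M) \<le> space \<and>
        represents_domains (word_size w P) P query T M D)"

end

theory Submission
  imports Defs
begin

text \<open>
  All domains only grow, so the algorithm can be run in rounds in which every clause that has ever
  been on the worklist propagates its domains again.  In a round, a pair of an effect and a
  precondition is unified completely only if a new clause has become active or a constant of one
  of the two atoms has just entered some individual domain; this happens \<open>O(n\<^sub>p)\<close> times per pair and costs \<open>O(m)\<close>.
  Otherwise only the constants \<open>c\<close> that entered some domain in the preceding round are
  propagated.  A constant enters at most \<open>O(n\<^sub>p)\<close> individual domains, so it is treated in \<open>O(n\<^sub>p)\<close>
  rounds at cost \<open>O(n\<^sub>p n\<^sub>e)\<close> each.  Both parts sum up to \<open>O(m n\<^sub>p\<^sup>2 n\<^sub>e)\<close>.  There are \<open>O(m n\<^sub>p)\<close> rounds, because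
  the individual domains have that many elements in total; their overhead of \<open>O(n\<^sub>p n\<^sub>e + m + n\<^sub>p)\<close> fits
  the bound since \<open>m = O(n\<^sub>p + n\<^sub>e)\<close>.

  For the space bound, neither intersected domains nor the common domains of equated variables are
  stored per when-clause and parameter.  The tables record which constants are excluded by the
  preconditions, once for the classes of variables equated in a primary clause, and once for the
  classes that the equations of a secondary clause form from these; a query combines the two levels.
\<close>

section \<open>Reasoning about the machine\<close>

text \<open>Unifying every pair anew for every constant in every round would cost
  \<open>m * np * ne\<close> in up to \<open>m * np\<close> rounds, a factor \<open>m\<close> too
  much. The work is therefore charged to constants: whether a pair unifies depends on the domains
  only at the boundedly many constants of its two atoms, and whether \<open>c\<close> is contributed
  depends, beyond that, only on the membership of \<open>c\<close>. A round is simultaneous.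
  Propagation writes individual domains but reads intersected ones through the table of excluded
  constants, which is brought up to date only afterwards; hence a round is exactly one step of a
  recurrence for the individual domains. Space is bounded by counting: every command is shown to
  stay inside a set \<open>K\<close> of keys, and all keys are built from precondition rows, so
  nothing is stored per effect. Time is first kept as a sum of costs that depend on the state. Only
  at the end are these sums interchanged, and the rounds in which a given pair or constant is
  expensive are counted along monotone chains of states of the algorithm. Since the arity bound
  \<open>A\<close> is a constant, a complete unification test is one expression of fixed
  size.\<close>

type_synonym tmem = "nat \<Rightarrow> nat list \<Rightarrow> nat"

text \<open>A missing entry reads as 0, so assertions can speak of total functions; only the space
  bound has to remember which entries exist.\<close>

definition contents :: "mem \<Rightarrow> tmem" where
  "contents M t k = (case M (t, k) of None \<Rightarrow> 0 | Some n \<Rightarrow> n)"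

fun ev :: "nat \<Rightarrow> input \<Rightarrow> tmem \<Rightarrow> exp \<Rightarrow> nat" where
  "ev B I m (Const n) = n"
| "ev B I m (In e f) = input_word I (ev B I m e) (ev B I m f)"
| "ev B I m (Get t es) = m t (map (ev B I m) es)"
| "ev B I m (Plus e f) = (ev B I m e + ev B I m f) mod B"
| "ev B I m (Minus e f) = ev B I m e - ev B I m f"
| "ev B I m (Equal e f) = (if ev B I m e = ev B I m f then 1 else 0)"
| "ev B I m (Less e f) = (if ev B I m e < ev B I m f then 1 else 0)"

lemma eval_eq_ev: "eval B I M e = ev B I (contents M) e"
proof (induction e)
  case (Get t es)
  then have "map (eval B I M) es = map (ev B I (contents M)) es" by simp
  then show ?case by (simp only: eval.simps ev.simps contents_def[of M t])
qed simp_all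

lemma contents_upd: "contents (M((t, k) \<mapsto> v)) = (contents M)(t := (contents M t)(k := v))"
  by (auto simp: contents_def fun_eq_iff)

lemma contents_empty: "contents Map.empty = (\<lambda>t k. 0)"
  by (auto simp: contents_def fun_eq_iff)

text \<open>The set \<open>K\<close> of admissible table keys bounds the space that the command uses.\<close>

definition runs :: "nat \<Rightarrow> input \<Rightarrow> (nat \<times> nat list) set \<Rightarrow> com \<Rightarrow> tmem \<Rightarrow> nat \<Rightarrow> (tmem \<Rightarrow> bool) \<Rightarrow> bool" where
  "runs B I K c m T Q \<longleftrightarrow>
     (\<forall>M. contents M = m \<longrightarrow> dom M \<subseteq> K \<longrightarrow>
        (\<exists>n M'. exec B I c M n M' \<and> n \<le> T \<and> dom M' \<subseteq> K \<and> Q (contents M')))"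

lemma runs_weaken:
  assumes "runs B I K c m T Q" "T \<le> T'" "\<And>m'. Q m' \<Longrightarrow> Q' m'"
  shows "runs B I K c m T' Q'"
  unfolding runs_def
proof (intro allI impI)
  fix M assume "contents M = m" "dom M \<subseteq> K"
  then obtain n M' where "exec B I c M n M'" "n \<le> T" "dom M' \<subseteq> K" "Q (contents M')"
    using assms(1) unfolding runs_def by blast
  then show "\<exists>n M'. exec B I c M n M' \<and> n \<le> T' \<and> dom M' \<subseteq> K \<and> Q' (contents M')"
    using assms(2,3) le_trans by blast
qed

lemma runs_Skip: "Q m \<Longrightarrow> 1 \<le> T \<Longrightarrow> runs B I K Skip m T Q"
  unfolding runs_def by (blast intro: exec.Skip)

lemma runs_Put:
  assumes "(t, map (ev B I m) es) \<in> K" "1 \<le> T"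
    and "Q (m(t := (m t)(map (ev B I m) es := ev B I m e)))"
  shows "runs B I K (Put t es e) m T Q"
  unfolding runs_def
proof (intro allI impI)
  fix M assume M: "contents M = m" "dom M \<subseteq> K"
  have eq: "map (eval B I M) es = map (ev B I m) es" by (simp add: eval_eq_ev M)
  show "\<exists>n M'. exec B I (Put t es e) M n M' \<and> n \<le> T \<and> dom M' \<subseteq> K \<and> Q (contents M')"
    using assms M exec.Put[of B I t es e M]
    by (intro exI[of _ 1] exI[of _ "M((t, map (eval B I M) es) \<mapsto> eval B I M e)"])
       (simp add: contents_upd eval_eq_ev[of _ _ _ e] eq del: map_eq_conv)
qed

lemma runs_Seq:
  assumes "runs B I K c1 m T1 (\<lambda>m1. runs B I K c2 m1 T2 Q)" "T1 + T2 \<le> T"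
  shows "runs B I K (Seq c1 c2) m T Q"
  unfolding runs_def
proof (intro allI impI)
  fix M assume M: "contents M = m" "dom M \<subseteq> K"
  obtain n1 M1 where 1: "exec B I c1 M n1 M1" "n1 \<le> T1" "dom M1 \<subseteq> K" "runs B I K c2 (contents M1) T2 Q"
    using assms(1) M unfolding runs_def by blast
  then obtain n2 M2 where 2: "exec B I c2 M1 n2 M2" "n2 \<le> T2" "dom M2 \<subseteq> K" "Q (contents M2)"
    unfolding runs_def by blast
  then show "\<exists>n M'. exec B I (Seq c1 c2) M n M' \<and> n \<le> T \<and> dom M' \<subseteq> K \<and> Q (contents M')"
    using 1 assms(2) exec.Seq[OF 1(1) 2(1)] by (meson add_mono le_trans)
qed

lemma runs_Cond:
  assumes "ev B I m e \<noteq> 0 \<Longrightarrow> runs B I K c1 m T Q"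
    and "ev B I m e = 0 \<Longrightarrow> runs B I K c2 m T Q" and "Suc T \<le> T'"
  shows "runs B I K (Cond e c1 c2) m T' Q"
  unfolding runs_def
proof (intro allI impI)
  fix M assume M: "contents M = m" "dom M \<subseteq> K"
  show "\<exists>n M'. exec B I (Cond e c1 c2) M n M' \<and> n \<le> T' \<and> dom M' \<subseteq> K \<and> Q (contents M')"
  proof (cases "ev B I m e = 0")
    case True
    then obtain n M' where "exec B I c2 M n M'" "n \<le> T" "dom M' \<subseteq> K" "Q (contents M')"
      using assms(2) M unfolding runs_def by blast
    then show ?thesis using True M assms(3) exec.CondFalse[of B I M e c2 n M' c1]
      by (intro exI[of _ "n + 1"] exI[of _ M']) (auto simp: eval_eq_ev)
  next
    case False
    then obtain n M' where "exec B I c1 M n M'" "n \<le> T" "dom M' \<subseteq> K" "Q (contents M')"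
      using assms(1) M unfolding runs_def by blast
    then show ?thesis using False M assms(3) exec.CondTrue[of B I M e c1 n M' c2]
      by (intro exI[of _ "n + 1"] exI[of _ M']) (auto simp: eval_eq_ev)
  qed
qed

lemma runs_LoopFalse: "ev B I m e = 0 \<Longrightarrow> Q m \<Longrightarrow> 1 \<le> T \<Longrightarrow> runs B I K (Loop e c) m T Q"
  unfolding runs_def using exec.LoopFalse by (metis eval_eq_ev)

lemma runs_LoopTrue:
  assumes "ev B I m e \<noteq> 0" "runs B I K c m T1 (\<lambda>m1. runs B I K (Loop e c) m1 T2 Q)" "Suc (T1 + T2) \<le> T"
  shows "runs B I K (Loop e c) m T Q"
  unfolding runs_def
proof (intro allI impI)
  fix M assume M: "contents M = m" "dom M \<subseteq> K"
  obtain n1 M1 where 1: "exec B I c M n1 M1" "n1 \<le> T1" "dom M1 \<subseteq> K"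
      "runs B I K (Loop e c) (contents M1) T2 Q"
    using assms(2) M unfolding runs_def by blast
  then obtain n2 M2 where 2: "exec B I (Loop e c) M1 n2 M2" "n2 \<le> T2" "dom M2 \<subseteq> K" "Q (contents M2)"
    unfolding runs_def by blast
  have "exec B I (Loop e c) M (n1 + n2 + 1) M2"
    using exec.LoopTrue[OF _ 1(1) 2(1)] assms(1) M by (simp add: eval_eq_ev)
  then show "\<exists>n M'. exec B I (Loop e c) M n M' \<and> n \<le> T \<and> dom M' \<subseteq> K \<and> Q (contents M')"
    using 1 2 assms(3) by (intro exI[of _ "n1 + n2 + 1"] exI[of _ M2]) auto
qed

text \<open>The number \<open>N\<close> of iterations is fixed beforehand and iteration
  \<open>t\<close> has a cost \<open>f t\<close> of its own. The costs are merely added up, so that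
  loops with uneven iterations can be estimated globally later.\<close>

lemma runs_Loop:
  assumes "Inv 0 m"
    and "\<And>t m. t < N \<Longrightarrow> Inv t m \<Longrightarrow> ev B I m e \<noteq> 0 \<and> runs B I K c m (f t) (Inv (Suc t))"
    and "\<And>m. Inv N m \<Longrightarrow> ev B I m e = 0"
  shows "runs B I K (Loop e c) m ((\<Sum>t<N. f t + 1) + 1) (Inv N)"
proof -
  have "k \<le> N \<Longrightarrow> Inv k m \<Longrightarrow> runs B I K (Loop e c) m ((\<Sum>t=k..<N. f t + 1) + 1) (Inv N)" for k m
  proof (induction "N - k" arbitrary: k m)
    case 0
    then show ?case by (intro runs_LoopFalse assms(3)) auto
  next
    case (Suc d)
    then have k: "k < N" by simp
    have s: "(\<Sum>t=k..<N. f t + 1) = f k + 1 + (\<Sum>t=Suc k..<N. f t + 1)"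
      using k by (simp add: sum.atLeast_Suc_lessThan)
    have r: "runs B I K (Loop e c) m' ((\<Sum>t=Suc k..<N. f t + 1) + 1) (Inv N)" if "Inv (Suc k) m'" for m'
      using Suc(1)[of "Suc k" m'] Suc(2) k that by auto
    show ?case
    proof (rule runs_LoopTrue[OF conjunct1[OF assms(2)[OF k Suc(4)]]])
      show "runs B I K c m (f k) (\<lambda>m1. runs B I K (Loop e c) m1 ((\<Sum>t=Suc k..<N. f t + 1) + 1) (Inv N))"
        by (rule runs_weaken[OF conjunct2[OF assms(2)[OF k Suc(4)]] order_refl r])
    qed (use s in linarith)
  qed
  from this[of 0 m] assms(1) show ?thesis by (simp add: atLeast0LessThan)
qed

section \<open>Counting loops whose invariant records the work already done\<close>

abbreviation Reg :: "nat \<Rightarrow> exp" where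
  "Reg x \<equiv> Get x []"

definition For :: "nat \<Rightarrow> exp \<Rightarrow> exp \<Rightarrow> com \<Rightarrow> com" where
  "For x lo hi body = Seq (Put x [] lo)
     (Loop (Less (Reg x) hi) (Seq body (Put x [] (Plus (Reg x) (Const 1)))))"

text \<open>The set argument of \<open>J\<close> collects the contributions made so far; iteration
  \<open>i\<close> adds \<open>G i\<close>. The invariant must survive any change of table
  \<open>x\<close>, which holds the counter, and \<open>hi < B\<close> keeps the counter from
  wrapping around. Here the body may use exactly what has been treated before;
  \<open>runs_For\<close> hides this.\<close>

lemma runs_For_upto:
  assumes K: "(x, []) \<in> K" and lo: "ev B I m loE = lo" and le: "lo \<le> hi" and hi: "hi < B"
    and J: "J Z m"
    and Jx: "\<And>Z m v. J Z m \<Longrightarrow> J Z (m(x := v))"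
    and hiE: "\<And>Z m. J Z m \<Longrightarrow> ev B I m hiE = hi"
    and body: "\<And>i m. lo \<le> i \<Longrightarrow> i < hi \<Longrightarrow> J (Z \<union> \<Union>(G ` {lo..<i})) m \<Longrightarrow> m x [] = i \<Longrightarrow>
                 runs B I K body m (f i) (\<lambda>m'. J (Z \<union> \<Union>(G ` {lo..<i}) \<union> G i) m' \<and> m' x [] = i)"
  shows "runs B I K (For x loE hiE body) m ((\<Sum>i=lo..<hi. f i + 2) + 2) (J (Z \<union> \<Union>(G ` {lo..<hi})))"
proof -
  define Inv where "Inv t m \<longleftrightarrow> J (Z \<union> \<Union>(G ` {lo..<lo + t})) m \<and> m x [] = lo + t" for t m
  have step: "runs B I K (Seq body (Put x [] (Plus (Reg x) (Const 1)))) m (f (lo + t) + 1) (Inv (Suc t))"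
    if t: "t < hi - lo" and m: "Inv t m" for t m
  proof (rule runs_Seq[OF runs_weaken[OF body[of "lo + t"] order_refl]])
    show "lo \<le> lo + t" "lo + t < hi" "J (Z \<union> \<Union>(G ` {lo..<lo + t})) m" "m x [] = lo + t"
      using t m by (auto simp: Inv_def)
    fix m' assume m': "J (Z \<union> \<Union> (G ` {lo..<lo + t}) \<union> G (lo + t)) m' \<and> m' x [] = lo + t"
    have eq: "Z \<union> \<Union> (G ` {lo..<lo + t}) \<union> G (lo + t) = Z \<union> \<Union>(G ` {lo..<lo + Suc t})"
      by (auto simp: less_Suc_eq)
    show "runs B I K (Put x [] (Plus (Reg x) (Const 1))) m' 1 (Inv (Suc t))"
    proof (intro runs_Put)
      show "Inv (Suc t) (m'(x := (m' x)(map (ev B I m') [] := ev B I m' (Plus (Reg x) (Const 1)))))"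
        using m' t hi Jx[OF conjunct1[OF m'], unfolded eq] by (simp add: Inv_def)
    qed (use K in simp_all)
  qed simp
  have hiE': "ev B I m hiE = hi" if "Inv t m" for t m
    using that hiE unfolding Inv_def by blast
  have loop: "runs B I K (Loop (Less (Reg x) hiE) (Seq body (Put x [] (Plus (Reg x) (Const 1))))) m'
       ((\<Sum>t<hi - lo. f (lo + t) + 1 + 1) + 1) (Inv (hi - lo))" if "Inv 0 m'" for m'
    using that
  proof (rule runs_Loop[where Inv = Inv and N = "hi - lo" and f = "\<lambda>t. f (lo + t) + 1"])
    fix t m assume t: "t < hi - lo" and m: "Inv t m"
    have "ev B I m (Less (Reg x) hiE) = 1"
      using t m by (simp add: hiE'[OF m] Inv_def)
    then show "ev B I m (Less (Reg x) hiE) \<noteq> 0 \<and>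
        runs B I K (Seq body (Put x [] (Plus (Reg x) (Const 1)))) m (f (lo + t) + 1) (Inv (Suc t))"
      using step[OF t m] by simp
  next
    fix m assume m: "Inv (hi - lo) m"
    show "ev B I m (Less (Reg x) hiE) = 0"
      using m le by (simp add: hiE'[OF m] Inv_def)
  qed
  have sum: "(\<Sum>t<hi - lo. f (lo + t) + 1 + 1) = (\<Sum>i=lo..<hi. f i + 2)"
    by (rule sum.reindex_bij_witness[where i = "\<lambda>i. i - lo" and j = "\<lambda>t. lo + t"]) auto
  show ?thesis
    unfolding For_def
  proof (rule runs_Seq[of _ _ _ _ _ 1])
    have "runs B I K (Loop (Less (Reg x) hiE) (Seq body (Put x [] (Plus (Reg x) (Const 1)))))
       (m(x := (m x)([] := lo))) ((\<Sum>i=lo..<hi. f i + 2) + 1) (J (Z \<union> \<Union>(G ` {lo..<hi})))"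
      using Jx[OF J, of "(m x)([] := lo)"] le sum
      by (intro runs_weaken[OF loop]) (simp_all add: Inv_def)
    then show "runs B I K (Put x [] loE) m 1 (\<lambda>m1. runs B I K (Loop (Less (Reg x) hiE)
       (Seq body (Put x [] (Plus (Reg x) (Const 1))))) m1 ((\<Sum>i=lo..<hi. f i + 2) + 1) (J (Z \<union> \<Union>(G ` {lo..<hi}))))"
      using K lo by (intro runs_Put) (simp_all only: list.map)
  qed simp
qed

lemma runs_For:
  assumes "(x, []) \<in> K" "ev B I m loE = lo" "lo \<le> hi" "hi < B" "J Z m"
    and "\<And>Z m v. J Z m \<Longrightarrow> J Z (m(x := v))" "\<And>Z m. J Z m \<Longrightarrow> ev B I m hiE = hi"
    and "\<And>i Z m. lo \<le> i \<Longrightarrow> i < hi \<Longrightarrow> J Z m \<Longrightarrow> m x [] = i \<Longrightarrow>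
                 runs B I K body m (f i) (\<lambda>m'. J (Z \<union> G i) m' \<and> m' x [] = i)"
  shows "runs B I K (For x loE hiE body) m ((\<Sum>i=lo..<hi. f i + 2) + 2) (J (Z \<union> \<Union>(G ` {lo..<hi})))"
  by (rule runs_For_upto[where J = J]) (rule assms; assumption)+

fun seqs :: "com list \<Rightarrow> com" where
  "seqs [] = Skip"
| "seqs (c # cs) = Seq c (seqs cs)"

text \<open>Loops over the arguments of an atom are unrolled when the program is built:
  \<open>n\<close> is a constant such as the arity bound, so the program does not depend on the
  input.\<close>

lemma runs_seqs:
  assumes "J Z m"
    and "\<And>a Z m. a < n \<Longrightarrow> J Z m \<Longrightarrow> runs B I K (f a) m T (\<lambda>m'. J (Z \<union> G a) m')"
  shows "runs B I K (seqs (map f [0..<n])) m (n * T + 1) (J (Z \<union> (\<Union>a<n. G a)))"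
proof -
  have "k \<le> n \<Longrightarrow> J (Z \<union> (\<Union>a<k. G a)) m \<Longrightarrow>
      runs B I K (seqs (map f [k..<n])) m ((n - k) * T + 1) (J (Z \<union> (\<Union>a<n. G a)))" for k m
  proof (induction "n - k" arbitrary: k m)
    case 0
    then show ?case by (auto intro!: runs_Skip)
  next
    case (Suc d)
    then have k: "k < n" by simp
    have eq: "Z \<union> (\<Union>a<k. G a) \<union> G k = Z \<union> (\<Union>a<Suc k. G a)"
      by (auto simp: less_Suc_eq)
    have nk: "n - k = Suc (n - Suc k)" using k by simp
    have ih: "runs B I K (seqs (map f [Suc k..<n])) m' ((n - Suc k) * T + 1) (J (Z \<union> (\<Union>a<n. G a)))"
      if "J (Z \<union> (\<Union>a<Suc k. G a)) m'" for m'
      using Suc(1)[of "Suc k" m'] Suc(2) k that by auto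
    have "runs B I K (Seq (f k) (seqs (map f [Suc k..<n]))) m ((n - k) * T + 1) (J (Z \<union> (\<Union>a<n. G a)))"
    proof (rule runs_Seq[OF runs_weaken[OF assms(2)[OF k Suc(4)] order_refl]])
      fix m' assume "J (Z \<union> (\<Union>a<k. G a) \<union> G k) m'"
      then show "runs B I K (seqs (map f [Suc k..<n])) m' ((n - Suc k) * T + 1) (J (Z \<union> (\<Union>a<n. G a)))"
        by (intro ih) (simp only: eq)
    qed (simp add: nk)
    then show ?case using k by (simp add: upt_conv_Cons)
  qed
  from this[of 0 m] assms(1) show ?thesis by simp
qed

section \<open>Tables as sets of keys, and frame conditions\<close>

definition tab :: "nat list set \<Rightarrow> nat list \<Rightarrow> nat" where
  "tab S k = (if k \<in> S then 1 else 0)"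

lemma tab_insert: "(tab S)(k := Suc 0) = tab (insert k S)"
  by (auto simp: tab_def fun_eq_iff)

lemma tab_remove: "(tab S)(k := 0) = tab (S - {k})"
  by (auto simp: tab_def fun_eq_iff)

lemma tab_eq_0 [simp]: "tab S k = 0 \<longleftrightarrow> k \<notin> S"
  by (simp add: tab_def)

lemma tab_pos [simp]: "0 < tab S k \<longleftrightarrow> k \<in> S"
  by (simp add: tab_def)

lemma tab_empty: "tab {} = (\<lambda>k. 0)"
  by (simp add: tab_def fun_eq_iff)

definition agree :: "nat set \<Rightarrow> tmem \<Rightarrow> tmem \<Rightarrow> bool" where
  "agree X m m' \<longleftrightarrow> (\<forall>t. t \<notin> X \<longrightarrow> m' t = m t)"

lemma agree_refl [simp]: "agree X m m"
  by (simp add: agree_def)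

lemma agree_upd: "agree X m m' \<Longrightarrow> t \<in> X \<Longrightarrow> agree X m (m'(t := v))"
  by (auto simp: agree_def)

lemma agreeD: "agree X m m' \<Longrightarrow> t \<notin> X \<Longrightarrow> m' t = m t"
  by (simp add: agree_def)

lemma agree_trans: "agree X m m' \<Longrightarrow> agree Y m' m'' \<Longrightarrow> X \<subseteq> Z \<Longrightarrow> Y \<subseteq> Z \<Longrightarrow> agree Z m m''"
  unfolding agree_def by (metis in_mono)

definition Not_exp :: "exp \<Rightarrow> exp" where
  "Not_exp e = Equal e (Const 0)"

text \<open>The machine has no connectives, so the two negations are counted. The sum is taken
  modulo \<open>B\<close>, and \<open>1 + 1\<close> must not wrap to 0: this is the source of the
  hypothesis \<open>2 < B\<close> in the lemmas on connectives.\<close>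

definition And :: "exp \<Rightarrow> exp \<Rightarrow> exp" where
  "And e f = Less (Plus (Not_exp e) (Not_exp f)) (Const 1)"

definition Or :: "exp \<Rightarrow> exp \<Rightarrow> exp" where
  "Or e f = Not_exp (And (Not_exp e) (Not_exp f))"

fun Ands :: "exp list \<Rightarrow> exp" where
  "Ands [] = Const 1"
| "Ands (e # es) = And e (Ands es)"

fun Ors :: "exp list \<Rightarrow> exp" where
  "Ors [] = Const 0"
| "Ors (e # es) = Or e (Ors es)"

definition tr :: "nat \<Rightarrow> input \<Rightarrow> tmem \<Rightarrow> exp \<Rightarrow> bool" where
  "tr B I m e \<longleftrightarrow> ev B I m e \<noteq> 0"

lemma tr_Not [simp]: "tr B I m (Not_exp e) \<longleftrightarrow> \<not> tr B I m e"
  by (simp add: tr_def Not_exp_def)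

lemma tr_And [simp]: "2 < B \<Longrightarrow> tr B I m (And e f) \<longleftrightarrow> tr B I m e \<and> tr B I m f"
  by (simp add: tr_def And_def Not_exp_def)

lemma tr_Or [simp]: "2 < B \<Longrightarrow> tr B I m (Or e f) \<longleftrightarrow> tr B I m e \<or> tr B I m f"
  by (simp add: Or_def)

lemma tr_Ands [simp]: "2 < B \<Longrightarrow> tr B I m (Ands es) \<longleftrightarrow> (\<forall>e \<in> set es. tr B I m e)"
  by (induction es) (auto simp: tr_def[of _ _ _ "Const _"])

lemma tr_Ors [simp]: "2 < B \<Longrightarrow> tr B I m (Ors es) \<longleftrightarrow> (\<exists>e \<in> set es. tr B I m e)"
  by (induction es) (auto simp: tr_def[of _ _ _ "Const _"])

lemma tr_Equal [simp]: "tr B I m (Equal e f) \<longleftrightarrow> ev B I m e = ev B I m f"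
  by (simp add: tr_def)

lemma tr_Less [simp]: "tr B I m (Less e f) \<longleftrightarrow> ev B I m e < ev B I m f"
  by (simp add: tr_def)

lemma tr_Get [simp]: "tr B I m (Get t es) \<longleftrightarrow> m t (map (ev B I m) es) \<noteq> 0"
  by (simp add: tr_def)

lemma runs_If:
  assumes "tr B I m e \<Longrightarrow> runs B I K c1 m T Q"
    and "\<not> tr B I m e \<Longrightarrow> runs B I K c2 m T Q" and "Suc T \<le> T'"
  shows "runs B I K (Cond e c1 c2) m T' Q"
  using assms by (intro runs_Cond) (auto simp: tr_def)

declare split_paired_All [simp del] split_paired_Ex [simp del]

section \<open>Unification of function-free atoms\<close>

text \<open>Without function symbols a unification problem is just an equivalence relation on terms:
  for lists of equal length it is solvable if and only if no class contains two different
  constants.\<close>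

definition links :: "'v trm list \<Rightarrow> 'v trm list \<Rightarrow> ('v trm \<times> 'v trm) set" where
  "links ss ts = (set (zip ss ts) \<union> (set (zip ss ts))\<inverse>)\<^sup>*"

definition consistent :: "'v trm list \<Rightarrow> 'v trm list \<Rightarrow> bool" where
  "consistent ss ts \<longleftrightarrow> length ss = length ts \<and> (\<forall>c d. (Cst c, Cst d) \<in> links ss ts \<longrightarrow> c = d)"

lemma links_refl [simp]: "(s, s) \<in> links ss ts"
  by (simp add: links_def)

lemma links_sym: "(s, t) \<in> links ss ts \<Longrightarrow> (t, s) \<in> links ss ts"
  unfolding links_def by (metis converse_Un converse_converse rtrancl_converseI sup_commute)

lemma links_trans: "(s, t) \<in> links ss ts \<Longrightarrow> (t, u) \<in> links ss ts \<Longrightarrow> (s, u) \<in> links ss ts"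
  unfolding links_def by simp

lemma links_nth: "i < length ss \<Longrightarrow> i < length ts \<Longrightarrow> (ss ! i, ts ! i) \<in> links ss ts"
  unfolding links_def by (rule r_into_rtrancl) (auto simp: set_zip)

lemma links_ends: "(s, t) \<in> links ss ts \<Longrightarrow> s = t \<or> t \<in> set ss \<union> set ts"
  unfolding links_def by (erule rtranclE) (auto dest: set_zip_leftD set_zip_rightD)

lemma unifier_links:
  assumes "is_unifier \<sigma> ss ts" "(s, t) \<in> links ss ts"
  shows "subst \<sigma> s = subst \<sigma> t"
  using assms(2) unfolding links_def
proof induction
  case (step t u)
  have eq: "subst \<sigma> a = subst \<sigma> b" if "(a, b) \<in> set (zip ss ts)" for a b
    using that assms(1) unfolding is_unifier_def set_zip
    by (auto simp: list_eq_iff_nth_eq)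
  show ?case using step eq[of t u] eq[of u t] by auto
qed simp

text \<open>The representative is chosen from the class itself, by a predicate that is the same for
  all linked variables; so linked variables receive the same representative.\<close>

definition canonical :: "'v trm list \<Rightarrow> 'v trm list \<Rightarrow> 'v \<Rightarrow> 'v trm" where
  "canonical ss ts v = (if \<exists>c. (Var v, Cst c) \<in> links ss ts
     then Cst (THE c. (Var v, Cst c) \<in> links ss ts)
     else Var (SOME w. (Var v, Var w) \<in> links ss ts))"

lemma canonical_Cst:
  assumes "consistent ss ts"
  shows "canonical ss ts v = Cst c \<longleftrightarrow> (Var v, Cst c) \<in> links ss ts"
proof -
  have "c = d" if "(Var v, Cst c) \<in> links ss ts" "(Var v, Cst d) \<in> links ss ts" for c d
    using assms that links_sym links_trans unfolding consistent_def by blast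
  then have "(THE c. (Var v, Cst c) \<in> links ss ts) = d" if "(Var v, Cst d) \<in> links ss ts" for d
    using that by blast
  then show ?thesis unfolding canonical_def by auto
qed

lemma canonical_Var: "canonical ss ts v = Var w \<Longrightarrow> (Var v, Var w) \<in> links ss ts"
  unfolding canonical_def by (auto split: if_splits intro: someI[of "\<lambda>w. (Var v, Var w) \<in> links ss ts" v])

lemma canonical_links: 
  assumes "consistent ss ts" "(Var v, Var w) \<in> links ss ts"
  shows "canonical ss ts v = canonical ss ts w"
proof -
  have "(Var v, x) \<in> links ss ts \<longleftrightarrow> (Var w, x) \<in> links ss ts" for x
    using assms(2) links_sym links_trans by blast
  then show ?thesis unfolding canonical_def by simp
qed

lemma canonical_mgu:
  assumes "consistent ss ts"
  shows "is_mgu (canonical ss ts) ss ts"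
proof -
  have "subst (canonical ss ts) (ss ! i) = subst (canonical ss ts) (ts ! i)"
    if "i < length ss" "i < length ts" for i
    using links_nth[OF that] assms canonical_Cst[OF assms] canonical_links[OF assms]
    by (cases "ss ! i"; cases "ts ! i") (auto simp: consistent_def dest: links_sym, metis links_sym)
  then have "is_unifier (canonical ss ts) ss ts"
    using assms by (auto simp: is_unifier_def consistent_def list_eq_iff_nth_eq)
  moreover have "\<tau> v = subst \<tau> (canonical ss ts v)" if "is_unifier \<tau> ss ts" for \<tau> v
  proof (cases "canonical ss ts v")
    case (Cst c)
    then show ?thesis using unifier_links[OF that] canonical_Cst[OF assms] by fastforce
  next
    case (Var w)
    then show ?thesis using unifier_links[OF that canonical_Var[OF Var]] by simp
  qed
  ultimately show ?thesis unfolding is_mgu_def by metis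
qed

lemma mgu_None: "mgu ss ts = None \<Longrightarrow> \<not> consistent ss ts"
  unfolding mgu_def using canonical_mgu by (metis option.distinct(1))

text \<open>\<open>mgu\<close> picks an arbitrary most general unifier, so its values cannot be
  computed. Being a unifier, it agrees on linked terms; being most general, it has
  \<open>canonical ss ts\<close> as an instance and therefore identifies no more than that one
  does.\<close>

lemma mgu_Some:
  assumes "mgu ss ts = Some \<sigma>"
  shows "consistent ss ts" "\<sigma> v = Cst c \<longleftrightarrow> (Var v, Cst c) \<in> links ss ts"
    "\<sigma> v = \<sigma> w \<longleftrightarrow> (Var v, Var w) \<in> links ss ts"
proof -
  have \<sigma>: "is_mgu \<sigma> ss ts"
    using assms someI_ex[of "\<lambda>\<sigma>. is_mgu \<sigma> ss ts"] unfolding mgu_def by (auto split: if_splits)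
  then have u: "is_unifier \<sigma> ss ts" by (simp add: is_mgu_def)
  show con: "consistent ss ts"
    using unifier_links[OF u] u unfolding consistent_def is_unifier_def by (fastforce dest: map_eq_imp_length_eq)
  obtain \<rho> where \<rho>: "\<And>v. canonical ss ts v = subst \<rho> (\<sigma> v)"
    using \<sigma> canonical_mgu[OF con] unfolding is_mgu_def by blast
  show "\<sigma> v = Cst c \<longleftrightarrow> (Var v, Cst c) \<in> links ss ts"
    using unifier_links[OF u, of "Var v" "Cst c"] \<rho>[of v] canonical_Cst[OF con, of v c] by auto
  show "\<sigma> v = \<sigma> w \<longleftrightarrow> (Var v, Var w) \<in> links ss ts"
  proof
    assume "\<sigma> v = \<sigma> w"
    then have eq: "canonical ss ts v = canonical ss ts w" by (simp add: \<rho>)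
    show "(Var v, Var w) \<in> links ss ts"
    proof (cases "canonical ss ts v")
      case (Cst c)
      then show ?thesis using eq canonical_Cst[OF con] links_sym links_trans by metis
    next
      case (Var x)
      then show ?thesis using eq canonical_Var links_sym links_trans by metis
    qed
  qed (use unifier_links[OF u] in fastforce)
qed

lemma Cst_in_map: "Cst c \<in> map_trm f ` S \<longleftrightarrow> Cst c \<in> S"
proof -
  have "Cst c = map_trm f s \<longleftrightarrow> s = Cst c" for s by (cases s) auto
  then show ?thesis by (auto simp: image_iff)
qed

definition atom_links :: "atom \<Rightarrow> atom \<Rightarrow> ((nat + nat) trm \<times> (nat + nat) trm) set" where
  "atom_links e p = links (map (map_trm Inl) (args e)) (map (map_trm Inr) (args p))"

definition unifiable :: "(nat \<Rightarrow> nat set) \<Rightarrow> atom \<Rightarrow> atom \<Rightarrow> bool" where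
  "unifiable D e p \<longleftrightarrow> pred e = pred p \<and> length (args e) = length (args p) \<and>
     (\<forall>c d. (Cst c, Cst d) \<in> atom_links e p \<longrightarrow> c = d) \<and>
     (\<forall>v c. Var v \<in> set (args e) \<and> (Var (Inl v), Cst c) \<in> atom_links e p \<longrightarrow> c \<in> D v)"

definition contributes :: "(nat \<Rightarrow> nat set) \<Rightarrow> atom \<Rightarrow> atom \<Rightarrow> nat \<Rightarrow> nat \<Rightarrow> bool" where
  "contributes D e p u c \<longleftrightarrow> (\<forall>d. (Var (Inr u), Cst d) \<in> atom_links e p \<longrightarrow> c = d) \<and>
     (\<forall>v. Var v \<in> set (args e) \<and> (Var (Inl v), Var (Inr u)) \<in> atom_links e p \<longrightarrow> c \<in> D v)"

lemma unify_Some_iff: "(\<exists>\<sigma>. unify D e p = Some \<sigma>) \<longleftrightarrow> unifiable D e p"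
proof (cases "mgu (map (map_trm Inl) (args e)) (map (map_trm Inr) (args p))")
  case None
  then show ?thesis
    using mgu_None[OF None] by (auto simp: unify_def unifiable_def consistent_def atom_links_def)
next
  case (Some \<sigma>)
  then show ?thesis
    using mgu_Some[OF Some] by (auto simp: unify_def unifiable_def consistent_def atom_links_def)
qed

text \<open>If \<open>u\<close> is bound to a constant \<open>d\<close>, the condition on the linked
  effect variables follows from the check that \<open>unify\<close> has made for \<open>d\<close>.
  If \<open>u\<close> stays a variable, no constant is linked to it.\<close>

lemma contribution_iff:
  assumes "unify D e p = Some \<sigma>"
  shows "c \<in> contribution D e \<sigma> u \<longleftrightarrow> contributes D e p u c"
proof -
  have m: "mgu (map (map_trm Inl) (args e)) (map (map_trm Inr) (args p)) = Some \<sigma>"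
    and D: "\<And>v c. Var v \<in> set (args e) \<Longrightarrow> \<sigma> (Inl v) = Cst c \<Longrightarrow> c \<in> D v"
    using assms by (auto simp: unify_def split: if_splits option.splits)
  note s = mgu_Some[OF m, folded atom_links_def]
  show ?thesis
  proof (cases "\<sigma> (Inr u)")
    case (Cst d)
    then have "c \<in> contribution D e \<sigma> u \<longleftrightarrow> c = d" by (simp add: contribution_def)
    moreover have "contributes D e p u c \<longleftrightarrow> c = d"
      using Cst D unfolding contributes_def s(2)[symmetric] s(3)[symmetric] by auto
    ultimately show ?thesis by simp
  next
    case (Var w)
    then show ?thesis
      unfolding contributes_def contribution_def s(2)[symmetric] s(3)[symmetric] by auto
  qed
qed

section \<open>The sequence of states of the main loop\<close>

lemma mem_relevant:
  "(q, a) \<in> relevant P k \<longleftrightarrow> (q, a) \<in> pos_pre P \<and> fst q = fst k \<and> (fst (snd q) = snd k \<or> fst (snd q) = 0)"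
  by (cases q, cases k) (simp add: relevant_def)

lemma mem_intersected:
  "c \<in> intersected P ind k x \<longleftrightarrow>
     c \<in> consts_of P \<and> (\<forall>q a. (q, a) \<in> relevant P k \<and> Var x \<in> set (args a) \<longrightarrow> c \<in> ind q x)"
  by (auto simp: intersected_def)

lemma matches_unifiable:
  "(\<exists>\<sigma>. (q, p, k, e, \<sigma>) \<in> matches P s) \<longleftrightarrow>
     (q, p) \<in> pos_pre P \<and> k \<in> worklist s \<and> e \<in> pos_eff P k \<and> unifiable (inters s k) e p"
  by (auto simp: matches_def unify_Some_iff[symmetric])

lemma matched_step_iff:
  "q \<in> matched_step P s \<longleftrightarrow> q \<in> matched s \<or> (\<exists>p k e. (q, p) \<in> pos_pre P \<and> k \<in> worklist s \<and>
     e \<in> pos_eff P k \<and> unifiable (inters s k) e p)"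
  unfolding matched_step_def by (auto simp flip: matches_unifiable)

lemma individual_step_iff:
  "c \<in> individual_step P s q u \<longleftrightarrow> c \<in> individual s q u \<or> (\<exists>p k e. (q, p) \<in> pos_pre P \<and>
     k \<in> worklist s \<and> e \<in> pos_eff P k \<and> unifiable (inters s k) e p \<and> Var u \<in> set (args p) \<and>
     contributes (inters s k) e p u c)"
proof -
  have "c \<in> individual_step P s q u \<longleftrightarrow> c \<in> individual s q u \<or> (\<exists>p k e \<sigma>. (q, p) \<in> pos_pre P \<and>
     k \<in> worklist s \<and> e \<in> pos_eff P k \<and> unify (inters s k) e p = Some \<sigma> \<and> Var u \<in> set (args p) \<and>
     contributes (inters s k) e p u c)"
    unfolding individual_step_def matches_def by (simp cong: conj_cong add: contribution_iff)
  then show ?thesis unfolding unify_Some_iff[symmetric] by blast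
qed

text \<open>Defined for all \<open>t\<close>, also after the worklist has become empty, because the
  machine may run further rounds after that moment.\<close>

definition state :: "problem \<Rightarrow> nat \<Rightarrow> fpd_state" where
  "state P t = (fpd_step P ^^ t) (fpd_init P)"

lemma state_0: "state P 0 = fpd_init P"
  by (simp add: state_def)

lemma state_Suc: "state P (Suc t) = fpd_step P (state P t)"
  by (simp add: state_def)

abbreviation ind_at :: "problem \<Rightarrow> nat \<Rightarrow> pre_id \<Rightarrow> nat \<Rightarrow> nat set" where
  "ind_at P t \<equiv> individual (state P t)"

abbreviation inters_at :: "problem \<Rightarrow> nat \<Rightarrow> clause_id \<Rightarrow> nat \<Rightarrow> nat set" where
  "inters_at P t \<equiv> inters (state P t)"

lemma state_Suc_sel:
  "ind_at P (Suc t) = individual_step P (state P t)"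
  "matched (state P (Suc t)) = matched_step P (state P t)"
  "inters_at P (Suc t) = inters_step P (state P t)"
  "worklist (state P (Suc t)) = worklist_step P (state P t)"
  by (simp_all add: state_Suc fpd_step_def)

lemma ind_at_mono: "ind_at P t q u \<subseteq> ind_at P (Suc t) q u"
  by (auto simp: state_Suc_sel individual_step_iff)

lemma matched_mono: "matched (state P t) \<subseteq> matched (state P (Suc t))"
  by (auto simp: state_Suc_sel matched_step_iff)

text \<open>The clauses that have been propagation candidates before round \<open>t\<close>.\<close>

fun flagged :: "problem \<Rightarrow> nat \<Rightarrow> clause_id set" where
  "flagged P 0 = {}"
| "flagged P (Suc t) = flagged P t \<union> candidates P (state P t)"

text \<open>
  Once a clause has been a candidate, the domains that the algorithm stores for it agree with
  the intersections of the current individual domains, so they need not be stored.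
\<close>

lemma flagged_matched:
  "k \<in> flagged P t \<Longrightarrow> k \<in> clause_ids P \<and> (\<forall>q a. (q, a) \<in> relevant P k \<longrightarrow> q \<in> matched (state P t)) \<and>
     (\<exists>q a u. (q, a) \<in> relevant P k \<and> Var u \<in> set (args a))"
proof (induction t)
  case (Suc t)
  then show ?case
  proof (cases "k \<in> flagged P t")
    case True
    then show ?thesis using Suc matched_mono by blast
  next
    case False
    then have "k \<in> candidates P (state P t)" using Suc by simp
    then show ?thesis unfolding candidates_def state_Suc_sel by fastforce
  qed
qed simp

text \<open>A flagged clause has all its preconditions matched. If it nevertheless fails to be a
  candidate, none of its relevant individual domains was augmented in this round, and recomputing
  the intersection would give the stored one.\<close>

lemma inters_at_eq:
  "inters_at P t k = intersected P (if k \<in> flagged P t then ind_at P t else (\<lambda>_ _. {})) k"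
proof (induction t)
  case 0
  then show ?case by (simp add: state_0 fpd_init_def)
next
  case (Suc t)
  show ?case
  proof (cases "k \<in> candidates P (state P t)")
    case True
    then show ?thesis by (simp add: state_Suc_sel inters_step_def)
  next
    case False
    have "intersected P (individual_step P (state P t)) k x = intersected P (ind_at P t) k x"
      if k: "k \<in> flagged P t" for x
    proof -
      have "individual_step P (state P t) q x = ind_at P t q x"
        if "(q, a) \<in> relevant P k" "Var x \<in> set (args a)" for q a
        using that flagged_matched[OF k] False matched_mono[of P t] ind_at_mono[of P t q x]
        unfolding candidates_def state_Suc_sel by blast
      then show ?thesis by (auto simp: set_eq_iff mem_intersected)
    qed
    then show ?thesis using False Suc by (auto simp: state_Suc_sel inters_step_def fun_eq_iff)
  qed
qed

lemma inters_at_mono: "inters_at P t k x \<subseteq> inters_at P (Suc t) k x"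
proof
  fix c assume c: "c \<in> inters_at P t k x"
  show "c \<in> inters_at P (Suc t) k x"
  proof (cases "k \<in> flagged P t")
    case True
    then show ?thesis
      using c ind_at_mono[of P t, THEN subsetD] by (simp add: inters_at_eq mem_intersected)
  next
    case False
    then show ?thesis
      using c by (auto simp: inters_at_eq mem_intersected)
  qed
qed

lemma inters_at_subset: "inters_at P t k x \<subseteq> consts_of P"
  by (auto simp: inters_at_eq mem_intersected)

lemma zero_clause: "(0, 0) \<in> clause_ids P" "the_clause P (0, 0) = When [] (map Pos (inits P))"
  by (simp_all add: clause_ids_def clauses_def all_ops_def the_clause_def the_op_def start_op_def)

lemma relevant_zero: "relevant P (0, 0) = {}"
proof -
  have False if "(q, a) \<in> relevant P (0, 0)" for q a
  proof -
    have "fst q = 0" "fst (snd q) = 0" "(q, a) \<in> pos_pre P" using that by (auto simp: mem_relevant)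
    then show False by (cases q) (simp add: pos_pre_def zero_clause)
  qed
  then show ?thesis by auto
qed

lemma worklist_clause_ids: "worklist (state P t) \<subseteq> clause_ids P"
  by (cases t) (auto simp: state_0 fpd_init_def zero_clause state_Suc_sel worklist_step_def candidates_def)

lemma the_clause_mem: "k \<in> clause_ids P \<Longrightarrow> the_clause P k \<in> set (all_clauses P)"
proof -
  assume k: "k \<in> clause_ids P"
  then have "all_ops P ! fst k \<in> set (all_ops P)"
    "clauses (all_ops P ! fst k) ! snd k \<in> set (clauses (all_ops P ! fst k))"
    by (auto simp: clause_ids_def)
  then show ?thesis by (auto simp: all_clauses_def the_clause_def the_op_def)
qed

lemma pos_eff_consts: "k \<in> clause_ids P \<Longrightarrow> e \<in> pos_eff P k \<Longrightarrow> Cst c \<in> set (args e) \<Longrightarrow> c \<in> consts_of P"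
proof -
  assume a: "k \<in> clause_ids P" "e \<in> pos_eff P k" "Cst c \<in> set (args e)"
  have "Cst c \<in> set (clause_terms (the_clause P k))"
    using a unfolding clause_terms_def pos_eff_def by force
  then show ?thesis using the_clause_mem[OF a(1)] unfolding consts_of_def by force
qed

text \<open>Opposite to an occurrence of \<open>u\<close> stands an argument of the effect: a
  constant of the problem, which \<open>c\<close> must equal, or a variable, whose domain must
  contain \<open>c\<close>. In particular the intersection defining a contribution is never taken
  over the empty family.\<close>

lemma contributes_consts:
  assumes u: "Var u \<in> set (args p)" and un: "unifiable D e p" and c: "contributes D e p u c"
    and D: "\<And>v. D v \<subseteq> consts_of P" and k: "k \<in> clause_ids P" "e \<in> pos_eff P k"
  shows "c \<in> consts_of P"
proof -
  obtain i where i: "i < length (args p)" "args p ! i = Var u"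
    using u by (auto simp: in_set_conv_nth)
  have len: "length (args e) = length (args p)" using un by (simp add: unifiable_def)
  have l: "(map_trm Inl (args e ! i), Var (Inr u)) \<in> atom_links e p"
    using links_nth[of i "map (map_trm Inl) (args e)" "map (map_trm Inr) (args p)"] i len
    by (simp add: atom_links_def)
  have e: "args e ! i \<in> set (args e)" using i len by simp
  show ?thesis
  proof (cases "args e ! i")
    case (Cst d)
    then have "c = d" using c links_sym l unfolding contributes_def atom_links_def by fastforce
    then show ?thesis using pos_eff_consts[OF k, of d] e Cst by simp
  next
    case (Var v)
    then show ?thesis using c l e D unfolding contributes_def by auto
  qed
qed

lemma ind_at_consts: "ind_at P t q u \<subseteq> consts_of P"
proof (induction t)
  case 0
  then show ?case by (simp add: state_0 fpd_init_def)
next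
  case (Suc t)
  show ?case
  proof
    fix c assume "c \<in> ind_at P (Suc t) q u"
    then consider "c \<in> ind_at P t q u" | p k e where "k \<in> worklist (state P t)" "e \<in> pos_eff P k"
        "unifiable (inters_at P t k) e p" "Var u \<in> set (args p)" "contributes (inters_at P t k) e p u c"
      unfolding state_Suc_sel(1) individual_step_iff by blast
    then show "c \<in> consts_of P"
    proof cases
      case 2
      then show ?thesis
        using contributes_consts[OF 2(4,3,5) inters_at_subset _ 2(2)] worklist_clause_ids by blast
    qed (use Suc in blast)
  qed
qed

lemma ind_at_args: "c \<in> ind_at P t q u \<Longrightarrow> \<exists>p. (q, p) \<in> pos_pre P \<and> Var u \<in> set (args p)"
  by (induction t) (auto simp: state_0 fpd_init_def state_Suc_sel individual_step_iff)

text \<open>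
  The clauses that have been on the worklist before.  Outside the worklist their domains have
  not changed since they were last propagated, so propagating all of them changes nothing.
\<close>

definition active :: "problem \<Rightarrow> nat \<Rightarrow> clause_id set" where
  "active P t = {(0, 0)} \<union>
     {k \<in> flagged P t. \<forall>x \<in> set (params (the_op P k)). inters_at P t k x \<noteq> {}}"

lemma active_mono: "active P t \<subseteq> active P (Suc t)"
  using inters_at_mono[of P t] by (fastforce simp: active_def)

lemma active_clause_ids: "active P t \<subseteq> clause_ids P"
  using flagged_matched by (auto simp: active_def zero_clause)

lemma relevant_params:
  assumes "wf_problem P" "(q, a) \<in> relevant P k" "Var u \<in> set (args a)"
  shows "u \<in> set (params (the_op P k))"
proof -
  obtain i j l where q: "q = (i, j, l)" by (cases q)
  have k: "(i, j) \<in> clause_ids P" and m: "Lit (Pos a) \<in> set (pre (the_clause P (i, j)))" and i: "i = fst k"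
    using assms(2) unfolding q mem_relevant pos_pre_def by (auto dest: nth_mem)
  have cl: "the_clause P (i, j) \<in> set (clauses (the_op P k))"
    using k i unfolding the_clause_def the_op_def clause_ids_def by auto
  have u: "Var u \<in> set (clause_terms (the_clause P (i, j)))"
    using m assms(3) unfolding clause_terms_def by force
  have "the_op P k \<in> set (all_ops P)"
    using k i unfolding the_op_def clause_ids_def by auto
  then consider "the_op P k = start_op P" | "the_op P k \<in> set (operators P)" | "the_op P k = end_op P"
    unfolding all_ops_def by auto
  then show ?thesis
  proof cases
    case 1
    then show ?thesis using cl m by (auto simp: start_op_def clauses_def)
  next
    case 2
    then have "set (trm_vars (Var u)) \<subseteq> set (params (the_op P k))"
      using cl assms(1) u unfolding wf_problem_def by blast
    then show ?thesis by simp
  next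
    case 3
    then show ?thesis using cl m assms(3)
      by (auto simp: end_op_def clauses_def intro!: bexI[of _ "Lit (Pos a)"] bexI[of _ "Var u"])
  qed
qed

lemma relevant_not_param:
  assumes "wf_problem P" "x \<notin> set (params (the_op P k))"
  shows "intersected P ind k x = consts_of P"
proof -
  have "Var x \<notin> set (args a)" if "(q, a) \<in> relevant P k" for q a
    using relevant_params[OF assms(1) that] assms(2) by blast
  then show ?thesis by (auto simp: set_eq_iff mem_intersected)
qed

text \<open>The encoded input lists no parameters, so nonemptiness can be tested only for variables
  of relevant positive preconditions. All other parameters have the universal domain, which is
  nonempty by assumption.\<close>

lemma active_iff:
  assumes "wf_problem P" "consts_of P \<noteq> {}"
  shows "k \<in> active P t \<longleftrightarrow> k = (0, 0) \<or> k \<in> flagged P t \<and>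
    (\<forall>q a u. (q, a) \<in> relevant P k \<and> Var u \<in> set (args a) \<longrightarrow> intersected P (ind_at P t) k u \<noteq> {})"
proof -
  have "intersected P (ind_at P t) k u = consts_of P"
    if "\<nexists>q a. (q, a) \<in> relevant P k \<and> Var u \<in> set (args a)" for u
    using that by (auto simp: set_eq_iff mem_intersected)
  then have "(\<forall>x \<in> set (params (the_op P k)). intersected P (ind_at P t) k x \<noteq> {}) \<longleftrightarrow>
    (\<forall>q a u. (q, a) \<in> relevant P k \<and> Var u \<in> set (args a) \<longrightarrow> intersected P (ind_at P t) k u \<noteq> {})"
    using relevant_params[OF assms(1), of _ _ k] assms(2) by metis
  then show ?thesis by (auto simp: active_def inters_at_eq)
qed

text \<open>This is why \<open>active\<close> means having been on the worklist. A clause that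
  becomes active, or whose domains change while it is active, is at that moment a candidate with an
  enlarged domain and without empty ones. A newly flagged clause had an empty domain before, since
  its stored intersection was that of empty individual domains.\<close>

lemma inactive_unchanged:
  assumes wf: "wf_problem P" and k: "k \<in> active P (Suc t)" "k \<notin> worklist (state P (Suc t))"
  shows "k \<in> active P t \<and> inters_at P (Suc t) k = inters_at P t k"
proof (cases "k = (0, 0)")
  case True
  then have "k \<notin> candidates P (state P t)" by (simp add: candidates_def relevant_zero)
  then show ?thesis using True by (simp add: active_def state_Suc_sel inters_step_def)
next
  case False
  then have f: "k \<in> flagged P (Suc t)"
    and ne: "\<And>x. x \<in> set (params (the_op P k)) \<Longrightarrow> inters_at P (Suc t) k x \<noteq> {}"
    using k by (auto simp: active_def)
  show ?thesis
  proof (cases "k \<in> candidates P (state P t)")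
    case True
    then have eq: "inters_at P (Suc t) k x = inters_at P t k x" if "x \<in> set (params (the_op P k))" for x
      using k(2) ne that inters_at_mono[of P t k x] unfolding state_Suc_sel worklist_step_def by blast
    have eq: "inters_at P (Suc t) k x = inters_at P t k x" for x
      using eq[of x] by (cases "x \<in> set (params (the_op P k))")
        (simp_all add: inters_at_eq relevant_not_param[OF wf])
    moreover have "k \<in> flagged P t"
    proof (rule ccontr)
      assume "k \<notin> flagged P t"
      moreover obtain q a u where "(q, a) \<in> relevant P k" "Var u \<in> set (args a)"
        using flagged_matched[OF f] by blast
      ultimately have "inters_at P t k u = {}" "u \<in> set (params (the_op P k))"
        using relevant_params[OF wf, of q a k u] by (auto simp: inters_at_eq set_eq_iff mem_intersected)
      then show False using ne eq by simp
    qed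
    ultimately show ?thesis using ne by (auto simp: active_def)
  next
    case False
    then show ?thesis using f ne by (auto simp: active_def state_Suc_sel inters_step_def)
  qed
qed

text \<open>When the clause was last on the worklist it was propagated with the domains it still
  has. Matched marks and individual domains only grow, so the effect of that propagation
  persists.\<close>

lemma active_closed:
  assumes wf: "wf_problem P"
  shows "k \<in> active P t \<Longrightarrow> k \<notin> worklist (state P t) \<Longrightarrow> (q, p) \<in> pos_pre P \<Longrightarrow> e \<in> pos_eff P k \<Longrightarrow>
    unifiable (inters_at P t k) e p \<Longrightarrow> q \<in> matched (state P t) \<and>
    (\<forall>u c. Var u \<in> set (args p) \<and> contributes (inters_at P t k) e p u c \<longrightarrow> c \<in> ind_at P t q u)"
proof (induction t)
  case 0
  then show ?case by (simp add: active_def state_0 fpd_init_def)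
next
  case (Suc t)
  have a: "k \<in> active P t" and eq: "inters_at P (Suc t) k = inters_at P t k"
    using inactive_unchanged[OF wf Suc(2,3)] by auto
  show ?case
  proof (cases "k \<in> worklist (state P t)")
    case True
    then show ?thesis
      using Suc(4-6) unfolding eq state_Suc_sel(1,2) matched_step_iff individual_step_iff by blast
  next
    case False
    then show ?thesis
      using Suc.IH[OF a False Suc(4,5)] Suc(6) ind_at_mono matched_mono unfolding eq by blast
  qed
qed

lemma worklist_active: "worklist (state P t) \<subseteq> active P t"
  by (cases t) (auto simp: active_def state_0 fpd_init_def state_Suc_sel worklist_step_def)

lemma active_inters: "k \<in> active P t \<Longrightarrow> inters_at P t k = intersected P (ind_at P t) k"
  by (auto simp: active_def inters_at_eq fun_eq_iff intersected_def relevant_zero)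

text \<open>Together with \<open>ind_at_Suc\<close> this replaces worklist and stored intersections
  by a recurrence in which all active clauses propagate. The clauses that are active without being
  on the worklist add nothing, by \<open>active_closed\<close>.\<close>

lemma matched_Suc:
  assumes "wf_problem P"
  shows "q \<in> matched (state P (Suc t)) \<longleftrightarrow> q \<in> matched (state P t) \<or> (\<exists>p k e. (q, p) \<in> pos_pre P \<and>
     k \<in> active P t \<and> e \<in> pos_eff P k \<and> unifiable (intersected P (ind_at P t) k) e p)"
proof
  assume "q \<in> matched (state P (Suc t))"
  then show "q \<in> matched (state P t) \<or> (\<exists>p k e. (q, p) \<in> pos_pre P \<and>
     k \<in> active P t \<and> e \<in> pos_eff P k \<and> unifiable (intersected P (ind_at P t) k) e p)"
    using worklist_active[of P t] active_inters[of _ P t]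
    unfolding state_Suc_sel(2) matched_step_iff by (metis in_mono)
next
  assume "q \<in> matched (state P t) \<or> (\<exists>p k e. (q, p) \<in> pos_pre P \<and>
     k \<in> active P t \<and> e \<in> pos_eff P k \<and> unifiable (intersected P (ind_at P t) k) e p)"
  then show "q \<in> matched (state P (Suc t))"
    using active_closed[OF assms, of _ t] active_inters[of _ P t]
    unfolding state_Suc_sel(2) matched_step_iff by metis
qed

lemma ind_at_Suc:
  assumes "wf_problem P"
  shows "c \<in> ind_at P (Suc t) q u \<longleftrightarrow> c \<in> ind_at P t q u \<or> (\<exists>p k e. (q, p) \<in> pos_pre P \<and>
     k \<in> active P t \<and> e \<in> pos_eff P k \<and> unifiable (intersected P (ind_at P t) k) e p \<and>
     Var u \<in> set (args p) \<and> contributes (intersected P (ind_at P t) k) e p u c)"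
proof
  assume "c \<in> ind_at P (Suc t) q u"
  then show "c \<in> ind_at P t q u \<or> (\<exists>p k e. (q, p) \<in> pos_pre P \<and>
     k \<in> active P t \<and> e \<in> pos_eff P k \<and> unifiable (intersected P (ind_at P t) k) e p \<and>
     Var u \<in> set (args p) \<and> contributes (intersected P (ind_at P t) k) e p u c)"
    using worklist_active[of P t] active_inters[of _ P t]
    unfolding state_Suc_sel(1) individual_step_iff by (metis in_mono)
next
  assume "c \<in> ind_at P t q u \<or> (\<exists>p k e. (q, p) \<in> pos_pre P \<and>
     k \<in> active P t \<and> e \<in> pos_eff P k \<and> unifiable (intersected P (ind_at P t) k) e p \<and>
     Var u \<in> set (args p) \<and> contributes (intersected P (ind_at P t) k) e p u c)"
  then show "c \<in> ind_at P (Suc t) q u"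
    using active_closed[OF assms, of _ t] active_inters[of _ P t]
    unfolding state_Suc_sel(1) individual_step_iff by metis
qed

text \<open>
  The constants whose membership in some individual domain has changed in the preceding round.
  A clause that was active before needs to be propagated again only for these constants, unless
  one of the atoms to be unified contains such a constant.
\<close>

definition dirty :: "problem \<Rightarrow> nat \<Rightarrow> nat set" where
  "dirty P t = (if t = 0 then {} else {c. \<exists>q u. c \<in> ind_at P t q u \<and> c \<notin> ind_at P (t - 1) q u})"

text \<open>A clean constant belongs to the same intersected domains at \<open>t - 1\<close> and at
  \<open>t\<close>. Unifiability asks only about constants of the two atoms, and the contribution of
  \<open>c\<close> only about \<open>c\<close>; so the pair already had this result in the preceding
  round.\<close>

lemma seminaive:
  assumes wf: "wf_problem P" and k: "k \<in> active P t" "e \<in> pos_eff P k" and p: "(q, p) \<in> pos_pre P"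
    and t: "0 < t" "active P t = active P (t - 1)"
    and clean: "\<And>c. Cst c \<in> set (args e) \<union> set (args p) \<Longrightarrow> c \<notin> dirty P t"
    and un: "unifiable (intersected P (ind_at P t) k) e p"
  shows "q \<in> matched (state P t)"
    and "Var u \<in> set (args p) \<Longrightarrow> contributes (intersected P (ind_at P t) k) e p u c \<Longrightarrow> c \<notin> dirty P t \<Longrightarrow>
           c \<in> ind_at P t q u"
proof -
  obtain t' where t': "t = Suc t'" using t(1) gr0_implies_Suc by blast
  have D: "c \<in> intersected P (ind_at P t') k x \<longleftrightarrow> c \<in> intersected P (ind_at P t) k x"
    if "c \<notin> dirty P t" for c x
  proof -
    have "c \<in> ind_at P t' q u \<longleftrightarrow> c \<in> ind_at P t q u" for q u
      using that ind_at_mono[of P t' q u] unfolding dirty_def t' by simp blast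
    then show ?thesis by (simp add: mem_intersected)
  qed
  have "Cst c \<in> set (args e) \<union> set (args p)"
    if "(Var (Inl v), Cst c) \<in> atom_links e p" for v c
    using links_ends[OF that[unfolded atom_links_def]] by (simp add: Cst_in_map)
  then have un': "unifiable (intersected P (ind_at P t') k) e p"
    using un clean D unfolding unifiable_def by blast
  have k': "k \<in> active P t'" using k t t' by simp
  show "q \<in> matched (state P t)"
    unfolding t' matched_Suc[OF wf] using k k' p un' by blast
  assume "Var u \<in> set (args p)" "contributes (intersected P (ind_at P t) k) e p u c" "c \<notin> dirty P t"
  moreover from this have "contributes (intersected P (ind_at P t') k) e p u c"
    using D unfolding contributes_def by blast
  ultimately show "c \<in> ind_at P t q u"
    unfolding t' ind_at_Suc[OF wf] using k k' p un' by blast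
qed

lemma stable_state:
  assumes "worklist (state P t) = {}" "t \<le> t'"
  shows "inters_at P t' = inters_at P t \<and> worklist (state P t') = {}"
  using assms(2)
proof (induction t' rule: dec_induct)
  case (step t')
  have "individual_step P (state P t') q u = ind_at P t' q u" for q u
    using step.IH by (auto simp: individual_step_iff)
  then have "candidates P (state P t') = {}" by (auto simp: candidates_def)
  then show ?case using step.IH by (auto simp: state_Suc_sel inters_step_def worklist_step_def)
qed (simp add: assms(1))

text \<open>The machine stops when no individual domain has changed, which may be later than the
  first empty worklist, where the algorithm stops. By \<open>stable_state\<close> the intersected
  domains are the same at both times.\<close>

lemma find_parameter_domains_eq:
  assumes "ind_at P (Suc t) = ind_at P t"
  shows "find_parameter_domains P = Some (eq_restrict P (inters_at P (Suc t)))"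
proof -
  have "candidates P (state P t) = {}"
    using assms by (auto simp: candidates_def state_Suc_sel)
  then have w: "worklist (state P (Suc t)) = {}" by (auto simp: state_Suc_sel worklist_step_def)
  let ?t = "LEAST t. worklist (state P t) = {}"
  have "worklist (state P ?t) = {}" "?t \<le> Suc t"
    using LeastI[of "\<lambda>t. worklist (state P t) = {}", OF w] Least_le[of "\<lambda>t. worklist (state P t) = {}", OF w] by auto
  then have "inters_at P (Suc t) = inters_at P ?t" using stable_state by blast
  moreover have "while_option (\<lambda>s. worklist s \<noteq> {}) (fpd_step P) (fpd_init P) = Some (state P ?t)"
    using w unfolding while_option_def state_def[symmetric] by auto
  ultimately show ?thesis by (simp add: find_parameter_domains_def)
qed

section \<open>Rows of the input\<close>

text \<open>
  The registers and tables of the program.  Rows are the numbers of preconditions and effects in the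
  input, clauses are given by the positions \<open>i, j\<close>.
  \<^item> \<open>tR, tE, tS\<close>: current row; \<open>tX, tC\<close>: index and value of the current constant
  \<^item> \<open>tCNT, tCL, tSEEN\<close>: number, list and set of the constants
  \<^item> \<open>tOWN [i, j]\<close>: the clause has positive preconditions of its own
  \<^item> \<open>tIND [r, x, c], tMAT [r]\<close>: individual domains, matched preconditions
  \<^item> \<open>tREJ [i, j, x, c]\<close>: some own positive precondition excludes \<open>c\<close> from the domain of \<open>x\<close>
  \<^item> \<open>tNE [i, j, x]\<close> and \<open>tUN, tBAD [i, j]\<close>: nonempty domains, clauses with unmatched preconditions or empty domains
  \<^item> \<open>tFLAG, tACT, tAUG [i, j]\<close>: clauses that have been candidates, are active, have just been augmented
  \<^item> \<open>tDIRTY, tND [c]\<close>: constants that entered some domain in the last and in the current round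
  \<^item> \<open>tFULL, tCH\<close>: all pairs have to be unified completely; the last round has changed something
  \<^item> \<open>tL0 [i, x], tL1 [i, j, l]\<close>: labels of the classes of equated variables on the two levels, and
    \<open>tU, tV\<close>: the labels being merged
  \<^item> \<open>tW0, tW1 [l, c]\<close> and \<open>tH0, tH1 [l]\<close>: constants excluded from the domain of a class, classes
    with a positive precondition
\<close>

abbreviation tR :: nat where "tR \<equiv> 31"
abbreviation tE :: nat where "tE \<equiv> 2"
abbreviation tX :: nat where "tX \<equiv> 3"
abbreviation tC :: nat where "tC \<equiv> 4"
abbreviation tCNT :: nat where "tCNT \<equiv> 5"
abbreviation tSEEN :: nat where "tSEEN \<equiv> 6"
abbreviation tCL :: nat where "tCL \<equiv> 7"
abbreviation tOWN :: nat where "tOWN \<equiv> 8"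
abbreviation tIND :: nat where "tIND \<equiv> 9"
abbreviation tMAT :: nat where "tMAT \<equiv> 10"
abbreviation tREJ :: nat where "tREJ \<equiv> 11"
abbreviation tNE :: nat where "tNE \<equiv> 12"
abbreviation tUN :: nat where "tUN \<equiv> 13"
abbreviation tBAD :: nat where "tBAD \<equiv> 14"
abbreviation tFLAG :: nat where "tFLAG \<equiv> 15"
abbreviation tACT :: nat where "tACT \<equiv> 16"
abbreviation tAUG :: nat where "tAUG \<equiv> 17"
abbreviation tND :: nat where "tND \<equiv> 18"
abbreviation tDIRTY :: nat where "tDIRTY \<equiv> 19"
abbreviation tFULL :: nat where "tFULL \<equiv> 20"
abbreviation tCH :: nat where "tCH \<equiv> 21"
abbreviation tL0 :: nat where "tL0 \<equiv> 22"
abbreviation tL1 :: nat where "tL1 \<equiv> 23"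
abbreviation tW0 :: nat where "tW0 \<equiv> 24"
abbreviation tH0 :: nat where "tH0 \<equiv> 25"
abbreviation tW1 :: nat where "tW1 \<equiv> 26"
abbreviation tH1 :: nat where "tH1 \<equiv> 27"
abbreviation tU :: nat where "tU \<equiv> 28"
abbreviation tV :: nat where "tV \<equiv> 29"
abbreviation tS :: nat where "tS \<equiv> 30"

definition fld :: "nat \<Rightarrow> nat \<Rightarrow> exp" where
  "fld \<rho> n = In (Reg \<rho>) (Const n)"

definition kindE :: "nat \<Rightarrow> nat \<Rightarrow> exp" where
  "kindE \<rho> a = fld \<rho> (5 + 2 * a)"

definition valE :: "nat \<Rightarrow> nat \<Rightarrow> exp" where
  "valE \<rho> a = fld \<rho> (6 + 2 * a)"

definition varE :: "nat \<Rightarrow> nat \<Rightarrow> exp" where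
  "varE \<rho> a = Equal (kindE \<rho> a) (Const 1)"

definition validE :: "nat \<Rightarrow> nat \<Rightarrow> exp" where
  "validE \<rho> a = Less (Const a) (fld \<rho> 4)"

text \<open>Beyond the last argument the input reads 0, which is also the tag of a constant; hence
  the test \<open>validE\<close>. The tag 1 of a variable cannot arise there.\<close>

definition cstE :: "nat \<Rightarrow> nat \<Rightarrow> exp" where
  "cstE \<rho> a = And (validE \<rho> a) (Equal (kindE \<rho> a) (Const 0))"

definition num_pre_exp :: exp where
  "num_pre_exp = In (Const 0) (Const 0)"

definition num_eff_exp :: exp where
  "num_eff_exp = In (Const 0) (Const 1)"

definition for_rows :: "nat \<Rightarrow> com \<Rightarrow> com" where
  "for_rows \<rho> body = For \<rho> (Const 1) (Plus num_pre_exp (Const 1)) body"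

definition for_effs :: "com \<Rightarrow> com" where
  "for_effs body = For tE (Plus num_pre_exp (Const 1)) (Plus (Plus num_pre_exp num_eff_exp) (Const 1)) body"

definition set_rows :: "nat \<Rightarrow> nat \<Rightarrow> (nat \<Rightarrow> exp list) \<Rightarrow> (nat \<Rightarrow> exp) \<Rightarrow> com" where
  "set_rows A T key cond =
     for_rows tR (seqs (map (\<lambda>a. Cond (cond a) (Put T (key a) (Const 1)) Skip) [0..<A]))"

definition clear_rows :: "nat \<Rightarrow> nat \<Rightarrow> (nat \<Rightarrow> exp list) \<Rightarrow> com" where
  "clear_rows A T key = for_rows tR (seqs (map (\<lambda>a. Put T (key a) (Const 0)) [0..<A]))"

text \<open>The input as the program sees it: rows \<open>1..np\<close> are preconditions, the
  following \<open>ne\<close> rows effects, each with operator, clause, tag, predicate and terms.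
  \<open>Suc np * A < B\<close> leaves room for labels of the form \<open>r * A + a\<close>, and
  \<open>2 \<le> A\<close> lets the two sides of an equation count as arguments.\<close>

locale rows =
  fixes B :: nat and I :: input and A np ne :: nat and cs :: "nat set"
    and rop rcl rtag rprd :: "nat \<Rightarrow> nat" and rtms :: "nat \<Rightarrow> nat trm list"
  assumes B: "Suc (np + ne) < B" "Suc np * A < B" "card cs < B" "2 < B"
    and np: "0 < np" and ne: "0 < ne" and cs: "finite cs" "cs \<noteq> {}" and A: "2 \<le> A"
    and in_hd: "input_word I 0 0 = np" "input_word I 0 (Suc 0) = ne"
    and in_row: "\<And>r. 0 < r \<Longrightarrow> r \<le> np + ne \<Longrightarrow> input_word I r 0 = rop r \<and> input_word I r (Suc 0) = rcl r \<and>
           input_word I r 2 = rtag r \<and> input_word I r 3 = rprd r \<and> input_word I r 4 = length (rtms r)"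
    and in_trm: "\<And>r a. 0 < r \<Longrightarrow> r \<le> np + ne \<Longrightarrow> a < length (rtms r) \<Longrightarrow>
           [input_word I r (5 + 2 * a), input_word I r (6 + 2 * a)] = enc_trm (rtms r ! a)"
    and in_out: "\<And>r a. 0 < r \<Longrightarrow> r \<le> np + ne \<Longrightarrow> length (rtms r) \<le> a \<Longrightarrow>
           input_word I r (5 + 2 * a) = 0 \<and> input_word I r (6 + 2 * a) = 0"
    and len: "\<And>r. 0 < r \<Longrightarrow> r \<le> np + ne \<Longrightarrow> length (rtms r) \<le> A"
    and cs_eq: "cs = {c. \<exists>r. 0 < r \<and> r \<le> np + ne \<and> Cst c \<in> set (rtms r)}"
begin

definition isv :: "nat \<Rightarrow> nat \<Rightarrow> bool" where
  "isv r a \<longleftrightarrow> a < length (rtms r) \<and> (\<exists>x. rtms r ! a = Var x)"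

definition isc :: "nat \<Rightarrow> nat \<Rightarrow> bool" where
  "isc r a \<longleftrightarrow> a < length (rtms r) \<and> (\<exists>c. rtms r ! a = Cst c)"

definition nam :: "nat \<Rightarrow> nat \<Rightarrow> nat" where
  "nam r a = (if a < length (rtms r) then enc_trm (rtms r ! a) ! 1 else 0)"

definition row :: "nat \<Rightarrow> bool" where
  "row r \<longleftrightarrow> 0 < r \<and> r \<le> np + ne"

definition prow :: "nat \<Rightarrow> bool" where
  "prow r \<longleftrightarrow> 0 < r \<and> r \<le> np"

definition erow :: "nat \<Rightarrow> bool" where
  "erow e \<longleftrightarrow> np < e \<and> e \<le> np + ne"

lemma prow_row: "prow r \<Longrightarrow> row r"
  by (simp add: prow_def row_def)

lemma erow_row: "erow r \<Longrightarrow> row r"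
  by (simp add: erow_def row_def)

lemma nam_simps:
  "a < length (rtms r) \<Longrightarrow> rtms r ! a = Var x \<Longrightarrow> nam r a = x"
  "a < length (rtms r) \<Longrightarrow> rtms r ! a = Cst c \<Longrightarrow> nam r a = c"
  by (simp_all add: nam_def)

lemma Var_iff: "row r \<Longrightarrow> Var x \<in> set (rtms r) \<longleftrightarrow> (\<exists>a<A. isv r a \<and> nam r a = x)"
proof -
  assume "row r"
  then have "length (rtms r) \<le> A" using len by (simp add: row_def)
  moreover have "isv r a \<and> nam r a = x \<longleftrightarrow> a < length (rtms r) \<and> rtms r ! a = Var x" for a
    by (cases "rtms r ! a") (auto simp: isv_def nam_simps)
  ultimately show ?thesis unfolding in_set_conv_nth using order_less_le_trans by metis
qed

lemma Cst_iff: "row r \<Longrightarrow> Cst x \<in> set (rtms r) \<longleftrightarrow> (\<exists>a<A. isc r a \<and> nam r a = x)"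
proof -
  assume "row r"
  then have "length (rtms r) \<le> A" using len by (simp add: row_def)
  moreover have "isc r a \<and> nam r a = x \<longleftrightarrow> a < length (rtms r) \<and> rtms r ! a = Cst x" for a
    by (cases "rtms r ! a") (auto simp: isc_def nam_simps)
  ultimately show ?thesis unfolding in_set_conv_nth using order_less_le_trans by metis
qed

lemma isc_cs: "row r \<Longrightarrow> isc r a \<Longrightarrow> nam r a \<in> cs"
  using Cst_iff[of r "nam r a"] len[of r] unfolding cs_eq row_def isc_def by fastforce

lemma ev_fld:
  assumes "m \<rho> [] = r" "row r"
  shows "ev B I m (fld \<rho> 0) = rop r" "ev B I m (fld \<rho> (Suc 0)) = rcl r" "ev B I m (fld \<rho> 2) = rtag r"
    "ev B I m (fld \<rho> 3) = rprd r" "ev B I m (fld \<rho> 4) = length (rtms r)"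
  using assms in_row[of r] by (simp_all add: fld_def row_def)

lemma ev_valE: "m \<rho> [] = r \<Longrightarrow> row r \<Longrightarrow> ev B I m (valE \<rho> a) = nam r a"
  using in_trm[of r a] in_out[of r a]
  by (cases "a < length (rtms r)") (auto simp: fld_def row_def valE_def nam_def dest: arg_cong[of _ _ "\<lambda>xs. xs ! 1"])

lemma ev_kindE: "m \<rho> [] = r \<Longrightarrow> row r \<Longrightarrow> ev B I m (kindE \<rho> a) = (if isv r a then 1 else 0)"
  using in_trm[of r a] in_out[of r a]
  by (cases "a < length (rtms r)"; cases "rtms r ! a") (auto simp: fld_def row_def kindE_def isv_def)

lemma tr_varE: "m \<rho> [] = r \<Longrightarrow> row r \<Longrightarrow> tr B I m (varE \<rho> a) \<longleftrightarrow> isv r a"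
  by (simp add: varE_def ev_kindE)

lemma tr_validE: "m \<rho> [] = r \<Longrightarrow> row r \<Longrightarrow> tr B I m (validE \<rho> a) \<longleftrightarrow> a < length (rtms r)"
  by (simp add: validE_def ev_fld)

lemma tr_cstE: "m \<rho> [] = r \<Longrightarrow> row r \<Longrightarrow> tr B I m (cstE \<rho> a) \<longleftrightarrow> isc r a"
  using B by (cases "rtms r ! a") (auto simp: cstE_def ev_kindE tr_validE isv_def isc_def)

lemmas ev_row = ev_fld ev_valE ev_kindE tr_varE tr_validE tr_cstE

lemma ev_num:
  "ev B I m num_pre_exp = np" "ev B I m num_eff_exp = ne"
  "ev B I m (Plus num_pre_exp (Const 1)) = Suc np"
  "ev B I m (Plus (Plus num_pre_exp num_eff_exp) (Const 1)) = Suc (np + ne)"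
  using B by (simp_all add: num_pre_exp_def num_eff_exp_def in_hd)

text \<open>Keys are enumerated by row, argument position and constant, so the arbitrary size of
  variable names does not matter. Only precondition rows contribute. One-element keys serve for
  rows, labels, constants and indices into the list of constants.\<close>

definition base_keys :: "nat list set" where
  "base_keys = {[]} \<union> {[i] |i. i < Suc np * A + card cs \<or> i \<in> cs} \<union>
     {[l, c] |l c. l < Suc np * A \<and> c \<in> cs} \<union>
     {[rop r, rcl r] |r. prow r} \<union>
     {[rop r, nam r a] |r a. prow r \<and> a < A} \<union>
     {[rop r, rcl r, nam r a] |r a. prow r \<and> a < A} \<union>
     {[r, nam r a, c] |r a c. prow r \<and> a < A \<and> c \<in> cs} \<union>
     {[rop r, rcl r, nam r a, c] |r a c. prow r \<and> a < A \<and> c \<in> cs}"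

end

section \<open>Scans over precondition rows and effect rows within the admissible keys\<close>

locale rows_mem = rows +
  fixes K :: "(nat \<times> nat list) set"
  assumes K: "{..<32} \<times> base_keys \<subseteq> K"
begin

lemma in_KI: "t < 32 \<Longrightarrow> x \<in> base_keys \<Longrightarrow> (t, x) \<in> K"
  using K by auto

lemma in_K:
  assumes "t < 32"
  shows "(t, []) \<in> K" "c \<in> cs \<Longrightarrow> (t, [c]) \<in> K" "i < Suc np * A + card cs \<Longrightarrow> (t, [i]) \<in> K"
    "prow r \<Longrightarrow> (t, [r]) \<in> K"
    "l < Suc np * A \<Longrightarrow> c \<in> cs \<Longrightarrow> (t, [l, c]) \<in> K"
    "prow r \<Longrightarrow> (t, [rop r, rcl r]) \<in> K"
    "prow r \<Longrightarrow> a < A \<Longrightarrow> (t, [rop r, nam r a]) \<in> K"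
    "prow r \<Longrightarrow> a < A \<Longrightarrow> (t, [rop r, rcl r, nam r a]) \<in> K"
    "prow r \<Longrightarrow> a < A \<Longrightarrow> c \<in> cs \<Longrightarrow> (t, [r, nam r a, c]) \<in> K"
    "prow r \<Longrightarrow> a < A \<Longrightarrow> c \<in> cs \<Longrightarrow> (t, [rop r, rcl r, nam r a, c]) \<in> K"
proof -
  have "r < Suc np * A" if "prow r" for r
  proof -
    have "r < Suc np * 1" using that by (simp add: prow_def)
    also have "\<dots> \<le> Suc np * A" using A by (intro mult_le_mono) auto
    finally show ?thesis .
  qed
  then have "i \<in> cs \<or> i < Suc np * A + card cs \<or> prow i \<Longrightarrow> (t, [i]) \<in> K" for i
    by (intro in_KI[OF assms]) (fastforce simp: base_keys_def)
  then show "c \<in> cs \<Longrightarrow> (t, [c]) \<in> K" "i < Suc np * A + card cs \<Longrightarrow> (t, [i]) \<in> K"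
    "prow r \<Longrightarrow> (t, [r]) \<in> K" by blast+
qed (rule in_KI[OF assms], unfold base_keys_def, blast)+

lemma runs_for_rows:
  assumes "\<rho> < 32" and "J Z m"
    and "\<And>Z m v. J Z m \<Longrightarrow> J Z (m(\<rho> := v))"
    and "\<And>r Z m. prow r \<Longrightarrow> J Z m \<Longrightarrow> m \<rho> [] = r \<Longrightarrow>
                 runs B I K body m (f r) (\<lambda>m'. J (Z \<union> G r) m' \<and> m' \<rho> [] = r)"
  shows "runs B I K (for_rows \<rho> body) m ((\<Sum>r=1..np. f r + 2) + 2) (J (Z \<union> (\<Union>r\<in>{r. prow r}. G r)))"
proof -
  have body: "runs B I K body m (f i) (\<lambda>m'. J (Z \<union> G i) m' \<and> m' \<rho> [] = i)"
    if "1 \<le> i" "i < Suc np" "J Z m" "m \<rho> [] = i" for i Z m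
    by (rule assms(4)[OF _ that(3,4)]) (use that in \<open>simp add: prow_def\<close>)
  have hi: "Suc np < B" using B by linarith
  have "runs B I K (For \<rho> (Const 1) (Plus num_pre_exp (Const 1)) body) m
      ((\<Sum>r=1..<Suc np. f r + 2) + 2) (J (Z \<union> \<Union>(G ` {1..<Suc np})))"
    by (rule runs_For[where J = J, OF in_K(1)[OF assms(1)] _ _ hi assms(2,3) ev_num(3) body]) simp_all
  moreover have "{1..<Suc np} = {1..np}" "{r. prow r} = {1..np}" by (auto simp: prow_def)
  ultimately show ?thesis by (simp only: for_rows_def)
qed

lemma runs_for_effs:
  assumes "J Z m"
    and "\<And>Z m v. J Z m \<Longrightarrow> J Z (m(tE := v))"
    and "\<And>e Z m. erow e \<Longrightarrow> J Z m \<Longrightarrow> m tE [] = e \<Longrightarrow>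
                 runs B I K body m (f e) (\<lambda>m'. J (Z \<union> G e) m' \<and> m' tE [] = e)"
  shows "runs B I K (for_effs body) m ((\<Sum>e=Suc np..np + ne. f e + 2) + 2) (J (Z \<union> (\<Union>e\<in>{e. erow e}. G e)))"
proof -
  have body: "runs B I K body m (f i) (\<lambda>m'. J (Z \<union> G i) m' \<and> m' tE [] = i)"
    if "Suc np \<le> i" "i < Suc (np + ne)" "J Z m" "m tE [] = i" for i Z m
    by (rule assms(3)[OF _ that(3,4)]) (use that in \<open>simp add: erow_def\<close>)
  have "runs B I K (For tE (Plus num_pre_exp (Const 1)) (Plus (Plus num_pre_exp num_eff_exp) (Const 1)) body) m
      ((\<Sum>e=Suc np..<Suc (np + ne). f e + 2) + 2) (J (Z \<union> \<Union>(G ` {Suc np..<Suc (np + ne)})))"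
    by (rule runs_For[where J = J, OF in_K(1) ev_num(3) _ B(1) assms(1,2) ev_num(4) body]) simp_all
  moreover have "{Suc np..<Suc (np + ne)} = {Suc np..np + ne}" "{e. erow e} = {Suc np..np + ne}"
    by (auto simp: erow_def)
  ultimately show ?thesis by (simp only: for_effs_def)
qed

lemma rows_time: "(\<Sum>r=1..np. n + 2) + 2 \<le> np * (n + 4)"
  using np by (simp add: algebra_simps)

text \<open>Apart from the row counter and \<open>T\<close> itself, \<open>cond\<close> sees all
  tables as they were at the start. The scan thus acts as one simultaneous assignment, whatever the
  order of the rows.\<close>

lemma runs_set_rows:
  assumes T: "T < 32" "T \<noteq> tR" and mT: "m T = tab S"
    and key: "\<And>r a m'. prow r \<Longrightarrow> a < A \<Longrightarrow> m' tR [] = r \<Longrightarrow> agree {tR, T} m m' \<Longrightarrow> 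
      map (ev B I m') (key a) = kf r a \<and> (tr B I m' (cond a) \<longleftrightarrow> cf r a)"
    and inK: "\<And>r a. prow r \<Longrightarrow> a < A \<Longrightarrow> cf r a \<Longrightarrow> (T, kf r a) \<in> K"
  shows "runs B I K (set_rows A T key cond) m (np * (2 * A + 5))
    (\<lambda>m'. m' T = tab (S \<union> {kf r a |r a. prow r \<and> a < A \<and> cf r a}) \<and> agree {tR, T} m m')"
proof -
  define J where "J Z m' \<longleftrightarrow> m' T = tab (S \<union> Z) \<and> agree {tR, T} m m'" for Z m'
  define G where "G r = (\<Union>a<A. if cf r a then {kf r a} else {})" for r
  have step: "runs B I K (Cond (cond a) (Put T (key a) (Const 1)) Skip) m' 2
      (\<lambda>m''. J (Z \<union> (if cf r a then {kf r a} else {})) m'' \<and> m'' tR [] = r)"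
    if "prow r" "a < A" "J Z m' \<and> m' tR [] = r" for r a Z m'
    using that key[of r a m'] inK[of r a] T
    by (intro runs_If[where T = 1] runs_Put runs_Skip) (auto simp: J_def tab_insert agree_upd)
  have "runs B I K (set_rows A T key cond) m ((\<Sum>r=1..np. (A * 2 + 1) + 2) + 2) (J ({} \<union> (\<Union>r\<in>{r. prow r}. G r)))"
    unfolding set_rows_def
  proof (rule runs_for_rows[where J = J])
    show "J {} m" using mT by (simp add: J_def)
    fix r Z m' assume "prow r" "J Z m'" "m' tR [] = r"
    then show "runs B I K (seqs (map (\<lambda>a. Cond (cond a) (Put T (key a) (Const 1)) Skip) [0..<A])) m' (A * 2 + 1)
        (\<lambda>m'. J (Z \<union> G r) m' \<and> m' tR [] = r)"
      unfolding G_def by (intro runs_seqs[of "\<lambda>Z m'. J Z m' \<and> m' tR [] = r"] step) auto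
  qed (use T in \<open>simp_all add: J_def agree_upd\<close>)
  moreover have "(\<Union>r\<in>{r. prow r}. G r) = {kf r a |r a. prow r \<and> a < A \<and> cf r a}"
    by (auto simp: G_def split: if_splits)
  ultimately show ?thesis
    using rows_time[of "A * 2 + 1"] by (elim runs_weaken) (auto simp: J_def algebra_simps)
qed

lemma runs_clear_rows:
  assumes T: "T < 32" "T \<noteq> tR" and mT: "m T = tab S"
    and key: "\<And>r a m'. prow r \<Longrightarrow> a < A \<Longrightarrow> m' tR [] = r \<Longrightarrow> agree {tR, T} m m' \<Longrightarrow> 
      map (ev B I m') (key a) = kf r a"
    and inK: "\<And>r a. prow r \<Longrightarrow> a < A \<Longrightarrow> (T, kf r a) \<in> K"
  shows "runs B I K (clear_rows A T key) m (np * (2 * A + 5))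
    (\<lambda>m'. m' T = tab (S - {kf r a |r a. prow r \<and> a < A}) \<and> agree {tR, T} m m')"
proof -
  define J where "J Z m' \<longleftrightarrow> m' T = tab (S - Z) \<and> agree {tR, T} m m'" for Z m'
  define G where "G r = (\<Union>a<A. {kf r a})" for r
  have eq: "S - Z - {k} = S - insert k Z" for k :: "nat list" and Z by auto
  have step: "runs B I K (Put T (key a) (Const 0)) m' 2 (\<lambda>m''. J (Z \<union> {kf r a}) m'' \<and> m'' tR [] = r)"
    if "prow r" "a < A" "J Z m' \<and> m' tR [] = r" for r a Z m'
    using that key[of r a m'] inK[of r a] T
    by (intro runs_Put) (auto simp: J_def tab_remove agree_upd eq)
  have "runs B I K (clear_rows A T key) m ((\<Sum>r=1..np. (A * 2 + 1) + 2) + 2) (J ({} \<union> (\<Union>r\<in>{r. prow r}. G r)))"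
    unfolding clear_rows_def
  proof (rule runs_for_rows[where J = J])
    show "J {} m" using mT by (simp add: J_def)
    fix r Z m' assume "prow r" "J Z m'" "m' tR [] = r"
    then show "runs B I K (seqs (map (\<lambda>a. Put T (key a) (Const 0)) [0..<A])) m' (A * 2 + 1)
        (\<lambda>m'. J (Z \<union> G r) m' \<and> m' tR [] = r)"
      unfolding G_def by (intro runs_seqs[of "\<lambda>Z m'. J Z m' \<and> m' tR [] = r"] step) auto
  qed (use T in \<open>simp_all add: J_def agree_upd\<close>)
  moreover have "(\<Union>r\<in>{r. prow r}. G r) = {kf r a |r a. prow r \<and> a < A}"
    by (auto simp: G_def)
  ultimately show ?thesis
    using rows_time[of "A * 2 + 1"] by (elim runs_weaken) (auto simp: J_def algebra_simps)
qed

end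

section \<open>Unification on the machine\<close>

lemma tr_Const [simp]: "tr B I m (Const n) \<longleftrightarrow> n \<noteq> 0"
  by (simp add: tr_def)

text \<open>A position is an argument of the precondition (\<open>True\<close>) or of the effect (\<open>False\<close>).\<close>

type_synonym position = "bool \<times> nat"

definition positions :: "nat \<Rightarrow> position list" where
  "positions A = List.product [False, True] [0..<A]"

definition reg :: "position \<Rightarrow> nat" where
  "reg z = (if fst z then tR else tE)"

text \<open>The last entry of the list implements renaming apart: arguments of different atoms can
  be the same term only if they are constants.\<close>

definition sameE :: "position \<Rightarrow> position \<Rightarrow> exp" where
  "sameE z z' = Ands [validE (reg z) (snd z), validE (reg z') (snd z'),
     Equal (kindE (reg z) (snd z)) (kindE (reg z') (snd z')),
     Equal (valE (reg z) (snd z)) (valE (reg z') (snd z')),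
     if fst z = fst z' then Const 1 else Equal (kindE (reg z) (snd z)) (Const 0)]"

text \<open>
  Reachability in at most \<open>k\<close> steps in the graph that joins corresponding arguments; since the
  arities are bounded, this is an expression of constant size.
\<close>

fun reachE :: "nat \<Rightarrow> nat \<Rightarrow> position \<Rightarrow> position \<Rightarrow> exp" where
  "reachE A 0 z z' = sameE z z'"
| "reachE A (Suc k) z z' = Or (reachE A k z z')
     (Ors (map (\<lambda>i. Or (And (reachE A k z (False, i)) (sameE (True, i) z'))
                       (And (reachE A k z (True, i)) (sameE (False, i) z'))) [0..<A]))"

text \<open>The graph has at most \<open>A\<close> pairs of corresponding arguments and their
  converses, hence at most \<open>2 * A\<close> edges, and the number of edges bounds the length of
  the walks that have to be considered.\<close>

definition linkE :: "nat \<Rightarrow> position \<Rightarrow> position \<Rightarrow> exp" where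
  "linkE A = reachE A (2 * A)"

definition pcstE :: "position \<Rightarrow> exp" where
  "pcstE z = cstE (reg z) (snd z)"

definition pvalE :: "position \<Rightarrow> exp" where
  "pvalE z = valE (reg z) (snd z)"

definition Imp :: "exp \<Rightarrow> exp \<Rightarrow> exp" where
  "Imp e f = Or (Not_exp e) f"

lemma tr_Imp [simp]: "2 < B \<Longrightarrow> tr B I m (Imp e f) \<longleftrightarrow> (tr B I m e \<longrightarrow> tr B I m f)"
  by (simp add: Imp_def)

text \<open>Intersected domains are not stored: a constant belongs to one if neither the
  preconditions of the clause itself nor the primary ones exclude it, which takes two
  lookups.\<close>

definition inE :: "exp \<Rightarrow> exp \<Rightarrow> exp" where
  "inE v c = And (Not_exp (Get tREJ [fld tE 0, fld tE 1, v, c])) (Not_exp (Get tREJ [fld tE 0, Const 0, v, c]))"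

text \<open>
  A clause without positive preconditions of its own has the same domains as the primary clause.
\<close>

definition actE :: exp where
  "actE = Ors [Equal (fld tE 0) (Const 0),
     And (Get tOWN [fld tE 0, fld tE 1]) (Get tACT [fld tE 0, fld tE 1]),
     And (Not_exp (Get tOWN [fld tE 0, fld tE 1])) (Get tACT [fld tE 0, Const 0])]"

text \<open>Constants are quantified through the positions they occupy. This covers all cases,
  because by \<open>links_ends\<close> a constant linked to another term occurs as an
  argument.\<close>

definition unifiableE :: "nat \<Rightarrow> exp" where
  "unifiableE A = Ands [Equal (fld tE 2) (Const 0), Equal (fld tR 2) (Const 0),
     Equal (fld tE 3) (fld tR 3), Equal (fld tE 4) (fld tR 4),
     Ands (map (\<lambda>(z, z'). Imp (And (And (pcstE z) (pcstE z')) (linkE A z z')) (Equal (pvalE z) (pvalE z')))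
       (List.product (positions A) (positions A))),
     Ands (map (\<lambda>(a, z). Imp (And (And (varE tE a) (pcstE z)) (linkE A (False, a) z)) (inE (valE tE a) (pvalE z)))
       (List.product [0..<A] (positions A)))]"

definition contributesE :: "nat \<Rightarrow> nat \<Rightarrow> exp" where
  "contributesE A b = Ands [varE tR b,
     Ands (map (\<lambda>z. Imp (And (pcstE z) (linkE A (True, b) z)) (Equal (Reg tC) (pvalE z))) (positions A)),
     Ands (map (\<lambda>a. Imp (And (varE tE a) (linkE A (False, a) (True, b))) (inE (valE tE a) (Reg tC))) [0..<A])]"

context rows
begin

definition ratom :: "nat \<Rightarrow> atom" where
  "ratom r = Atom (rprd r) (rtms r)"

text \<open>As a complement this also contains numbers that are no constants of the problem when
  \<open>RJ\<close> is the table of the machine. It agrees with the intersected domain only at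
  constants of the problem, for which congruence rules are proved later.\<close>

definition rdom :: "nat list set \<Rightarrow> nat \<Rightarrow> nat \<Rightarrow> nat set" where
  "rdom RJ e v = {c. [rop e, rcl e, v, c] \<notin> RJ \<and> [rop e, 0, v, c] \<notin> RJ}"

definition runifiable :: "nat list set \<Rightarrow> nat \<Rightarrow> nat \<Rightarrow> bool" where
  "runifiable RJ e r \<longleftrightarrow> rtag e = 0 \<and> rtag r = 0 \<and> unifiable (rdom RJ e) (ratom e) (ratom r)"

definition rcontributes :: "nat list set \<Rightarrow> nat \<Rightarrow> nat \<Rightarrow> nat \<Rightarrow> nat \<Rightarrow> bool" where
  "rcontributes RJ e r u c \<longleftrightarrow> Var u \<in> set (rtms r) \<and> contributes (rdom RJ e) (ratom e) (ratom r) u c"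

definition ract :: "nat list set \<Rightarrow> nat list set \<Rightarrow> nat \<Rightarrow> bool" where
  "ract OW AC e \<longleftrightarrow> rop e = 0 \<or> (if [rop e, rcl e] \<in> OW then [rop e, rcl e] \<in> AC else [rop e, 0] \<in> AC)"

definition prow_of :: "nat \<Rightarrow> nat \<Rightarrow> position \<Rightarrow> nat" where
  "prow_of e r z = (if fst z then r else e)"

definition trm_at :: "nat \<Rightarrow> nat \<Rightarrow> position \<Rightarrow> (nat + nat) trm" where
  "trm_at e r z = (if fst z then map_trm Inr (rtms r ! snd z) else map_trm Inl (rtms e ! snd z))"

definition valid_at :: "nat \<Rightarrow> nat \<Rightarrow> position \<Rightarrow> bool" where
  "valid_at e r z \<longleftrightarrow> snd z < length (rtms (prow_of e r z))"

end

locale rows_pair = rows +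
  fixes m :: tmem and e r :: nat
  assumes e: "erow e" "m tE [] = e" and r: "prow r" "m tR [] = r"
begin

lemma rows_e: "row e" "row r"
  using e r by (simp_all add: erow_row prow_row)

lemma reg: "m (reg z) [] = prow_of e r z" "row (prow_of e r z)"
  using e r rows_e by (simp_all add: reg_def prow_of_def)

lemma tr_sameE: "tr B I m (sameE z z') \<longleftrightarrow> valid_at e r z \<and> valid_at e r z' \<and> trm_at e r z = trm_at e r z'"
proof -
  have "tr B I m (sameE z z') \<longleftrightarrow> valid_at e r z \<and> valid_at e r z' \<and>
     (isv (prow_of e r z) (snd z) \<longleftrightarrow> isv (prow_of e r z') (snd z')) \<and>
     nam (prow_of e r z) (snd z) = nam (prow_of e r z') (snd z') \<and>
     (fst z \<noteq> fst z' \<longrightarrow> \<not> isv (prow_of e r z) (snd z))"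
    using B reg[of z] reg[of z'] by (auto simp: sameE_def ev_row valid_at_def)
  also have "\<dots> \<longleftrightarrow> valid_at e r z \<and> valid_at e r z' \<and> trm_at e r z = trm_at e r z'"
    by (cases "rtms (prow_of e r z) ! snd z"; cases "rtms (prow_of e r z') ! snd z'")
       (auto simp: valid_at_def trm_at_def prow_of_def isv_def nam_simps)
  finally show ?thesis .
qed

definition step :: "((nat + nat) trm \<times> (nat + nat) trm) set" where
  "step = (let S = set (zip (map (map_trm Inl) (rtms e)) (map (map_trm Inr) (rtms r))) in S \<union> S\<inverse>)"

lemma step_iff:
  assumes "length (rtms e) = length (rtms r)"
  shows "(x, y) \<in> step \<longleftrightarrow> (\<exists>i<A. valid_at e r (False, i) \<and> valid_at e r (True, i) \<and>
    (x = trm_at e r (False, i) \<and> y = trm_at e r (True, i) \<or> x = trm_at e r (True, i) \<and> y = trm_at e r (False, i)))"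
proof -
  define S where "S = set (zip (map (map_trm (Inl :: nat \<Rightarrow> nat + nat)) (rtms e)) (map (map_trm (Inr :: nat \<Rightarrow> nat + nat)) (rtms r)))"
  have le: "length (rtms e) \<le> A" using len[of e] rows_e by (simp add: row_def)
  have S: "(x, y) \<in> S \<longleftrightarrow> (\<exists>i<length (rtms e). x = map_trm Inl (rtms e ! i) \<and> y = map_trm Inr (rtms r ! i))" for x y
    unfolding S_def in_set_zip using assms by simp (metis nth_map)
  have "(x, y) \<in> step \<longleftrightarrow> (x, y) \<in> S \<or> (y, x) \<in> S" by (simp add: step_def S_def Let_def)
  moreover have "i < length (rtms r) \<Longrightarrow> i < A" for i using le assms by simp
  ultimately show ?thesis
    unfolding S by (simp add: valid_at_def trm_at_def prow_of_def assms) blast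
qed

lemma tr_reachE:
  assumes l: "length (rtms e) = length (rtms r)"
  shows "tr B I m (reachE A k z z') \<longleftrightarrow>
    valid_at e r z \<and> valid_at e r z' \<and> (trm_at e r z, trm_at e r z') \<in> (\<Union>j\<le>k. step ^^ j)"
proof (induction k arbitrary: z')
  case 0
  then show ?case by (simp add: tr_sameE)
next
  case (Suc k)
  define W where "W = (\<Union>j\<le>k. step ^^ j)"
  have eq: "(\<Union>j\<le>Suc k. step ^^ j) = W \<union> W O step"
  proof (intro equalityI subrelI)
    fix x y assume "(x, y) \<in> (\<Union>j\<le>Suc k. step ^^ j)"
    then obtain j where j: "j \<le> Suc k" "(x, y) \<in> step ^^ j" by blast
    show "(x, y) \<in> W \<union> W O step"
    proof (cases "j \<le> k")
      case True
      then show ?thesis using j unfolding W_def by blast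
    next
      case False
      then have "(x, y) \<in> step ^^ k O step" using j by (simp add: le_Suc_eq)
      then show ?thesis unfolding W_def by blast
    qed
  next
    fix x y assume "(x, y) \<in> W \<union> W O step"
    then consider j where "j \<le> k" "(x, y) \<in> step ^^ j" | j where "Suc j \<le> Suc k" "(x, y) \<in> step ^^ Suc j"
      unfolding W_def by auto
    then show "(x, y) \<in> (\<Union>j\<le>Suc k. step ^^ j)" by cases (blast intro: le_SucI)+
  qed
  have "tr B I m (reachE A (Suc k) z z') \<longleftrightarrow> tr B I m (reachE A k z z') \<or>
    (\<exists>i<A. tr B I m (reachE A k z (False, i)) \<and> tr B I m (sameE (True, i) z') \<or>
           tr B I m (reachE A k z (True, i)) \<and> tr B I m (sameE (False, i) z'))"
    using B by (simp add: Bex_def atLeast0LessThan)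
  moreover have "(x, y) \<in> W O step \<longleftrightarrow> (\<exists>i<A. valid_at e r (False, i) \<and> valid_at e r (True, i) \<and>
      ((x, trm_at e r (False, i)) \<in> W \<and> trm_at e r (True, i) = y \<or>
       (x, trm_at e r (True, i)) \<in> W \<and> trm_at e r (False, i) = y))" for x y
    unfolding relcomp_unfold mem_Collect_eq prod.case step_iff[OF l] by (safe; blast)
  ultimately show ?case
    unfolding eq Suc.IH W_def[symmetric] tr_sameE Un_iff by simp meson
qed

lemma tr_linkE:
  assumes l: "length (rtms e) = length (rtms r)"
  shows "tr B I m (linkE A z z') \<longleftrightarrow>
    valid_at e r z \<and> valid_at e r z' \<and> (trm_at e r z, trm_at e r z') \<in> atom_links (ratom e) (ratom r)"
proof -
  have fin: "finite step" by (simp add: step_def Let_def)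
  have "card step \<le> 2 * A"
  proof -
    define S where "S = set (zip (map (map_trm (Inl :: nat \<Rightarrow> nat + nat)) (rtms e)) (map (map_trm (Inr :: nat \<Rightarrow> nat + nat)) (rtms r)))"
    have "card S \<le> length (rtms e)"
      using card_length[of "zip (map (map_trm (Inl :: nat \<Rightarrow> nat + nat)) (rtms e)) (map (map_trm (Inr :: nat \<Rightarrow> nat + nat)) (rtms r))"]
      by (simp add: S_def)
    moreover have "card step \<le> card S + card (S\<inverse>)"
      unfolding step_def S_def[symmetric] Let_def by (rule card_Un_le)
    moreover have "length (rtms e) \<le> A" using len[of e] rows_e by (simp add: row_def)
    ultimately show ?thesis by simp
  qed
  then have "(\<Union>n\<in>{n. n \<le> card step}. step ^^ n) \<subseteq> (\<Union>j\<le>2 * A. step ^^ j)" by fastforce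
  then have "step\<^sup>* \<subseteq> (\<Union>j\<le>2 * A. step ^^ j)" unfolding rtrancl_finite_eq_relpow[OF fin] .
  moreover have "(\<Union>j\<le>2 * A. step ^^ j) \<subseteq> step\<^sup>*" by (auto intro: relpow_imp_rtrancl)
  moreover have "atom_links (ratom e) (ratom r) = step\<^sup>*"
    by (simp add: atom_links_def links_def ratom_def step_def Let_def)
  ultimately show ?thesis
    unfolding linkE_def tr_reachE[OF l] by auto
qed

end

text \<open>The treatment of one effect, one precondition and one constant. It reads domains and
  activity only through \<open>tREJ\<close>, \<open>tOWN\<close> and \<open>tACT\<close>, which do
  not change during propagation; so all unifications of a round see the situation at its start.
  \<open>tIND\<close> is consulted only to recognise new elements.\<close>

definition elem :: "nat \<Rightarrow> com" where
  "elem A = Cond (And actE (unifiableE A))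
     (Seq (Put tMAT [Reg tR] (Const 1))
       (seqs (map (\<lambda>b. Cond (And (contributesE A b) (Not_exp (Get tIND [Reg tR, valE tR b, Reg tC])))
         (Seq (Put tIND [Reg tR, valE tR b, Reg tC] (Const 1))
           (Seq (Put tND [Reg tC] (Const 1)) (Put tAUG [fld tR 0, fld tR 1] (Const 1)))) Skip) [0..<A])))
     Skip"

lemma tr_Ands_list:
  assumes "2 < B"
  shows "tr B I m (Ands []) \<longleftrightarrow> True" "tr B I m (Ands (e # es)) \<longleftrightarrow> tr B I m e \<and> tr B I m (Ands es)"
  using assms by simp_all

context rows_pair
begin

lemma tr_pcstE: "tr B I m (pcstE z) \<longleftrightarrow> valid_at e r z \<and> (\<exists>c. trm_at e r z = Cst c)"
  using reg[of z] by (cases "rtms (prow_of e r z) ! snd z")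
    (auto simp: pcstE_def ev_row isc_def valid_at_def trm_at_def prow_of_def)

lemma ev_pvalE: "valid_at e r z \<Longrightarrow> trm_at e r z = Cst c \<Longrightarrow> ev B I m (pvalE z) = c"
  using reg[of z] by (cases "rtms (prow_of e r z) ! snd z")
    (auto simp: pvalE_def ev_row nam_simps valid_at_def trm_at_def prow_of_def split: if_splits)

lemma Cst_position:
  assumes "Cst c \<in> set (map (map_trm Inl) (rtms e)) \<union> set (map (map_trm Inr) (rtms r))"
  shows "\<exists>z \<in> set (positions A). valid_at e r z \<and> trm_at e r z = Cst c"
proof -
  have le: "length (rtms e) \<le> A" "length (rtms r) \<le> A"
    using len[of e] len[of r] rows_e by (auto simp: row_def)
  show ?thesis
    using assms
  proof
    assume "Cst c \<in> set (map (map_trm Inl) (rtms e))"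
    then obtain i where "i < length (rtms e)" "rtms e ! i = Cst c"
      by (auto simp: Cst_in_map in_set_conv_nth)
    then show ?thesis using le
      by (intro bexI[of _ "(False, i)"]) (auto simp: positions_def valid_at_def trm_at_def prow_of_def)
  next
    assume "Cst c \<in> set (map (map_trm Inr) (rtms r))"
    then obtain i where "i < length (rtms r)" "rtms r ! i = Cst c"
      by (auto simp: Cst_in_map in_set_conv_nth)
    then show ?thesis using le
      by (intro bexI[of _ "(True, i)"]) (auto simp: positions_def valid_at_def trm_at_def prow_of_def)
  qed
qed

lemma isv_position:
  "isv e a \<Longrightarrow> valid_at e r (False, a) \<and> trm_at e r (False, a) = Var (Inl (nam e a))"
  "isv r a \<Longrightarrow> valid_at e r (True, a) \<and> trm_at e r (True, a) = Var (Inr (nam r a))"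
  by (auto simp: isv_def valid_at_def trm_at_def prow_of_def nam_simps)

lemma tr_inE:
  assumes "m tREJ = tab RJ" "ev B I m v = x" "ev B I m c = y"
  shows "tr B I m (inE v c) \<longleftrightarrow> y \<in> rdom RJ e x"
  using B assms e rows_e by (simp add: inE_def ev_row rdom_def)

lemma tr_actE:
  assumes "m tOWN = tab OW" "m tACT = tab AC"
  shows "tr B I m actE \<longleftrightarrow> ract OW AC e"
  using B assms e rows_e by (auto simp: actE_def ev_row ract_def)

lemma tr_unifiableE:
  assumes m: "m tREJ = tab RJ"
  shows "tr B I m (unifiableE A) \<longleftrightarrow> runifiable RJ e r"
proof (cases "length (rtms e) = length (rtms r)")
  case True
  let ?L = "atom_links (ratom e) (ratom r)"
  note link = tr_linkE[OF True]
  have ends: "\<exists>z \<in> set (positions A). valid_at e r z \<and> trm_at e r z = Cst c"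
    if "(s, Cst c) \<in> ?L" "s \<noteq> Cst c" for s c
    using links_ends[OF that(1)[unfolded atom_links_def]] that(2) Cst_position[of c] by (simp add: ratom_def)
  have sym: "(s, t) \<in> ?L \<Longrightarrow> (t, s) \<in> ?L" for s t
    unfolding atom_links_def by (rule links_sym)
  have 1: "tr B I m (Ands (map (\<lambda>(z, z'). Imp (And (And (pcstE z) (pcstE z')) (linkE A z z')) (Equal (pvalE z) (pvalE z')))
       (List.product (positions A) (positions A)))) \<longleftrightarrow> (\<forall>c d. (Cst c, Cst d) \<in> ?L \<longrightarrow> c = d)" (is "?l \<longleftrightarrow> ?r")
  proof
    assume l: ?l
    show ?r
    proof (intro allI impI, rule ccontr)
      fix c d assume L: "(Cst c, Cst d) \<in> ?L" and ne: "c \<noteq> d"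
      obtain z where z: "z \<in> set (positions A)" "valid_at e r z" "trm_at e r z = Cst c"
        using ends[OF sym[OF L]] ne by auto
      obtain z' where z': "z' \<in> set (positions A)" "valid_at e r z'" "trm_at e r z' = Cst d"
        using ends[OF L] ne by auto
      have "tr B I m (Imp (And (And (pcstE z) (pcstE z')) (linkE A z z')) (Equal (pvalE z) (pvalE z')))"
        using l B z(1) z'(1) by simp
      then show False using B z z' L ne by (simp add: tr_pcstE link ev_pvalE)
    qed
  next
    assume r: ?r
    show ?l using B r by (auto simp: tr_pcstE link ev_pvalE)
  qed
  have 2: "tr B I m (Ands (map (\<lambda>(a, z). Imp (And (And (varE tE a) (pcstE z)) (linkE A (False, a) z)) (inE (valE tE a) (pvalE z)))
       (List.product [0..<A] (positions A)))) \<longleftrightarrow>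
     (\<forall>v c. Var v \<in> set (rtms e) \<and> (Var (Inl v), Cst c) \<in> ?L \<longrightarrow> c \<in> rdom RJ e v)" (is "?l \<longleftrightarrow> ?r")
  proof
    assume l: ?l
    show ?r
    proof (intro allI impI, elim conjE)
      fix v c assume v: "Var v \<in> set (rtms e)" and L: "(Var (Inl v), Cst c) \<in> ?L"
      obtain a where a: "a < A" "isv e a" "nam e a = v" using v Var_iff[OF rows_e(1)] by blast
      obtain z where z: "z \<in> set (positions A)" "valid_at e r z" "trm_at e r z = Cst c"
        using ends[OF L] by auto
      have "tr B I m (Imp (And (And (varE tE a) (pcstE z)) (linkE A (False, a) z)) (inE (valE tE a) (pvalE z)))"
        using l B z(1) a(1) by simp
      moreover have "tr B I m (inE (valE tE a) (pvalE z)) \<longleftrightarrow> c \<in> rdom RJ e v"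
        by (rule tr_inE[OF m]) (use e rows_e a z in \<open>simp_all add: ev_row ev_pvalE\<close>)
      ultimately show "c \<in> rdom RJ e v"
        using B z a L e rows_e isv_position(1)[OF a(2)] by (simp add: tr_pcstE link ev_row)
    qed
  next
    assume r: ?r
    have "tr B I m (inE (valE tE a) (pvalE z))"
      if "isv e a" "a < A" "trm_at e r z = Cst c" "valid_at e r z" "(trm_at e r (False, a), trm_at e r z) \<in> ?L" for a z c
    proof -
      have "c \<in> rdom RJ e (nam e a)"
        using r that Var_iff[OF rows_e(1)] isv_position(1)[OF that(1)] by auto
      then show ?thesis
        using tr_inE[OF m, of "valE tE a" _ "pvalE z"] e rows_e that by (simp add: ev_row ev_pvalE)
    qed
    then show ?l using B e rows_e by (auto simp: tr_pcstE link ev_row)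
  qed
  show ?thesis
    using B e r rows_e unfolding unifiableE_def tr_Ands_list[OF B(4)] 1 2
    by (simp add: ev_row runifiable_def unifiable_def ratom_def True)
next
  case False
  then show ?thesis using B e r rows_e by (simp add: unifiableE_def ev_row runifiable_def unifiable_def ratom_def)
qed

lemma tr_contributesE:
  assumes m: "m tREJ = tab RJ" and l: "length (rtms e) = length (rtms r)"
  shows "tr B I m (contributesE A b) \<longleftrightarrow>
    isv r b \<and> contributes (rdom RJ e) (ratom e) (ratom r) (nam r b) (m tC [])"
proof (cases "isv r b")
  case True
  let ?L = "atom_links (ratom e) (ratom r)"
  note link = tr_linkE[OF l] and b = isv_position(2)[OF True]
  have 1: "tr B I m (Ands (map (\<lambda>z. Imp (And (pcstE z) (linkE A (True, b) z)) (Equal (Reg tC) (pvalE z))) (positions A)))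
     \<longleftrightarrow> (\<forall>d. (Var (Inr (nam r b)), Cst d) \<in> ?L \<longrightarrow> m tC [] = d)" (is "?l \<longleftrightarrow> ?r")
  proof
    assume l: ?l
    show ?r
    proof (intro allI impI)
      fix d assume L: "(Var (Inr (nam r b)), Cst d) \<in> ?L"
      obtain z where z: "z \<in> set (positions A)" "valid_at e r z" "trm_at e r z = Cst d"
        using links_ends[OF L[unfolded atom_links_def]] Cst_position[of d] by (auto simp: ratom_def)
      have "tr B I m (Imp (And (pcstE z) (linkE A (True, b) z)) (Equal (Reg tC) (pvalE z)))"
        using l B z(1) by simp
      then show "m tC [] = d" using B z L b by (simp add: tr_pcstE link ev_pvalE)
    qed
  next
    assume r: ?r
    then show ?l using B b by (auto simp: tr_pcstE link ev_pvalE)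
  qed
  have 2: "tr B I m (Ands (map (\<lambda>a. Imp (And (varE tE a) (linkE A (False, a) (True, b))) (inE (valE tE a) (Reg tC))) [0..<A]))
     \<longleftrightarrow> (\<forall>v. Var v \<in> set (rtms e) \<and> (Var (Inl v), Var (Inr (nam r b))) \<in> ?L \<longrightarrow> m tC [] \<in> rdom RJ e v)"
  proof -
    have "tr B I m (inE (valE tE a) (Reg tC)) \<longleftrightarrow> m tC [] \<in> rdom RJ e (nam e a)" for a
      by (rule tr_inE[OF m]) (use e rows_e in \<open>simp_all add: ev_row\<close>)
    then show ?thesis
      using B e rows_e b isv_position(1) unfolding Var_iff[OF rows_e(1)] by (auto simp: link ev_row) blast
  qed
  show ?thesis
    using B True r rows_e unfolding contributesE_def tr_Ands_list[OF B(4)] 1 2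
    by (simp add: ev_row contributes_def ratom_def)
next
  case False
  then show ?thesis using B r rows_e by (simp add: contributesE_def ev_row)
qed

end

context rows
begin

definition fresh_consts :: "nat list set \<Rightarrow> nat list set \<Rightarrow> nat list set" where
  "fresh_consts X0 X = {[c] |r u c. [r, u, c] \<in> X \<and> [r, u, c] \<notin> X0}"

definition augmented :: "nat list set \<Rightarrow> nat list set \<Rightarrow> nat list set" where
  "augmented X0 X = {[rop r, rcl r] |r u c. [r, u, c] \<in> X \<and> [r, u, c] \<notin> X0}"

lemma fresh_insert: "[r, u, c] \<notin> X0 \<Longrightarrow> fresh_consts X0 (insert [r, u, c] X) = insert [c] (fresh_consts X0 X)"
  by (auto simp: fresh_consts_def)

lemma augmented_insert:
  "[r, u, c] \<notin> X0 \<Longrightarrow> augmented X0 (insert [r, u, c] X) = insert [rop r, rcl r] (augmented X0 X)"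
  by (auto simp: augmented_def)

definition fires :: "nat list set \<Rightarrow> nat list set \<Rightarrow> nat list set \<Rightarrow> nat \<Rightarrow> nat \<Rightarrow> bool" where
  "fires OW AC RJ e r \<longleftrightarrow> ract OW AC e \<and> runifiable RJ e r"

text \<open>A function of the set \<open>Z\<close> of triples treated so far. As
  \<open>fires\<close> refers to tables fixed during the round, the triples contribute independently
  of each other, and neither their order nor repetitions matter.\<close>

definition ind_after where
  "ind_after OW AC RJ X0 Z = X0 \<union> {[r, u, c] |e r c u. (e, r, c) \<in> Z \<and> fires OW AC RJ e r \<and> rcontributes RJ e r u c}"

definition mat_after where
  "mat_after OW AC RJ M0 Z = M0 \<union> {[r] |e r c. (e, r, c) \<in> Z \<and> fires OW AC RJ e r}"

definition elem_inv where
  "elem_inv OW AC RJ X0 M0 m0 Z m \<longleftrightarrow> m tIND = tab (ind_after OW AC RJ X0 Z) \<and> m tMAT = tab (mat_after OW AC RJ M0 Z) \<and>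
     m tND = tab (fresh_consts X0 (ind_after OW AC RJ X0 Z)) \<and>
     m tAUG = tab (augmented X0 (ind_after OW AC RJ X0 Z)) \<and>
     agree {tR, tE, tX, tC, tIND, tMAT, tND, tAUG} m0 m"

end

context rows_mem
begin

lemma runs_elem:
  assumes m0: "m0 tREJ = tab RJ" "m0 tOWN = tab OW" "m0 tACT = tab AC"
    and inv: "elem_inv OW AC RJ X0 M0 m0 Z m"
    and regs: "erow e" "prow r" "m tE [] = e" "m tR [] = r" "m tC [] = c" "c \<in> cs"
  shows "runs B I K (elem A) m (4 * A + 3)
    (\<lambda>m'. elem_inv OW AC RJ X0 M0 m0 (Z \<union> {(e, r, c)}) m' \<and> agree {tIND, tMAT, tND, tAUG} m m')"
proof -
  let ?T = "{tIND, tMAT, tND, tAUG}" and ?X = "ind_after OW AC RJ X0 Z" and ?M = "mat_after OW AC RJ M0 Z"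
  have ag: "agree {tR, tE, tX, tC, tIND, tMAT, tND, tAUG} m0 m"
    and m: "m tIND = tab ?X" "m tMAT = tab ?M" "m tND = tab (fresh_consts X0 ?X)" "m tAUG = tab (augmented X0 ?X)"
    using inv by (auto simp: elem_inv_def)
  have X0: "X0 \<subseteq> ?X" by (auto simp: ind_after_def)
  have pair: "rows_pair B I A np ne cs rop rcl rtag rprd rtms m' e r" if "agree ?T m m'" for m'
    using that regs agreeD[OF that] by unfold_locales auto
  have tabs: "m' tREJ = tab RJ \<and> m' tOWN = tab OW \<and> m' tACT = tab AC" if "agree ?T m m'" for m'
    using agreeD[OF that] agreeD[OF ag] m0 by simp
  have cond: "tr B I m (And actE (unifiableE A)) \<longleftrightarrow> fires OW AC RJ e r"
    using rows_pair.tr_actE[OF pair[OF agree_refl]] rows_pair.tr_unifiableE[OF pair[OF agree_refl]] tabs[OF agree_refl] B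
    by (simp add: fires_def)
  show ?thesis
    unfolding elem_def
  proof (rule runs_If[where T = "4 * A + 2"])
    assume "\<not> tr B I m (And actE (unifiableE A))"
    then have nf: "\<not> fires OW AC RJ e r" by (simp add: cond)
    have "ind_after OW AC RJ X0 (Z \<union> {(e, r, c)}) = ?X" "mat_after OW AC RJ M0 (Z \<union> {(e, r, c)}) = ?M"
      using nf by (auto simp: ind_after_def mat_after_def)
    then show "runs B I K Skip m (4 * A + 2)
      (\<lambda>m'. elem_inv OW AC RJ X0 M0 m0 (Z \<union> {(e, r, c)}) m' \<and> agree ?T m m')"
      using inv by (intro runs_Skip) (auto simp: elem_inv_def)
  next
    assume "tr B I m (And actE (unifiableE A))"
    then have f: "fires OW AC RJ e r" by (simp add: cond)
    then have len_eq: "length (rtms e) = length (rtms r)"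
      by (simp add: fires_def runifiable_def unifiable_def ratom_def)
    define J where "J Y m' \<longleftrightarrow> m' tIND = tab (?X \<union> Y) \<and> m' tMAT = tab (insert [r] ?M) \<and>
      m' tND = tab (fresh_consts X0 (?X \<union> Y)) \<and> m' tAUG = tab (augmented X0 (?X \<union> Y)) \<and> agree ?T m m'" for Y m'
    define G where "G b = (if isv r b \<and> rcontributes RJ e r (nam r b) c then {[r, nam r b, c]} else {})" for b
    have upd: "J (Y \<union> {[r, nam r b, c]})
       (m'(tIND := tab (insert [r, nam r b, c] (?X \<union> Y)), tND := tab (insert [c] (fresh_consts X0 (?X \<union> Y))),
           tAUG := tab (insert [rop r, rcl r] (augmented X0 (?X \<union> Y)))))"
      if J: "J Y m'" and n: "[r, nam r b, c] \<notin> ?X \<union> Y" for Y m' b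
    proof -
      \<comment> \<open>What is new now is also new relative to the start of the round, so the marks
        in \<open>tND\<close> and \<open>tAUG\<close> are justified.\<close>
      have "[r, nam r b, c] \<notin> X0" using n X0 by blast
      then show ?thesis
        using J fresh_insert[of r "nam r b" c X0 "?X \<union> Y"] augmented_insert[of r "nam r b" c X0 "?X \<union> Y"]
        by (auto simp: J_def intro!: agree_upd)
    qed
    have step: "runs B I K (Cond (And (contributesE A b) (Not_exp (Get tIND [Reg tR, valE tR b, Reg tC])))
         (Seq (Put tIND [Reg tR, valE tR b, Reg tC] (Const 1))
           (Seq (Put tND [Reg tC] (Const 1)) (Put tAUG [fld tR 0, fld tR 1] (Const 1)))) Skip) m' 4 (J (Y \<union> G b))"
      if b: "b < A" and J: "J Y m'" for b Y m'
    proof -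
      have ag': "agree ?T m m'" using J by (simp add: J_def)
      have r': "m' tR [] = r" "m' tC [] = c" "row r" using agreeD[OF ag'] regs prow_row by auto
      have c: "tr B I m' (And (contributesE A b) (Not_exp (Get tIND [Reg tR, valE tR b, Reg tC])))
         \<longleftrightarrow> G b \<noteq> {} \<and> [r, nam r b, c] \<notin> ?X \<union> Y"
        using B r' J rows_pair.tr_contributesE[OF pair[OF ag'] _ len_eq, of RJ b] tabs[OF ag'] Var_iff[OF r'(3), of "nam r b"] b
        by (auto simp: G_def J_def ev_row rcontributes_def)
      show ?thesis
      proof (rule runs_If[where T = 3])
        assume "tr B I m' (And (contributesE A b) (Not_exp (Get tIND [Reg tR, valE tR b, Reg tC])))"
        then have Gb: "G b = {[r, nam r b, c]}" and n: "[r, nam r b, c] \<notin> ?X \<union> Y"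
          using c by (auto simp: G_def split: if_splits)
        have m': "m' tIND = tab (?X \<union> Y)" "m' tND = tab (fresh_consts X0 (?X \<union> Y))" "m' tAUG = tab (augmented X0 (?X \<union> Y))"
          using J by (auto simp: J_def)
        show "runs B I K (Seq (Put tIND [Reg tR, valE tR b, Reg tC] (Const 1))
           (Seq (Put tND [Reg tC] (Const 1)) (Put tAUG [fld tR 0, fld tR 1] (Const 1)))) m' 3 (J (Y \<union> G b))"
          using upd[OF J n] r' regs b m' in_K unfolding Gb
          by (intro runs_Seq[where ?T1.0 = 1 and ?T2.0 = 2] runs_Seq[where ?T1.0 = 1 and ?T2.0 = 1] runs_Put) (simp_all add: ev_row tab_insert)
      next
        assume "\<not> tr B I m' (And (contributesE A b) (Not_exp (Get tIND [Reg tR, valE tR b, Reg tC])))"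
        then have "?X \<union> (Y \<union> G b) = ?X \<union> Y" using c by (auto simp: G_def split: if_splits)
        then show "runs B I K Skip m' 3 (J (Y \<union> G b))"
          using J by (intro runs_Skip) (simp_all add: J_def)
      qed simp
    qed
    have XG: "?X \<union> ({} \<union> (\<Union>b<A. G b)) = ind_after OW AC RJ X0 (Z \<union> {(e, r, c)})"
    proof -
      have "(\<Union>b<A. G b) = {[r, u, c] |u. rcontributes RJ e r u c}"
        using Var_iff[OF prow_row[OF regs(2)]] by (auto simp: G_def rcontributes_def split: if_splits)
      then show ?thesis using f by (auto simp: ind_after_def)
    qed
    have M: "insert [r] ?M = mat_after OW AC RJ M0 (Z \<union> {(e, r, c)})"
      using f by (auto simp: mat_after_def)
    have fin: "elem_inv OW AC RJ X0 M0 m0 (Z \<union> {(e, r, c)}) m' \<and> agree ?T m m'"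
      if "J ({} \<union> (\<Union>b<A. G b)) m'" for m'
    proof -
      have "agree {tR, tE, tX, tC, tIND, tMAT, tND, tAUG} m0 m'"
        using that by (intro agree_trans[OF ag, of ?T m']) (auto simp: J_def)
      then show ?thesis using that unfolding elem_inv_def J_def XG M by blast
    qed
    show "runs B I K (Seq (Put tMAT [Reg tR] (Const 1)) (seqs (map (\<lambda>b. Cond (And (contributesE A b) (Not_exp (Get tIND [Reg tR, valE tR b, Reg tC])))
         (Seq (Put tIND [Reg tR, valE tR b, Reg tC] (Const 1))
           (Seq (Put tND [Reg tC] (Const 1)) (Put tAUG [fld tR 0, fld tR 1] (Const 1)))) Skip) [0..<A]))) m (4 * A + 2)
      (\<lambda>m'. elem_inv OW AC RJ X0 M0 m0 (Z \<union> {(e, r, c)}) m' \<and> agree ?T m m')"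
    proof (rule runs_Seq[where ?T1.0 = 1 and ?T2.0 = "A * 4 + 1"], rule runs_Put)
      let ?m = "m(tMAT := (m tMAT)(map (ev B I m) [Reg tR] := ev B I m (Const 1)))"
      have "J {} ?m"
        using m regs by (simp add: J_def tab_insert agree_upd)
      then show "runs B I K (seqs (map (\<lambda>b. Cond (And (contributesE A b) (Not_exp (Get tIND [Reg tR, valE tR b, Reg tC])))
         (Seq (Put tIND [Reg tR, valE tR b, Reg tC] (Const 1))
           (Seq (Put tND [Reg tC] (Const 1)) (Put tAUG [fld tR 0, fld tR 1] (Const 1)))) Skip) [0..<A])) ?m (A * 4 + 1)
        (\<lambda>m'. elem_inv OW AC RJ X0 M0 m0 (Z \<union> {(e, r, c)}) m' \<and> agree ?T m m')"
        by (intro runs_weaken[OF runs_seqs[where J = J and G = G, OF _ step] order_refl fin])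
    qed (use in_K(4) regs in simp_all)
  qed simp
qed

end

section \<open>One round of the main loop\<close>

definition for_consts :: "com \<Rightarrow> com" where
  "for_consts body = For tX (Const 0) (Reg tCNT) (Seq (Put tC [] (Get tCL [Reg tX])) body)"

definition posE :: exp where
  "posE = Equal (fld tR 2) (Const 0)"

definition dirtyE :: "nat \<Rightarrow> nat \<Rightarrow> exp" where
  "dirtyE A \<rho> = Ors (map (\<lambda>a. And (cstE \<rho> a) (Get tDIRTY [valE \<rho> a])) [0..<A])"

definition propagate_pairs :: "nat \<Rightarrow> com" where
  "propagate_pairs A = for_effs (for_rows tR
     (Cond (Ors [Reg tFULL, dirtyE A tE, dirtyE A tR]) (for_consts (elem A)) Skip))"

definition propagate_consts :: "nat \<Rightarrow> com" where
  "propagate_consts A = for_consts (Cond (Get tDIRTY [Reg tC]) (for_effs (for_rows tR (elem A))) Skip)"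

definition own_key :: "exp list" where
  "own_key = [fld tR 0, fld tR 1]"

definition primary_key :: "exp list" where
  "primary_key = [fld tR 0, Const 0]"

text \<open>An entry of \<open>tREJ\<close> stands for the existence of an excluding precondition,
  so the growth of a single individual domain does not decide whether it may be erased. All entries
  of the constant are erased and rebuilt in one scan each. Entries of \<open>tNE\<close> only
  appear, because domains only grow.\<close>

definition update_rej :: "nat \<Rightarrow> com" where
  "update_rej A = Seq (clear_rows A tREJ (\<lambda>a. own_key @ [valE tR a, Reg tC]))
     (Seq (set_rows A tREJ (\<lambda>a. own_key @ [valE tR a, Reg tC])
            (\<lambda>a. Ands [posE, varE tR a, Not_exp (Get tIND [Reg tR, valE tR a, Reg tC])]))
          (set_rows A tNE (\<lambda>a. own_key @ [valE tR a])
            (\<lambda>a. Ands [posE, varE tR a, Not_exp (Get tREJ (own_key @ [valE tR a, Reg tC])),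
                        Not_exp (Get tREJ (primary_key @ [valE tR a, Reg tC]))])))"

definition commit :: "nat \<Rightarrow> com" where
  "commit A = Seq (Put tCH [] (Const 0)) (for_consts (Cond (Get tND [Reg tC])
     (Seq (update_rej A) (Seq (Put tCH [] (Const 1)) (Seq (Put tDIRTY [Reg tC] (Const 1)) (Put tND [Reg tC] (Const 0)))))
     (Put tDIRTY [Reg tC] (Const 0))))"

definition activeE :: exp where
  "activeE = Ands [posE, Get tFLAG own_key, Not_exp (Get tBAD own_key), Not_exp (Get tBAD primary_key)]"

text \<open>\<open>tFULL\<close> is computed before \<open>tACT\<close> is extended, since it
  compares the active clauses of now with those of the previous round. \<open>tUN\<close> and
  \<open>tBAD\<close> are rebuilt because clauses can leave them; \<open>tFLAG\<close> and
  \<open>tACT\<close> only grow.\<close>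

definition update_clauses :: "nat \<Rightarrow> com" where
  "update_clauses A =
     Seq (clear_rows A tUN (\<lambda>a. own_key))
    (Seq (set_rows A tUN (\<lambda>a. own_key) (\<lambda>a. Ands [posE, Not_exp (Get tMAT [Reg tR])]))
    (Seq (clear_rows A tBAD (\<lambda>a. own_key))
    (Seq (set_rows A tBAD (\<lambda>a. own_key)
            (\<lambda>a. Ands [posE, varE tR a, Not_exp (Get tNE (own_key @ [valE tR a]))]))
    (Seq (set_rows A tFLAG (\<lambda>a. own_key)
            (\<lambda>a. Ands [posE, Not_exp (Get tUN own_key), Not_exp (Get tUN primary_key),
                        Or (Get tAUG own_key) (Get tAUG primary_key)]))
    (Seq (Put tFULL [] (Const 0))
    (Seq (set_rows A tFULL (\<lambda>a. []) (\<lambda>a. And activeE (Not_exp (Get tACT own_key))))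
    (Seq (set_rows A tACT (\<lambda>a. own_key) (\<lambda>a. activeE))
         (clear_rows A tAUG (\<lambda>a. own_key)))))))))"

definition round :: "nat \<Rightarrow> com" where
  "round A = Seq (propagate_pairs A) (Seq (propagate_consts A) (Seq (commit A) (update_clauses A)))"

context rows
begin

definition consts_ok :: "tmem \<Rightarrow> bool" where
  "consts_ok m \<longleftrightarrow> (\<exists>l. distinct l \<and> set l = cs \<and> m tCNT [] = length l \<and> (\<forall>i<length l. m tCL [i] = l ! i))"

definition pos :: "nat \<Rightarrow> bool" where
  "pos r \<longleftrightarrow> prow r \<and> rtag r = 0"

definition dirty_row :: "nat list set \<Rightarrow> nat \<Rightarrow> bool" where
  "dirty_row DS r \<longleftrightarrow> (\<exists>c. Cst c \<in> set (rtms r) \<and> [c] \<in> DS)"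

definition rej :: "nat list set \<Rightarrow> nat list set" where
  "rej X = {[rop r, rcl r, x, c] |r x c. pos r \<and> Var x \<in> set (rtms r) \<and> c \<in> cs \<and> [r, x, c] \<notin> X}"

definition nonempty :: "nat list set \<Rightarrow> nat list set" where
  "nonempty X = {[rop r, rcl r, x] |r x. pos r \<and> Var x \<in> set (rtms r) \<and>
     (\<exists>c \<in> cs. [rop r, rcl r, x, c] \<notin> rej X \<and> [rop r, 0, x, c] \<notin> rej X)}"

definition own :: "nat list set" where
  "own = {[rop r, rcl r] |r. pos r}"

definition unmatched :: "nat list set \<Rightarrow> nat list set" where
  "unmatched M = {[rop r, rcl r] |r. pos r \<and> [r] \<notin> M}"

definition blocked :: "nat list set \<Rightarrow> nat list set" where
  "blocked X = {[rop r, rcl r] |r x. pos r \<and> Var x \<in> set (rtms r) \<and> [rop r, rcl r, x] \<notin> nonempty X}"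

definition flags :: "nat list set \<Rightarrow> nat list set \<Rightarrow> nat list set \<Rightarrow> nat list set" where
  "flags X0 X M = {[rop r, rcl r] |r. pos r \<and> [rop r, rcl r] \<notin> unmatched M \<and> [rop r, 0] \<notin> unmatched M \<and>
     ([rop r, rcl r] \<in> augmented X0 X \<or> [rop r, 0] \<in> augmented X0 X)}"

definition act_keys :: "nat list set \<Rightarrow> nat list set \<Rightarrow> nat list set" where
  "act_keys FL X = {[rop r, rcl r] |r. pos r \<and> [rop r, rcl r] \<in> FL \<and> [rop r, rcl r] \<notin> blocked X \<and>
     [rop r, 0] \<notin> blocked X}"

definition triples :: "bool \<Rightarrow> nat list set \<Rightarrow> (nat \<times> nat \<times> nat) set" where
  "triples F DS = {(e, r, c). erow e \<and> prow r \<and> c \<in> cs \<and>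
     (F \<or> dirty_row DS e \<or> dirty_row DS r \<or> [c] \<in> DS)}"

definition full_pairs :: "bool \<Rightarrow> nat list set \<Rightarrow> (nat \<times> nat) set" where
  "full_pairs F DS = {(e, r). erow e \<and> prow r \<and> (F \<or> dirty_row DS e \<or> dirty_row DS r)}"

end

context rows_mem
begin

text \<open>The list behind \<open>consts_ok\<close> is distinct, so the body may assume that its
  constant has not been treated yet. The commit step relies on this: its invariant combines new
  slices for treated constants with old ones for the rest.\<close>

lemma runs_for_consts_upto:
  assumes m: "consts_ok m" and J: "J Z m"
    and JX: "\<And>Z m v. J Z m \<Longrightarrow> J Z (m(tX := v))" and JC: "\<And>Z m v. J Z m \<Longrightarrow> J Z (m(tC := v))"
    and Jm: "\<And>Z m'. J Z m' \<Longrightarrow> m' tCNT = m tCNT \<and> m' tCL = m tCL"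
    and body: "\<And>c Y m'. c \<in> cs \<Longrightarrow> Y \<subseteq> cs \<Longrightarrow> c \<notin> Y \<Longrightarrow> J (Z \<union> \<Union>(G ` Y)) m' \<Longrightarrow> m' tC [] = c \<Longrightarrow>
      runs B I K body m' (f c) (\<lambda>m''. J (Z \<union> \<Union>(G ` Y) \<union> G c) m'' \<and> m'' tX = m' tX)"
  shows "runs B I K (for_consts body) m ((\<Sum>c\<in>cs. f c + 3) + 2) (J (Z \<union> (\<Union>c\<in>cs. G c)))"
proof -
  obtain l where l: "distinct l" "set l = cs" "m tCNT [] = length l" "\<And>i. i < length l \<Longrightarrow> m tCL [i] = l ! i"
    using m unfolding consts_ok_def by blast
  have card: "length l = card cs" using l(1,2) distinct_card by fastforce
  have K: "(t, []) \<in> K" if "t < 32" for t using in_K(1)[OF that] .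
  have step: "runs B I K (Seq (Put tC [] (Get tCL [Reg tX])) body) m' (f (l ! i) + 1)
      (\<lambda>m''. J (Z \<union> \<Union>((\<lambda>i. G (l ! i)) ` {0..<i}) \<union> G (l ! i)) m'' \<and> m'' tX [] = i)"
    if "0 \<le> i" "i < length l" "J (Z \<union> \<Union>((\<lambda>i. G (l ! i)) ` {0..<i})) m'" "m' tX [] = i" for i m'
  proof (rule runs_Seq[where ?T1.0 = 1 and ?T2.0 = "f (l ! i)"], rule runs_Put)
    let ?m = "m'(tC := (m' tC)(map (ev B I m') [] := ev B I m' (Get tCL [Reg tX])))"
    let ?Y = "(!) l ` {0..<i}"
    have Y: "\<Union>((\<lambda>i. G (l ! i)) ` {0..<i}) = \<Union>(G ` ?Y)" by simp
    have nY: "?Y \<subseteq> cs" "l ! i \<in> cs" "l ! i \<notin> ?Y"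
      using l(1,2) that(2) by (auto simp: nth_eq_iff_index_eq)
    have "J (Z \<union> \<Union>(G ` ?Y)) ?m" "?m tC [] = l ! i" "?m tX [] = i"
      using that JC[OF that(3)] Jm[OF that(3)] l(4) by simp_all
    then show "runs B I K body ?m (f (l ! i)) (\<lambda>m''. J (Z \<union> \<Union>((\<lambda>i. G (l ! i)) ` {0..<i}) \<union> G (l ! i)) m'' \<and> m'' tX [] = i)"
      unfolding Y using nY by (intro runs_weaken[OF body]) auto
  qed (use K in simp_all)
  have "runs B I K (for_consts body) m ((\<Sum>i=0..<length l. (f (l ! i) + 1) + 2) + 2)
      (J (Z \<union> \<Union>((\<lambda>i. G (l ! i)) ` {0..<length l})))"
    unfolding for_consts_def
    by (rule runs_For_upto[where J = J and lo = 0 and hi = "length l" and f = "\<lambda>i. f (l ! i) + 1" and G = "\<lambda>i. G (l ! i)",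
          OF K _ _ _ J JX _ step]) (use B card Jm l(3) in simp_all)
  moreover have "(\<Sum>i=0..<length l. (f (l ! i) + 1) + 2) = (\<Sum>i=0..<length l. f (l ! i) + 3)"
    by (intro sum.cong) auto
  moreover have "(\<Sum>i=0..<length l. f (l ! i) + 3) = (\<Sum>c\<in>cs. f c + 3)"
    by (rule sum.reindex_bij_betw[OF bij_betw_nth[OF l(1) _ l(2)[symmetric]]]) (rule atLeast0LessThan)
  moreover have "\<Union>((\<lambda>i. G (l ! i)) ` {0..<length l}) = (\<Union>c\<in>cs. G c)"
    unfolding bij_betw_imp_surj_on[OF bij_betw_nth[OF l(1) refl l(2)[symmetric]], symmetric] atLeast0LessThan
    by simp
  ultimately show ?thesis by (simp only:)
qed

lemma runs_for_consts:
  assumes "consts_ok m" "J Z m" "\<And>Z m v. J Z m \<Longrightarrow> J Z (m(tX := v))" "\<And>Z m v. J Z m \<Longrightarrow> J Z (m(tC := v))"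
    and "\<And>Z m'. J Z m' \<Longrightarrow> m' tCNT = m tCNT \<and> m' tCL = m tCL"
    and "\<And>c Z m'. c \<in> cs \<Longrightarrow> J Z m' \<Longrightarrow> m' tC [] = c \<Longrightarrow>
      runs B I K body m' (f c) (\<lambda>m''. J (Z \<union> G c) m'' \<and> m'' tX = m' tX)"
  shows "runs B I K (for_consts body) m ((\<Sum>c\<in>cs. f c + 3) + 2) (J (Z \<union> (\<Union>c\<in>cs. G c)))"
  by (rule runs_for_consts_upto[where J = J]) (rule assms; assumption)+

lemma runs_set_rows':
  assumes "T < 32" "T \<noteq> tR" "m T = tab S"
    and "\<And>r a m'. prow r \<Longrightarrow> row r \<Longrightarrow> a < A \<Longrightarrow> m' tR [] = r \<Longrightarrow> (\<And>t. t \<noteq> tR \<Longrightarrow> t \<noteq> T \<Longrightarrow> m' t = m t) \<Longrightarrow>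
      map (ev B I m') (key a) = kf r a \<and> (tr B I m' (cond a) \<longleftrightarrow> cf r a)"
    and "\<And>r a. prow r \<Longrightarrow> a < A \<Longrightarrow> cf r a \<Longrightarrow> (T, kf r a) \<in> K"
    and "S' = S \<union> {kf r a |r a. prow r \<and> a < A \<and> cf r a}"
  shows "runs B I K (set_rows A T key cond) m (np * (2 * A + 5)) (\<lambda>m'. m' T = tab S' \<and> agree {tR, T} m m')"
  unfolding assms(6)
  by (rule runs_set_rows[where T = T and m = m and S = S and kf = kf and cf = cf, OF assms(1-3) _ assms(5)]) (use assms(4) prow_row in \<open>simp_all add: agree_def\<close>)

lemma runs_clear_rows':
  assumes "T < 32" "T \<noteq> tR" "m T = tab S"
    and "\<And>r a m'. prow r \<Longrightarrow> row r \<Longrightarrow> a < A \<Longrightarrow> m' tR [] = r \<Longrightarrow> (\<And>t. t \<noteq> tR \<Longrightarrow> t \<noteq> T \<Longrightarrow> m' t = m t) \<Longrightarrow>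
      map (ev B I m') (key a) = kf r a"
    and "\<And>r a. prow r \<Longrightarrow> a < A \<Longrightarrow> (T, kf r a) \<in> K"
    and "S' = S - {kf r a |r a. prow r \<and> a < A}"
  shows "runs B I K (clear_rows A T key) m (np * (2 * A + 5)) (\<lambda>m'. m' T = tab S' \<and> agree {tR, T} m m')"
  unfolding assms(6)
  by (rule runs_clear_rows[where T = T and m = m and S = S and kf = kf, OF assms(1-3) _ assms(5)]) (use assms(4) prow_row in \<open>simp_all add: agree_def\<close>)

lemma tr_posE: "m tR [] = r \<Longrightarrow> prow r \<Longrightarrow> tr B I m posE \<longleftrightarrow> pos r"
  using prow_row[of r] by (simp add: posE_def ev_row pos_def)

lemma ev_keys: "m tR [] = r \<Longrightarrow> row r \<Longrightarrow> map (ev B I m) own_key = [rop r, rcl r]"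
  "m tR [] = r \<Longrightarrow> row r \<Longrightarrow> map (ev B I m) primary_key = [rop r, 0]"
  by (simp_all add: own_key_def primary_key_def ev_row)

lemma tr_dirtyE:
  assumes "m tDIRTY = tab DS" "m \<rho> [] = r" "row r"
  shows "tr B I m (dirtyE A \<rho>) \<longleftrightarrow> dirty_row DS r"
  using B assms Cst_iff[OF assms(3)] by (auto simp: dirtyE_def dirty_row_def ev_row Bex_def)

lemma elem_inv_upd:
  "elem_inv OW AC RJ X0 M0 m0 Z m \<Longrightarrow> t \<in> {tR, tE, tX, tC} \<Longrightarrow> elem_inv OW AC RJ X0 M0 m0 Z (m(t := v))"
  unfolding elem_inv_def by (auto intro: agree_upd)

lemma elem_inv_sel:
  "elem_inv OW AC RJ X0 M0 m0 Z m \<Longrightarrow> t \<notin> {tR, tE, tX, tC, tIND, tMAT, tND, tAUG} \<Longrightarrow> m t = m0 t"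
  unfolding elem_inv_def using agreeD by blast

context
  fixes m0 :: tmem and RJ OW AC DS F X0 M0 :: "nat list set"
  assumes m0: "m0 tREJ = tab RJ" "m0 tOWN = tab OW" "m0 tACT = tab AC" "m0 tDIRTY = tab DS" "m0 tFULL = tab F"
    and ok: "consts_ok m0"
begin

abbreviation inv where "inv \<equiv> elem_inv OW AC RJ X0 M0 m0"

lemma inv_ok: "inv Z m \<Longrightarrow> consts_ok m"
  using ok elem_inv_sel[of OW AC RJ X0 M0 m0 Z m tCNT] elem_inv_sel[of OW AC RJ X0 M0 m0 Z m tCL]
  by (simp add: consts_ok_def)

text \<open>The time stays a sum over pairs with a case distinction: in a single round all pairs may
  be expensive, and only over all rounds together are complete unifications rare.\<close>

lemma runs_propagate_pairs:
  assumes "inv Z m"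
  shows "runs B I K (propagate_pairs A) m
    ((\<Sum>e=Suc np..np + ne. (\<Sum>r=1..np. (if (e, r) \<in> full_pairs ([] \<in> F) DS then card cs * (4 * A + 6) + 2 else 0) + 4) + 4) + 2)
    (inv (Z \<union> {(e, r, c). (e, r) \<in> full_pairs ([] \<in> F) DS \<and> c \<in> cs}))"
proof -
  let ?P = "full_pairs ([] \<in> F) DS"
  let ?w = "\<lambda>e r. if (e, r) \<in> ?P then card cs * (4 * A + 6) + 2 else 0"
  define G where "G e r = {(e, r, c) |c. (e, r) \<in> ?P \<and> c \<in> cs}" for e r
  have inner: "runs B I K (Cond (Ors [Reg tFULL, dirtyE A tE, dirtyE A tR]) (for_consts (elem A)) Skip) m (?w e r + 2)
      (\<lambda>m'. inv (Z \<union> G e r) m' \<and> m' tE [] = e \<and> m' tR [] = r)"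
    if e: "erow e" "m tE [] = e" and r: "prow r" "m tR [] = r" and m: "inv Z m" for e r Z m
  proof -
    have tabs: "m tDIRTY = tab DS" "m tFULL = tab F" using elem_inv_sel[OF m] m0 by simp_all
    have cond: "tr B I m (Ors [Reg tFULL, dirtyE A tE, dirtyE A tR]) \<longleftrightarrow> (e, r) \<in> ?P"
      using B tr_dirtyE[OF tabs(1) e(2) erow_row[OF e(1)]] tr_dirtyE[OF tabs(1) r(2) prow_row[OF r(1)]] e r tabs
      by (auto simp: full_pairs_def)
    show ?thesis
    proof (rule runs_If)
      assume "tr B I m (Ors [Reg tFULL, dirtyE A tE, dirtyE A tR])"
      then have P: "(e, r) \<in> ?P" using cond by blast
      define J where "J Z m' \<longleftrightarrow> inv Z m' \<and> m' tE [] = e \<and> m' tR [] = r" for Z m'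
      have "runs B I K (for_consts (elem A)) m ((\<Sum>c\<in>cs. (4 * A + 3) + 3) + 2) (J (Z \<union> (\<Union>c\<in>cs. {(e, r, c)})))"
      proof (rule runs_for_consts[where J = J])
        fix c Z m' assume c: "c \<in> cs" and J: "J Z m'" and C: "m' tC [] = c"
        have "runs B I K (elem A) m' (4 * A + 3) (\<lambda>m''. inv (Z \<union> {(e, r, c)}) m'' \<and> agree {tIND, tMAT, tND, tAUG} m' m'')"
          using J C by (intro runs_elem m0 e r c) (auto simp: J_def)
        then show "runs B I K (elem A) m' (4 * A + 3) (\<lambda>m''. J (Z \<union> {(e, r, c)}) m'' \<and> m'' tX = m' tX)"
          using J by (elim runs_weaken) (auto simp: J_def agree_def)
      next
        fix Z m' assume "J Z m'"
        then show "m' tCNT = m tCNT \<and> m' tCL = m tCL"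
          using elem_inv_sel[OF m] elem_inv_sel[of OW AC RJ X0 M0 m0 Z m'] by (simp add: J_def)
      qed (use m e r inv_ok in \<open>auto simp: J_def elem_inv_upd\<close>)
      moreover have "(\<Union>c\<in>cs. {(e, r, c)}) = G e r" using P by (auto simp: G_def)
      ultimately show "runs B I K (for_consts (elem A)) m (?w e r + 1)
          (\<lambda>m'. inv (Z \<union> G e r) m' \<and> m' tE [] = e \<and> m' tR [] = r)"
        using P by (elim runs_weaken) (auto simp: J_def algebra_simps)
    next
      assume "\<not> tr B I m (Ors [Reg tFULL, dirtyE A tE, dirtyE A tR])"
      then have "(e, r) \<notin> ?P" using cond by blast
      then have "G e r = {}" by (auto simp: G_def)
      then show "runs B I K Skip m (?w e r + 1) (\<lambda>m'. inv (Z \<union> G e r) m' \<and> m' tE [] = e \<and> m' tR [] = r)"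
        using m e r by (intro runs_Skip) auto
    qed simp
  qed
  have "runs B I K (propagate_pairs A) m
    ((\<Sum>e=Suc np..np + ne. ((\<Sum>r=1..np. (?w e r + 2) + 2) + 2) + 2) + 2) (inv (Z \<union> (\<Union>e\<in>{e. erow e}. (\<Union>r\<in>{r. prow r}. G e r))))"
    unfolding propagate_pairs_def
  proof (rule runs_for_effs[where J = inv, OF assms])
    fix e Z m assume e: "erow e" and m: "inv Z m" "m tE [] = e"
    have "runs B I K (for_rows tR (Cond (Ors [Reg tFULL, dirtyE A tE, dirtyE A tR]) (for_consts (elem A)) Skip)) m
       ((\<Sum>r=1..np. (?w e r + 2) + 2) + 2) ((\<lambda>Z m. inv Z m \<and> m tE [] = e) (Z \<union> (\<Union>r\<in>{r. prow r}. G e r)))"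
    proof (rule runs_for_rows[where J = "\<lambda>Z m. inv Z m \<and> m tE [] = e"])
      fix r Z m assume "prow r" "inv Z m \<and> m tE [] = e" "m tR [] = r"
      then show "runs B I K (Cond (Ors [Reg tFULL, dirtyE A tE, dirtyE A tR]) (for_consts (elem A)) Skip) m
          (?w e r + 2) (\<lambda>m'. (inv (Z \<union> G e r) m' \<and> m' tE [] = e) \<and> m' tR [] = r)"
        by (elim conjE) (rule runs_weaken[OF inner[OF e] order_refl], simp_all)
    qed (use m in \<open>simp_all add: elem_inv_upd\<close>)
    then show "runs B I K (for_rows tR (Cond (Ors [Reg tFULL, dirtyE A tE, dirtyE A tR]) (for_consts (elem A)) Skip)) m
       ((\<Sum>r=1..np. (?w e r + 2) + 2) + 2) (\<lambda>m'. inv (Z \<union> (\<Union>r\<in>{r. prow r}. G e r)) m' \<and> m' tE [] = e)" .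
  qed (simp add: elem_inv_upd)
  moreover have "(\<Union>e\<in>{e. erow e}. (\<Union>r\<in>{r. prow r}. G e r)) = {(e, r, c). (e, r) \<in> ?P \<and> c \<in> cs}"
    by (auto simp: G_def full_pairs_def)
  moreover have "(\<Sum>r=1..np. (?w e r + 2) + 2) = (\<Sum>r=1..np. ?w e r + 4)" for e
    by (intro sum.cong) auto
  then have "(\<Sum>e=Suc np..np + ne. ((\<Sum>r=1..np. (?w e r + 2) + 2) + 2) + 2) = (\<Sum>e=Suc np..np + ne. (\<Sum>r=1..np. ?w e r + 4) + 4)"
    by (intro sum.cong) auto
  ultimately show ?thesis by (simp only:)
qed

lemma runs_propagate_consts:
  assumes "inv Z m"
  shows "runs B I K (propagate_consts A) m
    ((\<Sum>c\<in>cs. (if [c] \<in> DS then ne * (np * (4 * A + 5) + 4) + 2 else 0) + 5) + 2)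
    (inv (Z \<union> {(e, r, c). erow e \<and> prow r \<and> c \<in> cs \<and> [c] \<in> DS}))"
proof -
  let ?w = "\<lambda>c. if [c] \<in> DS then ne * (np * (4 * A + 5) + 4) + 2 else 0"
  define G where "G c = {(e, r, c) |e r. erow e \<and> prow r \<and> [c] \<in> DS}" for c
  have "runs B I K (propagate_consts A) m ((\<Sum>c\<in>cs. (?w c + 2) + 3) + 2) (inv (Z \<union> (\<Union>c\<in>cs. G c)))"
    unfolding propagate_consts_def
  proof (rule runs_for_consts[where J = inv])
    fix c Z m assume c: "c \<in> cs" and m: "inv Z m" and C: "m tC [] = c"
    have tabs: "m tDIRTY = tab DS" using elem_inv_sel[OF m] m0 by simp
    show "runs B I K (Cond (Get tDIRTY [Reg tC]) (for_effs (for_rows tR (elem A))) Skip) m (?w c + 2)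
        (\<lambda>m'. inv (Z \<union> G c) m' \<and> m' tX = m tX)"
    proof (rule runs_If)
      assume "tr B I m (Get tDIRTY [Reg tC])"
      then have d: "[c] \<in> DS" using tabs C by simp
      define J where "J Z m' \<longleftrightarrow> inv Z m' \<and> m' tC [] = c \<and> m' tX = m tX" for Z m'
      have "runs B I K (for_effs (for_rows tR (elem A))) m
         ((\<Sum>e=Suc np..np + ne. ((\<Sum>r=1..np. (4 * A + 3) + 2) + 2) + 2) + 2)
         (J (Z \<union> (\<Union>e\<in>{e. erow e}. (\<Union>r\<in>{r. prow r}. {(e, r, c)}))))"
      proof (rule runs_for_effs[where J = J])
        fix e Z m' assume e: "erow e" and J: "J Z m'" "m' tE [] = e"
        define J' where "J' Z m' \<longleftrightarrow> J Z m' \<and> m' tE [] = e" for Z m'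
        have "runs B I K (for_rows tR (elem A)) m' ((\<Sum>r=1..np. (4 * A + 3) + 2) + 2) (J' (Z \<union> (\<Union>r\<in>{r. prow r}. {(e, r, c)})))"
        proof (rule runs_for_rows[where J = J'])
          fix r Z m' assume r: "prow r" and J: "J' Z m'" "m' tR [] = r"
          have "runs B I K (elem A) m' (4 * A + 3) (\<lambda>m''. inv (Z \<union> {(e, r, c)}) m'' \<and> agree {tIND, tMAT, tND, tAUG} m' m'')"
            using J by (intro runs_elem m0 e r c) (auto simp: J_def J'_def)
          then show "runs B I K (elem A) m' (4 * A + 3) (\<lambda>m''. J' (Z \<union> {(e, r, c)}) m'' \<and> m'' tR [] = r)"
            using J by (elim runs_weaken) (auto simp: J_def J'_def agree_def)
        qed (use J in \<open>auto simp: J_def J'_def elem_inv_upd\<close>)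
        then show "runs B I K (for_rows tR (elem A)) m' ((\<Sum>r=1..np. (4 * A + 3) + 2) + 2)
           (\<lambda>m''. J (Z \<union> (\<Union>r\<in>{r. prow r}. {(e, r, c)})) m'' \<and> m'' tE [] = e)"
          by (elim runs_weaken) (simp_all add: J'_def)
      qed (use m C in \<open>auto simp: J_def elem_inv_upd\<close>)
      moreover have "(\<Union>e\<in>{e. erow e}. (\<Union>r\<in>{r. prow r}. {(e, r, c)})) = G c" using d by (auto simp: G_def)
      ultimately show "runs B I K (for_effs (for_rows tR (elem A))) m (?w c + 1) (\<lambda>m'. inv (Z \<union> G c) m' \<and> m' tX = m tX)"
        using d by (elim runs_weaken) (auto simp: J_def algebra_simps)
    next
      assume "\<not> tr B I m (Get tDIRTY [Reg tC])"
      then have "G c = {}" using tabs C by (simp add: G_def)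
      then show "runs B I K Skip m (?w c + 1) (\<lambda>m'. inv (Z \<union> G c) m' \<and> m' tX = m tX)"
        using m by (intro runs_Skip) auto
    qed simp
  next
    fix Z m' assume m': "inv Z m'"
    then show "m' tCNT = m tCNT \<and> m' tCL = m tCL"
      using elem_inv_sel[OF assms] elem_inv_sel[OF m'] by simp
  qed (use assms inv_ok in \<open>auto simp: elem_inv_upd\<close>)
  moreover have "(\<Union>c\<in>cs. G c) = {(e, r, c). erow e \<and> prow r \<and> c \<in> cs \<and> [c] \<in> DS}" by (auto simp: G_def)
  ultimately show ?thesis by (elim runs_weaken) (auto intro!: sum_mono)
qed

end

end

lemma runs_Seq':
  assumes "runs B I K c1 m T1 Q1" "\<And>m1. Q1 m1 \<Longrightarrow> runs B I K c2 m1 T2 Q" "T1 + T2 \<le> T"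
  shows "runs B I K (Seq c1 c2) m T Q"
  by (rule runs_Seq[OF runs_weaken[OF assms(1) order_refl assms(2)] assms(3)])

section \<open>The slices of the tables that belong to one constant\<close>

context rows
begin

definition rej_at :: "nat \<Rightarrow> nat list set \<Rightarrow> nat list set" where
  "rej_at c X = {[rop r, rcl r, x, c] |r x. pos r \<and> Var x \<in> set (rtms r) \<and> [r, x, c] \<notin> X}"

definition nonempty_at :: "nat \<Rightarrow> nat list set \<Rightarrow> nat list set" where
  "nonempty_at c X = {[rop r, rcl r, x] |r x. pos r \<and> Var x \<in> set (rtms r) \<and>
     [rop r, rcl r, x, c] \<notin> rej_at c X \<and> [rop r, 0, x, c] \<notin> rej_at c X}"

lemma rej_eq: "rej X = (\<Union>c\<in>cs. rej_at c X)"
  by (auto simp: rej_def rej_at_def)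

lemma mem_rej: "c \<in> cs \<Longrightarrow> [i, j, x, c] \<in> rej X \<longleftrightarrow> [i, j, x, c] \<in> rej_at c X"
  by (auto simp: rej_def rej_at_def)

lemma nonempty_eq: "nonempty X = (\<Union>c\<in>cs. nonempty_at c X)"
  using mem_rej by (auto simp: nonempty_def nonempty_at_def)

text \<open>A slice looks at the individual domains only at the constant \<open>c\<close>. Therefore
  rebuilding the slices of the fresh constants updates the whole table.\<close>

lemma rej_at_cong:
  assumes "X \<subseteq> X'" "[c] \<notin> fresh_consts X X'"
  shows "rej_at c X' = rej_at c X" "nonempty_at c X' = nonempty_at c X"
proof -
  have "[r, x, c] \<in> X' \<longleftrightarrow> [r, x, c] \<in> X" for r x
    using assms by (auto simp: fresh_consts_def)
  then show "rej_at c X' = rej_at c X" by (simp add: rej_at_def)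
  then show "nonempty_at c X' = nonempty_at c X" by (simp add: nonempty_at_def)
qed

lemma nonempty_at_mono: "X \<subseteq> X' \<Longrightarrow> nonempty_at c X \<subseteq> nonempty_at c X'"
  unfolding nonempty_at_def rej_at_def by blast

text \<open>The machine scans argument positions while the tables are specified by variables; each
  variable of an atom sits at some position below \<open>A\<close>.\<close>

lemma pos_Var_keys:
  "{g r x |r x. pos r \<and> Var x \<in> set (rtms r) \<and> Q r x} =
   {g r (nam r a) |r a. prow r \<and> a < A \<and> pos r \<and> isv r a \<and> Q r (nam r a)}"
proof -
  have v: "Var x \<in> set (rtms r) \<longleftrightarrow> (\<exists>a<A. isv r a \<and> nam r a = x)" and p: "prow r" if "pos r" for r x
    using that Var_iff[OF prow_row] by (auto simp: pos_def)
  show ?thesis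
  proof (intro Collect_cong iffI)
    fix k assume "\<exists>r x. k = g r x \<and> pos r \<and> Var x \<in> set (rtms r) \<and> Q r x"
    then obtain r x where "k = g r x" "pos r" "Var x \<in> set (rtms r)" "Q r x" by blast
    then show "\<exists>r a. k = g r (nam r a) \<and> prow r \<and> a < A \<and> pos r \<and> isv r a \<and> Q r (nam r a)"
      using v[of r x] p[of r] by blast
  next
    fix k assume "\<exists>r a. k = g r (nam r a) \<and> prow r \<and> a < A \<and> pos r \<and> isv r a \<and> Q r (nam r a)"
    then obtain r a where "k = g r (nam r a)" "a < A" "pos r" "isv r a" "Q r (nam r a)" by blast
    then show "\<exists>r x. k = g r x \<and> pos r \<and> Var x \<in> set (rtms r) \<and> Q r x"
      using v[of r "nam r a"] by blast
  qed
qed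

definition clause_keys :: "nat list set" where
  "clause_keys = {[rop r, rcl r] |r. prow r}"

definition round_state where
  "round_state X M FL AC DS F CH m \<longleftrightarrow>
     m tIND = tab X \<and> m tMAT = tab M \<and> m tREJ = tab (rej X) \<and> m tNE = tab (nonempty X) \<and>
     m tFLAG = tab FL \<and> m tACT = tab AC \<and> m tDIRTY = tab DS \<and> m tFULL = tab F \<and> m tCH = tab CH \<and>
     m tND = tab {} \<and> m tAUG = tab {} \<and> m tOWN = tab own \<and>
     (\<exists>U \<subseteq> clause_keys. m tUN = tab U) \<and> (\<exists>U \<subseteq> clause_keys. m tBAD = tab U) \<and>
     consts_ok m \<and> (\<forall>t \<in> {22..30}. m t = (\<lambda>_. 0))"

definition ind_keys :: "nat list set" where
  "ind_keys = {[r, x, c] |r x c. prow r \<and> Var x \<in> set (rtms r) \<and> c \<in> cs}"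

definition round_time :: "nat list set \<Rightarrow> nat list set \<Rightarrow> nat list set \<Rightarrow> nat" where
  "round_time F DS FC =
     ((\<Sum>e=Suc np..np + ne. (\<Sum>r=1..np. (if (e, r) \<in> full_pairs ([] \<in> F) DS then card cs * (4 * A + 6) + 2 else 0) + 4) + 4) + 2) +
     ((\<Sum>c\<in>cs. (if [c] \<in> DS then ne * (np * (4 * A + 5) + 4) + 2 else 0) + 5) + 2) +
     ((\<Sum>c\<in>cs. (if [c] \<in> FC then 3 * (np * (2 * A + 5)) + 3 else 1) + 4) + 3) +
     (8 * (np * (2 * A + 5)) + 1)"

lemma ind_after_keys: "X \<subseteq> ind_keys \<Longrightarrow> Z \<subseteq> {(e, r, c). prow r \<and> c \<in> cs} \<Longrightarrow> ind_after OW AC RJ X Z \<subseteq> ind_keys"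
  unfolding ind_after_def ind_keys_def rcontributes_def by blast

end

context rows_mem
begin

lemma runs_update_rej:
  assumes c: "m tC [] = c" "c \<in> cs" and m: "m tREJ = tab S" "m tIND = tab X" "m tNE = tab N"
    and S': "S' = S - {[rop r, rcl r, nam r a, c] |r a. prow r \<and> a < A} \<union> rej_at c X"
  shows "runs B I K (update_rej A) m (3 * (np * (2 * A + 5)))
    (\<lambda>m'. m' tREJ = tab S' \<and>
      m' tNE = tab (N \<union> {[rop r, rcl r, x] |r x. pos r \<and> Var x \<in> set (rtms r) \<and> [rop r, rcl r, x, c] \<notin> S' \<and> [rop r, 0, x, c] \<notin> S'}) \<and>
      agree {tR, tREJ, tNE} m m')"
  unfolding update_rej_def
proof (rule runs_Seq')
  let ?S1 = "S - {[rop r, rcl r, nam r a, c] |r a. prow r \<and> a < A}"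
  show "runs B I K (clear_rows A tREJ (\<lambda>a. own_key @ [valE tR a, Reg tC])) m (np * (2 * A + 5))
     (\<lambda>m'. m' tREJ = tab ?S1 \<and> agree {tR, tREJ} m m')"
    by (rule runs_clear_rows'[where kf = "\<lambda>r a. [rop r, rcl r, nam r a, c]" and S = S])
      (use c m in_K(10) in \<open>auto simp: ev_keys ev_row\<close>)
  fix m1 assume m1: "m1 tREJ = tab ?S1 \<and> agree {tR, tREJ} m m1"
  then have ag1: "\<And>t. t \<noteq> tR \<Longrightarrow> t \<noteq> tREJ \<Longrightarrow> m1 t = m t" by (simp add: agree_def)
  show "runs B I K (Seq (set_rows A tREJ (\<lambda>a. own_key @ [valE tR a, Reg tC])
            (\<lambda>a. Ands [posE, varE tR a, Not_exp (Get tIND [Reg tR, valE tR a, Reg tC])]))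
          (set_rows A tNE (\<lambda>a. own_key @ [valE tR a])
            (\<lambda>a. Ands [posE, varE tR a, Not_exp (Get tREJ (own_key @ [valE tR a, Reg tC])),
                        Not_exp (Get tREJ (primary_key @ [valE tR a, Reg tC]))]))) m1 (2 * (np * (2 * A + 5)))
    (\<lambda>m'. m' tREJ = tab S' \<and>
      m' tNE = tab (N \<union> {[rop r, rcl r, x] |r x. pos r \<and> Var x \<in> set (rtms r) \<and> [rop r, rcl r, x, c] \<notin> S' \<and> [rop r, 0, x, c] \<notin> S'}) \<and>
      agree {tR, tREJ, tNE} m m')"
  proof (rule runs_Seq')
    have "rej_at c X = {[rop r, rcl r, nam r a, c] |r a. prow r \<and> a < A \<and> pos r \<and> isv r a \<and> [r, nam r a, c] \<notin> X}"
      unfolding rej_at_def by (rule pos_Var_keys)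
    then show "runs B I K (set_rows A tREJ (\<lambda>a. own_key @ [valE tR a, Reg tC])
            (\<lambda>a. Ands [posE, varE tR a, Not_exp (Get tIND [Reg tR, valE tR a, Reg tC])])) m1 (np * (2 * A + 5))
       (\<lambda>m'. m' tREJ = tab S' \<and> agree {tR, tREJ} m1 m')"
      by (intro runs_set_rows'[where kf = "\<lambda>r a. [rop r, rcl r, nam r a, c]" and S = ?S1
             and cf = "\<lambda>r a. pos r \<and> isv r a \<and> [r, nam r a, c] \<notin> X"])
        (use B c m m1 ag1 S' in_K(10) in \<open>auto simp: ev_keys ev_row tr_posE\<close>)
    fix m2 assume m2: "m2 tREJ = tab S' \<and> agree {tR, tREJ} m1 m2"
    then have ag2: "\<And>t. t \<noteq> tR \<Longrightarrow> t \<noteq> tREJ \<Longrightarrow> m2 t = m t" using ag1 by (simp add: agree_def)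
    let ?N = "N \<union> {[rop r, rcl r, x] |r x. pos r \<and> Var x \<in> set (rtms r) \<and> [rop r, rcl r, x, c] \<notin> S' \<and> [rop r, 0, x, c] \<notin> S'}"
    have "?N = N \<union> {[rop r, rcl r, nam r a] |r a. prow r \<and> a < A \<and> pos r \<and> isv r a \<and>
        [rop r, rcl r, nam r a, c] \<notin> S' \<and> [rop r, 0, nam r a, c] \<notin> S'}"
      by (simp only: pos_Var_keys)
    then have "runs B I K (set_rows A tNE (\<lambda>a. own_key @ [valE tR a])
            (\<lambda>a. Ands [posE, varE tR a, Not_exp (Get tREJ (own_key @ [valE tR a, Reg tC])),
                        Not_exp (Get tREJ (primary_key @ [valE tR a, Reg tC]))])) m2 (np * (2 * A + 5))
       (\<lambda>m'. m' tNE = tab ?N \<and> agree {tR, tNE} m2 m')"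
      by (intro runs_set_rows'[where kf = "\<lambda>r a. [rop r, rcl r, nam r a]" and S = N
             and cf = "\<lambda>r a. pos r \<and> isv r a \<and> [rop r, rcl r, nam r a, c] \<notin> S' \<and> [rop r, 0, nam r a, c] \<notin> S'"])
        (use B c m m2 ag2 in_K(8) in \<open>auto simp: ev_keys ev_row tr_posE\<close>)
    then show "runs B I K (set_rows A tNE (\<lambda>a. own_key @ [valE tR a])
            (\<lambda>a. Ands [posE, varE tR a, Not_exp (Get tREJ (own_key @ [valE tR a, Reg tC])),
                        Not_exp (Get tREJ (primary_key @ [valE tR a, Reg tC]))])) m2 (np * (2 * A + 5))
       (\<lambda>m'. m' tREJ = tab S' \<and> m' tNE = tab ?N \<and> agree {tR, tREJ, tNE} m m')"
      by (rule runs_weaken) (use m2 ag2 in \<open>simp_all add: agree_def\<close>)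
  qed simp
qed simp

lemma runs_commit:
  assumes m: "m tIND = tab X'" "m tREJ = tab (rej X)" "m tNE = tab (nonempty X)" "m tND = tab FC" "m tDIRTY = tab DS" "m tCH = tab CH"
    and ok: "consts_ok m" and X: "X \<subseteq> X'" and FC: "FC = fresh_consts X X'" "FC \<subseteq> {[c] |c. c \<in> cs}"
    and DS: "DS \<subseteq> {[c] |c. c \<in> cs}" and CH: "CH \<subseteq> {[]}"
  shows "runs B I K (commit A) m ((\<Sum>c\<in>cs. (if [c] \<in> FC then 3 * (np * (2 * A + 5)) + 3 else 1) + 4) + 3)
    (\<lambda>m'. m' tREJ = tab (rej X') \<and> m' tNE = tab (nonempty X') \<and> m' tDIRTY = tab FC \<and> m' tND = tab {} \<and>
      m' tCH = tab {k. k = [] \<and> FC \<noteq> {}} \<and> agree {tR, tX, tC, tREJ, tNE, tDIRTY, tND, tCH} m m')"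
proof -
  let ?w = "\<lambda>c. if [c] \<in> FC then 3 * (np * (2 * A + 5)) + 3 else 1"
  \<comment> \<open>The invariant of the pass over the constants: the slice of a treated constant is
    built from \<open>X'\<close>, that of an untreated one still from \<open>X\<close>.\<close>
  define V where "V Z c = (if c \<in> Z then X' else X)" for Z :: "nat set" and c
  define L where "L Z = (\<lambda>c. [c]) ` Z" for Z :: "nat set"
  define J where "J Z m' \<longleftrightarrow> m' tREJ = tab (\<Union>c\<in>cs. rej_at c (V Z c)) \<and> m' tNE = tab (\<Union>c\<in>cs. nonempty_at c (V Z c)) \<and>
     m' tDIRTY = tab (DS - L Z \<union> (FC \<inter> L Z)) \<and> m' tND = tab (FC - L Z) \<and>
     m' tCH = tab {k. k = [] \<and> FC \<inter> L Z \<noteq> {}} \<and> agree {tR, tX, tC, tREJ, tNE, tDIRTY, tND, tCH} m m'" for Z m'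
  have L: "L (Z \<union> {c}) = insert [c] (L Z)" "L (insert c Z) = insert [c] (L Z)" for Z c by (auto simp: L_def)
  have same: "rej_at c (V Z c) = rej_at c X'" "nonempty_at c (V Z c) = nonempty_at c X'" if "[c] \<notin> FC" for c Z
    using rej_at_cong[OF X, of c] that by (auto simp: V_def FC(1))
  have step: "runs B I K (Cond (Get tND [Reg tC])
     (Seq (update_rej A) (Seq (Put tCH [] (Const 1)) (Seq (Put tDIRTY [Reg tC] (Const 1)) (Put tND [Reg tC] (Const 0)))))
     (Put tDIRTY [Reg tC] (Const 0))) m' (?w c + 1) (\<lambda>m''. J (Z \<union> {c}) m'' \<and> m'' tX = m' tX)"
    if c: "c \<in> cs" "c \<notin> Z" "m' tC [] = c" and J: "J Z m'" for c Z m'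
  proof -
    let ?R = "\<lambda>Z. \<Union>c\<in>cs. rej_at c (V Z c)" and ?N = "\<lambda>Z. \<Union>c\<in>cs. nonempty_at c (V Z c)"
    have tabs: "m' tREJ = tab (?R Z)" "m' tNE = tab (?N Z)" "m' tDIRTY = tab (DS - L Z \<union> (FC \<inter> L Z))" "m' tND = tab (FC - L Z)"
        "m' tCH = tab {k. k = [] \<and> FC \<inter> L Z \<noteq> {}}" "m' tIND = tab X'"
        and ag: "agree {tR, tX, tC, tREJ, tNE, tDIRTY, tND, tCH} m m'"
      using J m(1) by (auto simp: J_def agree_def)
    have nL: "[c] \<notin> L Z" using c by (auto simp: L_def)
    have VZ: "V Z c = X" using c by (simp add: V_def)
    have sp: "?R (Z \<union> {c}) = (\<Union>d\<in>cs - {c}. rej_at d (V Z d)) \<union> rej_at c X'"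
      "?N (Z \<union> {c}) = (\<Union>d\<in>cs - {c}. nonempty_at d (V Z d)) \<union> nonempty_at c X'"
      "?R Z = (\<Union>d\<in>cs - {c}. rej_at d (V Z d)) \<union> rej_at c (V Z c)"
      "?N Z = (\<Union>d\<in>cs - {c}. nonempty_at d (V Z d)) \<union> nonempty_at c (V Z c)"
    proof -
      have s: "(\<Union>d\<in>cs. f d) = (\<Union>d\<in>cs - {c}. f d) \<union> f c" for f :: "nat \<Rightarrow> nat list set"
        using c(1) by blast
      have "V (Z \<union> {c}) c = X'" by (simp add: V_def)
      moreover have "(\<Union>d\<in>cs - {c}. rej_at d (V (Z \<union> {c}) d)) = (\<Union>d\<in>cs - {c}. rej_at d (V Z d))"
        "(\<Union>d\<in>cs - {c}. nonempty_at d (V (Z \<union> {c}) d)) = (\<Union>d\<in>cs - {c}. nonempty_at d (V Z d))"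
        by (intro SUP_cong refl; simp add: V_def)+
      ultimately show "?R (Z \<union> {c}) = (\<Union>d\<in>cs - {c}. rej_at d (V Z d)) \<union> rej_at c X'"
        "?N (Z \<union> {c}) = (\<Union>d\<in>cs - {c}. nonempty_at d (V Z d)) \<union> nonempty_at c X'"
        "?R Z = (\<Union>d\<in>cs - {c}. rej_at d (V Z d)) \<union> rej_at c (V Z c)"
        "?N Z = (\<Union>d\<in>cs - {c}. nonempty_at d (V Z d)) \<union> nonempty_at c (V Z c)"
        using s[of "\<lambda>d. rej_at d (V (Z \<union> {c}) d)"] s[of "\<lambda>d. rej_at d (V Z d)"]
          s[of "\<lambda>d. nonempty_at d (V (Z \<union> {c}) d)"] s[of "\<lambda>d. nonempty_at d (V Z d)"]
        by (simp_all only:)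
    qed
    show ?thesis
    proof (rule runs_If)
      assume "tr B I m' (Get tND [Reg tC])"
      then have f: "[c] \<in> FC" using tabs c by simp
      \<comment> \<open>The constant is the last component of a key, so erasing the keys of
        \<open>c\<close> cannot damage the slice of another constant.\<close>
      have keys: "{[rop r, rcl r, nam r a, c] |r a. prow r \<and> a < A} \<inter> rej_at d Y = {}" if "d \<noteq> c" for d Y
        using that by (auto simp: rej_at_def)
      have keys': "rej_at c Y \<subseteq> {[rop r, rcl r, nam r a, c] |r a. prow r \<and> a < A}" for Y
        unfolding rej_at_def pos_Var_keys by blast
      have R: "?R (Z \<union> {c}) = ?R Z - {[rop r, rcl r, nam r a, c] |r a. prow r \<and> a < A} \<union> rej_at c X'"
      proof -
        have gen: "S \<inter> K = {} \<Longrightarrow> R \<subseteq> K \<Longrightarrow> S \<union> N = S \<union> R - K \<union> N" for S R K N :: "nat list set" by blast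
        have disj: "(\<Union>d\<in>cs - {c}. rej_at d (V Z d)) \<inter> {[rop r, rcl r, nam r a, c] |r a. prow r \<and> a < A} = {}"
          using keys by (subst Int_commute) (simp only: Int_UN_distrib, simp)
        show ?thesis
          unfolding sp(1,3) by (rule gen[OF disj keys'])
      qed
      have at: "[i, j, x, c] \<in> ?R (Z \<union> {c}) \<longleftrightarrow> [i, j, x, c] \<in> rej_at c X'" for i j x
      proof -
        have "[i, j, x, c] \<notin> rej_at d Y" if "d \<noteq> c" for d Y
          using that by (auto simp: rej_at_def)
        then show ?thesis unfolding sp by simp
      qed
      have N: "?N (Z \<union> {c}) = ?N Z \<union> {[rop r, rcl r, x] |r x. pos r \<and> Var x \<in> set (rtms r) \<and>
          [rop r, rcl r, x, c] \<notin> ?R (Z \<union> {c}) \<and> [rop r, 0, x, c] \<notin> ?R (Z \<union> {c})}"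
        unfolding at unfolding nonempty_at_def[symmetric] unfolding sp(2,4) VZ
        using nonempty_at_mono[OF X, of c] by (simp add: Un_assoc Un_absorb1)
      show "runs B I K (Seq (update_rej A) (Seq (Put tCH [] (Const 1)) (Seq (Put tDIRTY [Reg tC] (Const 1)) (Put tND [Reg tC] (Const 0)))))
          m' (?w c) (\<lambda>m''. J (Z \<union> {c}) m'' \<and> m'' tX = m' tX)"
      proof (rule runs_Seq'[OF runs_update_rej[OF c(3,1) tabs(1,6,2) R]])
        fix m1 assume "m1 tREJ = tab (?R (Z \<union> {c})) \<and> m1 tNE = tab (?N Z \<union> {[rop r, rcl r, x] |r x. pos r \<and> Var x \<in> set (rtms r) \<and>
          [rop r, rcl r, x, c] \<notin> ?R (Z \<union> {c}) \<and> [rop r, 0, x, c] \<notin> ?R (Z \<union> {c})}) \<and> agree {tR, tREJ, tNE} m' m1"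
        then have m1: "m1 tREJ = tab (?R (Z \<union> {c}))" "m1 tNE = tab (?N (Z \<union> {c}))" "agree {tR, tREJ, tNE} m' m1"
          unfolding N by simp_all
        then have ag1: "\<And>t. t \<noteq> tR \<Longrightarrow> t \<noteq> tREJ \<Longrightarrow> t \<noteq> tNE \<Longrightarrow> m1 t = m' t" by (simp add: agree_def)
        have ag2: "agree {tR, tX, tC, tREJ, tNE, tDIRTY, tND, tCH} m m1"
          using ag m1(3) by (auto intro: agree_trans[OF ag])
        let ?m = "m1(tCH := (m1 tCH)([] := Suc 0), tDIRTY := (m1 tDIRTY)([c] := Suc 0), tND := (m1 tND)([c] := 0))"
        have "J (Z \<union> {c}) ?m \<and> ?m tX = m' tX"
          unfolding J_def using m1(1,2) ag1 ag2 tabs f nL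
          by (auto simp: L tab_insert tab_remove intro!: agree_upd arg_cong[where f = tab])
        then show "runs B I K (Seq (Put tCH [] (Const 1)) (Seq (Put tDIRTY [Reg tC] (Const 1)) (Put tND [Reg tC] (Const 0))))
          m1 3 (\<lambda>m''. J (Z \<union> {c}) m'' \<and> m'' tX = m' tX)"
          using c in_K ag1
          by (intro runs_Seq[where ?T1.0 = 1 and ?T2.0 = 2] runs_Seq[where ?T1.0 = 1 and ?T2.0 = 1] runs_Put) simp_all
      qed (use f in simp)
    next
      assume "\<not> tr B I m' (Get tND [Reg tC])"
      then have nf: "[c] \<notin> FC" using tabs c nL by simp
      have R: "?R (Z \<union> {c}) = ?R Z" "?N (Z \<union> {c}) = ?N Z"
        unfolding sp same[OF nf] by (rule refl)+
      have "J (Z \<union> {c}) (m'(tDIRTY := (m' tDIRTY)([c] := 0)))"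
        using J nf nL unfolding J_def R by (auto simp: tab_remove L intro!: agree_upd arg_cong[where f = tab])
      then show "runs B I K (Put tDIRTY [Reg tC] (Const 0)) m' (?w c) (\<lambda>m''. J (Z \<union> {c}) m'' \<and> m'' tX = m' tX)"
        using c in_K(2) nf by (intro runs_Put) simp_all
    qed simp
  qed
  show ?thesis
    unfolding commit_def
  proof (rule runs_Seq[where ?T1.0 = 1], rule runs_Put)
    let ?m = "m(tCH := (m tCH)(map (ev B I m) [] := ev B I m (Const 0)))"
    have J0: "J {} ?m"
      using m CH by (auto simp: J_def V_def L_def rej_eq nonempty_eq tab_remove agree_upd intro!: arg_cong[where f = tab])
    have "runs B I K (for_consts (Cond (Get tND [Reg tC])
     (Seq (update_rej A) (Seq (Put tCH [] (Const 1)) (Seq (Put tDIRTY [Reg tC] (Const 1)) (Put tND [Reg tC] (Const 0)))))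
     (Put tDIRTY [Reg tC] (Const 0)))) ?m ((\<Sum>c\<in>cs. (?w c + 1) + 3) + 2) (J ({} \<union> (\<Union>c\<in>cs. {c})))"
    proof (rule runs_for_consts_upto[where J = J, OF _ J0])
      show "consts_ok ?m" using ok by (simp add: consts_ok_def)
      fix Z m' assume "J Z m'"
      then show "m' tCNT = ?m tCNT \<and> m' tCL = ?m tCL" by (auto simp: J_def agree_def)
    next
      fix c Y m' assume "c \<in> cs" "Y \<subseteq> cs" "c \<notin> Y" "J ({} \<union> \<Union>((\<lambda>c. {c}) ` Y)) m'" "m' tC [] = c"
      then show "runs B I K (Cond (Get tND [Reg tC])
         (Seq (update_rej A) (Seq (Put tCH [] (Const 1)) (Seq (Put tDIRTY [Reg tC] (Const 1)) (Put tND [Reg tC] (Const 0)))))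
         (Put tDIRTY [Reg tC] (Const 0))) m' (?w c + 1) (\<lambda>m''. J ({} \<union> \<Union>((\<lambda>c. {c}) ` Y) \<union> {c}) m'' \<and> m'' tX = m' tX)"
        using step[of c Y m'] by simp
    qed (auto simp: J_def agree_upd)
    moreover have "J ({} \<union> (\<Union>c\<in>cs. {c})) m' \<Longrightarrow> m' tREJ = tab (rej X') \<and> m' tNE = tab (nonempty X') \<and> m' tDIRTY = tab FC \<and> m' tND = tab {} \<and>
      m' tCH = tab {k. k = [] \<and> FC \<noteq> {}} \<and> agree {tR, tX, tC, tREJ, tNE, tDIRTY, tND, tCH} m m'" for m'
    proof -
      have "DS - L cs \<union> FC \<inter> L cs = FC" "FC - L cs = {}" "FC \<inter> L cs = FC"
        using DS FC(2) by (auto simp: L_def)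
      moreover assume "J ({} \<union> (\<Union>c\<in>cs. {c})) m'"
      ultimately show ?thesis by (simp add: J_def V_def rej_eq nonempty_eq Diff_eq_empty_iff[THEN iffD2])
    qed
    ultimately show "runs B I K (for_consts (Cond (Get tND [Reg tC])
     (Seq (update_rej A) (Seq (Put tCH [] (Const 1)) (Seq (Put tDIRTY [Reg tC] (Const 1)) (Put tND [Reg tC] (Const 0)))))
     (Put tDIRTY [Reg tC] (Const 0)))) ?m ((\<Sum>c\<in>cs. ?w c + 4) + 2)
     (\<lambda>m'. m' tREJ = tab (rej X') \<and> m' tNE = tab (nonempty X') \<and> m' tDIRTY = tab FC \<and> m' tND = tab {} \<and>
      m' tCH = tab {k. k = [] \<and> FC \<noteq> {}} \<and> agree {tR, tX, tC, tREJ, tNE, tDIRTY, tND, tCH} m m')"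
      by (elim runs_weaken) (auto intro!: sum_mono)
  qed (use in_K(1) in simp_all)
qed

lemma pos_keys: "{g r |r. pos r \<and> Q r} = {g r |r a. prow r \<and> a < A \<and> pos r \<and> Q r}"
proof -
  have "\<exists>a. a < A" using A by (intro exI[of _ 0]) simp
  then show ?thesis by (auto simp: pos_def)
qed

lemma clause_keys_eq: "clause_keys = {[rop r, rcl r] |r a. prow r \<and> a < A}"
proof -
  have "\<exists>a. a < A" using A by (intro exI[of _ 0]) simp
  then show ?thesis by (auto simp: clause_keys_def)
qed

lemma runs_clear_clause_keys:
  assumes "T < 32" "T \<noteq> tR" "m T = tab S" "S \<subseteq> clause_keys"
  shows "runs B I K (clear_rows A T (\<lambda>a. own_key)) m (np * (2 * A + 5)) (\<lambda>m'. m' T = tab {} \<and> agree {tR, T} m m')"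
proof (rule runs_clear_rows'[where kf = "\<lambda>r a. [rop r, rcl r]" and S = S])
  show "{} = S - {[rop r, rcl r] |r a. prow r \<and> a < A}"
    using assms(4) unfolding clause_keys_eq by (rule Diff_eq_empty_iff[THEN iffD2, symmetric])
qed (use assms in_K(6) in \<open>simp_all add: ev_keys\<close>)

lemma runs_update_clauses:
  assumes m: "m tMAT = tab M" "m tNE = tab (nonempty X')" "m tUN = tab U" "m tBAD = tab V" "m tFLAG = tab FL"
      "m tFULL = tab F" "m tACT = tab AC" "m tAUG = tab (augmented X X')"
    and sub: "U \<subseteq> clause_keys" "V \<subseteq> clause_keys" "F \<subseteq> {[]}" "augmented X X' \<subseteq> clause_keys"
    and FL': "FL' = FL \<union> flags X X' M"
  shows "runs B I K (update_clauses A) m (8 * (np * (2 * A + 5)) + 1)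
    (\<lambda>m'. m' tUN = tab (unmatched M) \<and> m' tBAD = tab (blocked X') \<and> m' tFLAG = tab FL' \<and>
       m' tFULL = tab {k. k = [] \<and> \<not> act_keys FL' X' \<subseteq> AC} \<and> m' tACT = tab (AC \<union> act_keys FL' X') \<and>
       m' tAUG = tab {} \<and> agree {tR, tUN, tBAD, tFLAG, tFULL, tACT, tAUG} m m')"
    (is "runs _ _ _ _ _ _ ?Q")
proof -
  let ?w = "np * (2 * A + 5)"
  let ?c7 = "Seq (set_rows A tACT (\<lambda>a. own_key) (\<lambda>a. activeE)) (clear_rows A tAUG (\<lambda>a. own_key))"
  let ?c6 = "Seq (Put tFULL [] (Const 0)) (Seq (set_rows A tFULL (\<lambda>a. []) (\<lambda>a. And activeE (Not_exp (Get tACT own_key)))) ?c7)"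
  let ?c5 = "Seq (set_rows A tFLAG (\<lambda>a. own_key) (\<lambda>a. Ands [posE, Not_exp (Get tUN own_key), Not_exp (Get tUN primary_key),
    Or (Get tAUG own_key) (Get tAUG primary_key)])) ?c6"
  let ?c4 = "Seq (set_rows A tBAD (\<lambda>a. own_key) (\<lambda>a. Ands [posE, varE tR a, Not_exp (Get tNE (own_key @ [valE tR a]))])) ?c5"
  let ?c3 = "Seq (clear_rows A tBAD (\<lambda>a. own_key)) ?c4"
  let ?c2 = "Seq (set_rows A tUN (\<lambda>a. own_key) (\<lambda>a. Ands [posE, Not_exp (Get tMAT [Reg tR])])) ?c3"
  note [simp] = ev_keys ev_row tr_posE B(4)
  have act: "{[rop r, rcl r] |r a. prow r \<and> a < A \<and> pos r \<and> [rop r, rcl r] \<in> FL' \<and> [rop r, rcl r] \<notin> blocked X' \<and> [rop r, 0] \<notin> blocked X'} = act_keys FL' X'"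
    unfolding act_keys_def by (rule pos_keys[symmetric])
  \<comment> \<open>The commands are verified from the last one backwards; each fact assumes the
    tables that the preceding commands have established.\<close>
  have 8: "runs B I K (clear_rows A tAUG (\<lambda>a. own_key)) m8 ?w ?Q"
    if m8: "m8 tUN = tab (unmatched M)" "m8 tBAD = tab (blocked X')" "m8 tFLAG = tab FL'"
      "m8 tFULL = tab {k. k = [] \<and> \<not> act_keys FL' X' \<subseteq> AC}" "m8 tACT = tab (AC \<union> act_keys FL' X')"
      "agree {tR, tUN, tBAD, tFLAG, tFULL, tACT} m m8" for m8
  proof (rule runs_weaken[OF runs_clear_clause_keys order_refl])
    show "m8 tAUG = tab (augmented X X')" using m8(6) m(8) by (simp add: agree_def)
    fix m' assume "m' tAUG = tab {} \<and> agree {tR, tAUG} m8 m'"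
    then show "?Q m'" using m8 by (simp add: agree_def)
  qed (use sub in simp_all)
  have 7: "runs B I K ?c7 m7 (2 * ?w) ?Q"
    if m7: "m7 tUN = tab (unmatched M)" "m7 tBAD = tab (blocked X')" "m7 tFLAG = tab FL'"
      "m7 tFULL = tab {k. k = [] \<and> \<not> act_keys FL' X' \<subseteq> AC}" "m7 tACT = tab AC"
      "agree {tR, tUN, tBAD, tFLAG, tFULL, tACT} m m7" for m7
  proof (rule runs_Seq')
    show "runs B I K (set_rows A tACT (\<lambda>a. own_key) (\<lambda>a. activeE)) m7 ?w
        (\<lambda>m'. m' tACT = tab (AC \<union> act_keys FL' X') \<and> agree {tR, tACT} m7 m')"
      by (rule runs_set_rows'[OF _ _ _ _ _ arg_cong[where f = "(\<union>) AC", OF act[symmetric]]])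
        (use m7 in_K(6) in \<open>simp_all add: activeE_def\<close>)
    fix m8 assume "m8 tACT = tab (AC \<union> act_keys FL' X') \<and> agree {tR, tACT} m7 m8"
    then show "runs B I K (clear_rows A tAUG (\<lambda>a. own_key)) m8 ?w ?Q"
      using m7 by (intro 8) (simp_all add: agree_def)
  qed simp
  have 6: "runs B I K ?c6 m6 (3 * ?w + 1) ?Q"
    if m6: "m6 tUN = tab (unmatched M)" "m6 tBAD = tab (blocked X')" "m6 tFLAG = tab FL'"
      "m6 tFULL = tab F" "m6 tACT = tab AC" "agree {tR, tUN, tBAD, tFLAG, tFULL, tACT} m m6" for m6
  proof (rule runs_Seq[where ?T1.0 = 1], rule runs_Put)
    let ?m = "m6(tFULL := (m6 tFULL)(map (ev B I m6) [] := ev B I m6 (Const 0)))"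
    have F: "?m tFULL = tab {}" using m6 sub(3) by (auto simp: tab_remove intro!: arg_cong[where f = tab])
    have full: "{k. k = [] \<and> \<not> act_keys FL' X' \<subseteq> AC} = {} \<union> {[] |r a. prow r \<and> a < A \<and> pos r \<and> [rop r, rcl r] \<in> FL' \<and>
       [rop r, rcl r] \<notin> blocked X' \<and> [rop r, 0] \<notin> blocked X' \<and> [rop r, rcl r] \<notin> AC}"
      unfolding act[symmetric] by blast
    show "runs B I K (Seq (set_rows A tFULL (\<lambda>a. []) (\<lambda>a. And activeE (Not_exp (Get tACT own_key))))
      ?c7) ?m (3 * ?w) ?Q"
    proof (rule runs_Seq')
      show "runs B I K (set_rows A tFULL (\<lambda>a. []) (\<lambda>a. And activeE (Not_exp (Get tACT own_key)))) ?m ?w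
          (\<lambda>m'. m' tFULL = tab {k. k = [] \<and> \<not> act_keys FL' X' \<subseteq> AC} \<and> agree {tR, tFULL} ?m m')"
        by (rule runs_set_rows'[where T = tFULL and m = ?m and S = "{}", OF _ _ F _ _ full])
          (use m6 in_K(1) in \<open>simp_all add: activeE_def\<close>)
      fix m7 assume "m7 tFULL = tab {k. k = [] \<and> \<not> act_keys FL' X' \<subseteq> AC} \<and> agree {tR, tFULL} ?m m7"
      then show "runs B I K ?c7 m7 (2 * ?w) ?Q"
        using m6 by (intro 7) (simp_all add: agree_def)
    qed simp
  qed (use in_K(1) in simp_all)
  have 5: "runs B I K ?c5 m5 (4 * ?w + 1) ?Q"
    if m5: "m5 tUN = tab (unmatched M)" "m5 tBAD = tab (blocked X')" "agree {tR, tUN, tBAD} m m5" for m5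
  proof (rule runs_Seq')
    have fl: "FL' = FL \<union> {[rop r, rcl r] |r a. prow r \<and> a < A \<and> pos r \<and> [rop r, rcl r] \<notin> unmatched M \<and> [rop r, 0] \<notin> unmatched M \<and>
       ([rop r, rcl r] \<in> augmented X X' \<or> [rop r, 0] \<in> augmented X X')}"
      unfolding FL' flags_def pos_keys ..
    show "runs B I K (set_rows A tFLAG (\<lambda>a. own_key)
            (\<lambda>a. Ands [posE, Not_exp (Get tUN own_key), Not_exp (Get tUN primary_key),
                        Or (Get tAUG own_key) (Get tAUG primary_key)])) m5 ?w
        (\<lambda>m'. m' tFLAG = tab FL' \<and> agree {tR, tFLAG} m5 m')"
      by (rule runs_set_rows'[OF _ _ _ _ _ fl])
        (use m m5 in_K(6) in \<open>simp_all add: agree_def\<close>)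
    fix m6 assume "m6 tFLAG = tab FL' \<and> agree {tR, tFLAG} m5 m6"
    then show "runs B I K ?c6 m6 (3 * ?w + 1) ?Q"
      using m m5 by (intro 6) (simp_all add: agree_def)
  qed simp
  show ?thesis
    unfolding update_clauses_def
  proof (rule runs_Seq'[OF runs_clear_clause_keys[where T = tUN and m = m, OF _ _ m(3) sub(1)]])
    fix m1 assume m1: "m1 tUN = tab {} \<and> agree {tR, tUN} m m1"
    have un: "unmatched M = {} \<union> {[rop r, rcl r] |r a. prow r \<and> a < A \<and> pos r \<and> [r] \<notin> M}"
      unfolding unmatched_def pos_keys by simp
    show "runs B I K ?c2 m1 (7 * ?w + 1) ?Q"
    proof (rule runs_Seq')
      show "runs B I K (set_rows A tUN (\<lambda>a. own_key) (\<lambda>a. Ands [posE, Not_exp (Get tMAT [Reg tR])])) m1 ?w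
          (\<lambda>m'. m' tUN = tab (unmatched M) \<and> agree {tR, tUN} m1 m')"
        by (rule runs_set_rows'[OF _ _ _ _ _ un]) (use m m1 in_K(6) in \<open>simp_all add: agree_def\<close>)
      fix m2 assume m2: "m2 tUN = tab (unmatched M) \<and> agree {tR, tUN} m1 m2"
      show "runs B I K ?c3 m2 (6 * ?w + 1) ?Q"
      proof (rule runs_Seq'[OF runs_clear_clause_keys[where T = tBAD and m = m2, OF _ _ _ sub(2)]])
        show "m2 tBAD = tab V" using m m1 m2 by (simp add: agree_def)
        fix m3 assume m3: "m3 tBAD = tab {} \<and> agree {tR, tBAD} m2 m3"
        have bl: "blocked X' = {} \<union> {[rop r, rcl r] |r a. prow r \<and> a < A \<and> pos r \<and> isv r a \<and> [rop r, rcl r, nam r a] \<notin> nonempty X'}"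
          unfolding blocked_def using pos_Var_keys[of "\<lambda>r x. [rop r, rcl r]" "\<lambda>r x. [rop r, rcl r, x] \<notin> nonempty X'"] by simp
        show "runs B I K ?c4 m3 (5 * ?w + 1) ?Q"
        proof (rule runs_Seq')
          show "runs B I K (set_rows A tBAD (\<lambda>a. own_key)
            (\<lambda>a. Ands [posE, varE tR a, Not_exp (Get tNE (own_key @ [valE tR a]))])) m3 ?w
            (\<lambda>m'. m' tBAD = tab (blocked X') \<and> agree {tR, tBAD} m3 m')"
            by (rule runs_set_rows'[OF _ _ _ _ _ bl]) (use m m1 m2 m3 in_K(6) in \<open>simp_all add: agree_def\<close>)
          fix m4 assume "m4 tBAD = tab (blocked X') \<and> agree {tR, tBAD} m3 m4"
          then show "runs B I K ?c5 m4 (4 * ?w + 1) ?Q"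
            using m1 m2 m3 by (intro 5) (simp_all add: agree_def)
        qed simp
      qed simp_all
    qed simp
  qed simp_all
qed


lemma runs_round:
  assumes st: "round_state X M FL AC DS F CH m"
    and sub: "X \<subseteq> ind_keys" "DS \<subseteq> {[c] |c. c \<in> cs}" "F \<subseteq> {[]}" "CH \<subseteq> {[]}"
    and X': "X' = ind_after own AC (rej X) X (triples ([] \<in> F) DS)"
    and M': "M' = mat_after own AC (rej X) M (triples ([] \<in> F) DS)"
    and FL': "FL' = FL \<union> flags X X' M'"
  shows "runs B I K (round A) m (round_time F DS (fresh_consts X X'))
    (round_state X' M' FL' (AC \<union> act_keys FL' X') (fresh_consts X X')
       {k. k = [] \<and> \<not> act_keys FL' X' \<subseteq> AC} {k. k = [] \<and> fresh_consts X X' \<noteq> {}})"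
proof -
  let ?inv = "elem_inv own AC (rej X) X M m" and ?FC = "fresh_consts X X'"
  note s = st[unfolded round_state_def]
  have m: "m tREJ = tab (rej X)" "m tOWN = tab own" "m tACT = tab AC" "m tDIRTY = tab DS" "m tFULL = tab F" "consts_ok m"
    using s by blast+
  obtain U V where UV: "U \<subseteq> clause_keys" "m tUN = tab U" "V \<subseteq> clause_keys" "m tBAD = tab V" using s by blast
  \<comment> \<open>The two passes together cover exactly \<open>triples\<close>. Triples met by
    both are processed twice, which the description by sets absorbs.\<close>
  have tr: "{} \<union> {(e, r, c). (e, r) \<in> full_pairs ([] \<in> F) DS \<and> c \<in> cs} \<union> {(e, r, c). erow e \<and> prow r \<and> c \<in> cs \<and> [c] \<in> DS} =
     triples ([] \<in> F) DS"
    by (auto simp: triples_def full_pairs_def)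
  have XX': "X \<subseteq> X'" by (auto simp: X' ind_after_def)
  have X'k: "X' \<subseteq> ind_keys"
    unfolding X' by (rule ind_after_keys[OF sub(1)]) (auto simp: triples_def)
  have FC: "?FC \<subseteq> {[c] |c. c \<in> cs}" using X'k by (auto simp: fresh_consts_def ind_keys_def)
  have aug: "augmented X X' \<subseteq> clause_keys" using X'k by (auto simp: augmented_def ind_keys_def clause_keys_def)
  have inv0: "?inv {} m"
    using s by (auto simp: elem_inv_def ind_after_def mat_after_def fresh_consts_def augmented_def)
  show ?thesis
    unfolding round_def round_time_def add.assoc
  proof (rule runs_Seq'[OF runs_propagate_pairs[OF m inv0]])
    fix m1 assume m1: "?inv ({} \<union> {(e, r, c). (e, r) \<in> full_pairs ([] \<in> F) DS \<and> c \<in> cs}) m1"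
    show "runs B I K (Seq (propagate_consts A) (Seq (commit A) (update_clauses A))) m1
       (((\<Sum>c\<in>cs. (if [c] \<in> DS then ne * (np * (4 * A + 5) + 4) + 2 else 0) + 5) + 2) +
     (((\<Sum>c\<in>cs. (if [c] \<in> ?FC then 3 * (np * (2 * A + 5)) + 3 else 1) + 4) + 3) +
     (8 * (np * (2 * A + 5)) + 1)))
      (round_state X' M' FL' (AC \<union> act_keys FL' X') ?FC
       {k. k = [] \<and> \<not> act_keys FL' X' \<subseteq> AC} {k. k = [] \<and> ?FC \<noteq> {}})"
    proof (rule runs_Seq'[OF runs_propagate_consts[OF m m1, unfolded tr]])
      fix m2 assume m2: "?inv (triples ([] \<in> F) DS) m2"
      then have m2': "m2 tIND = tab X'" "m2 tMAT = tab M'" "m2 tND = tab ?FC" "m2 tAUG = tab (augmented X X')"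
          and ag2: "agree {tR, tE, tX, tC, tIND, tMAT, tND, tAUG} m m2"
        by (simp_all add: elem_inv_def X' M')
      then have t2: "\<And>t. t \<notin> {tR, tE, tX, tC, tIND, tMAT, tND, tAUG} \<Longrightarrow> m2 t = m t" by (simp add: agree_def)
      show "runs B I K (Seq (commit A) (update_clauses A)) m2
         (((\<Sum>c\<in>cs. (if [c] \<in> ?FC then 3 * (np * (2 * A + 5)) + 3 else 1) + 4) + 3) + (8 * (np * (2 * A + 5)) + 1))
         (round_state X' M' FL' (AC \<union> act_keys FL' X') ?FC
           {k. k = [] \<and> \<not> act_keys FL' X' \<subseteq> AC} {k. k = [] \<and> ?FC \<noteq> {}})"
      proof (rule runs_Seq'[OF runs_commit[OF m2'(1) _ _ m2'(3) _ _ _ XX' refl FC sub(2,4)]])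
        show "m2 tREJ = tab (rej X)" "m2 tNE = tab (nonempty X)" "m2 tDIRTY = tab DS" "m2 tCH = tab CH" "consts_ok m2"
          using s by (simp_all add: t2 consts_ok_def)
        fix m3 assume m3: "m3 tREJ = tab (rej X') \<and> m3 tNE = tab (nonempty X') \<and> m3 tDIRTY = tab ?FC \<and> m3 tND = tab {} \<and>
          m3 tCH = tab {k. k = [] \<and> ?FC \<noteq> {}} \<and> agree {tR, tX, tC, tREJ, tNE, tDIRTY, tND, tCH} m2 m3"
        then have t3: "\<And>t. t \<notin> {tR, tX, tC, tREJ, tNE, tDIRTY, tND, tCH} \<Longrightarrow> m3 t = m2 t" by (simp add: agree_def)
        show "runs B I K (update_clauses A) m3 (8 * (np * (2 * A + 5)) + 1)
          (round_state X' M' FL' (AC \<union> act_keys FL' X') ?FC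
           {k. k = [] \<and> \<not> act_keys FL' X' \<subseteq> AC} {k. k = [] \<and> ?FC \<noteq> {}})"
        proof (rule runs_weaken[OF runs_update_clauses[of m3 M' X' U V FL F AC X, OF _ _ _ _ _ _ _ _ UV(1,3) sub(3) aug FL'] order_refl])
          fix m4 assume m4: "m4 tUN = tab (unmatched M') \<and> m4 tBAD = tab (blocked X') \<and> m4 tFLAG = tab FL' \<and>
            m4 tFULL = tab {k. k = [] \<and> \<not> act_keys FL' X' \<subseteq> AC} \<and> m4 tACT = tab (AC \<union> act_keys FL' X') \<and>
            m4 tAUG = tab {} \<and> agree {tR, tUN, tBAD, tFLAG, tFULL, tACT, tAUG} m3 m4"
          then have t4: "\<And>t. t \<notin> {tR, tUN, tBAD, tFLAG, tFULL, tACT, tAUG} \<Longrightarrow> m4 t = m3 t" by (simp add: agree_def)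
          have un: "unmatched M' \<subseteq> clause_keys" "blocked X' \<subseteq> clause_keys"
            by (auto simp: unmatched_def blocked_def clause_keys_def pos_def)
          have z: "m4 t = (\<lambda>_. 0)" if "t \<in> {22..30}" for t
            using s that by (simp add: t2 t3 t4)
          show "round_state X' M' FL' (AC \<union> act_keys FL' X') ?FC
           {k. k = [] \<and> \<not> act_keys FL' X' \<subseteq> AC} {k. k = [] \<and> ?FC \<noteq> {}} m4"
            unfolding round_state_def using s m2' m3 m4 un z by (auto simp: t2 t3 t4 consts_ok_def)
        qed (use s m2' m3 UV in \<open>simp_all add: t2 t3\<close>)
      qed simp
    qed simp
  qed simp
qed

end

section \<open>Initialisation\<close>

definition collect_consts :: "nat \<Rightarrow> com" where
  "collect_consts A = For tE (Const 1) (Plus (Plus num_pre_exp num_eff_exp) (Const 1))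
     (seqs (map (\<lambda>a. Cond (And (cstE tE a) (Not_exp (Get tSEEN [valE tE a])))
        (Seq (Put tSEEN [valE tE a] (Const 1)) (Seq (Put tCL [Reg tCNT] (valE tE a))
          (Put tCNT [] (Plus (Reg tCNT) (Const 1))))) Skip) [0..<A]))"

text \<open>With empty individual domains, every positive precondition excludes every constant at
  each of its variables, while a blank table would mean the opposite; so \<open>tREJ\<close> has to
  be filled. \<open>tFULL\<close> and \<open>tCH\<close> make the first round happen and unify all
  pairs.\<close>

definition initialise :: "nat \<Rightarrow> com" where
  "initialise A = Seq (collect_consts A)
    (Seq (set_rows A tOWN (\<lambda>a. own_key) (\<lambda>a. posE))
    (Seq (for_consts (set_rows A tREJ (\<lambda>a. own_key @ [valE tR a, Reg tC]) (\<lambda>a. And posE (varE tR a))))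
    (Seq (Put tFULL [] (Const 1)) (Put tCH [] (Const 1)))))"

context rows_mem
begin

lemma runs_collect_consts:
  assumes m: "m tSEEN = (\<lambda>_. 0)" "m tCNT [] = 0"
  shows "runs B I K (collect_consts A) m ((np + ne) * (4 * A + 3) + 2)
    (\<lambda>m'. consts_ok m' \<and> agree {tE, tSEEN, tCL, tCNT} m m')"
proof -
  define J where "J Z m' \<longleftrightarrow> Z \<subseteq> cs \<and> (\<exists>l. distinct l \<and> set l = Z \<and> m' tSEEN = tab ((\<lambda>c. [c]) ` Z) \<and>
     m' tCNT [] = length l \<and> (\<forall>i<length l. m' tCL [i] = l ! i)) \<and> agree {tE, tSEEN, tCL, tCNT} m m'" for Z m'
  define g where "g r a = (if isc r a then {nam r a} else {})" for r a
  have step: "runs B I K (Cond (And (cstE tE a) (Not_exp (Get tSEEN [valE tE a])))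
        (Seq (Put tSEEN [valE tE a] (Const 1)) (Seq (Put tCL [Reg tCNT] (valE tE a))
          (Put tCNT [] (Plus (Reg tCNT) (Const 1))))) Skip) m' 4 (\<lambda>m''. J (Z \<union> g r a) m'' \<and> m'' tE [] = r)"
    if r: "row r" "m' tE [] = r" and J: "J Z m'" for r a Z m'
  proof -
    from J obtain l where l: "distinct l" "set l = Z" "m' tSEEN = tab ((\<lambda>c. [c]) ` Z)" "m' tCNT [] = length l"
        "\<And>i. i < length l \<Longrightarrow> m' tCL [i] = l ! i" and Z: "Z \<subseteq> cs" and ag: "agree {tE, tSEEN, tCL, tCNT} m m'"
      unfolding J_def by blast
    have cond: "tr B I m' (And (cstE tE a) (Not_exp (Get tSEEN [valE tE a]))) \<longleftrightarrow> isc r a \<and> nam r a \<notin> Z"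
      using B(4) r l(3) by (auto simp: ev_row)
    show ?thesis
    proof (rule runs_If[where T = 3])
      assume "tr B I m' (And (cstE tE a) (Not_exp (Get tSEEN [valE tE a])))"
      then have c: "isc r a" "nam r a \<notin> Z" using cond by blast+
      then have ccs: "nam r a \<in> cs" using isc_cs[OF r(1)] by blast
      \<comment> \<open>The constant at hand is not yet listed, so the list is strictly shorter than
        the number of constants. Hence its length is an admissible key and the incremented counter
        does not wrap.\<close>
      have "length l = card Z" using l(1,2) distinct_card by fastforce
      also have "\<dots> < card cs" using Z ccs c(2) cs(1) by (intro psubset_card_mono) auto
      finally have len: "length l < card cs" .
      let ?m = "m'(tSEEN := tab (insert [nam r a] ((\<lambda>c. [c]) ` Z)), tCL := (m' tCL)([length l] := nam r a),
          tCNT := (m' tCNT)([] := Suc (length l)))"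
      have "J (Z \<union> g r a) ?m"
        unfolding J_def
      proof (intro conjI exI[of _ "l @ [nam r a]"] allI impI)
        show "Z \<union> g r a \<subseteq> cs" using Z ccs by (auto simp: g_def)
        show "distinct (l @ [nam r a])" "set (l @ [nam r a]) = Z \<union> g r a" using l(1,2) c by (auto simp: g_def)
        fix i assume "i < length (l @ [nam r a])"
        then show "?m tCL [i] = (l @ [nam r a]) ! i"
          using l(5)[of i] by (cases "i = length l") (auto simp: nth_append)
      qed (use ag c in \<open>auto simp: g_def intro!: agree_upd arg_cong[where f = tab]\<close>)
      then show "runs B I K (Seq (Put tSEEN [valE tE a] (Const 1)) (Seq (Put tCL [Reg tCNT] (valE tE a))
          (Put tCNT [] (Plus (Reg tCNT) (Const 1))))) m' 3 (\<lambda>m''. J (Z \<union> g r a) m'' \<and> m'' tE [] = r)"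
        using r l(3,4) len B in_K(1)[of tCNT] in_K(2)[OF _ ccs] in_K(3)[of tCL "length l"]
        by (intro runs_Seq[where ?T1.0 = 1 and ?T2.0 = 2] runs_Seq[where ?T1.0 = 1 and ?T2.0 = 1] runs_Put)
           (simp_all add: ev_row tab_insert)
    next
      assume "\<not> tr B I m' (And (cstE tE a) (Not_exp (Get tSEEN [valE tE a])))"
      then have "Z \<union> g r a = Z" using cond by (auto simp: g_def)
      then show "runs B I K Skip m' 3 (\<lambda>m''. J (Z \<union> g r a) m'' \<and> m'' tE [] = r)"
        using J r by (intro runs_Skip) simp_all
    qed simp
  qed
  have J0: "J {} m" using m by (simp add: J_def tab_empty)
  have body: "runs B I K (seqs (map (\<lambda>a. Cond (And (cstE tE a) (Not_exp (Get tSEEN [valE tE a])))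
        (Seq (Put tSEEN [valE tE a] (Const 1)) (Seq (Put tCL [Reg tCNT] (valE tE a))
          (Put tCNT [] (Plus (Reg tCNT) (Const 1))))) Skip) [0..<A])) m' (A * 4 + 1)
        (\<lambda>m''. J (Z \<union> (\<Union>a<A. g i a)) m'' \<and> m'' tE [] = i)"
    if "1 \<le> i" "i < Suc (np + ne)" "J Z m'" "m' tE [] = i" for i Z m'
    using that by (intro runs_seqs[of "\<lambda>Z m'. J Z m' \<and> m' tE [] = i"] step) (auto simp: row_def)
  have Jx: "J Z (m'(tE := v))" if "J Z m'" for Z m' v
    using that by (auto simp: J_def agree_upd)
  have "runs B I K (collect_consts A) m ((\<Sum>i=1..<Suc (np + ne). (A * 4 + 1) + 2) + 2)
      (J ({} \<union> \<Union>((\<lambda>i. \<Union>a<A. g i a) ` {1..<Suc (np + ne)})))"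
    unfolding collect_consts_def
    by (rule runs_For[where J = J, OF in_K(1) _ _ B(1) J0 Jx ev_num(4) body]) simp_all
  moreover have "{} \<union> \<Union>((\<lambda>i. \<Union>a<A. g i a) ` {1..<Suc (np + ne)}) = cs"
  proof -
    have cs_iff: "c \<in> cs \<longleftrightarrow> (\<exists>r a. row r \<and> a < A \<and> isc r a \<and> nam r a = c)" for c
      unfolding cs_eq using Cst_iff by (auto simp: row_def)
    have g: "c \<in> g r a \<longleftrightarrow> isc r a \<and> nam r a = c" for c r a by (auto simp: g_def)
    have rows: "{1..<Suc (np + ne)} = {r. row r}" by (auto simp: row_def)
    show ?thesis
      unfolding rows by (rule set_eqI) (simp add: cs_iff g Bex_def)
  qed
  ultimately show ?thesis
    by (elim runs_weaken) (auto simp: J_def consts_ok_def algebra_simps)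
qed

lemma runs_initialise:
  assumes m: "\<And>t. m t = (\<lambda>_. 0)"
  shows "runs B I K (initialise A) m ((np + ne) * (4 * A + 3) + np * (2 * A + 5) + card cs * (np * (2 * A + 5) + 3) + 6)
    (round_state {} {} {} {} {} {[]} {[]})"
proof -
  let ?w = "np * (2 * A + 5)"
  note [simp] = ev_keys ev_row tr_posE B(4)
  show ?thesis
    unfolding initialise_def
  proof (rule runs_Seq'[OF runs_collect_consts])
    fix m1 assume "consts_ok m1 \<and> agree {tE, tSEEN, tCL, tCNT} m m1"
    then have ok: "consts_ok m1" and t1: "\<And>t. t \<notin> {tE, tSEEN, tCL, tCNT} \<Longrightarrow> m1 t = tab {}"
      using m by (simp_all add: agree_def tab_empty)
    have ow: "own = {} \<union> {[rop r, rcl r] |r a. prow r \<and> a < A \<and> pos r}"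
      using pos_keys[of "\<lambda>r. [rop r, rcl r]" "\<lambda>_. True"] by (simp add: own_def)
    show "runs B I K (Seq (set_rows A tOWN (\<lambda>a. own_key) (\<lambda>a. posE))
      (Seq (for_consts (set_rows A tREJ (\<lambda>a. own_key @ [valE tR a, Reg tC]) (\<lambda>a. And posE (varE tR a))))
      (Seq (Put tFULL [] (Const 1)) (Put tCH [] (Const 1))))) m1 (?w + (card cs * (?w + 3) + 4))
      (round_state {} {} {} {} {} {[]} {[]})"
    proof (rule runs_Seq')
      show "runs B I K (set_rows A tOWN (\<lambda>a. own_key) (\<lambda>a. posE)) m1 ?w
          (\<lambda>m'. m' tOWN = tab own \<and> agree {tR, tOWN} m1 m')"
        by (rule runs_set_rows'[where T = tOWN and m = m1, OF _ _ t1 _ _ ow]) (use in_K(6) in simp_all)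
      fix m2 assume m2: "m2 tOWN = tab own \<and> agree {tR, tOWN} m1 m2"
      then have t2: "\<And>t. t \<notin> {tE, tSEEN, tCL, tCNT, tR, tOWN} \<Longrightarrow> m2 t = tab {}" using t1 by (simp add: agree_def)
      have ok2: "consts_ok m2" using m2 ok by (simp add: consts_ok_def agree_def)
      define J where "J Z m' \<longleftrightarrow> m' tREJ = tab (\<Union>c\<in>Z. rej_at c {}) \<and> agree {tR, tX, tC, tREJ} m2 m'" for Z m'
      have "runs B I K (for_consts (set_rows A tREJ (\<lambda>a. own_key @ [valE tR a, Reg tC]) (\<lambda>a. And posE (varE tR a)))) m2
          ((\<Sum>c\<in>cs. ?w + 3) + 2) (J ({} \<union> (\<Union>c\<in>cs. {c})))"
      proof (rule runs_for_consts[where J = J, OF ok2])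
        show "J {} m2" by (simp add: J_def t2)
        fix c Z m' assume c: "c \<in> cs" "m' tC [] = c" and J: "J Z m'"
        have eq: "(\<Union>c\<in>Z \<union> {c}. rej_at c {}) = (\<Union>c\<in>Z. rej_at c {}) \<union>
            {[rop r, rcl r, nam r a, c] |r a. prow r \<and> a < A \<and> pos r \<and> isv r a}"
          using pos_Var_keys[of "\<lambda>r x. [rop r, rcl r, x, c]" "\<lambda>_ _. True"] by (simp add: rej_at_def Un_commute)
        have R: "m' tREJ = tab (\<Union>c\<in>Z. rej_at c {})" using J by (simp add: J_def)
        have "runs B I K (set_rows A tREJ (\<lambda>a. own_key @ [valE tR a, Reg tC]) (\<lambda>a. And posE (varE tR a))) m' ?w
            (\<lambda>m''. m'' tREJ = tab (\<Union>c\<in>Z \<union> {c}. rej_at c {}) \<and> agree {tR, tREJ} m' m'')"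
          by (rule runs_set_rows'[where T = tREJ and m = m', OF _ _ R _ _ eq]) (use c in_K(10) in simp_all)
        then show "runs B I K (set_rows A tREJ (\<lambda>a. own_key @ [valE tR a, Reg tC]) (\<lambda>a. And posE (varE tR a))) m' ?w
            (\<lambda>m''. J (Z \<union> {c}) m'' \<and> m'' tX = m' tX)"
          using J by (elim runs_weaken) (auto simp: J_def agree_def)
      qed (auto simp: J_def agree_upd agree_def)
      then show "runs B I K (Seq (for_consts (set_rows A tREJ (\<lambda>a. own_key @ [valE tR a, Reg tC]) (\<lambda>a. And posE (varE tR a))))
          (Seq (Put tFULL [] (Const 1)) (Put tCH [] (Const 1)))) m2 (card cs * (?w + 3) + 4) (round_state {} {} {} {} {} {[]} {[]})"
      proof (rule runs_Seq'[where ?T2.0 = 2])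
        fix m3 assume J: "J ({} \<union> (\<Union>c\<in>cs. {c})) m3"
        then have t3: "\<And>t. t \<notin> {tR, tX, tC, tREJ} \<Longrightarrow> m3 t = m2 t" and R: "m3 tREJ = tab (rej {})"
          by (simp_all add: J_def agree_def rej_eq)
        have n: "nonempty {} = {}" by (auto simp: nonempty_def rej_def)
        have "round_state {} {} {} {} {} {[]} {[]} (m3(tFULL := tab {[]}, tCH := tab {[]}))"
          using m2 ok2 by (auto simp: round_state_def R n t2 t3 consts_ok_def tab_empty)
        then show "runs B I K (Seq (Put tFULL [] (Const 1)) (Put tCH [] (Const 1))) m3 2 (round_state {} {} {} {} {} {[]} {[]})"
          using in_K(1) by (intro runs_Seq[where ?T1.0 = 1 and ?T2.0 = 1] runs_Put) (simp_all add: t3 t2 tab_insert)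
      qed simp
    qed simp
  qed (use m in simp_all)
qed

end

section \<open>The rows of an encoded problem\<close>

text \<open>Keeps the position of a precondition within its clause, which the encoding drops. As the
  list is distinct, row numbers and precondition identifiers correspond one to one.\<close>

definition pre_list :: "problem \<Rightarrow> (pre_id \<times> condition) list" where
  "pre_list P = [((i, j, l), b). (i, op) \<leftarrow> enumerate 0 (all_ops P),
     (j, cl) \<leftarrow> enumerate 0 (clauses op), (l, b) \<leftarrow> enumerate 0 (pre cl)]"

definition eff_list :: "problem \<Rightarrow> (clause_id \<times> literal) list" where
  "eff_list P = [((i, j), l). (i, op) \<leftarrow> enumerate 0 (all_ops P),
     (j, cl) \<leftarrow> enumerate 0 (clauses op), l \<leftarrow> eff cl]"

lemma map_snd_enum: "map (\<lambda>x. f (snd x)) (enumerate n xs) = map f xs"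
  using map_map[of f snd "enumerate n xs"] by (simp add: o_def)

lemma pre_rows_eq: "pre_rows P = map (\<lambda>((i, j, l), b). [i, j] @ enc_cond b) (pre_list P)"
  by (simp add: pre_rows_def pre_list_def map_concat o_def case_prod_unfold
      map_snd_enum[of "\<lambda>b. _ # _ # enc_cond b"])

lemma eff_rows_eq: "eff_rows P = map (\<lambda>((i, j), l). [i, j] @ enc_lit l) (eff_list P)"
  by (simp add: eff_rows_def eff_list_def map_concat o_def case_prod_unfold)

lemma sum_list_map_concat: "sum_list (map f (concat xss)) = sum_list (map (\<lambda>xs. sum_list (map f xs)) xss)"
  by (induction xss) auto

lemma length_pre_list: "length (pre_list P) = num_pre P"
  by (simp add: pre_list_def num_pre_def all_clauses_def length_concat sum_list_map_concat o_def
      case_prod_unfold map_snd_enum[of "\<lambda>op. sum_list (map (\<lambda>cl. length (pre cl)) (clauses op))"]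
      map_snd_enum[of "\<lambda>cl. length (pre cl)"])

lemma length_eff_list: "length (eff_list P) = num_eff P"
  by (simp add: eff_list_def num_eff_def all_clauses_def length_concat sum_list_map_concat o_def
      case_prod_unfold map_snd_enum[of "\<lambda>op. sum_list (map (\<lambda>cl. length (eff cl)) (clauses op))"]
      map_snd_enum[of "\<lambda>cl. length (eff cl)"])

lemma mem_pre_list:
  "((i, j, l), b) \<in> set (pre_list P) \<longleftrightarrow>
     (i, j) \<in> clause_ids P \<and> l < length (pre (the_clause P (i, j))) \<and> pre (the_clause P (i, j)) ! l = b"
  by (fastforce simp: pre_list_def in_set_enumerate_eq clause_ids_def the_clause_def the_op_def)

lemma mem_eff_list: "(k, l) \<in> set (eff_list P) \<longleftrightarrow> k \<in> clause_ids P \<and> l \<in> set (eff (the_clause P k))"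
  by (cases k) (fastforce simp: eff_list_def in_set_enumerate_eq clause_ids_def the_clause_def the_op_def)

text \<open>Different blocks are disjoint because each member reveals, through \<open>g\<close>, the
  key of its block. Used for the operator component and then for the clause component of an
  identifier.\<close>

lemma distinct_concat_keyed:
  assumes "distinct (map h xs)" "\<And>x. x \<in> set xs \<Longrightarrow> distinct (f x)"
    "\<And>x y. x \<in> set xs \<Longrightarrow> y \<in> set (f x) \<Longrightarrow> g y = h x"
  shows "distinct (concat (map f xs))"
  using assms
proof (induction xs)
  case (Cons x xs)
  have "h x \<noteq> h y" if "y \<in> set xs" for y using Cons.prems(1) that by (auto simp: image_iff)
  moreover have "g z = h y" if "y \<in> insert x (set xs)" "z \<in> set (f y)" for y z
    using Cons.prems(3) that by auto
  ultimately have "set (f x) \<inter> set (concat (map f xs)) = {}" by (auto, metis insertI1 insertI2)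
  then show ?case using Cons by auto
qed simp

lemma distinct_pre_list: "distinct (pre_list P)"
  unfolding pre_list_def case_prod_unfold
proof (rule distinct_concat_keyed[where h = fst and g = "\<lambda>y. fst (fst y)"])
  fix x :: "nat \<times> operator"
  show "distinct (concat (map (\<lambda>p. map (\<lambda>q. ((fst x, fst p, fst q), snd q)) (enumerate 0 (pre (snd p)))) (enumerate 0 (clauses (snd x)))))"
    by (rule distinct_concat_keyed[where h = fst and g = "\<lambda>y. fst (snd (fst y))"])
      (auto simp: distinct_map inj_on_def)
qed auto

fun cond_tag :: "condition \<Rightarrow> nat" where
  "cond_tag (Lit (Pos a)) = 0"
| "cond_tag (Lit (Neg a)) = 1"
| "cond_tag (EQ s t) = 2"
| "cond_tag (NEQ s t) = 3"

fun cond_pred :: "condition \<Rightarrow> nat" where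
  "cond_pred (Lit l) = pred (lit_atom l)"
| "cond_pred (EQ s t) = 0"
| "cond_pred (NEQ s t) = 0"

definition enc_row :: "nat \<times> nat \<times> condition \<Rightarrow> nat list" where
  "enc_row = (\<lambda>(i, j, b). [i, j, cond_tag b, cond_pred b, length (cond_terms b)] @ concat (map enc_trm (cond_terms b)))"

lemma enc_lit_eq: "enc_lit l = enc_cond (Lit l)"
  by simp

lemma enc_row_eq: "[i, j] @ enc_cond b = enc_row (i, j, b)"
  by (cases b rule: cond_tag.cases) (simp_all add: enc_row_def)

text \<open>Effects are wrapped as literal conditions, so that rows of both kinds share one format
  and one decoding.\<close>

definition rows_of :: "problem \<Rightarrow> (nat \<times> nat \<times> condition) list" where
  "rows_of P = map (\<lambda>((i, j, l), b). (i, j, b)) (pre_list P) @ map (\<lambda>((i, j), l). (i, j, Lit l)) (eff_list P)"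

lemma length_rows_of: "length (rows_of P) = num_pre P + num_eff P"
  by (simp add: rows_of_def length_pre_list length_eff_list)

lemma encode_eq: "encode P = [num_pre P, num_eff P] # map enc_row (rows_of P)"
  unfolding encode_def pre_rows_eq eff_rows_eq rows_of_def enc_lit_eq
  by (simp add: o_def case_prod_unfold enc_row_eq[simplified] del: enc_cond.simps)

lemma length_enc_trms: "length (concat (map enc_trm ts)) = 2 * length ts"
proof (induction ts)
  case (Cons t ts)
  then show ?case by (cases t) auto
qed simp

lemma nth_enc_trms:
  "a < length ts \<Longrightarrow> [concat (map enc_trm ts) ! (2 * a), concat (map enc_trm ts) ! Suc (2 * a)] = enc_trm (ts ! a)"
proof (induction ts arbitrary: a)
  case (Cons t ts)
  show ?case
  proof (cases a)
    case 0
    then show ?thesis by (cases t) auto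
  next
    case (Suc a')
    then show ?thesis using Cons.IH[of a'] Cons.prems by (cases t) auto
  qed
qed simp

text \<open>Row 0 of the input is the header with the two counts, hence the shift by one.\<close>

definition row_at :: "problem \<Rightarrow> nat \<Rightarrow> nat \<times> nat \<times> condition" where
  "row_at P r = rows_of P ! (r - 1)"

definition row_op :: "problem \<Rightarrow> nat \<Rightarrow> nat" where
  "row_op P r = fst (row_at P r)"

definition row_clause :: "problem \<Rightarrow> nat \<Rightarrow> nat" where
  "row_clause P r = fst (snd (row_at P r))"

definition row_cond :: "problem \<Rightarrow> nat \<Rightarrow> condition" where
  "row_cond P r = snd (snd (row_at P r))"

lemma encode_nth:
  assumes "0 < r" "r \<le> num_pre P + num_eff P"
  shows "input_word (encode P) r c =
    (let b = row_cond P r; xs = [row_op P r, row_clause P r, cond_tag b, cond_pred b, length (cond_terms b)] @ concat (map enc_trm (cond_terms b))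
     in if c < length xs then xs ! c else 0)"
proof -
  obtain r' where r: "r = Suc r'" "r' < length (rows_of P)" using assms length_rows_of by (cases r) auto
  then show ?thesis
    by (auto simp: input_word_def encode_eq row_op_def row_clause_def row_cond_def row_at_def enc_row_def case_prod_unfold Let_def)
qed

locale encoded =
  fixes P :: problem and A B :: nat
  assumes wf: "wf_problem P" and arity: "arity_bounded A P" and A: "2 \<le> A"
    and np: "0 < num_pre P" and ne: "0 < num_eff P" and cs: "0 < num_consts P"
    and B: "Suc (num_pre P + num_eff P) < B" "Suc (num_pre P) * A < B" "num_consts P < B" "2 < B"
begin

lemma row_mem:
  assumes "0 < r" "r \<le> num_pre P + num_eff P"
  shows "(row_op P r, row_clause P r) \<in> clause_ids P \<and>
    (row_cond P r \<in> set (pre (the_clause P (row_op P r, row_clause P r))) \<or>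
     (\<exists>l \<in> set (eff (the_clause P (row_op P r, row_clause P r))). row_cond P r = Lit l))"
proof -
  have "row_at P r \<in> set (rows_of P)"
    unfolding row_at_def using assms length_rows_of[of P] by (intro nth_mem) linarith
  then show ?thesis
    unfolding rows_of_def row_op_def row_clause_def row_cond_def
    by (auto simp: mem_pre_list mem_eff_list)
qed

lemma row_terms_length:
  assumes "0 < r" "r \<le> num_pre P + num_eff P"
  shows "length (cond_terms (row_cond P r)) \<le> A"
proof -
  let ?cl = "the_clause P (row_op P r, row_clause P r)"
  have cl: "?cl \<in> set (all_clauses P)" using row_mem[OF assms] the_clause_mem by blast
  show ?thesis
  proof (cases "row_cond P r")
    case (Lit l)
    then show ?thesis using row_mem[OF assms] arity cl unfolding arity_bounded_def by auto
  qed (use A in simp_all)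
qed

lemma consts_rows: "consts_of P = {c. \<exists>r. 0 < r \<and> r \<le> num_pre P + num_eff P \<and> Cst c \<in> set (cond_terms (row_cond P r))}"
proof (intro set_eqI iffI)
  fix c assume "c \<in> consts_of P"
  then obtain cl t where cl: "cl \<in> set (all_clauses P)" and t: "t \<in> set (clause_terms cl)" "c \<in> set (trm_consts t)"
    unfolding consts_of_def by blast
  then have tc: "t = Cst c" by (cases t) auto
  obtain i j where ij: "(i, j) \<in> clause_ids P" "cl = the_clause P (i, j)"
    using cl unfolding all_clauses_def clause_ids_def the_clause_def the_op_def by (auto simp: in_set_conv_nth)
  consider b where "b \<in> set (pre cl)" "Cst c \<in> set (cond_terms b)" | l where "l \<in> set (eff cl)" "Cst c \<in> set (cond_terms (Lit l))"
    using t(1) unfolding clause_terms_def tc by auto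
  then obtain b where "(i, j, b) \<in> set (rows_of P)" "Cst c \<in> set (cond_terms b)"
  proof cases
    case 1
    then obtain l where "l < length (pre cl)" "pre cl ! l = b" by (auto simp: in_set_conv_nth)
    then have "((i, j, l), b) \<in> set (pre_list P)" using ij by (simp add: mem_pre_list)
    then show ?thesis using that[of b] 1(2) unfolding rows_of_def by force
  next
    case 2
    then have "((i, j), l) \<in> set (eff_list P)" using ij by (simp add: mem_eff_list)
    then show ?thesis using that[of "Lit l"] 2(2) unfolding rows_of_def by force
  qed
  then obtain r' where "r' < length (rows_of P)" "rows_of P ! r' = (i, j, b)" "Cst c \<in> set (cond_terms b)"
    by (auto simp: in_set_conv_nth)
  then show "c \<in> {c. \<exists>r. 0 < r \<and> r \<le> num_pre P + num_eff P \<and> Cst c \<in> set (cond_terms (row_cond P r))}"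
    using length_rows_of[of P] by (auto simp: row_cond_def row_at_def intro!: exI[of _ "Suc r'"])
next
  fix c assume "c \<in> {c. \<exists>r. 0 < r \<and> r \<le> num_pre P + num_eff P \<and> Cst c \<in> set (cond_terms (row_cond P r))}"
  then obtain r where r: "0 < r" "r \<le> num_pre P + num_eff P" "Cst c \<in> set (cond_terms (row_cond P r))" by blast
  let ?cl = "the_clause P (row_op P r, row_clause P r)"
  have cl: "?cl \<in> set (all_clauses P)" using row_mem[OF r(1,2)] the_clause_mem by blast
  have "Cst c \<in> set (clause_terms ?cl)"
    using row_mem[OF r(1,2)] r(3) unfolding clause_terms_def by force
  then show "c \<in> consts_of P" using cl unfolding consts_of_def by force
qed

lemma finite_consts: "finite (consts_of P)"
  using cs card_ge_0_finite unfolding num_consts_def by blast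

sublocale rows B "encode P" A "num_pre P" "num_eff P" "consts_of P" "row_op P" "row_clause P"
  "\<lambda>r. cond_tag (row_cond P r)" "\<lambda>r. cond_pred (row_cond P r)" "\<lambda>r. cond_terms (row_cond P r)"
proof
  show "Suc (num_pre P + num_eff P) < B" "Suc (num_pre P) * A < B" "card (consts_of P) < B" "2 < B"
    using B by (simp_all add: num_consts_def)
  show "consts_of P \<noteq> {}" using cs by (auto simp: num_consts_def)
  show "input_word (encode P) 0 0 = num_pre P" "input_word (encode P) 0 (Suc 0) = num_eff P"
    by (simp_all add: input_word_def encode_eq)
  fix r assume r: "0 < r" "r \<le> num_pre P + num_eff P"
  show "input_word (encode P) r 0 = row_op P r \<and> input_word (encode P) r (Suc 0) = row_clause P r \<and>
      input_word (encode P) r 2 = cond_tag (row_cond P r) \<and> input_word (encode P) r 3 = cond_pred (row_cond P r) \<and>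
      input_word (encode P) r 4 = length (cond_terms (row_cond P r))"
    by (simp add: encode_nth[OF r] Let_def numeral_eq_Suc)
  fix a
  show "[input_word (encode P) r (5 + 2 * a), input_word (encode P) r (6 + 2 * a)] = enc_trm (cond_terms (row_cond P r) ! a)"
    if "a < length (cond_terms (row_cond P r))"
    using nth_enc_trms[OF that] that by (simp add: encode_nth[OF r] Let_def length_enc_trms numeral_eq_Suc)
  show "input_word (encode P) r (5 + 2 * a) = 0 \<and> input_word (encode P) r (6 + 2 * a) = 0"
    if "length (cond_terms (row_cond P r)) \<le> a"
    using that by (simp add: encode_nth[OF r] Let_def length_enc_trms)
qed (use A np ne finite_consts row_terms_length consts_rows in simp_all)

end

section \<open>Rounds of the machine and of the algorithm\<close>

text \<open>The domain tests concern only constants linked to an effect variable, and these occur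
  among the arguments of the two atoms. So membership has to agree only on \<open>S\<close>.\<close>

lemma unifiable_cong:
  assumes "\<And>v c. c \<in> S \<Longrightarrow> c \<in> D v \<longleftrightarrow> c \<in> D' v" "\<And>c. Cst c \<in> set (args e) \<union> set (args p) \<Longrightarrow> c \<in> S"
  shows "unifiable D e p \<longleftrightarrow> unifiable D' e p"
proof -
  have "c \<in> S" if "(Var (Inl v), Cst c) \<in> atom_links e p" for v c
    using links_ends[OF that[unfolded atom_links_def]] assms(2) by (simp add: Cst_in_map)
  then show ?thesis unfolding unifiable_def using assms(1) by blast
qed

lemma contributes_cong:
  assumes "\<And>v. c \<in> D v \<longleftrightarrow> c \<in> D' v"
  shows "contributes D e p u c \<longleftrightarrow> contributes D' e p u c"
  unfolding contributes_def using assms by blast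

section \<open>Rows as preconditions and effects of the problem\<close>

context encoded
begin

definition pid :: "nat \<Rightarrow> pre_id" where
  "pid r = fst (pre_list P ! (r - 1))"

definition kid :: "nat \<Rightarrow> clause_id" where
  "kid r = (row_op P r, row_clause P r)"

lemma prow_pid:
  assumes "prow r"
  shows "(pid r, row_cond P r) \<in> set (pre_list P)" "row_op P r = fst (pid r)" "row_clause P r = fst (snd (pid r))"
proof -
  have r: "r - 1 < length (pre_list P)" using assms by (auto simp: prow_def length_pre_list)
  then have "row_at P r = (\<lambda>((i, j, l), b). (i, j, b)) (pre_list P ! (r - 1))"
    by (simp add: row_at_def rows_of_def nth_append)
  then have *: "row_cond P r = snd (pre_list P ! (r - 1))" "row_op P r = fst (pid r)" "row_clause P r = fst (snd (pid r))"
    by (simp_all add: row_op_def row_clause_def row_cond_def pid_def case_prod_unfold)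
  then show "(pid r, row_cond P r) \<in> set (pre_list P)" "row_op P r = fst (pid r)" "row_clause P r = fst (snd (pid r))"
    using nth_mem[OF r] by (simp_all add: pid_def)
qed

lemma pre_list_functional: "(q, b) \<in> set (pre_list P) \<Longrightarrow> (q, b') \<in> set (pre_list P) \<Longrightarrow> b = b'"
  by (cases q) (auto simp: mem_pre_list)

lemma pid_inj:
  assumes "prow r" "prow r'" "pid r = pid r'"
  shows "r = r'"
proof -
  have l: "r - 1 < length (pre_list P)" "r' - 1 < length (pre_list P)"
    using assms(1,2) by (auto simp: prow_def length_pre_list)
  then have "snd (pre_list P ! (r - 1)) = snd (pre_list P ! (r' - 1))"
    using pre_list_functional[of "pid r"] assms(3) nth_mem[OF l(1)] nth_mem[OF l(2)] by (metis pid_def prod.collapse)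
  then have "pre_list P ! (r - 1) = pre_list P ! (r' - 1)"
    using assms(3) by (simp add: pid_def prod_eq_iff)
  then have "r - 1 = r' - 1" using nth_eq_iff_index_eq[OF distinct_pre_list l] by blast
  then show ?thesis using assms(1,2) by (cases r; cases r') (auto simp: prow_def)
qed

lemma tag_0: "cond_tag b = 0 \<longleftrightarrow> (\<exists>a. b = Lit (Pos a))"
  by (cases b rule: cond_tag.cases) auto

lemma ratom_eq: "row_cond P r = Lit l \<Longrightarrow> ratom r = lit_atom l"
  by (simp add: ratom_def)

lemma pos_pre_row: "pos r \<Longrightarrow> (pid r, ratom r) \<in> pos_pre P"
proof -
  assume r: "pos r"
  then obtain a where a: "row_cond P r = Lit (Pos a)" by (auto simp: pos_def tag_0)
  obtain i j l where "pid r = (i, j, l)" by (cases "pid r")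
  then show ?thesis
    using prow_pid(1)[of r] r a by (auto simp: pos_def ratom_eq mem_pre_list pos_pre_def)
qed

lemma pos_pre_ex:
  assumes "(q, a) \<in> pos_pre P"
  shows "\<exists>r. pos r \<and> pid r = q \<and> ratom r = a"
proof -
  obtain i j l where q: "q = (i, j, l)" by (cases q)
  then have "(q, Lit (Pos a)) \<in> set (pre_list P)" using assms by (auto simp: mem_pre_list pos_pre_def)
  then obtain r' where r': "r' < num_pre P" "pre_list P ! r' = (q, Lit (Pos a))"
    by (auto simp: in_set_conv_nth length_pre_list)
  then have p: "prow (Suc r')" "pid (Suc r') = q" by (simp_all add: prow_def pid_def)
  then have "row_cond P (Suc r') = Lit (Pos a)"
    using prow_pid(1)[OF p(1)] \<open>(q, Lit (Pos a)) \<in> set (pre_list P)\<close> pre_list_functional by auto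
  then show ?thesis using p by (intro exI[of _ "Suc r'"]) (auto simp: pos_def ratom_eq)
qed

lemma prow_matched: "prow r \<Longrightarrow> (pid r, a) \<in> pos_pre P \<Longrightarrow> pos r \<and> a = ratom r"
  using pos_pre_ex[of "pid r" a] pid_inj by (auto simp: pos_def)

lemma erow_at:
  assumes "erow e"
  shows "row_at P e = (\<lambda>((i, j), l). (i, j, Lit l)) (eff_list P ! (e - 1 - num_pre P))" "e - 1 - num_pre P < length (eff_list P)"
proof -
  have "\<not> e - 1 < num_pre P" "e - 1 < num_pre P + num_eff P" using assms by (auto simp: erow_def)
  then show "row_at P e = (\<lambda>((i, j), l). (i, j, Lit l)) (eff_list P ! (e - 1 - num_pre P))" "e - 1 - num_pre P < length (eff_list P)"
    by (simp_all add: row_at_def rows_of_def nth_append length_pre_list length_eff_list)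
qed

lemma erow_eff: "erow e \<Longrightarrow> \<exists>l. (kid e, l) \<in> set (eff_list P) \<and> row_cond P e = Lit l"
proof -
  assume e: "erow e"
  obtain i j l where x: "eff_list P ! (e - 1 - num_pre P) = ((i, j), l)" by (metis prod.collapse)
  have "((i, j), l) \<in> set (eff_list P)" using nth_mem[OF erow_at(2)[OF e]] unfolding x .
  moreover have "row_at P e = (i, j, Lit l)" unfolding erow_at(1)[OF e] x by simp
  ultimately show ?thesis by (auto simp: kid_def row_op_def row_clause_def row_cond_def)
qed

lemma eff_row:
  assumes "erow e"
  shows "kid e \<in> clause_ids P" "cond_tag (row_cond P e) = 0 \<Longrightarrow> ratom e \<in> pos_eff P (kid e)"
proof -
  obtain l where l: "(kid e, l) \<in> set (eff_list P)" "row_cond P e = Lit l" using erow_eff[OF assms] by blast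
  then show "kid e \<in> clause_ids P" by (simp add: mem_eff_list)
  show "cond_tag (row_cond P e) = 0 \<Longrightarrow> ratom e \<in> pos_eff P (kid e)"
    using l by (auto simp: tag_0 pos_eff_def mem_eff_list ratom_eq)
qed

lemma eff_ex:
  assumes "k \<in> clause_ids P" "a \<in> pos_eff P k"
  shows "\<exists>e. erow e \<and> cond_tag (row_cond P e) = 0 \<and> kid e = k \<and> ratom e = a"
proof -
  have "(k, Pos a) \<in> set (eff_list P)" using assms by (simp add: mem_eff_list pos_eff_def)
  then obtain e' where e': "e' < num_eff P" "eff_list P ! e' = (k, Pos a)"
    by (auto simp: in_set_conv_nth length_eff_list)
  let ?e = "Suc (num_pre P + e')"
  have e: "erow ?e" using e' by (simp add: erow_def)
  have "row_at P ?e = (fst k, snd k, Lit (Pos a))" using erow_at(1)[OF e] e' by (simp add: case_prod_unfold)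
  then have c: "row_cond P ?e = Lit (Pos a)" and k: "kid ?e = k"
    by (simp_all add: kid_def row_op_def row_clause_def row_cond_def)
  show ?thesis using e ratom_eq[OF c] c k by (intro exI[of _ ?e]) simp
qed

section \<open>The intended tables of the machine at the start of a round\<close>

definition X_at :: "nat \<Rightarrow> nat list set" where
  "X_at t = {[r, u, c] |r u c. prow r \<and> c \<in> ind_at P t (pid r) u}"

definition M_at :: "nat \<Rightarrow> nat list set" where
  "M_at t = {[r] |r. prow r \<and> pid r \<in> matched (state P t)}"

text \<open>Restricted to clauses with positive preconditions of their own, because only those are
  reached as keys by a scan over positive rows. The remaining clauses behave like their primary
  clause.\<close>

definition F_at :: "nat \<Rightarrow> nat list set" where
  "F_at t = {[i, j] |i j. (i, j) \<in> flagged P t \<and> [i, j] \<in> own}"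

definition A_at :: "nat \<Rightarrow> nat list set" where
  "A_at t = {[i, j] |i j. (i, j) \<in> active P t \<and> [i, j] \<in> own}"

definition D_at :: "nat \<Rightarrow> nat list set" where
  "D_at t = {[c] |c. c \<in> dirty P t}"

lemma mem_X_at: "[r, u, c] \<in> X_at t \<longleftrightarrow> prow r \<and> c \<in> ind_at P t (pid r) u"
  by (auto simp: X_at_def)

lemma mem_M_at: "[r] \<in> M_at t \<longleftrightarrow> prow r \<and> pid r \<in> matched (state P t)"
  by (auto simp: M_at_def)

lemma own_iff: "[i, j] \<in> own \<longleftrightarrow> (\<exists>q a. (q, a) \<in> pos_pre P \<and> fst q = i \<and> fst (snd q) = j)"
proof
  assume "[i, j] \<in> own"
  then obtain r where "pos r" "row_op P r = i" "row_clause P r = j" by (auto simp: own_def)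
  then show "\<exists>q a. (q, a) \<in> pos_pre P \<and> fst q = i \<and> fst (snd q) = j"
    using pos_pre_row prow_pid by (metis pos_def)
next
  assume "\<exists>q a. (q, a) \<in> pos_pre P \<and> fst q = i \<and> fst (snd q) = j"
  then obtain r where "pos r" "fst (pid r) = i" "fst (snd (pid r)) = j" using pos_pre_ex by metis
  then have "pos r" "row_op P r = i" "row_clause P r = j" using prow_pid(2,3)[of r] by (simp_all add: pos_def)
  then show "[i, j] \<in> own" unfolding own_def by blast
qed

lemma rej_X_at:
  "[i, j, x, c] \<in> rej (X_at t) \<longleftrightarrow> c \<in> consts_of P \<and>
     (\<exists>q a. (q, a) \<in> pos_pre P \<and> fst q = i \<and> fst (snd q) = j \<and> Var x \<in> set (args a) \<and> c \<notin> ind_at P t q x)" (is "?l \<longleftrightarrow> ?r")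
proof
  assume ?l
  then obtain r where r: "pos r" "row_op P r = i" "row_clause P r = j" "Var x \<in> set (args (ratom r))" "c \<in> consts_of P"
      "[r, x, c] \<notin> X_at t"
    by (auto simp: rej_def ratom_def)
  then show ?r
    using pos_pre_row[OF r(1)] prow_pid[of r] by (auto simp: mem_X_at pos_def)
next
  assume ?r
  then obtain q a where q: "(q, a) \<in> pos_pre P" "fst q = i" "fst (snd q) = j" "Var x \<in> set (args a)" "c \<notin> ind_at P t q x"
      "c \<in> consts_of P" by blast
  obtain r where "pos r" "pid r = q" "ratom r = a" using pos_pre_ex[OF q(1)] by blast
  then show ?l using q prow_pid(2,3)[of r] by (auto simp: rej_def mem_X_at pos_def ratom_def intro!: exI[of _ r])
qed

lemma intersected_rej:
  "c \<in> intersected P (ind_at P t) (i, j) x \<longleftrightarrow>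
     c \<in> consts_of P \<and> [i, j, x, c] \<notin> rej (X_at t) \<and> [i, 0, x, c] \<notin> rej (X_at t)"
  unfolding mem_intersected mem_relevant rej_X_at fst_conv snd_conv by blast

lemma rdom_X_at: "c \<in> consts_of P \<Longrightarrow> c \<in> rdom (rej (X_at t)) e v \<longleftrightarrow> c \<in> intersected P (ind_at P t) (kid e) v"
  by (simp add: rdom_def intersected_rej kid_def)

lemma ratom_consts: "row r \<Longrightarrow> Cst c \<in> set (args (ratom r)) \<Longrightarrow> c \<in> consts_of P"
  unfolding consts_rows row_def by (auto simp: ratom_def)

lemma runifiable_X_at:
  assumes "erow e" "pos r"
  shows "runifiable (rej (X_at t)) e r \<longleftrightarrow>
    cond_tag (row_cond P e) = 0 \<and> unifiable (intersected P (ind_at P t) (kid e)) (ratom e) (ratom r)"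
proof -
  have "unifiable (rdom (rej (X_at t)) e) (ratom e) (ratom r) \<longleftrightarrow>
      unifiable (intersected P (ind_at P t) (kid e)) (ratom e) (ratom r)"
    using assms erow_row[of e] prow_row[of r]
    by (intro unifiable_cong[where S = "consts_of P"] rdom_X_at) (auto simp: pos_def intro: ratom_consts)
  then show ?thesis using assms(2) by (auto simp: runifiable_def pos_def)
qed

lemma rcontributes_X_at:
  assumes "c \<in> consts_of P"
  shows "rcontributes (rej (X_at t)) e r u c \<longleftrightarrow>
    Var u \<in> set (args (ratom r)) \<and> contributes (intersected P (ind_at P t) (kid e)) (ratom e) (ratom r) u c"
proof -
  have "contributes (rdom (rej (X_at t)) e) (ratom e) (ratom r) u c \<longleftrightarrow>
      contributes (intersected P (ind_at P t) (kid e)) (ratom e) (ratom r) u c"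
    by (intro contributes_cong rdom_X_at assms)
  then show ?thesis by (simp add: rcontributes_def ratom_def)
qed

lemma zero_op: "(0, j) \<in> clause_ids P \<longleftrightarrow> j = 0"
  by (auto simp: clause_ids_def all_ops_def clauses_def start_op_def)

lemma primary_clause: "(i, j) \<in> clause_ids P \<Longrightarrow> (i, 0) \<in> clause_ids P"
  by (auto simp: clause_ids_def clauses_def)

text \<open>Operator 0 is \<open>start_op\<close>, whose only clause has no preconditions.\<close>

lemma own_zero: "[0, j] \<notin> own"
proof
  assume "[0, j] \<in> own"
  then obtain q a where q: "(q, a) \<in> pos_pre P" "fst q = 0" "fst (snd q) = j" by (auto simp: own_iff)
  have "(fst q, fst (snd q)) \<in> clause_ids P" using q(1) by (cases q) (simp add: pos_pre_def)
  then have "j = 0" unfolding q(2,3) zero_op .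
  then have "(q, a) \<in> relevant P (0, 0)" unfolding mem_relevant using q by simp
  then show False by (simp add: relevant_zero)
qed

lemma relevant_not_own: "[i, j] \<notin> own \<Longrightarrow> relevant P (i, j) = relevant P (i, 0)"
proof (rule set_eqI)
  fix z :: "pre_id \<times> atom"
  assume "[i, j] \<notin> own"
  then have no: "(q, a) \<in> pos_pre P \<Longrightarrow> fst q = i \<Longrightarrow> fst (snd q) \<noteq> j" for q a
    unfolding own_iff by blast
  obtain q a where z: "z = (q, a)" by (cases z)
  show "z \<in> relevant P (i, j) \<longleftrightarrow> z \<in> relevant P (i, 0)"
    unfolding z mem_relevant fst_conv snd_conv using no[of q a] by argo
qed

lemma mem_candidates:
  "k \<in> candidates P s \<longleftrightarrow> k \<in> clause_ids P \<and> (\<forall>q a. (q, a) \<in> relevant P k \<longrightarrow> q \<in> matched_step P s) \<and>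
     (\<exists>q a u. (q, a) \<in> relevant P k \<and> Var u \<in> set (args a) \<and> individual s q u \<subset> individual_step P s q u)"
  unfolding candidates_def by blast

lemma flagged_not_own:
  assumes "[i, j] \<notin> own" "(i, j) \<in> clause_ids P"
  shows "(i, j) \<in> flagged P t \<longleftrightarrow> (i, 0) \<in> flagged P t"
proof -
  have "(i, j) \<in> candidates P s \<longleftrightarrow> (i, 0) \<in> candidates P s" for s
    using assms primary_clause by (auto simp: candidates_def relevant_not_own)
  then show ?thesis by (induction t) auto
qed

lemma flagged_primary_own:
  assumes "(i, 0) \<in> flagged P t"
  shows "[i, 0] \<in> own"
proof -
  obtain q a where "(q, a) \<in> relevant P (i, 0)" using flagged_matched[OF assms] by blast
  then show ?thesis by (auto simp: own_iff mem_relevant)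
qed

lemma consts_ne: "consts_of P \<noteq> {}"
  using cs by (auto simp: num_consts_def)

text \<open>A clause without positive preconditions of its own has the same relevant preconditions
  as its primary clause, hence the same flags and the same intersected domains. The clause of
  operator 0 is active from the beginning.\<close>

lemma active_ract:
  assumes k: "(i, j) \<in> clause_ids P"
  shows "(i, j) \<in> active P t \<longleftrightarrow> i = 0 \<or> (if [i, j] \<in> own then [i, j] \<in> A_at t else [i, 0] \<in> A_at t)"
proof (cases "i = 0")
  case True
  then show ?thesis using k zero_op by (auto simp: active_def)
next
  case False
  have "(i, j) \<in> active P t \<longleftrightarrow> (i, 0) \<in> active P t" if "[i, j] \<notin> own"
    unfolding active_iff[OF wf consts_ne] flagged_not_own[OF that k] relevant_not_own[OF that] intersected_def using False by auto
  moreover have "(i, 0) \<in> active P t \<Longrightarrow> [i, 0] \<in> own"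
    using False flagged_primary_own by (auto simp: active_def)
  ultimately show ?thesis using False by (auto simp: A_at_def)
qed

lemma ract_A_at: "erow e \<Longrightarrow> ract own (A_at t) e \<longleftrightarrow> kid e \<in> active P t"
  using active_ract[of "row_op P e" "row_clause P e" t] eff_row(1)[of e] by (auto simp: ract_def kid_def)

text \<open>Every triple that fires is an instance of the recurrences \<open>ind_at_Suc\<close> and
  \<open>matched_Suc\<close>, so nothing wrong is added. Conversely, an omitted element could come
  only from a triple that the round skips, and \<open>seminaive\<close> shows that skipped triples
  yield nothing new.\<close>

lemma X_at_Suc_eq:
  assumes F: "F \<longleftrightarrow> t = 0 \<or> \<not> A_at t \<subseteq> A_at (t - 1)"
  shows "ind_after own (A_at t) (rej (X_at t)) (X_at t) (triples F (D_at t)) = X_at (Suc t)" (is "?X = _")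
    and "mat_after own (A_at t) (rej (X_at t)) (M_at t) (triples F (D_at t)) = M_at (Suc t)" (is "?M = _")
proof -
  have fires: "fires own (A_at t) (rej (X_at t)) e r \<longleftrightarrow> kid e \<in> active P t \<and> ratom e \<in> pos_eff P (kid e) \<and>
      cond_tag (row_cond P e) = 0 \<and> unifiable (intersected P (ind_at P t) (kid e)) (ratom e) (ratom r)"
    if "erow e" "pos r" for e r
    using ract_A_at runifiable_X_at eff_row(2) that unfolding fires_def by blast
  have fires_pos: "fires own (A_at t) (rej (X_at t)) e r \<Longrightarrow> prow r \<Longrightarrow> pos r" for e r
    by (simp add: fires_def runifiable_def pos_def)
  have stable: "active P t = active P (t - 1)" "t > 0" if "\<not> F"
  proof -
    show t: "t > 0" using that F by simp
    have "A_at (t - 1) \<subseteq> A_at t"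
      using active_mono[of P "t - 1"] t by (auto simp: A_at_def)
    then have "A_at t = A_at (t - 1)" using that F by blast
    then have "(i, j) \<in> active P t \<longleftrightarrow> (i, j) \<in> active P (t - 1)" if "(i, j) \<in> clause_ids P" for i j
      using active_ract[OF that] by simp
    then show "active P t = active P (t - 1)"
      using active_clause_ids by (metis (no_types, opaque_lifting) subset_antisym subsetD subsetI surj_pair)
  qed
  have clean: "c \<notin> dirty P t" if "\<not> dirty_row (D_at t) e" "\<not> dirty_row (D_at t) r" "Cst c \<in> set (args (ratom e)) \<union> set (args (ratom r))" for e r c
    using that by (auto simp: dirty_row_def D_at_def ratom_def)
  show "?X = X_at (Suc t)"
  proof (intro equalityI subsetI)
    fix k assume "k \<in> ?X"
    then consider "k \<in> X_at t" | e r c u where "k = [r, u, c]" "(e, r, c) \<in> triples F (D_at t)"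
        "fires own (A_at t) (rej (X_at t)) e r" "rcontributes (rej (X_at t)) e r u c"
      unfolding ind_after_def by blast
    then show "k \<in> X_at (Suc t)"
    proof cases
      case 1
      then show ?thesis using ind_at_mono by (fastforce simp: X_at_def)
    next
      case 2
      then have er: "erow e" "prow r" "c \<in> consts_of P" by (auto simp: triples_def)
      then have r: "pos r" using 2 fires_pos by blast
      have "c \<in> ind_at P (Suc t) (pid r) u"
        unfolding ind_at_Suc[OF wf] using 2(3,4) fires[OF er(1) r] rcontributes_X_at[OF er(3)] pos_pre_row[OF r] by blast
      then show ?thesis using 2(1) er by (simp add: mem_X_at)
    qed
  next
    fix k assume "k \<in> X_at (Suc t)"
    then obtain r u c where k: "k = [r, u, c]" "prow r" "c \<in> ind_at P (Suc t) (pid r) u" by (auto simp: X_at_def)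
    have c: "c \<in> consts_of P" using k(3) ind_at_consts by blast
    show "k \<in> ?X"
    proof (cases "c \<in> ind_at P t (pid r) u")
      case True
      then show ?thesis using k by (simp add: ind_after_def mem_X_at)
    next
      case False
      then obtain p k' e' where p: "(pid r, p) \<in> pos_pre P" "k' \<in> active P t" "e' \<in> pos_eff P k'"
          "unifiable (intersected P (ind_at P t) k') e' p" "Var u \<in> set (args p)" "contributes (intersected P (ind_at P t) k') e' p u c"
        using k(3) unfolding ind_at_Suc[OF wf] by blast
      have r: "pos r" "p = ratom r" using prow_matched[OF k(2) p(1)] by auto
      obtain e where e: "erow e" "cond_tag (row_cond P e) = 0" "kid e = k'" "ratom e = e'"
        using eff_ex[OF _ p(3)] active_clause_ids p(2) by blast
      have "F \<or> dirty_row (D_at t) e \<or> dirty_row (D_at t) r \<or> c \<in> dirty P t"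
        using seminaive(2)[OF wf p(2,3,1) stable(2,1) _ p(4,5,6)] False clean[of e r] e r by blast
      then have "(e, r, c) \<in> triples F (D_at t)" using e k(2) c by (auto simp: triples_def D_at_def)
      moreover have "fires own (A_at t) (rej (X_at t)) e r" "rcontributes (rej (X_at t)) e r u c"
        using fires[OF e(1) r(1)] rcontributes_X_at[OF c] p e r by simp_all
      ultimately show ?thesis unfolding ind_after_def k(1) by blast
    qed
  qed
  show "?M = M_at (Suc t)"
  proof (intro equalityI subsetI)
    fix k assume "k \<in> ?M"
    then consider "k \<in> M_at t" | e r c where "k = [r]" "(e, r, c) \<in> triples F (D_at t)" "fires own (A_at t) (rej (X_at t)) e r"
      unfolding mat_after_def by blast
    then show "k \<in> M_at (Suc t)"
    proof cases
      case 1
      then show ?thesis using matched_mono by (fastforce simp: M_at_def)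
    next
      case 2
      then have er: "erow e" "prow r" by (auto simp: triples_def)
      then have r: "pos r" using 2 fires_pos by blast
      have "pid r \<in> matched (state P (Suc t))"
        unfolding matched_Suc[OF wf] using 2(3) fires[OF er(1) r] pos_pre_row[OF r] by blast
      then show ?thesis using 2(1) er by (simp add: mem_M_at)
    qed
  next
    fix k assume "k \<in> M_at (Suc t)"
    then obtain r where k: "k = [r]" "prow r" "pid r \<in> matched (state P (Suc t))" by (auto simp: M_at_def)
    show "k \<in> ?M"
    proof (cases "pid r \<in> matched (state P t)")
      case True
      then show ?thesis using k by (simp add: mat_after_def mem_M_at)
    next
      case False
      then obtain p k' e' where p: "(pid r, p) \<in> pos_pre P" "k' \<in> active P t" "e' \<in> pos_eff P k'"
          "unifiable (intersected P (ind_at P t) k') e' p"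
        using k(3) unfolding matched_Suc[OF wf] by blast
      have r: "pos r" "p = ratom r" using prow_matched[OF k(2) p(1)] by auto
      obtain e where e: "erow e" "cond_tag (row_cond P e) = 0" "kid e = k'" "ratom e = e'"
        using eff_ex[OF _ p(3)] active_clause_ids p(2) by blast
      \<comment> \<open>A precondition is marked while some constant is being treated, so at least
        one constant must exist.\<close>
      obtain c where c: "c \<in> consts_of P" using consts_ne by blast
      have "F \<or> dirty_row (D_at t) e \<or> dirty_row (D_at t) r"
        using seminaive(1)[OF wf p(2,3,1) stable(2,1) _ p(4)] False clean[of e r] e r by blast
      then have "(e, r, c) \<in> triples F (D_at t)" using e k(2) c by (auto simp: triples_def)
      moreover have "fires own (A_at t) (rej (X_at t)) e r"
        using fires[OF e(1) r(1)] p e r by simp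
      ultimately show ?thesis unfolding mat_after_def k(1) by blast
    qed
  qed
qed

lemma fresh_X_at: "fresh_consts (X_at t) (X_at (Suc t)) = D_at (Suc t)"
proof -
  have "(\<exists>r u. [r, u, c] \<in> X_at (Suc t) \<and> [r, u, c] \<notin> X_at t) \<longleftrightarrow> c \<in> dirty P (Suc t)" for c
  proof
    assume "c \<in> dirty P (Suc t)"
    then obtain q u where q: "c \<in> ind_at P (Suc t) q u" "c \<notin> ind_at P t q u" by (auto simp: dirty_def)
    then obtain p where "(q, p) \<in> pos_pre P" using ind_at_args by blast
    then obtain r where "pos r" "pid r = q" using pos_pre_ex by blast
    then show "\<exists>r u. [r, u, c] \<in> X_at (Suc t) \<and> [r, u, c] \<notin> X_at t" using q by (auto simp: mem_X_at pos_def)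
  qed (auto simp: mem_X_at dirty_def)
  then show ?thesis unfolding fresh_consts_def D_at_def by blast
qed

lemma flags_F_at: "F_at t \<union> flags (X_at t) (X_at (Suc t)) (M_at (Suc t)) = F_at (Suc t)"
proof -
  have un: "[i, j] \<in> unmatched (M_at (Suc t)) \<longleftrightarrow>
      (\<exists>q a. (q, a) \<in> pos_pre P \<and> fst q = i \<and> fst (snd q) = j \<and> q \<notin> matched_step P (state P t))" for i j
  proof
    assume "[i, j] \<in> unmatched (M_at (Suc t))"
    then obtain r where r: "pos r" "row_op P r = i" "row_clause P r = j" "[r] \<notin> M_at (Suc t)" by (auto simp: unmatched_def)
    then show "\<exists>q a. (q, a) \<in> pos_pre P \<and> fst q = i \<and> fst (snd q) = j \<and> q \<notin> matched_step P (state P t)"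
      using pos_pre_row[OF r(1)] prow_pid(2,3)[of r] by (auto simp: mem_M_at pos_def state_Suc_sel)
  next
    assume "\<exists>q a. (q, a) \<in> pos_pre P \<and> fst q = i \<and> fst (snd q) = j \<and> q \<notin> matched_step P (state P t)"
    then obtain q a where q: "(q, a) \<in> pos_pre P" "fst q = i" "fst (snd q) = j" "q \<notin> matched_step P (state P t)" by blast
    obtain r where "pos r" "pid r = q" using pos_pre_ex[OF q(1)] by blast
    then show "[i, j] \<in> unmatched (M_at (Suc t))"
      using q prow_pid(2,3)[of r] by (auto simp: unmatched_def mem_M_at pos_def state_Suc_sel intro!: exI[of _ r])
  qed
  have au: "[i, j] \<in> augmented (X_at t) (X_at (Suc t)) \<longleftrightarrow>
      (\<exists>q a u. (q, a) \<in> pos_pre P \<and> fst q = i \<and> fst (snd q) = j \<and> Var u \<in> set (args a) \<and>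
         ind_at P t q u \<subset> individual_step P (state P t) q u)" for i j
  proof
    assume "[i, j] \<in> augmented (X_at t) (X_at (Suc t))"
    then obtain r u c where r: "row_op P r = i" "row_clause P r = j" "prow r" "c \<in> ind_at P (Suc t) (pid r) u" "c \<notin> ind_at P t (pid r) u"
      by (auto simp: augmented_def mem_X_at)
    obtain a where a: "(pid r, a) \<in> pos_pre P" "Var u \<in> set (args a)" using ind_at_args[OF r(4)] by blast
    have "ind_at P t (pid r) u \<subset> individual_step P (state P t) (pid r) u"
      using r(4,5) ind_at_mono[of P t "pid r" u] by (auto simp: state_Suc_sel)
    then show "\<exists>q a u. (q, a) \<in> pos_pre P \<and> fst q = i \<and> fst (snd q) = j \<and> Var u \<in> set (args a) \<and>
         ind_at P t q u \<subset> individual_step P (state P t) q u"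
      using a r prow_pid(2,3)[OF r(3)] by metis
  next
    assume "\<exists>q a u. (q, a) \<in> pos_pre P \<and> fst q = i \<and> fst (snd q) = j \<and> Var u \<in> set (args a) \<and>
         ind_at P t q u \<subset> individual_step P (state P t) q u"
    then obtain q a u where q: "(q, a) \<in> pos_pre P" "fst q = i" "fst (snd q) = j" "ind_at P t q u \<subset> ind_at P (Suc t) q u"
      unfolding state_Suc_sel by blast
    then obtain c where c: "c \<in> ind_at P (Suc t) q u" "c \<notin> ind_at P t q u" by blast
    obtain r where r: "pos r" "pid r = q" using pos_pre_ex[OF q(1)] by blast
    then have "[r, u, c] \<in> X_at (Suc t)" "[r, u, c] \<notin> X_at t" "row_op P r = i" "row_clause P r = j"
      using q c prow_pid(2,3)[of r] by (auto simp: mem_X_at pos_def)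
    then show "[i, j] \<in> augmented (X_at t) (X_at (Suc t))" unfolding augmented_def by blast
  qed
  have own_ids: "(i, j) \<in> clause_ids P" if "[i, j] \<in> own" for i j
    using that by (auto simp: own_iff pos_pre_def)
  have fl: "[i, j] \<in> flags (X_at t) (X_at (Suc t)) (M_at (Suc t)) \<longleftrightarrow> [i, j] \<in> own \<and> (i, j) \<in> candidates P (state P t)" for i j
  proof -
    have "[i, j] \<in> flags (X_at t) (X_at (Suc t)) (M_at (Suc t)) \<longleftrightarrow> [i, j] \<in> own \<and>
       [i, j] \<notin> unmatched (M_at (Suc t)) \<and> [i, 0] \<notin> unmatched (M_at (Suc t)) \<and>
       ([i, j] \<in> augmented (X_at t) (X_at (Suc t)) \<or> [i, 0] \<in> augmented (X_at t) (X_at (Suc t)))"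
      unfolding flags_def own_def by auto
    also have "\<dots> \<longleftrightarrow> [i, j] \<in> own \<and> (i, j) \<in> candidates P (state P t)"
    proof (rule conj_cong[OF refl])
      assume "[i, j] \<in> own"
      then have "(i, j) \<in> clause_ids P" by (rule own_ids)
      then show "([i, j] \<notin> unmatched (M_at (Suc t)) \<and> [i, 0] \<notin> unmatched (M_at (Suc t)) \<and>
         ([i, j] \<in> augmented (X_at t) (X_at (Suc t)) \<or> [i, 0] \<in> augmented (X_at t) (X_at (Suc t)))) \<longleftrightarrow> (i, j) \<in> candidates P (state P t)"
        unfolding un au mem_candidates mem_relevant fst_conv snd_conv by blast
    qed
    finally show ?thesis .
  qed
  have form: "k \<in> flags (X_at t) (X_at (Suc t)) (M_at (Suc t)) \<Longrightarrow> \<exists>i j. k = [i, j]" for k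
    by (auto simp: flags_def)
  show ?thesis
  proof (intro set_eqI iffI)
    fix k assume "k \<in> F_at t \<union> flags (X_at t) (X_at (Suc t)) (M_at (Suc t))"
    then show "k \<in> F_at (Suc t)" using form[of k] fl by (auto simp: F_at_def)
  next
    fix k assume "k \<in> F_at (Suc t)"
    then show "k \<in> F_at t \<union> flags (X_at t) (X_at (Suc t)) (M_at (Suc t))" using fl by (auto simp: F_at_def)
  qed
qed

text \<open>For a secondary clause both entries of \<open>tBAD\<close> are consulted. Variables of
  its own preconditions are covered by its own entry; a variable that occurs only in primary
  preconditions has the same domain as in the primary clause (\<open>eq\<close>). Conversely, an
  empty primary domain forces an empty secondary one (\<open>sub\<close>).\<close>

lemma act_A_at: "A_at t \<union> act_keys (F_at (Suc t)) (X_at (Suc t)) = A_at (Suc t)"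
  and act_A_at_iff: "act_keys (F_at (Suc t)) (X_at (Suc t)) = A_at (Suc t)"
proof -
  let ?X = "X_at (Suc t)"
  have ne: "[i, j, x] \<in> nonempty ?X \<longleftrightarrow> intersected P (ind_at P (Suc t)) (i, j) x \<noteq> {}"
    if "(q, a) \<in> pos_pre P" "fst q = i" "fst (snd q) = j" "Var x \<in> set (args a)" for q a i j x
  proof -
    note q = that
    obtain r where "pos r" "pid r = q" "ratom r = a" using pos_pre_ex[OF q(1)] by blast
    then have r: "\<exists>r. pos r \<and> row_op P r = i \<and> row_clause P r = j \<and> Var x \<in> set (cond_terms (row_cond P r))"
      using q prow_pid(2,3)[of r] by (auto simp: pos_def ratom_def)
    have "[i, j, x] \<in> nonempty ?X \<longleftrightarrow> (\<exists>c \<in> consts_of P. [i, j, x, c] \<notin> rej ?X \<and> [i, 0, x, c] \<notin> rej ?X)"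
      using r by (auto simp: nonempty_def)
    then show ?thesis by (auto simp: intersected_rej set_eq_iff)
  qed
  have bl: "[i, j] \<in> blocked ?X \<longleftrightarrow> (\<exists>q a x. (q, a) \<in> pos_pre P \<and> fst q = i \<and> fst (snd q) = j \<and> Var x \<in> set (args a) \<and>
      intersected P (ind_at P (Suc t)) (i, j) x = {})" for i j
  proof
    assume "[i, j] \<in> blocked ?X"
    then obtain r x where r: "pos r" "row_op P r = i" "row_clause P r = j" "Var x \<in> set (args (ratom r))" "[i, j, x] \<notin> nonempty ?X"
      by (auto simp: blocked_def ratom_def)
    then show "\<exists>q a x. (q, a) \<in> pos_pre P \<and> fst q = i \<and> fst (snd q) = j \<and> Var x \<in> set (args a) \<and>
      intersected P (ind_at P (Suc t)) (i, j) x = {}"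
      using ne[OF pos_pre_row[OF r(1)] _ _ r(4)] pos_pre_row[OF r(1)] prow_pid(2,3)[of r] by (metis pos_def)
  next
    assume "\<exists>q a x. (q, a) \<in> pos_pre P \<and> fst q = i \<and> fst (snd q) = j \<and> Var x \<in> set (args a) \<and>
      intersected P (ind_at P (Suc t)) (i, j) x = {}"
    then obtain q a x where q: "(q, a) \<in> pos_pre P" "fst q = i" "fst (snd q) = j" "Var x \<in> set (args a)"
      "intersected P (ind_at P (Suc t)) (i, j) x = {}" by blast
    obtain r where r: "pos r" "pid r = q" "ratom r = a" using pos_pre_ex[OF q(1)] by blast
    then have "row_op P r = i" "row_clause P r = j" using q prow_pid(2,3)[of r] by (auto simp: pos_def)
    moreover have "Var x \<in> set (cond_terms (row_cond P r))" using q(4) r(3) by (auto simp: ratom_def)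
    moreover have "[i, j, x] \<notin> nonempty ?X" using ne[OF q(1-4)] q(5) by simp
    ultimately show "[i, j] \<in> blocked ?X" unfolding blocked_def using r(1) by blast
  qed
  have act: "[i, j] \<in> act_keys (F_at (Suc t)) ?X \<longleftrightarrow> [i, j] \<in> A_at (Suc t)" for i j
  proof -
    have "[i, j] \<in> act_keys (F_at (Suc t)) ?X \<longleftrightarrow> [i, j] \<in> own \<and> (i, j) \<in> flagged P (Suc t) \<and> [i, j] \<notin> blocked ?X \<and> [i, 0] \<notin> blocked ?X"
      unfolding act_keys_def own_def F_at_def by auto
    also have "\<dots> \<longleftrightarrow> [i, j] \<in> own \<and> (i, j) \<in> active P (Suc t)"
    proof (rule conj_cong[OF refl])
      assume "[i, j] \<in> own"
      then have i: "i \<noteq> 0" using own_zero by metis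
      have sub: "intersected P ind (i, j) x \<subseteq> intersected P ind (i, 0) x" for ind x
        unfolding mem_intersected mem_relevant fst_conv snd_conv subset_iff by blast
      have eq: "intersected P ind (i, j) x = intersected P ind (i, 0) x"
        if "\<nexists>q a. (q, a) \<in> pos_pre P \<and> fst q = i \<and> fst (snd q) = j \<and> Var x \<in> set (args a)" for ind x
        using that unfolding set_eq_iff mem_intersected mem_relevant fst_conv snd_conv by blast
      have "[i, j] \<notin> blocked ?X \<and> [i, 0] \<notin> blocked ?X \<longleftrightarrow>
        (\<forall>q a x. (q, a) \<in> relevant P (i, j) \<and> Var x \<in> set (args a) \<longrightarrow> intersected P (ind_at P (Suc t)) (i, j) x \<noteq> {})"
      proof
        assume nb: "[i, j] \<notin> blocked ?X \<and> [i, 0] \<notin> blocked ?X"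
        show "\<forall>q a x. (q, a) \<in> relevant P (i, j) \<and> Var x \<in> set (args a) \<longrightarrow> intersected P (ind_at P (Suc t)) (i, j) x \<noteq> {}"
        proof (intro allI impI, elim conjE)
          fix q a x assume q: "(q, a) \<in> relevant P (i, j)" "Var x \<in> set (args a)"
          show "intersected P (ind_at P (Suc t)) (i, j) x \<noteq> {}"
          proof (cases "\<exists>q a. (q, a) \<in> pos_pre P \<and> fst q = i \<and> fst (snd q) = j \<and> Var x \<in> set (args a)")
            case True
            then show ?thesis using nb unfolding bl by blast
          next
            case False
            then have "(q, a) \<in> pos_pre P" "fst q = i" "fst (snd q) = 0"
              using q unfolding mem_relevant fst_conv snd_conv by blast+
            then show ?thesis using nb q(2) unfolding bl eq[OF False] by blast
          qed
        qed
      next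
        assume all: "\<forall>q a x. (q, a) \<in> relevant P (i, j) \<and> Var x \<in> set (args a) \<longrightarrow> intersected P (ind_at P (Suc t)) (i, j) x \<noteq> {}"
        show "[i, j] \<notin> blocked ?X \<and> [i, 0] \<notin> blocked ?X"
        proof -
          have "intersected P (ind_at P (Suc t)) (i, j) x \<noteq> {}"
            if "(q, a) \<in> pos_pre P" "fst q = i" "fst (snd q) = j \<or> fst (snd q) = 0" "Var x \<in> set (args a)" for q a x
            using all that unfolding mem_relevant fst_conv snd_conv by blast
          then show ?thesis unfolding bl using sub by blast
        qed
      qed
      then show "((i, j) \<in> flagged P (Suc t) \<and> [i, j] \<notin> blocked ?X \<and> [i, 0] \<notin> blocked ?X) \<longleftrightarrow> (i, j) \<in> active P (Suc t)"
        unfolding active_iff[OF wf consts_ne] using i by blast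
    qed
    finally show ?thesis by (auto simp: A_at_def)
  qed
  have "\<exists>i j. k = [i, j]" if "k \<in> act_keys (F_at (Suc t)) ?X \<or> k \<in> A_at (Suc t)" for k
    using that by (auto simp: act_keys_def A_at_def)
  then show eq: "act_keys (F_at (Suc t)) ?X = A_at (Suc t)" using act by blast
  have "A_at t \<subseteq> A_at (Suc t)" using active_mono[of P t] by (auto simp: A_at_def)
  then show "A_at t \<union> act_keys (F_at (Suc t)) ?X = A_at (Suc t)" unfolding eq by blast
qed

end

section \<open>The main loop and its running time\<close>

lemma sum_if_card: "(\<Sum>t<N. if Q t then w else 0) = w * card {t. t < N \<and> Q t}" for w N :: nat
proof -
  have "{t. t < N \<and> Q t} = {..<N} \<inter> {t. Q t}" by auto
  then show ?thesis by (simp add: sum.If_cases)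
qed

text \<open>Each change adds at least one element of \<open>U\<close>. The amortised counts that
  follow instantiate this with a suitable chain of tables.\<close>

lemma chain_changes:
  assumes "\<And>t. S t \<subseteq> S (Suc t)" "\<And>t. S t \<subseteq> U" "finite U"
  shows "card {t. t < N \<and> S t \<noteq> S (Suc t)} \<le> card U"
proof -
  have "card {t. t < N \<and> S t \<noteq> S (Suc t)} \<le> card (S N)"
  proof (induction N)
    case (Suc N)
    have fin: "finite (S (Suc N))" using assms(2,3) finite_subset by blast
    show ?case
    proof (cases "S N = S (Suc N)")
      case True
      then have "{t. t < Suc N \<and> S t \<noteq> S (Suc t)} = {t. t < N \<and> S t \<noteq> S (Suc t)}"
        by (auto simp: less_Suc_eq)
      then show ?thesis using Suc True by simp
    next
      case False
      then have "{t. t < Suc N \<and> S t \<noteq> S (Suc t)} = insert N {t. t < N \<and> S t \<noteq> S (Suc t)}"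
        by (auto simp: less_Suc_eq)
      moreover have "card (S N) < card (S (Suc N))"
        using False assms(1) fin by (intro psubset_card_mono) auto
      ultimately show ?thesis using Suc by simp
    qed
  qed simp
  also have "\<dots> \<le> card U" using assms(2,3) by (intro card_mono) auto
  finally show ?thesis .
qed

text \<open>What holds at the start of a round was brought about in the round before; round 0 is
  exempt because the property fails at its start.\<close>

lemma card_shift:
  assumes "\<not> Q 0"
  shows "card {t. t < N \<and> Q t} \<le> card {t. t < N \<and> Q (Suc t)}"
proof -
  have "{t. t < N \<and> Q t} \<subseteq> Suc ` {t. t < N \<and> Q (Suc t)}"
  proof
    fix t assume t: "t \<in> {t. t < N \<and> Q t}"
    then obtain t' where "t = Suc t'" using assms by (cases t) auto
    then show "t \<in> Suc ` {t. t < N \<and> Q (Suc t)}" using t by auto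
  qed
  then have "card {t. t < N \<and> Q t} \<le> card (Suc ` {t. t < N \<and> Q (Suc t)})" by (intro card_mono) auto
  then show ?thesis by (simp add: card_image)
qed

context encoded
begin

abbreviation "mm \<equiv> card (consts_of P)"
abbreviation "np \<equiv> num_pre P"
abbreviation "ne \<equiv> num_eff P"

definition full_flag :: "nat \<Rightarrow> nat list set" where
  "full_flag t = {k. k = [] \<and> (t = 0 \<or> \<not> A_at t \<subseteq> A_at (t - 1))}"

definition change_flag :: "nat \<Rightarrow> nat list set" where
  "change_flag t = {k. k = [] \<and> (t = 0 \<or> D_at t \<noteq> {})}"

definition state_mem :: "nat \<Rightarrow> tmem \<Rightarrow> bool" where
  "state_mem t = round_state (X_at t) (M_at t) (F_at t) (A_at t) (D_at t) (full_flag t) (change_flag t)"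

text \<open>The number of rounds that the machine executes. Time 0 is excluded: nothing is dirty
  there, yet the loop has to be entered.\<close>

definition rounds :: nat where
  "rounds = (LEAST t. 0 < t \<and> D_at t = {})"

lemma X_at_mono: "X_at t \<subseteq> X_at (Suc t)"
  using ind_at_mono by (fastforce simp: X_at_def)

lemma X_at_keys: "X_at t \<subseteq> ind_keys"
proof
  fix k assume "k \<in> X_at t"
  then obtain r u c where k: "k = [r, u, c]" "prow r" "c \<in> ind_at P t (pid r) u" by (auto simp: X_at_def)
  obtain p where p: "(pid r, p) \<in> pos_pre P" "Var u \<in> set (args p)" using ind_at_args[OF k(3)] by blast
  have "Var u \<in> set (cond_terms (row_cond P r))" using prow_matched[OF k(2) p(1)] p(2) by (auto simp: ratom_def)
  moreover have "c \<in> consts_of P" using k(3) ind_at_consts by (rule subsetD[rotated])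
  ultimately show "k \<in> ind_keys" using k by (auto simp: ind_keys_def)
qed

lemma D_at_keys: "D_at t \<subseteq> {[c] |c. c \<in> consts_of P}"
proof
  fix k assume "k \<in> D_at t"
  then obtain c where "k = [c]" "c \<in> dirty P t" unfolding D_at_def by blast
  moreover have "dirty P t \<subseteq> consts_of P" 
    unfolding dirty_def using ind_at_consts[of P] by (cases t) fastforce+
  ultimately show "k \<in> {[c] |c. c \<in> consts_of P}" by blast
qed

lemma state_mem_0: "round_state {} {} {} {} {} {[]} {[]} m \<Longrightarrow> state_mem 0 m"
proof -
  have "active P 0 = {(0, 0)}" by (simp add: active_def)
  then have "A_at 0 = {}" using own_zero by (auto simp: A_at_def)
  moreover have "X_at 0 = {}" "M_at 0 = {}" "F_at 0 = {}" "D_at 0 = {}" "full_flag 0 = {[]}" "change_flag 0 = {[]}"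
    by (auto simp: X_at_def M_at_def F_at_def D_at_def full_flag_def change_flag_def state_0 fpd_init_def dirty_def)
  ultimately show "round_state {} {} {} {} {} {[]} {[]} m \<Longrightarrow> state_mem 0 m" by (simp add: state_mem_def)
qed

definition vars_keys :: "nat list set" where
  "vars_keys = (\<lambda>(r, a). [r, nam r a]) ` ({1..np} \<times> {..<A})"

lemma card_vars_keys: "card vars_keys \<le> np * A" "finite vars_keys"
  unfolding vars_keys_def using card_image_le[of "{1..np} \<times> {..<A}" "\<lambda>(r, a). [r, nam r a]"] by simp_all

lemma ind_keys_vars: "[r, u, c] \<in> ind_keys \<Longrightarrow> [r, u] \<in> vars_keys"
  using Var_iff[OF prow_row, of r u] by (force simp: ind_keys_def vars_keys_def prow_def)

text \<open>Each individual domain turns a given constant dirty at most once.\<close>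

lemma dirty_const_rounds: "card {t. t < N \<and> [c] \<in> D_at (Suc t)} \<le> np * A"
proof -
  define S where "S t = {[r, u] |r u. [r, u, c] \<in> X_at t}" for t
  have "S t \<noteq> S (Suc t)" if "[c] \<in> D_at (Suc t)" for t
  proof -
    have "\<exists>r u. [r, u, c] \<in> X_at (Suc t) \<and> [r, u, c] \<notin> X_at t"
      using that unfolding fresh_X_at[symmetric] fresh_consts_def by blast
    then obtain r u where "[r, u] \<in> S (Suc t)" "[r, u] \<notin> S t" unfolding S_def by blast
    then show ?thesis by blast
  qed
  then have "card {t. t < N \<and> [c] \<in> D_at (Suc t)} \<le> card {t. t < N \<and> S t \<noteq> S (Suc t)}"
    by (intro card_mono) auto
  also have "\<dots> \<le> card vars_keys"
  proof (rule chain_changes[OF _ _ card_vars_keys(2)])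
    show "S t \<subseteq> S (Suc t)" for t using X_at_mono[of t] by (auto simp: S_def)
    show "S t \<subseteq> vars_keys" for t using X_at_keys[of t] ind_keys_vars by (auto simp: S_def)
  qed
  finally show ?thesis using card_vars_keys(1) by linarith
qed

lemma dirty_const_rounds': "card {t. t < N \<and> [c] \<in> D_at t} \<le> np * A"
  using card_shift[of "\<lambda>t. [c] \<in> D_at t" N] dirty_const_rounds[of N c] by (simp add: D_at_def dirty_def)

lemma finite_ind_keys: "finite ind_keys" "card ind_keys \<le> np * A * mm"
proof -
  have sub: "ind_keys \<subseteq> (\<lambda>((r, a), c). [r, nam r a, c]) ` (({1..np} \<times> {..<A}) \<times> consts_of P)"
  proof
    fix k assume "k \<in> ind_keys"
    then obtain r x c where k: "k = [r, x, c]" "prow r" "Var x \<in> set (cond_terms (row_cond P r))" "c \<in> consts_of P"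
      by (auto simp: ind_keys_def)
    obtain a where "a < A" "nam r a = x" using Var_iff[OF prow_row[OF k(2)]] k(3) by blast
    then have "k = (\<lambda>((r, a), c). [r, nam r a, c]) ((r, a), c)" using k(1) by simp
    then show "k \<in> (\<lambda>((r, a), c). [r, nam r a, c]) ` (({1..np} \<times> {..<A}) \<times> consts_of P)"
      by (rule image_eqI) (use k \<open>a < A\<close> in \<open>simp add: prow_def\<close>)
  qed
  show "finite ind_keys" by (rule finite_subset[OF sub]) (simp add: finite_consts)
  have "card ind_keys \<le> card (({1..np} \<times> {..<A}) \<times> consts_of P)"
    using finite_consts by (intro surj_card_le[OF _ sub]) simp
  then show "card ind_keys \<le> np * A * mm" unfolding card_cartesian_product by simp
qed

lemma no_dirty: "D_at (Suc t) = {} \<Longrightarrow> ind_at P (Suc t) = ind_at P t"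
  using ind_at_mono[of P t] by (fastforce simp: D_at_def dirty_def fun_eq_iff)

lemma change_rounds: "card {t. t < N \<and> D_at (Suc t) \<noteq> {}} \<le> np * A * mm"
proof -
  have "D_at (Suc t) \<noteq> {} \<Longrightarrow> X_at t \<noteq> X_at (Suc t)" for t
    unfolding fresh_X_at[symmetric] fresh_consts_def by auto
  then have "card {t. t < N \<and> D_at (Suc t) \<noteq> {}} \<le> card {t. t < N \<and> X_at t \<noteq> X_at (Suc t)}"
    by (intro card_mono) auto
  also have "\<dots> \<le> card ind_keys" by (rule chain_changes[where S = X_at, OF X_at_mono X_at_keys finite_ind_keys(1)])
  finally show ?thesis using finite_ind_keys(2) by linarith
qed

lemma rounds:
  shows "0 < rounds" "D_at rounds = {}" "\<And>t. 0 < t \<Longrightarrow> t < rounds \<Longrightarrow> D_at t \<noteq> {}" "rounds \<le> 2 * A * (np * mm)"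
proof -
  have "\<exists>t. 0 < t \<and> D_at t = {}"
  proof (rule ccontr)
    assume "\<nexists>t. 0 < t \<and> D_at t = {}"
    then have "{t. t < Suc (np * A * mm) \<and> D_at (Suc t) \<noteq> {}} = {..<Suc (np * A * mm)}" by auto
    then show False using change_rounds[of "Suc (np * A * mm)"] by simp
  qed
  then show r: "0 < rounds" "D_at rounds = {}" unfolding rounds_def by (metis (mono_tags, lifting) LeastI_ex)+
  show least: "\<And>t. 0 < t \<Longrightarrow> t < rounds \<Longrightarrow> D_at t \<noteq> {}" unfolding rounds_def using not_less_Least by blast
  then have "{t. t < rounds - 1 \<and> D_at (Suc t) \<noteq> {}} = {..<rounds - 1}" by auto
  then have "rounds - 1 \<le> np * A * mm" using change_rounds[of "rounds - 1"] by simp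
  \<comment> \<open>The last round changes nothing, so there may be one round more than there are
    changes; doubling the bound absorbs it.\<close>
  moreover have "1 \<le> np * A * mm" using np A cs by (simp add: num_consts_def)
  ultimately have "rounds \<le> 2 * (np * A * mm)" by linarith
  then show "rounds \<le> 2 * A * (np * mm)" by (simp add: ac_simps)
qed

text \<open>Besides the first round, a full round requires a proper growth of \<open>A_at\<close>, a
  chain of sets of clause keys taken from the \<open>np\<close> precondition rows.\<close>

lemma full_rounds: "card {t. t < N \<and> [] \<in> full_flag t} \<le> np + 1"
proof -
  have own: "own \<subseteq> (\<lambda>r. [row_op P r, row_clause P r]) ` {1..np}" by (auto simp: own_def pos_def prow_def)
  have "card {t. t < N \<and> [] \<in> full_flag t} \<le> card (insert 0 {t. t < N \<and> 0 < t \<and> \<not> A_at t \<subseteq> A_at (t - 1)})"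
    by (intro card_mono) (auto simp: full_flag_def)
  also have "\<dots> \<le> Suc (card {t. t < N \<and> 0 < t \<and> \<not> A_at t \<subseteq> A_at (t - 1)})" by (rule card_insert_le_m1) simp_all
  also have "card {t. t < N \<and> 0 < t \<and> \<not> A_at t \<subseteq> A_at (t - 1)} \<le> card {t. t < N \<and> 0 < Suc t \<and> \<not> A_at (Suc t) \<subseteq> A_at (Suc t - 1)}"
    by (rule card_shift) simp
  also have "\<dots> \<le> card {t. t < N \<and> A_at t \<noteq> A_at (Suc t)}" by (intro card_mono) auto
  also have "\<dots> \<le> card ((\<lambda>r. [row_op P r, row_clause P r]) ` {1..np})"
  proof (rule chain_changes)
    show "A_at t \<subseteq> A_at (Suc t)" for t using active_mono[of P t] by (auto simp: A_at_def)
    show "A_at t \<subseteq> (\<lambda>r. [row_op P r, row_clause P r]) ` {1..np}" for t using own by (auto simp: A_at_def)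
  qed simp
  also have "\<dots> \<le> np" using card_image_le[of "{1..np}" "\<lambda>r. [row_op P r, row_clause P r]"] by simp
  finally show ?thesis by simp
qed

lemma dirty_row_rounds: 
  assumes "row r"
  shows "card {t. t < N \<and> dirty_row (D_at t) r} \<le> A * (np * A)"
proof -
  have "{t. t < N \<and> dirty_row (D_at t) r} \<subseteq> (\<Union>a<A. {t. t < N \<and> [nam r a] \<in> D_at t})"
    using Cst_iff[OF assms] by (auto simp: dirty_row_def)
  then have "card {t. t < N \<and> dirty_row (D_at t) r} \<le> card (\<Union>a<A. {t. t < N \<and> [nam r a] \<in> D_at t})"
    by (intro card_mono) auto
  also have "\<dots> \<le> (\<Sum>a<A. card {t. t < N \<and> [nam r a] \<in> D_at t})" by (rule card_UN_le) simp
  also have "\<dots> \<le> (\<Sum>a<A. np * A)" by (intro sum_mono dirty_const_rounds')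
  finally show ?thesis by simp
qed

text \<open>At most \<open>np + 1\<close> full rounds, and for each of the two atoms at most
  \<open>A\<close> constants, each of them dirty in at most \<open>np * A\<close> rounds.\<close>

lemma pair_rounds:
  assumes "erow e" "prow r"
  shows "card {t. t < N \<and> (e, r) \<in> full_pairs ([] \<in> full_flag t) (D_at t)} \<le> np * (2 * A * A + 2)"
proof -
  have "{t. t < N \<and> (e, r) \<in> full_pairs ([] \<in> full_flag t) (D_at t)} \<subseteq>
      {t. t < N \<and> [] \<in> full_flag t} \<union> ({t. t < N \<and> dirty_row (D_at t) e} \<union> {t. t < N \<and> dirty_row (D_at t) r})"
    by (auto simp: full_pairs_def)
  then have "card {t. t < N \<and> (e, r) \<in> full_pairs ([] \<in> full_flag t) (D_at t)} \<le>
      card ({t. t < N \<and> [] \<in> full_flag t} \<union> ({t. t < N \<and> dirty_row (D_at t) e} \<union> {t. t < N \<and> dirty_row (D_at t) r}))"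
    by (intro card_mono) auto
  also have "\<dots> \<le> card {t. t < N \<and> [] \<in> full_flag t} + card ({t. t < N \<and> dirty_row (D_at t) e} \<union> {t. t < N \<and> dirty_row (D_at t) r})"
    by (rule card_Un_le)
  also have "\<dots> \<le> card {t. t < N \<and> [] \<in> full_flag t} + (card {t. t < N \<and> dirty_row (D_at t) e} + card {t. t < N \<and> dirty_row (D_at t) r})"
    by (intro add_left_mono card_Un_le)
  also have "\<dots> \<le> (np + 1) + (A * (np * A) + A * (np * A))"
    using assms erow_row prow_row by (intro add_mono full_rounds dirty_row_rounds) auto
  also have "\<dots> \<le> np * (2 * A * A + 2)" using np by (simp add: algebra_simps)
  finally show ?thesis .
qed

text \<open>Every constant occupies an argument position of some row. This pays for the pass over
  all constants in each round, whose total \<open>np * mm * mm\<close> must fit the bound.\<close>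

lemma card_consts: "mm \<le> A * (np + ne)"
proof -
  have "consts_of P \<subseteq> (\<lambda>(r, a). nam r a) ` ({1..np + ne} \<times> {..<A})"
    using Cst_iff by (force simp: cs_eq row_def)
  then have "mm \<le> card ({1..np + ne} \<times> {..<A})" by (intro surj_card_le) auto
  then show ?thesis by (simp add: mult.commute)
qed

definition bound :: nat where
  "bound = mm * np * ne * (np + ne)"

lemma bounds:
  "mm * np * ne * np \<le> bound" "mm * np * np \<le> bound" "np * mm * mm \<le> A * bound" "mm * np \<le> bound"
  "np * ne \<le> bound" "1 \<le> bound" "mm \<le> bound" "ne \<le> bound" "np \<le> bound"
proof -
  have p: "1 \<le> mm" "1 \<le> np" "1 \<le> ne" using cs np ne by (auto simp: num_consts_def)
  have "mm * np * ne * np \<le> mm * np * ne * (np + ne)" by (intro mult_le_mono) auto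
  then show 1: "mm * np * ne * np \<le> bound" by (simp add: bound_def)
  have "mm * np * 1 * np \<le> mm * np * ne * np" using p by (intro mult_le_mono) auto
  then show 2: "mm * np * np \<le> bound" using 1 unfolding mult_1_right by (rule order_trans)
  have "np * mm * mm \<le> np * mm * (A * (np + ne))" using card_consts by (intro mult_le_mono) auto
  also have "\<dots> = A * (mm * np * 1 * (np + ne))" by (simp add: ac_simps)
  also have "\<dots> \<le> A * (mm * np * ne * (np + ne))" using p by (intro mult_le_mono) auto
  finally show "np * mm * mm \<le> A * bound" by (simp add: bound_def)
  have "mm * np * 1 \<le> mm * np * np" using p by (intro mult_le_mono) auto
  then show 3: "mm * np \<le> bound" using 2 unfolding mult_1_right by (rule order_trans)
  have "1 * np * ne * 1 \<le> mm * np * ne * np" using p by (intro mult_le_mono) auto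
  then show 4: "np * ne \<le> bound" using 1 unfolding mult_1_right mult_1_left by (rule order_trans)
  have "1 * 1 \<le> np * ne" "mm * 1 \<le> mm * np" "1 * ne \<le> np * ne" "np * 1 \<le> np * ne"
    using p by (intro mult_le_mono; linarith)+
  then show "1 \<le> bound" "mm \<le> bound" "ne \<le> bound" "np \<le> bound" using 3 4 by linarith+
qed

text \<open>The summands pay, in this order, for complete unifications, for the propagation of dirty
  constants, for rebuilding the slices of fresh constants, and for the fixed overhead of all
  rounds.\<close>

definition loop_const :: nat where
  "loop_const = (4 * A + 8) * (2 * A * A + 2) + A * (4 * A + 11) + A * (6 * A + 18) + 2 * A * (16 * A + 41 + 10 + 15 * A)"

text \<open>Summing over the rounds first: for a fixed pair the expensive rounds are counted by
  \<open>pair_rounds\<close>, for a fixed constant by \<open>dirty_const_rounds\<close> and its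
  shifted form.\<close>

lemma loop_time:
  "(\<Sum>t<rounds. round_time (full_flag t) (D_at t) (D_at (Suc t))) \<le> loop_const * bound"
proof -
  let ?N = rounds
  have p: "1 \<le> mm" "1 \<le> np" "1 \<le> ne" using cs np ne by (auto simp: num_consts_def)
  define w where "w = mm * (4 * A + 6) + 2"
  define fp where "fp t e r \<longleftrightarrow> (e, r) \<in> full_pairs ([] \<in> full_flag t) (D_at t)" for t e r
  define v where "v = ne * (np * (4 * A + 5) + 4) + 2"
  define z where "z = 3 * (np * (2 * A + 5)) + 3"
  have rt: "round_time (full_flag t) (D_at t) (D_at (Suc t)) \<le>
     (\<Sum>e=Suc np..np + ne. \<Sum>r=1..np. if fp t e r then w else 0) + (\<Sum>c\<in>consts_of P. if [c] \<in> D_at t then v else 0) +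
     (\<Sum>c\<in>consts_of P. if [c] \<in> D_at (Suc t) then z else 0) + (10 * (np * ne) + 15 * mm + np * (16 * A + 41))" for t
  proof -
    have 1: "(\<Sum>e=Suc np..np + ne. (\<Sum>r=1..np. (if fp t e r then w else 0) + 4) + 4) + 2 \<le>
        (\<Sum>e=Suc np..np + ne. \<Sum>r=1..np. if fp t e r then w else 0) + 10 * (np * ne)"
    proof -
      have "ne \<le> np * ne" "1 \<le> np * ne" using p by simp_all
      moreover have "(\<Sum>e=Suc np..np + ne. (\<Sum>r=1..np. (if fp t e r then w else 0) + 4) + 4) =
          (\<Sum>e=Suc np..np + ne. \<Sum>r=1..np. if fp t e r then w else 0) + (4 * (np * ne) + 4 * ne)"
        by (simp add: sum.distrib ac_simps)
      ultimately show ?thesis by linarith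
    qed
    have 3: "(\<Sum>c\<in>consts_of P. (if [c] \<in> D_at (Suc t) then z else 1) + 4) \<le> (\<Sum>c\<in>consts_of P. (if [c] \<in> D_at (Suc t) then z else 0) + 5)"
      by (intro sum_mono) auto
    have 2: "(\<Sum>c\<in>consts_of P. (if [c] \<in> D_at t then v else 0) + 5) = (\<Sum>c\<in>consts_of P. if [c] \<in> D_at t then v else 0) + 5 * mm"
      "(\<Sum>c\<in>consts_of P. (if [c] \<in> D_at (Suc t) then z else 0) + 5) = (\<Sum>c\<in>consts_of P. if [c] \<in> D_at (Suc t) then z else 0) + 5 * mm"
      by (simp_all add: sum.distrib)
    have 4: "8 * (np * (2 * A + 5)) + 1 \<le> np * (16 * A + 41)" using p by (simp add: algebra_simps)
    show ?thesis
      using 1 2 3 4 p unfolding round_time_def w_def[symmetric] v_def[symmetric] z_def[symmetric] fp_def by linarith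
  qed
  have s1: "(\<Sum>t<?N. \<Sum>e=Suc np..np + ne. \<Sum>r=1..np. if fp t e r then w else 0) \<le> ne * (np * (w * (np * (2 * A * A + 2))))"
  proof -
    have "(\<Sum>t<?N. \<Sum>e=Suc np..np + ne. \<Sum>r=1..np. if fp t e r then w else 0) =
        (\<Sum>e=Suc np..np + ne. \<Sum>t<?N. \<Sum>r=1..np. if fp t e r then w else 0)" by (rule sum.swap)
    also have "\<dots> = (\<Sum>e=Suc np..np + ne. \<Sum>r=1..np. \<Sum>t<?N. if fp t e r then w else 0)"
      by (intro sum.cong refl sum.swap)
    also have "\<dots> \<le> (\<Sum>e=Suc np..np + ne. \<Sum>r=1..np. w * (np * (2 * A * A + 2)))"
      unfolding sum_if_card fp_def using pair_rounds by (intro sum_mono mult_le_mono2) (auto simp: erow_def prow_def)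
    finally show ?thesis by simp
  qed
  have s2: "(\<Sum>t<?N. \<Sum>c\<in>consts_of P. if [c] \<in> D_at t then v else 0) \<le> mm * (v * (np * A))"
  proof -
    have "(\<Sum>t<?N. \<Sum>c\<in>consts_of P. if [c] \<in> D_at t then v else 0) = (\<Sum>c\<in>consts_of P. \<Sum>t<?N. if [c] \<in> D_at t then v else 0)"
      by (rule sum.swap)
    also have "\<dots> \<le> (\<Sum>c\<in>consts_of P. v * (np * A))"
      unfolding sum_if_card by (intro sum_mono mult_le_mono2 dirty_const_rounds')
    finally show ?thesis by simp
  qed
  have s3: "(\<Sum>t<?N. \<Sum>c\<in>consts_of P. if [c] \<in> D_at (Suc t) then z else 0) \<le> mm * (z * (np * A))"
  proof -
    have "(\<Sum>t<?N. \<Sum>c\<in>consts_of P. if [c] \<in> D_at (Suc t) then z else 0) = (\<Sum>c\<in>consts_of P. \<Sum>t<?N. if [c] \<in> D_at (Suc t) then z else 0)"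
      by (rule sum.swap)
    also have "\<dots> \<le> (\<Sum>c\<in>consts_of P. z * (np * A))"
      unfolding sum_if_card by (intro sum_mono mult_le_mono2 dirty_const_rounds)
    finally show ?thesis by simp
  qed
  have "w \<le> mm * (4 * A + 8)" using p by (simp add: w_def algebra_simps)
  then have "ne * (np * (w * (np * (2 * A * A + 2)))) \<le> ne * (np * ((mm * (4 * A + 8)) * (np * (2 * A * A + 2))))"
    by (intro mult_le_mono order_refl)
  also have "\<dots> = (4 * A + 8) * (2 * A * A + 2) * (mm * np * ne * np)" by (simp only: ac_simps)
  also have "\<dots> \<le> (4 * A + 8) * (2 * A * A + 2) * bound" by (intro mult_le_mono2 bounds)
  finally have b1: "ne * (np * (w * (np * (2 * A * A + 2)))) \<le> (4 * A + 8) * (2 * A * A + 2) * bound" .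
  have "v \<le> ne * np * (4 * A + 11)"
  proof -
    have "ne \<le> ne * np" "1 \<le> ne * np" using p by simp_all
    moreover have "v = 4 * A * (ne * np) + 5 * (ne * np) + 4 * ne + 2" "ne * np * (4 * A + 11) = 4 * A * (ne * np) + 11 * (ne * np)"
      by (simp_all add: v_def algebra_simps)
    ultimately show ?thesis by linarith
  qed
  then have "mm * (v * (np * A)) \<le> mm * ((ne * np * (4 * A + 11)) * (np * A))" by (intro mult_le_mono order_refl)
  also have "\<dots> = A * (4 * A + 11) * (mm * np * ne * np)" by (simp only: ac_simps)
  also have "\<dots> \<le> A * (4 * A + 11) * bound" by (intro mult_le_mono2 bounds)
  finally have b2: "mm * (v * (np * A)) \<le> A * (4 * A + 11) * bound" .
  have "z \<le> np * (6 * A + 18)" using p unfolding z_def by (simp add: distrib_left)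
  then have "mm * (z * (np * A)) \<le> mm * ((np * (6 * A + 18)) * (np * A))" by (intro mult_le_mono order_refl)
  also have "\<dots> = A * (6 * A + 18) * (mm * np * np)" by (simp only: ac_simps)
  also have "\<dots> \<le> A * (6 * A + 18) * bound" by (intro mult_le_mono2 bounds)
  finally have b3: "mm * (z * (np * A)) \<le> A * (6 * A + 18) * bound" .
  have "?N * (10 * (np * ne) + 15 * mm + np * (16 * A + 41)) \<le> 2 * A * (np * mm) * (10 * (np * ne) + 15 * mm + np * (16 * A + 41))"
    by (intro mult_le_mono1 rounds)
  also have "\<dots> = 2 * A * (10 * (mm * np * ne * np) + 15 * (np * mm * mm) + (16 * A + 41) * (mm * np * np))"
    by (simp only: distrib_left distrib_right ac_simps)
  also have "\<dots> \<le> 2 * A * (10 * bound + 15 * (A * bound) + (16 * A + 41) * bound)"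
    by (intro mult_le_mono2 add_mono bounds)
  also have "\<dots> = 2 * A * (16 * A + 41 + 10 + 15 * A) * bound" by (simp add: algebra_simps)
  finally have b4: "?N * (10 * (np * ne) + 15 * mm + np * (16 * A + 41)) \<le> 2 * A * (16 * A + 41 + 10 + 15 * A) * bound" .
  have "(\<Sum>t<?N. round_time (full_flag t) (D_at t) (D_at (Suc t))) \<le> (\<Sum>t<?N.
     (\<Sum>e=Suc np..np + ne. \<Sum>r=1..np. if fp t e r then w else 0) + (\<Sum>c\<in>consts_of P. if [c] \<in> D_at t then v else 0) +
     (\<Sum>c\<in>consts_of P. if [c] \<in> D_at (Suc t) then z else 0) + (10 * (np * ne) + 15 * mm + np * (16 * A + 41)))"
    by (intro sum_mono rt)
  also have "\<dots> = (\<Sum>t<?N. \<Sum>e=Suc np..np + ne. \<Sum>r=1..np. if fp t e r then w else 0) +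
     (\<Sum>t<?N. \<Sum>c\<in>consts_of P. if [c] \<in> D_at t then v else 0) +
     (\<Sum>t<?N. \<Sum>c\<in>consts_of P. if [c] \<in> D_at (Suc t) then z else 0) + ?N * (10 * (np * ne) + 15 * mm + np * (16 * A + 41))"
    by (simp only: sum.distrib sum_constant card_lessThan of_nat_id distrib_left)
  also have "\<dots> \<le> (4 * A + 8) * (2 * A * A + 2) * bound + A * (4 * A + 11) * bound + A * (6 * A + 18) * bound +
      2 * A * (16 * A + 41 + 10 + 15 * A) * bound"
    using s1 s2 s3 b1 b2 b3 b4 by linarith
  also have "\<dots> = loop_const * bound" by (simp only: loop_const_def distrib_right)
  finally show ?thesis .
qed

end

locale encoded_mem = encoded +
  fixes K :: "(nat \<times> nat list) set"
  assumes K: "{..<32} \<times> base_keys \<subseteq> K"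
begin

sublocale rows_mem B "encode P" A "num_pre P" "num_eff P" "consts_of P" "row_op P" "row_clause P"
  "\<lambda>r. cond_tag (row_cond P r)" "\<lambda>r. cond_pred (row_cond P r)" "\<lambda>r. cond_terms (row_cond P r)" K
  by unfold_locales (rule K)

lemma runs_main_loop:
  assumes "state_mem 0 m"
  shows "runs B (encode P) K (Loop (Reg tCH) (round A)) m ((loop_const + 2 * A + 1) * bound) (state_mem rounds)"
proof -
  have "runs B (encode P) K (Loop (Reg tCH) (round A)) m
      ((\<Sum>t<rounds. round_time (full_flag t) (D_at t) (D_at (Suc t)) + 1) + 1) (state_mem rounds)"
  proof (rule runs_Loop[where Inv = state_mem, OF assms])
    fix t m assume t: "t < rounds" and m: "state_mem t m"
    have ch: "m tCH = tab (change_flag t)" using m by (simp add: state_mem_def round_state_def)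
    have "[] \<in> change_flag t" using rounds(3)[OF _ t] by (auto simp: change_flag_def)
    then have "ev B (encode P) m (Reg tCH) \<noteq> 0" by (simp add: ch)
    moreover have F: "[] \<in> full_flag t \<longleftrightarrow> t = 0 \<or> \<not> A_at t \<subseteq> A_at (t - 1)" by (simp add: full_flag_def)
    have "runs B (encode P) K (round A) m (round_time (full_flag t) (D_at t) (D_at (Suc t))) (state_mem (Suc t))"
    proof -
      have eqs: "full_flag (Suc t) = {k. k = [] \<and> \<not> act_keys (F_at (Suc t)) (X_at (Suc t)) \<subseteq> A_at t}"
        "change_flag (Suc t) = {k. k = [] \<and> D_at (Suc t) \<noteq> {}}"
        by (auto simp: full_flag_def change_flag_def act_A_at_iff)
      show ?thesis
        using runs_round[OF m[unfolded state_mem_def] X_at_keys D_at_keys _ _ X_at_Suc_eq(1)[OF F, symmetric]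
            X_at_Suc_eq(2)[OF F, symmetric] flags_F_at[symmetric]]
        unfolding fresh_X_at act_A_at eqs[symmetric] state_mem_def[symmetric]
        by (auto simp: full_flag_def change_flag_def)
    qed
    ultimately show "ev B (encode P) m (Reg tCH) \<noteq> 0 \<and>
        runs B (encode P) K (round A) m (round_time (full_flag t) (D_at t) (D_at (Suc t))) (state_mem (Suc t))" by blast
  next
    fix m assume m: "state_mem rounds m"
    then have "m tCH = tab (change_flag rounds)" by (simp add: state_mem_def round_state_def)
    moreover have "change_flag rounds = {}" using rounds(1,2) by (simp add: change_flag_def)
    ultimately show "ev B (encode P) m (Reg tCH) = 0" by simp
  qed
  moreover have "(\<Sum>t<rounds. round_time (full_flag t) (D_at t) (D_at (Suc t)) + 1) + 1 \<le> (loop_const + 2 * A + 1) * bound"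
  proof -
    have "(\<Sum>t<rounds. round_time (full_flag t) (D_at t) (D_at (Suc t)) + 1) =
        (\<Sum>t<rounds. round_time (full_flag t) (D_at t) (D_at (Suc t))) + rounds" by (simp only: sum.distrib) simp
    moreover have "rounds \<le> 2 * A * bound"
      using rounds(4) mult_le_mono2[OF bounds(4), of "2 * A"] unfolding mult.commute[of np mm] by (rule order_trans)
    ultimately show ?thesis using loop_time bounds(6) unfolding distrib_right by linarith
  qed
  ultimately show ?thesis by (elim runs_weaken)
qed

end

section \<open>Equivalence classes of variables\<close>

text \<open>
  A labelling assigns equal labels to linked nodes and different labels to unlinked ones.
  Labels are positive, so that the default entry \<open>0\<close> is the label of a non-node.
\<close>

definition labelling ::
    "nat \<Rightarrow> nat list set \<Rightarrow> (nat list \<times> nat list) set \<Rightarrow> (nat list \<Rightarrow> nat) \<Rightarrow> bool" where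
  "labelling b N Z L \<longleftrightarrow> (\<forall>k. L k \<noteq> 0 \<longleftrightarrow> k \<in> N) \<and> (\<forall>k. L k < b) \<and> (\<forall>k k'. (k, k') \<in> Z \<longrightarrow> L k = L k') \<and>
     (\<forall>k k'. k \<in> N \<longrightarrow> L k = L k' \<longrightarrow> (k, k') \<in> (Z \<union> Z\<inverse>)\<^sup>*)"

lemma labelling_iff:
  assumes "labelling b N Z L" "k \<in> N"
  shows "L k = L k' \<longleftrightarrow> (k, k') \<in> (Z \<union> Z\<inverse>)\<^sup>*"
proof
  assume "(k, k') \<in> (Z \<union> Z\<inverse>)\<^sup>*"
  then show "L k = L k'"
  proof (induction rule: rtrancl_induct)
    case (step y z)
    then show ?case using assms(1) unfolding labelling_def by auto
  qed simp
qed (use assms in \<open>simp add: labelling_def\<close>)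

text \<open>Only the classes of \<open>k0\<close> and \<open>k1\<close> become identified, and the
  new pair connects precisely these two.\<close>

lemma labelling_merge:
  assumes L: "labelling b N Z L" and k: "k0 \<in> N" "k1 \<in> N"
  shows "labelling b N (Z \<union> {(k0, k1)}) (\<lambda>k. if L k = L k0 then L k1 else L k)" (is "labelling _ _ ?Z ?L")
proof -
  have nz: "L k \<noteq> 0 \<longleftrightarrow> k \<in> N" and bnd: "L k < b" and eq: "(k, k') \<in> Z \<Longrightarrow> L k = L k'" for k k'
    using L by (auto simp: labelling_def)
  have sub: "(Z \<union> Z\<inverse>)\<^sup>* \<subseteq> (?Z \<union> ?Z\<inverse>)\<^sup>*" by (rule rtrancl_mono) blast
  have conn: "(k, k') \<in> (?Z \<union> ?Z\<inverse>)\<^sup>*" if "k \<in> N" "L k = L k'" for k k'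
    using labelling_iff[OF L that(1)] that(2) sub by blast
  have e: "(k0, k1) \<in> (?Z \<union> ?Z\<inverse>)\<^sup>*" "(k1, k0) \<in> (?Z \<union> ?Z\<inverse>)\<^sup>*" by auto
  show ?thesis
    unfolding labelling_def
  proof (intro conjI allI impI)
    show "?L k \<noteq> 0 \<longleftrightarrow> k \<in> N" for k using nz[of k] nz[of k0] nz[of k1] k by auto
    show "?L k < b" for k using bnd by simp
    show "?L k = ?L k'" if "(k, k') \<in> ?Z" for k k' using that eq[of k k'] by auto
    fix k k' assume kN: "k \<in> N" and l: "?L k = ?L k'"
    have "k' \<in> N" using nz[of k] nz[of k'] nz[of k0] nz[of k1] l k kN by (auto split: if_splits)
    show "(k, k') \<in> (?Z \<union> ?Z\<inverse>)\<^sup>*"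
    proof (cases "L k = L k'")
      case False
      then consider "L k = L k0" "L k1 = L k'" | "L k = L k1" "L k0 = L k'" using l by (auto split: if_splits)
      then show ?thesis
      proof cases
        case 1
        have "(k, k0) \<in> (?Z \<union> ?Z\<inverse>)\<^sup>*" "(k1, k') \<in> (?Z \<union> ?Z\<inverse>)\<^sup>*" using conn kN k 1 by simp_all
        then show ?thesis using e(1) by (meson rtrancl_trans)
      next
        case 2
        have "(k, k1) \<in> (?Z \<union> ?Z\<inverse>)\<^sup>*" "(k0, k') \<in> (?Z \<union> ?Z\<inverse>)\<^sup>*" using conn kN k 2 by simp_all
        then show ?thesis using e(2) by (meson rtrancl_trans)
      qed
    qed (use conn kN in simp)
  qed
qed

text \<open>The machine has no multiplication; since the factor is the constant \<open>A\<close>,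
  repeated addition is an expression of fixed size.\<close>

fun times_exp :: "nat \<Rightarrow> exp \<Rightarrow> exp" where
  "times_exp 0 e = Const 0"
| "times_exp (Suc n) e = Plus e (times_exp n e)"

lemma ev_times_exp: "n * ev B I m e < B \<Longrightarrow> ev B I m (times_exp n e) = n * ev B I m e"
  by (induction n) auto

text \<open>The row register is a parameter of \<open>key\<close> because merging reads the equation
  in row \<open>tS\<close> while relabelling scans with \<open>tR\<close>.\<close>

definition init_labels :: "nat \<Rightarrow> nat \<Rightarrow> (nat \<Rightarrow> nat \<Rightarrow> exp list) \<Rightarrow> com" where
  "init_labels A T key = for_rows tR (seqs (map (\<lambda>a.
     Cond (varE tR a) (Put T (key tR a) (Plus (times_exp A (Reg tR)) (Const a))) Skip) [0..<A]))"

definition relabel :: "nat \<Rightarrow> nat \<Rightarrow> (nat \<Rightarrow> nat \<Rightarrow> exp list) \<Rightarrow> com" where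
  "relabel A T key = for_rows tR (seqs (map (\<lambda>a.
     Cond (And (varE tR a) (Equal (Get T (key tR a)) (Reg tU))) (Put T (key tR a) (Reg tV)) Skip) [0..<A]))"

text \<open>A complete relabelling for each equation costs time of order \<open>np * np\<close> in
  total, which the bound allows. Both labels are copied to registers first, because the scan changes
  the table from which they come.\<close>

definition merge_labels :: "nat \<Rightarrow> nat \<Rightarrow> (nat \<Rightarrow> nat \<Rightarrow> exp list) \<Rightarrow> exp \<Rightarrow> com" where
  "merge_labels A T key cond = for_rows tS (Cond cond
     (Seq (Put tU [] (Get T (key tS 0))) (Seq (Put tV [] (Get T (key tS 1))) (relabel A T key))) Skip)"

context rows
begin

definition classes_time :: nat where
  "classes_time = np * (2 * A + 5) + np * (np * (2 * A + 5) + 7)"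

end

context rows_mem
begin

text \<open>Division by \<open>A\<close> recovers the position from the label
  \<open>r * A + a\<close>, and the position determines the key. So different keys get different
  labels, even though positions with the same key overwrite each other. Rows start at 1, which makes
  labels positive.\<close>

lemma runs_init_labels:
  assumes T: "T < 32" "T \<noteq> tR" and mT: "m T = (\<lambda>_. 0)"
    and key: "\<And>r a m'. prow r \<Longrightarrow> a < A \<Longrightarrow> isv r a \<Longrightarrow> m' tR [] = r \<Longrightarrow> agree {tR, T} m m' \<Longrightarrow>
      map (ev B I m') (key tR a) = kf r a"
    and inK: "\<And>r a. prow r \<Longrightarrow> a < A \<Longrightarrow> isv r a \<Longrightarrow> (T, kf r a) \<in> K"
  shows "runs B I K (init_labels A T key) m (np * (2 * A + 5))
    (\<lambda>m'. labelling (Suc np * A) {kf r a |r a. prow r \<and> a < A \<and> isv r a} {} (m' T) \<and> agree {tR, T} m m')"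
proof -
  define J where "J Z m' \<longleftrightarrow> (\<forall>k. m' T k \<noteq> 0 \<longleftrightarrow> k \<in> Z) \<and>
    (\<forall>k\<in>Z. \<exists>r a. prow r \<and> a < A \<and> m' T k = r * A + a \<and> k = kf r a) \<and> agree {tR, T} m m'" for Z m'
  define G where "G r = (\<Union>a<A. if isv r a then {kf r a} else {})" for r
  have bound: "r * A + a < Suc np * A" "r * A + a \<noteq> 0" if "prow r" "a < A" for r a
  proof -
    have "r * A \<le> np * A" using that(1) unfolding prow_def by (intro mult_le_mono1) simp
    then show "r * A + a < Suc np * A" using that(2) unfolding mult_Suc by linarith
    show "r * A + a \<noteq> 0" using that A by (simp add: prow_def)
  qed
  have step: "runs B I K (Cond (varE tR a) (Put T (key tR a) (Plus (times_exp A (Reg tR)) (Const a))) Skip) m' 2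
      (\<lambda>m''. J (Z \<union> (if isv r a then {kf r a} else {})) m'' \<and> m'' tR [] = r)"
    if r: "prow r" "a < A" and J: "J Z m' \<and> m' tR [] = r" for r a Z m'
  proof (rule runs_If[where T = 1])
    have "r * A + a < B" using bound(1)[OF r] B(2) by linarith
    then have v: "ev B I m' (Plus (times_exp A (Reg tR)) (Const a)) = r * A + a"
      using J by (simp add: ev_times_exp mult.commute)
    have c: "tr B I m' (varE tR a) \<longleftrightarrow> isv r a" using J r prow_row by (simp add: ev_row)
    assume "tr B I m' (varE tR a)"
    then have i: "isv r a" using c by blast
    have k: "map (ev B I m') (key tR a) = kf r a" using key[OF r i] J by (simp add: J_def)
    have "J (insert (kf r a) Z) (m'(T := (m' T)(kf r a := r * A + a)))"
      using J bound[OF r] r T unfolding J_def by (auto intro!: agree_upd)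
    then show "runs B I K (Put T (key tR a) (Plus (times_exp A (Reg tR)) (Const a))) m' 1
      (\<lambda>m''. J (Z \<union> (if isv r a then {kf r a} else {})) m'' \<and> m'' tR [] = r)"
      using i k v inK[OF r i] T J by (intro runs_Put) (simp_all del: ev.simps)
  next
    assume "\<not> tr B I m' (varE tR a)"
    then have "\<not> isv r a" using J r prow_row by (simp add: ev_row)
    then show "runs B I K Skip m' 1 (\<lambda>m''. J (Z \<union> (if isv r a then {kf r a} else {})) m'' \<and> m'' tR [] = r)"
      using J by (intro runs_Skip) simp_all
  qed simp
  have "runs B I K (init_labels A T key) m ((\<Sum>r=1..np. (A * 2 + 1) + 2) + 2) (J ({} \<union> (\<Union>r\<in>{r. prow r}. G r)))"
    unfolding init_labels_def
  proof (rule runs_for_rows[where J = J])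
    show "J {} m" using mT by (simp add: J_def)
    fix r Z m' assume "prow r" "J Z m'" "m' tR [] = r"
    then show "runs B I K (seqs (map (\<lambda>a. Cond (varE tR a) (Put T (key tR a) (Plus (times_exp A (Reg tR)) (Const a))) Skip) [0..<A]))
        m' (A * 2 + 1) (\<lambda>m'. J (Z \<union> G r) m' \<and> m' tR [] = r)"
      unfolding G_def by (intro runs_seqs[of "\<lambda>Z m'. J Z m' \<and> m' tR [] = r"] step) auto
  qed (use T in \<open>simp_all add: J_def agree_upd\<close>)
  moreover have eq: "(\<Union>r\<in>{r. prow r}. G r) = {kf r a |r a. prow r \<and> a < A \<and> isv r a}" (is "_ = ?N")
    by (auto simp: G_def split: if_splits)
  moreover have "labelling (Suc np * A) ?N {} (m' T)" if J: "J ?N m'" for m'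
  proof -
    have nz: "m' T k \<noteq> 0 \<longleftrightarrow> k \<in> ?N" for k using J unfolding J_def by blast
    have v: "\<exists>r a. prow r \<and> a < A \<and> m' T k = r * A + a \<and> k = kf r a" if "k \<in> ?N" for k
      using J that unfolding J_def by blast
    show ?thesis
      unfolding labelling_def
    proof (intro conjI allI impI)
      show "m' T k < Suc np * A" for k
      proof (cases "k \<in> ?N")
        case True
        then show ?thesis using v[OF True] bound(1) by metis
      next
        case False
        then have "m' T k = 0" using nz by blast
        then show ?thesis using A by simp
      qed
      fix k k' assume k: "k \<in> ?N" and e: "m' T k = m' T k'"
      obtain r a where 1: "a < A" "m' T k = r * A + a" "k = kf r a" using v[OF k] by blast
      have "k' \<in> ?N" by (rule iffD1[OF nz]) (use iffD2[OF nz k] e in simp)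
      then obtain r' a' where 2: "a' < A" "m' T k' = r' * A + a'" "k' = kf r' a'" using v by blast
      have "(r * A + a) div A = (r' * A + a') div A" "(r * A + a) mod A = (r' * A + a') mod A"
        using 1(2) 2(2) e by simp_all
      then have "r = r'" "a = a'" using 1(1) 2(1) by simp_all
      then show "(k, k') \<in> ({} \<union> {}\<inverse>)\<^sup>*" using 1 2 by simp
    qed (use nz in blast)+
  qed
  ultimately show ?thesis
    using rows_time[of "A * 2 + 1"] unfolding eq by (elim runs_weaken) (auto simp: J_def algebra_simps)
qed

lemma runs_relabel:
  assumes T: "T < 32" "T \<notin> {tR, tU, tV}"
    and key: "\<And>r a m'. prow r \<Longrightarrow> a < A \<Longrightarrow> isv r a \<Longrightarrow> m' tR [] = r \<Longrightarrow> agree {tR, T} m m' \<Longrightarrow>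
      map (ev B I m') (key tR a) = kf r a"
    and inK: "\<And>r a. prow r \<Longrightarrow> a < A \<Longrightarrow> isv r a \<Longrightarrow> (T, kf r a) \<in> K"
    and nodes: "\<And>k. m T k \<noteq> 0 \<longleftrightarrow> k \<in> {kf r a |r a. prow r \<and> a < A \<and> isv r a}"
    and U: "m tU [] \<noteq> 0"
  shows "runs B I K (relabel A T key) m (np * (2 * A + 5))
    (\<lambda>m'. m' T = (\<lambda>k. if m T k = m tU [] then m tV [] else m T k) \<and> agree {tR, T} m m')"
proof -
  let ?u = "m tU []" and ?v = "m tV []"
  define J where "J Z m' \<longleftrightarrow> m' T = (\<lambda>k. if k \<in> Z \<and> m T k = ?u then ?v else m T k) \<and> agree {tR, T} m m'" for Z m'
  define G where "G r = (\<Union>a<A. if isv r a then {kf r a} else {})" for r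
  have step: "runs B I K (Cond (And (varE tR a) (Equal (Get T (key tR a)) (Reg tU))) (Put T (key tR a) (Reg tV)) Skip) m' 2
      (\<lambda>m''. J (Z \<union> (if isv r a then {kf r a} else {})) m'' \<and> m'' tR [] = r)"
    if r: "prow r" "a < A" and J: "J Z m' \<and> m' tR [] = r" for r a Z m'
  proof -
    have ag: "m' tU = m tU" "m' tV = m tV" using J T agreeD[of "{tR, T}" m m'] by (auto simp: J_def)
    have v: "tr B I m' (varE tR a) \<longleftrightarrow> isv r a" using J r prow_row by (simp add: ev_row)
    have k: "map (ev B I m') (key tR a) = kf r a" if "isv r a" using key[OF r that] J by (simp add: J_def)
    have c: "tr B I m' (And (varE tR a) (Equal (Get T (key tR a)) (Reg tU))) \<longleftrightarrow> isv r a \<and> m' T (kf r a) = ?u"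
      using v k B(4) ag by auto
    show ?thesis
    proof (rule runs_If[where T = 1], unfold c)
      assume i: "isv r a \<and> m' T (kf r a) = ?u"
      have "J (insert (kf r a) Z) (m'(T := (m' T)(kf r a := ?v)))"
        using J i T unfolding J_def by (auto simp: fun_eq_iff intro!: agree_upd split: if_splits)
      then show "runs B I K (Put T (key tR a) (Reg tV)) m' 1
        (\<lambda>m''. J (Z \<union> (if isv r a then {kf r a} else {})) m'' \<and> m'' tR [] = r)"
        using i k ag inK[OF r] T J by (intro runs_Put) simp_all
    next
      assume "\<not> (isv r a \<and> m' T (kf r a) = ?u)"
      then have "J (Z \<union> (if isv r a then {kf r a} else {})) m'"
        using J unfolding J_def by (auto simp: fun_eq_iff split: if_splits)
      then show "runs B I K Skip m' 1 (\<lambda>m''. J (Z \<union> (if isv r a then {kf r a} else {})) m'' \<and> m'' tR [] = r)"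
        using J by (intro runs_Skip) simp_all
    qed simp
  qed
  have "runs B I K (relabel A T key) m ((\<Sum>r=1..np. (A * 2 + 1) + 2) + 2) (J ({} \<union> (\<Union>r\<in>{r. prow r}. G r)))"
    unfolding relabel_def
  proof (rule runs_for_rows[where J = J])
    show "J {} m" by (simp add: J_def)
    fix r Z m' assume "prow r" "J Z m'" "m' tR [] = r"
    then show "runs B I K (seqs (map (\<lambda>a. Cond (And (varE tR a) (Equal (Get T (key tR a)) (Reg tU))) (Put T (key tR a) (Reg tV)) Skip) [0..<A]))
        m' (A * 2 + 1) (\<lambda>m'. J (Z \<union> G r) m' \<and> m' tR [] = r)"
      unfolding G_def by (intro runs_seqs[of "\<lambda>Z m'. J Z m' \<and> m' tR [] = r"] step) auto
  qed (use T in \<open>simp_all add: J_def agree_upd\<close>)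
  moreover have eq: "(\<Union>r\<in>{r. prow r}. G r) = {kf r a |r a. prow r \<and> a < A \<and> isv r a}" (is "_ = ?N")
    by (auto simp: G_def split: if_splits)
  moreover have "m' T = (\<lambda>k. if m T k = ?u then ?v else m T k) \<and> agree {tR, T} m m'" if J: "J ?N m'" for m'
  proof -
    \<comment> \<open>The label \<open>?u\<close> is nonzero, so only nodes carry it, and the scan
      over the rows meets every node.\<close>
    have "m T k = ?u \<Longrightarrow> k \<in> ?N" for k using nodes[of k] U by simp
    then show ?thesis using J unfolding J_def by (auto simp: fun_eq_iff)
  qed
  ultimately show ?thesis
    using rows_time[of "A * 2 + 1"] unfolding eq by (elim runs_weaken) (auto simp: algebra_simps)
qed

lemma runs_merge_labels:
  assumes T: "T < 32" "T \<notin> {tR, tS, tU, tV}"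
    and key: "\<And>\<rho> r a m'. \<rho> \<in> {tR, tS} \<Longrightarrow> prow r \<Longrightarrow> a < A \<Longrightarrow> isv r a \<Longrightarrow> m' \<rho> [] = r \<Longrightarrow>
      agree {tR, tS, tU, tV, T} m m' \<Longrightarrow> map (ev B I m') (key \<rho> a) = kf r a"
    and cond: "\<And>r m'. prow r \<Longrightarrow> m' tS [] = r \<Longrightarrow> tr B I m' cond \<longleftrightarrow> ed r"
    and ed: "\<And>r. ed r \<Longrightarrow> isv r 0 \<and> isv r 1"
    and inK: "\<And>r a. prow r \<Longrightarrow> a < A \<Longrightarrow> isv r a \<Longrightarrow> (T, kf r a) \<in> K"
    and L: "labelling (Suc np * A) {kf r a |r a. prow r \<and> a < A \<and> isv r a} {} (m T)"
  shows "runs B I K (merge_labels A T key cond) m (np * (np * (2 * A + 5) + 7))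
    (\<lambda>m'. labelling (Suc np * A) {kf r a |r a. prow r \<and> a < A \<and> isv r a} {(kf r 0, kf r 1) |r. prow r \<and> ed r} (m' T) \<and>
          agree {tR, tS, tU, tV, T} m m')"
proof -
  let ?N = "{kf r a |r a. prow r \<and> a < A \<and> isv r a}"
  let ?X = "{tR, tS, tU, tV, T}"
  define J where "J Z m' \<longleftrightarrow> labelling (Suc np * A) ?N Z (m' T) \<and> agree ?X m m'" for Z m'
  define G where "G r = (if ed r then {(kf r 0, kf r 1)} else {})" for r
  have body: "runs B I K (Cond cond (Seq (Put tU [] (Get T (key tS 0))) (Seq (Put tV [] (Get T (key tS 1))) (relabel A T key))) Skip)
      m' (np * (2 * A + 5) + 3) (\<lambda>m''. J (Z \<union> G r) m'' \<and> m'' tS [] = r)"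
    if r: "prow r" and J: "J Z m'" and m': "m' tS [] = r" for r Z m'
  proof (rule runs_If[where T = "np * (2 * A + 5) + 2"], unfold cond[of r m', OF r m'])
    assume e: "ed r"
    have v: "isv r 0" "isv r 1" "0 < A" "1 < A" using ed[OF e] A by auto
    have ag: "agree ?X m m'" using J by (simp add: J_def)
    let ?k0 = "kf r 0" and ?k1 = "kf r 1"
    define m1 where "m1 = m'(tU := (m' tU)([] := m' T ?k0))"
    define m2 where "m2 = m1(tV := (m1 tV)([] := m' T ?k1))"
    have ag1: "agree ?X m m1" using ag unfolding m1_def by (intro agree_upd) auto
    have ag2: "agree ?X m m2" using ag1 unfolding m2_def by (intro agree_upd) auto
    have m1: "m1 tS [] = r" "m1 T = m' T" using m' T by (auto simp: m1_def)
    have m2: "m2 tS [] = r" "m2 T = m' T" "m2 tU [] = m' T ?k0" "m2 tV [] = m' T ?k1" using m' T by (auto simp: m1_def m2_def)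
    have N: "?k0 \<in> ?N" "?k1 \<in> ?N" using r v by blast+
    have nz: "\<And>k. m' T k \<noteq> 0 \<longleftrightarrow> k \<in> ?N" using J unfolding J_def labelling_def by blast
    have "runs B I K (relabel A T key) m2 (np * (2 * A + 5))
      (\<lambda>m''. m'' T = (\<lambda>k. if m2 T k = m2 tU [] then m2 tV [] else m2 T k) \<and> agree {tR, T} m2 m'')"
    proof (rule runs_relabel)
      show "T < 32" "T \<notin> {tR, tU, tV}" using T by auto
      fix r a m'' assume "prow r" "a < A" "isv r a" "m'' tR [] = r" "agree {tR, T} m2 m''"
      moreover from this have "agree ?X m m''" using agree_trans[OF ag2, of "{tR, T}" m'' ?X] by blast
      ultimately show "map (ev B I m'') (key tR a) = kf r a" using key[of tR r a m''] by blast
    qed (use inK nz N m2 in simp_all)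
    then have rl: "runs B I K (relabel A T key) m2 (np * (2 * A + 5)) (\<lambda>m''. J (Z \<union> G r) m'' \<and> m'' tS [] = r)"
    proof (rule runs_weaken)
      fix m'' assume m'': "m'' T = (\<lambda>k. if m2 T k = m2 tU [] then m2 tV [] else m2 T k) \<and> agree {tR, T} m2 m''"
      then have "m'' T = (\<lambda>k. if m' T k = m' T ?k0 then m' T ?k1 else m' T k)" unfolding m2 by blast
      then have "labelling (Suc np * A) ?N (Z \<union> G r) (m'' T)"
        using labelling_merge[OF conjunct1[OF J[unfolded J_def]] N] e by (simp add: G_def)
      moreover have "agree ?X m m''" using agree_trans[OF ag2, of "{tR, T}" m'' ?X] m'' by blast
      moreover have "m'' tS = m2 tS" using agreeD[of "{tR, T}" m2 m'' tS] m'' T by auto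
      ultimately show "J (Z \<union> G r) m'' \<and> m'' tS [] = r" using m2(1) by (simp add: J_def)
    qed simp
    show "runs B I K (Seq (Put tU [] (Get T (key tS 0))) (Seq (Put tV [] (Get T (key tS 1))) (relabel A T key))) m'
        (np * (2 * A + 5) + 2) (\<lambda>m''. J (Z \<union> G r) m'' \<and> m'' tS [] = r)"
    proof (rule runs_Seq[where ?T1.0 = 1 and ?T2.0 = "np * (2 * A + 5) + 1"])
      have k0: "map (ev B I m') (key tS 0) = ?k0" by (rule key) (use r v m' ag in auto)
      have k1: "map (ev B I m1) (key tS 1) = ?k1" by (rule key) (use r v m1 ag1 in auto)
      have "runs B I K (Put tV [] (Get T (key tS 1))) m1 1
        (\<lambda>m2. runs B I K (relabel A T key) m2 (np * (2 * A + 5)) (\<lambda>m''. J (Z \<union> G r) m'' \<and> m'' tS [] = r))"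
        by (rule runs_Put) (use rl k1 m1 in \<open>simp_all add: in_K(1) m2_def\<close>)
      then have "runs B I K (Seq (Put tV [] (Get T (key tS 1))) (relabel A T key)) m1 (np * (2 * A + 5) + 1)
         (\<lambda>m''. J (Z \<union> G r) m'' \<and> m'' tS [] = r)"
        by (rule runs_Seq) simp
      then show "runs B I K (Put tU [] (Get T (key tS 0))) m' 1 (\<lambda>m1. runs B I K (Seq (Put tV [] (Get T (key tS 1))) (relabel A T key)) m1 (np * (2 * A + 5) + 1)
         (\<lambda>m''. J (Z \<union> G r) m'' \<and> m'' tS [] = r))"
        by (intro runs_Put) (use k0 in \<open>simp_all add: in_K(1) m1_def\<close>)
    qed simp
  next
    assume "\<not> ed r"
    then show "runs B I K Skip m' (np * (2 * A + 5) + 2) (\<lambda>m''. J (Z \<union> G r) m'' \<and> m'' tS [] = r)"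
      using J m' by (intro runs_Skip) (simp_all add: G_def)
  qed simp
  have "runs B I K (merge_labels A T key cond) m ((\<Sum>r=1..np. (np * (2 * A + 5) + 3) + 2) + 2) (J ({} \<union> (\<Union>r\<in>{r. prow r}. G r)))"
    unfolding merge_labels_def
    by (rule runs_for_rows[where J = J]) (use T L body in \<open>simp_all add: J_def agree_upd\<close>)
  moreover have "(\<Union>r\<in>{r. prow r}. G r) = {(kf r 0, kf r 1) |r. prow r \<and> ed r}"
    by (auto simp: G_def split: if_splits)
  ultimately show ?thesis
    using rows_time[of "np * (2 * A + 5) + 3"] by (elim runs_weaken) (simp_all add: J_def ac_simps)
qed

lemma runs_classes:
  assumes T: "T < 32" "T \<notin> {tR, tS, tU, tV}" and mT: "m T = (\<lambda>_. 0)"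
    and key: "\<And>\<rho> r a m'. \<rho> \<in> {tR, tS} \<Longrightarrow> prow r \<Longrightarrow> a < A \<Longrightarrow> isv r a \<Longrightarrow> m' \<rho> [] = r \<Longrightarrow>
      agree {tR, tS, tU, tV, T} m m' \<Longrightarrow> map (ev B I m') (key \<rho> a) = kf r a"
    and cond: "\<And>r m'. prow r \<Longrightarrow> m' tS [] = r \<Longrightarrow> tr B I m' cond \<longleftrightarrow> ed r"
    and ed: "\<And>r. ed r \<Longrightarrow> isv r 0 \<and> isv r 1"
    and inK: "\<And>r a. prow r \<Longrightarrow> a < A \<Longrightarrow> isv r a \<Longrightarrow> (T, kf r a) \<in> K"
  shows "runs B I K (Seq (init_labels A T key) (merge_labels A T key cond)) m classes_time
    (\<lambda>m'. labelling (Suc np * A) {kf r a |r a. prow r \<and> a < A \<and> isv r a} {(kf r 0, kf r 1) |r. prow r \<and> ed r} (m' T) \<and>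
          agree {tR, tS, tU, tV, T} m m')"
proof (rule runs_Seq')
  let ?X = "{tR, tS, tU, tV, T}"
  have sub: "agree {tR, T} m m' \<Longrightarrow> agree ?X m m'" for m' by (simp add: agree_def)
  show "runs B I K (init_labels A T key) m (np * (2 * A + 5))
    (\<lambda>m'. labelling (Suc np * A) {kf r a |r a. prow r \<and> a < A \<and> isv r a} {} (m' T) \<and> agree {tR, T} m m')"
    by (rule runs_init_labels) (use T mT key sub inK in auto)
  fix m1 assume m1: "labelling (Suc np * A) {kf r a |r a. prow r \<and> a < A \<and> isv r a} {} (m1 T) \<and> agree {tR, T} m m1"
  have ag: "agree ?X m1 m' \<Longrightarrow> agree ?X m m'" for m'
    using agree_trans[of "{tR, T}" m m1 ?X m' ?X] m1 by blast
  have "runs B I K (merge_labels A T key cond) m1 (np * (np * (2 * A + 5) + 7))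
    (\<lambda>m'. labelling (Suc np * A) {kf r a |r a. prow r \<and> a < A \<and> isv r a} {(kf r 0, kf r 1) |r. prow r \<and> ed r} (m' T) \<and> agree ?X m1 m')"
    by (rule runs_merge_labels) (use T m1 key cond ed inK ag in auto)
  then show "runs B I K (merge_labels A T key cond) m1 (np * (np * (2 * A + 5) + 7))
    (\<lambda>m'. labelling (Suc np * A) {kf r a |r a. prow r \<and> a < A \<and> isv r a} {(kf r 0, kf r 1) |r. prow r \<and> ed r} (m' T) \<and> agree ?X m m')"
    using ag by (elim runs_weaken) auto
qed (simp add: classes_time_def)

end

section \<open>Tables for the restricted domains\<close>

text \<open>
  The nodes of the second level are pairs of a clause and a primary class that occurs in it.  A
  variable without occurrences in the secondary clause thus still finds the class of the variables
  it is equated with there.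
\<close>

definition key0 :: "nat \<Rightarrow> nat \<Rightarrow> exp list" where
  "key0 \<rho> a = [fld \<rho> 0, valE \<rho> a]"

definition label0 :: "nat \<Rightarrow> nat \<Rightarrow> exp" where
  "label0 \<rho> a = Get tL0 (key0 \<rho> a)"

definition key1 :: "nat \<Rightarrow> nat \<Rightarrow> exp list" where
  "key1 \<rho> a = [fld \<rho> 0, fld \<rho> 1, label0 \<rho> a]"

definition label1 :: "nat \<Rightarrow> nat \<Rightarrow> exp" where
  "label1 \<rho> a = Get tL1 (key1 \<rho> a)"

definition eqE :: "nat \<Rightarrow> exp" where
  "eqE \<rho> = And (Equal (fld \<rho> 2) (Const 2)) (And (varE \<rho> 0) (varE \<rho> 1))"

definition primaryE :: "nat \<Rightarrow> exp" where
  "primaryE \<rho> = Equal (fld \<rho> 1) (Const 0)"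

definition primary_classes :: "nat \<Rightarrow> com" where
  "primary_classes A = Seq (init_labels A tL0 key0) (merge_labels A tL0 key0 (And (primaryE tS) (eqE tS)))"

definition clause_classes :: "nat \<Rightarrow> com" where
  "clause_classes A = Seq (init_labels A tL1 key1) (merge_labels A tL1 key1 (eqE tS))"

text \<open>Used at variable positions \<open>a\<close> only. There at most the other side of an
  equation is a constant, so it is safe to let \<open>b\<close> range over both sides.\<close>

definition excludesE :: "nat \<Rightarrow> exp" where
  "excludesE a = Or (And posE (Not_exp (Get tIND [Reg tR, valE tR a, Reg tC])))
     (And (Equal (fld tR 2) (Const 2))
       (Ors (map (\<lambda>b. And (cstE tR b) (Not_exp (Equal (valE tR b) (Reg tC)))) [0..<2])))"

text \<open>For the presence of positive preconditions, and for each excluded constant, the primary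
  table is filled before the secondary one, because a class of the second level inherits what is
  recorded for the primary classes that compose it.\<close>

definition class_tables :: "nat \<Rightarrow> com" where
  "class_tables A =
     Seq (set_rows A tH0 (\<lambda>a. [label0 tR a]) (\<lambda>a. And (primaryE tR) (And (varE tR a) posE)))
    (Seq (set_rows A tH1 (\<lambda>a. [label1 tR a]) (\<lambda>a. And (varE tR a) (Or posE (Get tH0 [label0 tR a]))))
    (for_consts
      (Seq (set_rows A tW0 (\<lambda>a. [label0 tR a, Reg tC]) (\<lambda>a. And (primaryE tR) (And (varE tR a) (excludesE a))))
           (set_rows A tW1 (\<lambda>a. [label1 tR a, Reg tC]) (\<lambda>a. And (varE tR a) (Or (excludesE a) (Get tW0 [label0 tR a, Reg tC])))))))"

context rows
begin

definition tables_time :: nat where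
  "tables_time = 2 * (np * (2 * A + 5)) + (card cs * (2 * (np * (2 * A + 5)) + 3) + 2)"

definition eqrow :: "nat \<Rightarrow> bool" where
  "eqrow r \<longleftrightarrow> rtag r = 2 \<and> isv r 0 \<and> isv r 1"

definition excludes :: "nat list set \<Rightarrow> nat \<Rightarrow> nat \<Rightarrow> nat \<Rightarrow> bool" where
  "excludes X c r a \<longleftrightarrow> rtag r = 0 \<and> [r, nam r a, c] \<notin> X \<or> rtag r = 2 \<and> (\<exists>b<2. isc r b \<and> nam r b \<noteq> c)"

definition primary_labelling :: "(nat list \<Rightarrow> nat) \<Rightarrow> bool" where
  "primary_labelling L0 = labelling (Suc np * A) {[rop r, nam r a] |r a. prow r \<and> a < A \<and> isv r a}
     {([rop r, nam r 0], [rop r, nam r 1]) |r. prow r \<and> rcl r = 0 \<and> eqrow r} L0"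

definition clause_labelling :: "(nat list \<Rightarrow> nat) \<Rightarrow> (nat list \<Rightarrow> nat) \<Rightarrow> bool" where
  "clause_labelling L0 L1 = labelling (Suc np * A) {[rop r, rcl r, L0 [rop r, nam r a]] |r a. prow r \<and> a < A \<and> isv r a}
     {([rop r, rcl r, L0 [rop r, nam r 0]], [rop r, rcl r, L0 [rop r, nam r 1]]) |r. prow r \<and> eqrow r} L1"

text \<open>\<open>b\<close> is the property of argument positions that is collected: later either
  the exclusion of a given constant or the presence of a positive precondition.\<close>

definition labels0 :: "(nat list \<Rightarrow> nat) \<Rightarrow> (nat \<Rightarrow> nat \<Rightarrow> bool) \<Rightarrow> nat set" where
  "labels0 L0 b = {L0 [rop r, nam r a] |r a. prow r \<and> a < A \<and> isv r a \<and> rcl r = 0 \<and> b r a}"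

definition labels1 :: "(nat list \<Rightarrow> nat) \<Rightarrow> (nat list \<Rightarrow> nat) \<Rightarrow> (nat \<Rightarrow> nat \<Rightarrow> bool) \<Rightarrow> nat set" where
  "labels1 L0 L1 b = {L1 [rop r, rcl r, L0 [rop r, nam r a]] |r a. prow r \<and> a < A \<and> isv r a \<and>
     (b r a \<or> L0 [rop r, nam r a] \<in> labels0 L0 b)}"

definition var_eqs :: "nat \<Rightarrow> nat \<Rightarrow> (nat \<times> nat) set" where
  "var_eqs i j = {(nam r 0, nam r 1) |r. prow r \<and> rop r = i \<and> (rcl r = 0 \<or> rcl r = j) \<and> eqrow r}"

abbreviation link :: "nat \<Rightarrow> nat \<Rightarrow> (nat \<times> nat) set" where
  "link i j \<equiv> (var_eqs i j \<union> (var_eqs i j)\<inverse>)\<^sup>*"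

lemma link_sym: "(x, y) \<in> link i j \<Longrightarrow> (y, x) \<in> link i j"
proof -
  have "sym (link i j)" by (rule sym_rtrancl) (auto simp: sym_def)
  then show "(x, y) \<in> link i j \<Longrightarrow> (y, x) \<in> link i j" by (rule symD)
qed

lemma link_mono: "link i 0 \<subseteq> link i j"
  by (rule rtrancl_mono) (auto simp: var_eqs_def)

text \<open>Edges join keys with the same operator, so walks from \<open>[i, x]\<close> never leave
  operator \<open>i\<close> and project to walks in \<open>link i 0\<close>.\<close>

lemma primary_link:
  assumes L0: "primary_labelling L0" and x: "[i, x] \<in> {[rop r, nam r a] |r a. prow r \<and> a < A \<and> isv r a}"
  shows "L0 [i, x] = L0 [i, y] \<longleftrightarrow> (x, y) \<in> link i 0"
proof -
  let ?Z = "{([rop r, nam r 0], [rop r, nam r 1]) |r. prow r \<and> rcl r = 0 \<and> eqrow r}"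
  have Z: "([i, y], k) \<in> ?Z \<union> ?Z\<inverse> \<longleftrightarrow> (\<exists>z. k = [i, z] \<and> (y, z) \<in> var_eqs i 0 \<union> (var_eqs i 0)\<inverse>)" for y k
    unfolding var_eqs_def by auto
  have "\<exists>y. k = [i, y] \<and> (x, y) \<in> link i 0" if "([i, x], k) \<in> (?Z \<union> ?Z\<inverse>)\<^sup>*" for k
    using that
  proof (induction rule: rtrancl_induct)
    case (step k k')
    then obtain y where y: "k = [i, y]" "(x, y) \<in> link i 0" by blast
    obtain z where z: "k' = [i, z]" "(y, z) \<in> var_eqs i 0 \<union> (var_eqs i 0)\<inverse>"
      using iffD1[OF Z step(2)[unfolded y(1)]] by blast
    have "(x, z) \<in> link i 0" using y(2) z(2) by (rule rtrancl_into_rtrancl)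
    then show ?case using z(1) by (intro exI[of _ z]) simp
  qed simp
  moreover have "([i, x], [i, y]) \<in> (?Z \<union> ?Z\<inverse>)\<^sup>*" if "(x, y) \<in> link i 0" for y
    using that
  proof (induction rule: rtrancl_induct)
    case (step y z)
    have "([i, y], [i, z]) \<in> ?Z \<union> ?Z\<inverse>" by (rule iffD2[OF Z]) (use step(2) in blast)
    with step(3) show ?case by (rule rtrancl_into_rtrancl)
  qed simp
  ultimately show ?thesis
    using labelling_iff[OF L0[unfolded primary_labelling_def] x] by blast
qed

lemma var_eqs_cases:
  assumes "(y, z) \<in> var_eqs i j \<union> (var_eqs i j)\<inverse>"
  obtains "(y, z) \<in> var_eqs i 0 \<union> (var_eqs i 0)\<inverse>"
  | r a b where "prow r" "rop r = i" "rcl r = j" "eqrow r" "y = nam r a" "z = nam r b" "a = 0 \<and> b = 1 \<or> a = 1 \<and> b = 0"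
proof (cases "(y, z) \<in> var_eqs i 0 \<union> (var_eqs i 0)\<inverse>")
  case False
  have "(y, z) \<in> var_eqs i j \<or> (z, y) \<in> var_eqs i j" using assms by blast
  then show thesis
  proof
    assume "(y, z) \<in> var_eqs i j"
    then obtain r where r: "prow r" "rop r = i" "rcl r = 0 \<or> rcl r = j" "eqrow r" "y = nam r 0" "z = nam r 1"
      by (auto simp: var_eqs_def)
    then have "rcl r = 0 \<Longrightarrow> (y, z) \<in> var_eqs i 0" by (auto simp: var_eqs_def)
    then show thesis using False r by (intro that(2)[of r 0 1]) auto
  next
    assume "(z, y) \<in> var_eqs i j"
    then obtain r where r: "prow r" "rop r = i" "rcl r = 0 \<or> rcl r = j" "eqrow r" "z = nam r 0" "y = nam r 1"
      by (auto simp: var_eqs_def)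
    then have "rcl r = 0 \<Longrightarrow> (z, y) \<in> var_eqs i 0" by (auto simp: var_eqs_def)
    then show thesis using False r by (intro that(2)[of r 1 0]) auto
  qed
qed (rule that(1))

lemma eqrow_isv: "eqrow r \<Longrightarrow> a = 0 \<and> b = 1 \<or> a = 1 \<and> b = 0 \<Longrightarrow> isv r a \<and> isv r b \<and> a < A \<and> b < A"
  using A by (auto simp: eqrow_def)

lemma link_nodes:
  assumes "(x, y) \<in> link i j" "[i, x] \<in> {[rop r, nam r a] |r a. prow r \<and> a < A \<and> isv r a}"
  shows "[i, y] \<in> {[rop r, nam r a] |r a. prow r \<and> a < A \<and> isv r a}"
  using assms(1)
proof (induction rule: rtrancl_induct)
  case (step y z)
  then obtain r where r: "prow r" "rop r = i" "eqrow r" "z = nam r 0 \<or> z = nam r 1"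
    by (auto simp: var_eqs_def)
  then show ?case using eqrow_isv[OF r(3), of 0 1] by auto
qed (rule assms(2))

text \<open>A walk in \<open>link i j\<close> consists of primary equations, which preserve the
  first label, and equations of clause \<open>j\<close>, which are edges of the second level. If the
  primary class of \<open>x\<close> does not occur in clause \<open>j\<close>, no equation of that
  clause touches it, and it is already the whole class.\<close>

lemma class_link:
  assumes L0: "primary_labelling L0" and L1: "clause_labelling L0 L1"
    and x: "[i, x] \<in> {[rop r, nam r a] |r a. prow r \<and> a < A \<and> isv r a}"
    and y: "[i, y] \<in> {[rop r, nam r a] |r a. prow r \<and> a < A \<and> isv r a}"
  shows "(x, y) \<in> link i j \<longleftrightarrow> (if L1 [i, j, L0 [i, x]] \<noteq> 0 then L1 [i, j, L0 [i, x]] = L1 [i, j, L0 [i, y]] else L0 [i, x] = L0 [i, y])"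
proof -
  let ?N0 = "{[rop r, nam r a] |r a. prow r \<and> a < A \<and> isv r a}"
  let ?N1 = "{[rop r, rcl r, L0 [rop r, nam r a]] |r a. prow r \<and> a < A \<and> isv r a}"
  let ?Z = "{([rop r, rcl r, L0 [rop r, nam r 0]], [rop r, rcl r, L0 [rop r, nam r 1]]) |r. prow r \<and> eqrow r}"
  let ?k = "\<lambda>y. [i, j, L0 [i, y]]"
  have nz: "L1 k \<noteq> 0 \<longleftrightarrow> k \<in> ?N1" for k using L1 by (auto simp: clause_labelling_def labelling_def)
  have prim: "L0 [i, y] = L0 [i, z] \<longleftrightarrow> (y, z) \<in> link i 0" if "[i, y] \<in> ?N0" for y z
    by (rule primary_link[OF L0 that])
  have node: "[i, y] \<in> ?N0" if "(x, y) \<in> link i j" for y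
    by (rule link_nodes[OF that x])
  have step0: "L0 [i, y] = L0 [i, z]" if "(x, y) \<in> link i j" "(y, z) \<in> var_eqs i 0 \<union> (var_eqs i 0)\<inverse>" for y z
    using prim[OF node[OF that(1)]] that(2) by blast
  show ?thesis
  proof (cases "?k x \<in> ?N1")
    case True
    have "(?k x, ?k y) \<in> (?Z \<union> ?Z\<inverse>)\<^sup>*" if "(x, y) \<in> link i j" for y
      using that
    proof (induction rule: rtrancl_induct)
      case (step y z)
      show ?case
      proof (rule var_eqs_cases[OF step(2)])
        assume "(y, z) \<in> var_eqs i 0 \<union> (var_eqs i 0)\<inverse>"
        then show ?thesis using step0[OF step(1)] step(3) by simp
      next
        fix r a b assume "prow r" "rop r = i" "rcl r = j" "eqrow r" "y = nam r a" "z = nam r b" "a = 0 \<and> b = 1 \<or> a = 1 \<and> b = 0"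
        then have "(?k y, ?k z) \<in> ?Z \<union> ?Z\<inverse>" by blast
        with step(3) show ?thesis by (rule rtrancl_into_rtrancl)
      qed
    qed simp
    moreover have "\<exists>y. k = ?k y \<and> (x, y) \<in> link i j" if "(?k x, k) \<in> (?Z \<union> ?Z\<inverse>)\<^sup>*" for k
      using that
    proof (induction rule: rtrancl_induct)
      case (step k k')
      then obtain y where y: "k = ?k y" "(x, y) \<in> link i j" by blast
      obtain r a b where r: "prow r" "eqrow r" "a = 0 \<and> b = 1 \<or> a = 1 \<and> b = (0::nat)"
        and k: "k = [rop r, rcl r, L0 [rop r, nam r a]]" "k' = [rop r, rcl r, L0 [rop r, nam r b]]"
        using step(2) by blast
      have ij: "rop r = i" "rcl r = j" "L0 [i, y] = L0 [i, nam r a]" using k(1) y(1) by auto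
      have "(y, nam r a) \<in> link i j" using prim[OF node[OF y(2)]] ij(3) link_mono by blast
      moreover have "(nam r a, nam r b) \<in> link i j" using r ij unfolding var_eqs_def by blast
      ultimately have "(x, nam r b) \<in> link i j" by (rule rtrancl_trans[OF y(2) rtrancl_trans])
      then show ?case using k(2) ij by blast
    qed blast
    moreover have "(x, y) \<in> link i j" if "?k y = ?k z" "(x, z) \<in> link i j" for z
    proof -
      have "(z, y) \<in> link i j" using prim[OF node[OF that(2)], of y] that(1) link_mono by auto
      then show ?thesis by (rule rtrancl_trans[OF that(2)])
    qed
    moreover have "L1 (?k x) = L1 (?k y) \<longleftrightarrow> (?k x, ?k y) \<in> (?Z \<union> ?Z\<inverse>)\<^sup>*"
      by (rule labelling_iff[OF L1[unfolded clause_labelling_def] True])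
    moreover have "L1 (?k x) \<noteq> 0" using nz True by blast
    ultimately have "(x, y) \<in> link i j \<longleftrightarrow> L1 (?k x) = L1 (?k y)" by blast
    then show ?thesis using \<open>L1 (?k x) \<noteq> 0\<close> by simp
  next
    case False
    have "L0 [i, x] = L0 [i, y]" if "(x, y) \<in> link i j" for y
      using that
    proof (induction rule: rtrancl_induct)
      case (step y z)
      show ?case
      proof (rule var_eqs_cases[OF step(2)])
        assume "(y, z) \<in> var_eqs i 0 \<union> (var_eqs i 0)\<inverse>"
        then show ?thesis using step0[OF step(1)] step(3) by simp
      next
        fix r a b assume r: "prow r" "rop r = i" "rcl r = j" "eqrow r" "y = nam r a" "z = nam r b" "a = 0 \<and> b = 1 \<or> a = 1 \<and> b = 0"
        then have "?k y \<in> ?N1" using eqrow_isv by blast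
        then show ?thesis using False step(3) by simp
      qed
    qed simp
    moreover have "L0 [i, x] = L0 [i, y] \<Longrightarrow> (x, y) \<in> link i j" using prim[OF x, of y] link_mono by blast
    moreover have "L1 (?k x) = 0" using nz False by blast
    ultimately show ?thesis by auto
  qed
qed

text \<open>The correctness of answering from two levels. With a nonzero second label, a primary row
  in the class of \<open>x\<close> is found through some row of clause \<open>j\<close> with the
  same primary label; such a row exists because the label is nonzero. With second label 0 the class
  is a primary one, and all relevant rows that meet it are primary.\<close>

lemma class_labels:
  assumes L0: "primary_labelling L0" and L1: "clause_labelling L0 L1"
  shows "(if L1 [i, j, L0 [i, x]] \<noteq> 0 then L1 [i, j, L0 [i, x]] \<in> labels1 L0 L1 b else L0 [i, x] \<in> labels0 L0 b) \<longleftrightarrow>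
     (\<exists>r a. prow r \<and> a < A \<and> isv r a \<and> rop r = i \<and> (rcl r = 0 \<or> rcl r = j) \<and> (x, nam r a) \<in> link i j \<and> b r a)"
    (is "?l \<longleftrightarrow> ?r")
proof -
  let ?N0 = "{[rop r, nam r a] |r a. prow r \<and> a < A \<and> isv r a}"
  let ?N1 = "{[rop r, rcl r, L0 [rop r, nam r a]] |r a. prow r \<and> a < A \<and> isv r a}"
  let ?Z0 = "{([rop r, nam r 0], [rop r, nam r 1]) |r. prow r \<and> rcl r = 0 \<and> eqrow r}"
  let ?Z1 = "{([rop r, rcl r, L0 [rop r, nam r 0]], [rop r, rcl r, L0 [rop r, nam r 1]]) |r. prow r \<and> eqrow r}"
  let ?k = "\<lambda>y. [i, j, L0 [i, y]]"
  have nz0: "L0 k \<noteq> 0 \<longleftrightarrow> k \<in> ?N0" for k using L0 by (auto simp: primary_labelling_def labelling_def)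
  have nz1: "L1 k \<noteq> 0 \<longleftrightarrow> k \<in> ?N1" for k using L1 by (auto simp: clause_labelling_def labelling_def)
  have inj0: "rop r = i" if "[i, x] \<in> ?N0" "L0 [i, x] = L0 [rop r, y]" for r y
  proof -
    have "([i, x], [rop r, y]) \<in> (?Z0 \<union> ?Z0\<inverse>)\<^sup>*"
      using labelling_iff[OF L0[unfolded primary_labelling_def] that(1)] that(2) by blast
    then have "hd [rop r, y] = i" by (induction rule: rtrancl_induct) auto
    then show ?thesis by simp
  qed
  have inj1: "k' = [i, j, l]" if "?k x \<in> ?N1" "L1 (?k x) = L1 k'" "k' = [i', j', l]" for i' j' l k'
  proof -
    have "(?k x, k') \<in> (?Z1 \<union> ?Z1\<inverse>)\<^sup>*"
      using labelling_iff[OF L1[unfolded clause_labelling_def] that(1)] that(2) by blast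
    then have "\<exists>l. k' = [i, j, l]" by (induction rule: rtrancl_induct) auto
    then show ?thesis using that(3) by auto
  qed
  show ?thesis
  proof (cases "[i, x] \<in> ?N0")
    case False
    \<comment> \<open>A variable that occurs in no precondition row of its operator has the default
      label 0 on both levels, and 0 is never recorded in a table of classes.\<close>
    then have "L0 [i, x] = 0" using nz0 by blast
    moreover have "L1 [i, j, 0] = 0"
    proof (rule ccontr)
      assume "L1 [i, j, 0] \<noteq> 0"
      then obtain r a where "prow r" "a < A" "isv r a" "L0 [rop r, nam r a] = 0" using nz1 by auto
      then show False using nz0[of "[rop r, nam r a]"] by blast
    qed
    moreover have "0 \<notin> labels0 L0 b"
    proof
      assume "0 \<in> labels0 L0 b"
      then obtain r a where "prow r" "a < A" "isv r a" "L0 [rop r, nam r a] = 0" unfolding labels0_def by auto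
      then show False using nz0[of "[rop r, nam r a]"] by blast
    qed
    moreover have "\<not> ?r"
    proof
      assume ?r
      then obtain r a where r: "prow r" "a < A" "isv r a" "rop r = i" "(x, nam r a) \<in> link i j" by blast
      then have "[i, nam r a] \<in> ?N0" by blast
      then have "[i, x] \<in> ?N0" by (rule link_nodes[OF link_sym[OF r(5)]])
      then show False using False by blast
    qed
    ultimately show ?thesis by simp
  next
    case x: True
    have link: "(x, nam r a) \<in> link i j \<longleftrightarrow> (if L1 (?k x) \<noteq> 0 then L1 (?k x) = L1 (?k (nam r a)) else L0 [i, x] = L0 [i, nam r a])"
      if "prow r" "a < A" "isv r a" "rop r = i" for r a
      by (rule class_link[OF L0 L1 x]) (use that in blast)
    show ?thesis
    proof (cases "L1 (?k x) \<noteq> 0")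
      case True
      then have kx: "?k x \<in> ?N1" using nz1 by blast
      have "L1 (?k x) \<in> labels1 L0 L1 b \<longleftrightarrow> ?r"
      proof
        assume "L1 (?k x) \<in> labels1 L0 L1 b"
        then obtain r a where r: "prow r" "a < A" "isv r a" "L1 (?k x) = L1 [rop r, rcl r, L0 [rop r, nam r a]]"
          and b: "b r a \<or> L0 [rop r, nam r a] \<in> labels0 L0 b" unfolding labels1_def by blast
        have ij: "rop r = i" "rcl r = j" using inj1[OF kx r(4) refl] by auto
        have ln: "(x, nam r a) \<in> link i j" using link[OF r(1-3) ij(1)] True r(4) ij by simp
        show ?r
        proof (cases "b r a")
          case False
          then obtain r' a' where r': "prow r'" "a' < A" "isv r' a'" "rcl r' = 0" "b r' a'" "L0 [rop r, nam r a] = L0 [rop r', nam r' a']"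
            using b unfolding labels0_def by blast
          have na: "[i, nam r a] \<in> ?N0" using r ij by blast
          have i': "rop r' = i"
          proof -
            have "([i, nam r a], [rop r', nam r' a']) \<in> (?Z0 \<union> ?Z0\<inverse>)\<^sup>*"
              using labelling_iff[OF L0[unfolded primary_labelling_def] na] r'(6) ij by blast
            then have "hd [rop r', nam r' a'] = i" by (induction rule: rtrancl_induct) auto
            then show ?thesis by simp
          qed
          then have "L0 [i, nam r a] = L0 [i, nam r' a']" using r'(6) ij by simp
          then have "(nam r a, nam r' a') \<in> link i j" by (rule subsetD[OF link_mono iffD1[OF primary_link[OF L0 na]]])
          then have "(x, nam r' a') \<in> link i j" by (rule rtrancl_trans[OF ln])
          then show ?thesis using r' i' by blast
        qed (use r ij ln in blast)
      next
        assume ?r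
        then obtain r a where r: "prow r" "a < A" "isv r a" "rop r = i" "rcl r = 0 \<or> rcl r = j" "(x, nam r a) \<in> link i j" "b r a" by blast
        have e: "L1 (?k x) = L1 (?k (nam r a))" using link[OF r(1-4)] r(6) True by simp
        then have "?k (nam r a) \<in> ?N1" using True nz1[of "?k (nam r a)"] by simp
        then obtain r' a' where r': "prow r'" "a' < A" "isv r' a'" "rop r' = i" "rcl r' = j" "L0 [i, nam r a] = L0 [i, nam r' a']"
          by auto
        show "L1 (?k x) \<in> labels1 L0 L1 b"
        proof (cases "rcl r = j")
          case True
          then show ?thesis unfolding labels1_def using r e by blast
        next
          case False
          then have "L0 [i, nam r' a'] \<in> labels0 L0 b" using r r'(6) unfolding labels0_def by force
          moreover have "L1 (?k x) = L1 [rop r', rcl r', L0 [rop r', nam r' a']]" using e r' by simp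
          ultimately show ?thesis unfolding labels1_def using r' by blast
        qed
      qed
      then show ?thesis using True by simp
    next
      case False
      have "L0 [i, x] \<in> labels0 L0 b \<longleftrightarrow> ?r"
      proof
        assume "L0 [i, x] \<in> labels0 L0 b"
        then obtain r a where r: "prow r" "a < A" "isv r a" "rcl r = 0" "b r a" "L0 [i, x] = L0 [rop r, nam r a]" unfolding labels0_def by blast
        moreover from this have "rop r = i" using inj0[OF x] by blast
        ultimately show ?r using link[of r a] False by auto
      next
        assume ?r
        then obtain r a where r: "prow r" "a < A" "isv r a" "rop r = i" "rcl r = 0 \<or> rcl r = j" "(x, nam r a) \<in> link i j" "b r a" by blast
        have e: "L0 [i, x] = L0 [i, nam r a]" using link[OF r(1-4)] r(6) False by simp
        have "rcl r \<noteq> j \<or> j = 0"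
        proof (rule ccontr)
          assume "\<not> (rcl r \<noteq> j \<or> j = 0)"
          then have "?k x \<in> ?N1" using r e by auto
          then show False using False nz1 by blast
        qed
        then show "L0 [i, x] \<in> labels0 L0 b" using r e unfolding labels0_def by auto
      qed
      then show ?thesis using False by simp
    qed
  qed
qed

end

context rows_mem
begin

lemma ev_key0: "m \<rho> [] = r \<Longrightarrow> row r \<Longrightarrow> map (ev B I m) (key0 \<rho> a) = [rop r, nam r a]"
  by (simp add: key0_def ev_row)

lemma ev_label0: "m \<rho> [] = r \<Longrightarrow> row r \<Longrightarrow> ev B I m (label0 \<rho> a) = m tL0 [rop r, nam r a]"
  by (simp add: label0_def ev_key0)

lemma ev_key1: "m \<rho> [] = r \<Longrightarrow> row r \<Longrightarrow> map (ev B I m) (key1 \<rho> a) = [rop r, rcl r, m tL0 [rop r, nam r a]]"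
  by (simp add: key1_def ev_row ev_label0)

lemma ev_label1: "m \<rho> [] = r \<Longrightarrow> row r \<Longrightarrow> ev B I m (label1 \<rho> a) = m tL1 [rop r, rcl r, m tL0 [rop r, nam r a]]"
  by (simp add: label1_def ev_key1)

lemma tr_eqE: "m \<rho> [] = r \<Longrightarrow> row r \<Longrightarrow> tr B I m (eqE \<rho>) \<longleftrightarrow> eqrow r"
  using B(4) by (simp add: eqE_def ev_row eqrow_def)

lemma tr_primaryE: "m \<rho> [] = r \<Longrightarrow> row r \<Longrightarrow> tr B I m (primaryE \<rho>) \<longleftrightarrow> rcl r = 0"
  by (simp add: primaryE_def ev_row)

lemma tr_excludesE:
  assumes "m tR [] = r" "prow r" "m tIND = tab X" "m tC [] = c"
  shows "tr B I m (excludesE a) \<longleftrightarrow> excludes X c r a"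
proof -
  have "(\<exists>b<2. Q b) \<longleftrightarrow> Q 0 \<or> Q 1" for Q :: "nat \<Rightarrow> bool" by (auto simp: less_2_cases_iff)
  then show ?thesis
    using assms prow_row[of r] B(4) by (simp add: excludesE_def excludes_def ev_row tr_posE pos_def upt_conv_Cons)
qed

lemma runs_primary_classes:
  assumes "m tL0 = (\<lambda>_. 0)"
  shows "runs B I K (primary_classes A) m classes_time
    (\<lambda>m'. primary_labelling (m' tL0) \<and> agree {tR, tS, tU, tV, tL0} m m')"
proof -
  have "runs B I K (primary_classes A) m classes_time
    (\<lambda>m'. labelling (Suc np * A) {[rop r, nam r a] |r a. prow r \<and> a < A \<and> isv r a}
      {([rop r, nam r 0], [rop r, nam r 1]) |r. prow r \<and> rcl r = 0 \<and> eqrow r} (m' tL0) \<and> agree {tR, tS, tU, tV, tL0} m m')"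
    unfolding primary_classes_def
    by (rule runs_classes[where kf = "\<lambda>r a. [rop r, nam r a]" and ed = "\<lambda>r. rcl r = 0 \<and> eqrow r"])
      (use assms B(4) prow_row in \<open>simp_all add: ev_key0 tr_eqE tr_primaryE in_K(7), simp_all add: eqrow_def\<close>)
  then show ?thesis by (simp add: primary_labelling_def)
qed

lemma runs_clause_classes:
  assumes "m tL1 = (\<lambda>_. 0)" "m tL0 = L0" "\<And>r a. prow r \<Longrightarrow> a < A \<Longrightarrow> isv r a \<Longrightarrow> (tL1, [rop r, rcl r, L0 [rop r, nam r a]]) \<in> K"
  shows "runs B I K (clause_classes A) m classes_time
    (\<lambda>m'. clause_labelling L0 (m' tL1) \<and> agree {tR, tS, tU, tV, tL1} m m')"
proof -
  have "runs B I K (clause_classes A) m classes_time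
    (\<lambda>m'. labelling (Suc np * A) {[rop r, rcl r, L0 [rop r, nam r a]] |r a. prow r \<and> a < A \<and> isv r a}
      {([rop r, rcl r, L0 [rop r, nam r 0]], [rop r, rcl r, L0 [rop r, nam r 1]]) |r. prow r \<and> eqrow r} (m' tL1) \<and> agree {tR, tS, tU, tV, tL1} m m')"
    unfolding clause_classes_def
    by (rule runs_classes[where kf = "\<lambda>r a. [rop r, rcl r, L0 [rop r, nam r a]]" and ed = eqrow])
      (use assms prow_row in \<open>simp_all add: ev_key1 tr_eqE agree_def, simp_all add: eqrow_def\<close>)
  then show ?thesis by (simp add: clause_labelling_def)
qed

lemma runs_class_tables:
  assumes co: "consts_ok m" and X: "m tIND = tab X" and L0: "m tL0 = L0" and L1: "m tL1 = L1"
    and bound: "\<And>k. L0 k < Suc np * A" "\<And>k. L1 k < Suc np * A"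
    and z: "m tH0 = (\<lambda>_. 0)" "m tH1 = (\<lambda>_. 0)" "m tW0 = (\<lambda>_. 0)" "m tW1 = (\<lambda>_. 0)"
  shows "runs B I K (class_tables A) m tables_time
    (\<lambda>m'. m' tH0 = tab {[l] |l. l \<in> labels0 L0 (\<lambda>r a. rtag r = 0)} \<and>
          m' tH1 = tab {[l] |l. l \<in> labels1 L0 L1 (\<lambda>r a. rtag r = 0)} \<and>
          m' tW0 = tab {[l, c] |l c. c \<in> cs \<and> l \<in> labels0 L0 (excludes X c)} \<and>
          m' tW1 = tab {[l, c] |l c. c \<in> cs \<and> l \<in> labels1 L0 L1 (excludes X c)} \<and>
          agree {tR, tX, tC, tH0, tH1, tW0, tW1} m m')"
proof -
  let ?p = "\<lambda>r a. rtag r = 0"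
  have K1: "(T, [L0 k]) \<in> K" "(T, [L1 k]) \<in> K" if "T < 32" for T k
    using in_K(3)[OF that] bound trans_less_add1 by blast+
  have K2: "(T, [L0 k, c]) \<in> K" "(T, [L1 k, c]) \<in> K" if "T < 32" "c \<in> cs" for T k c
    using in_K(5)[OF that(1) _ that(2)] bound by blast+
  have H0: "runs B I K (set_rows A tH0 (\<lambda>a. [label0 tR a]) (\<lambda>a. And (primaryE tR) (And (varE tR a) posE))) m (np * (2 * A + 5))
      (\<lambda>m'. m' tH0 = tab {[l] |l. l \<in> labels0 L0 ?p} \<and> agree {tR, tH0} m m')"
    by (rule runs_set_rows'[where S = "{}" and kf = "\<lambda>r a. [L0 [rop r, nam r a]]" and cf = "\<lambda>r a. rcl r = 0 \<and> isv r a \<and> rtag r = 0"])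
      (use B(4) L0 z K1 in \<open>auto simp: tab_empty ev_label0 tr_primaryE ev_row tr_posE pos_def labels0_def\<close>)
  have H1: "runs B I K (set_rows A tH1 (\<lambda>a. [label1 tR a]) (\<lambda>a. And (varE tR a) (Or posE (Get tH0 [label0 tR a])))) m1 (np * (2 * A + 5))
      (\<lambda>m'. m' tH1 = tab {[l] |l. l \<in> labels1 L0 L1 ?p} \<and> agree {tR, tH1} m1 m')"
    if "m1 tH0 = tab {[l] |l. l \<in> labels0 L0 ?p} \<and> agree {tR, tH0} m m1" for m1
    by (rule runs_set_rows'[where S = "{}" and kf = "\<lambda>r a. [L1 [rop r, rcl r, L0 [rop r, nam r a]]]"
          and cf = "\<lambda>r a. isv r a \<and> (rtag r = 0 \<or> L0 [rop r, nam r a] \<in> labels0 L0 ?p)"])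
      (use B(4) L0 L1 z K1 that in \<open>auto simp: tab_empty ev_label0 ev_label1 ev_row tr_posE pos_def labels1_def agree_def\<close>)
  define J where "J Z m' \<longleftrightarrow> m' tW0 = tab {[l, c] |l c. c \<in> Z \<and> l \<in> labels0 L0 (excludes X c)} \<and>
      m' tW1 = tab {[l, c] |l c. c \<in> Z \<and> l \<in> labels1 L0 L1 (excludes X c)} \<and>
      m' tIND = tab X \<and> m' tL0 = L0 \<and> m' tL1 = L1" for Z and m' :: tmem
  have body: "runs B I K (Seq (set_rows A tW0 (\<lambda>a. [label0 tR a, Reg tC]) (\<lambda>a. And (primaryE tR) (And (varE tR a) (excludesE a))))
           (set_rows A tW1 (\<lambda>a. [label1 tR a, Reg tC]) (\<lambda>a. And (varE tR a) (Or (excludesE a) (Get tW0 [label0 tR a, Reg tC])))))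
        m' (2 * (np * (2 * A + 5))) (\<lambda>m''. J (Z \<union> {c}) m'' \<and> agree {tR, tW0, tW1} m' m'')"
    if c: "c \<in> cs" and J: "J Z m'" and tC: "m' tC [] = c" for c Z m'
  proof (rule runs_Seq')
    show "runs B I K (set_rows A tW0 (\<lambda>a. [label0 tR a, Reg tC]) (\<lambda>a. And (primaryE tR) (And (varE tR a) (excludesE a)))) m' (np * (2 * A + 5))
      (\<lambda>m''. m'' tW0 = tab {[l, c'] |l c'. c' \<in> Z \<union> {c} \<and> l \<in> labels0 L0 (excludes X c')} \<and> agree {tR, tW0} m' m'')"
      by (rule runs_set_rows'[where S = "{[l, c'] |l c'. c' \<in> Z \<and> l \<in> labels0 L0 (excludes X c')}"
            and kf = "\<lambda>r a. [L0 [rop r, nam r a], c]" and cf = "\<lambda>r a. rcl r = 0 \<and> isv r a \<and> excludes X c r a"])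
        (use B(4) K2 J tC c in \<open>auto simp: J_def ev_label0 tr_primaryE ev_row tr_excludesE labels0_def\<close>)
    fix m1 assume m1: "m1 tW0 = tab {[l, c'] |l c'. c' \<in> Z \<union> {c} \<and> l \<in> labels0 L0 (excludes X c')} \<and> agree {tR, tW0} m' m1"
    have "runs B I K (set_rows A tW1 (\<lambda>a. [label1 tR a, Reg tC]) (\<lambda>a. And (varE tR a) (Or (excludesE a) (Get tW0 [label0 tR a, Reg tC])))) m1 (np * (2 * A + 5))
      (\<lambda>m''. m'' tW1 = tab {[l, c'] |l c'. c' \<in> Z \<union> {c} \<and> l \<in> labels1 L0 L1 (excludes X c')} \<and> agree {tR, tW1} m1 m'')"
      by (rule runs_set_rows'[where S = "{[l, c'] |l c'. c' \<in> Z \<and> l \<in> labels1 L0 L1 (excludes X c')}"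
            and kf = "\<lambda>r a. [L1 [rop r, rcl r, L0 [rop r, nam r a]], c]"
            and cf = "\<lambda>r a. isv r a \<and> (excludes X c r a \<or> L0 [rop r, nam r a] \<in> labels0 L0 (excludes X c))"])
        (use B(4) K2 J tC c m1 in \<open>auto simp: J_def ev_label0 ev_label1 ev_row tr_excludesE labels1_def agree_def\<close>)
    then show "runs B I K (set_rows A tW1 (\<lambda>a. [label1 tR a, Reg tC]) (\<lambda>a. And (varE tR a) (Or (excludesE a) (Get tW0 [label0 tR a, Reg tC])))) m1 (np * (2 * A + 5))
      (\<lambda>m''. J (Z \<union> {c}) m'' \<and> agree {tR, tW0, tW1} m' m'')"
      by (rule runs_weaken) (use m1 J in \<open>auto simp: J_def agree_def\<close>)
  qed simp
  have loop: "runs B I K (for_consts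
      (Seq (set_rows A tW0 (\<lambda>a. [label0 tR a, Reg tC]) (\<lambda>a. And (primaryE tR) (And (varE tR a) (excludesE a))))
           (set_rows A tW1 (\<lambda>a. [label1 tR a, Reg tC]) (\<lambda>a. And (varE tR a) (Or (excludesE a) (Get tW0 [label0 tR a, Reg tC]))))))
      m2 ((\<Sum>c\<in>cs. 2 * (np * (2 * A + 5)) + 3) + 2) (\<lambda>m'. J ({} \<union> (\<Union>c\<in>cs. {c})) m' \<and> agree {tR, tX, tC, tW0, tW1} m2 m')"
    if m2: "agree {tR, tH0, tH1} m m2" for m2
  proof (rule runs_for_consts[where J = "\<lambda>Z m'. J Z m' \<and> agree {tR, tX, tC, tW0, tW1} m2 m'" and G = "\<lambda>c. {c}"])
    show "consts_ok m2" using co m2 by (simp add: consts_ok_def agree_def)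
    show "J {} m2 \<and> agree {tR, tX, tC, tW0, tW1} m2 m2" using m2 X L0 L1 z by (auto simp: J_def agree_def tab_empty)
    fix c Z m' assume a: "c \<in> cs" "J Z m' \<and> agree {tR, tX, tC, tW0, tW1} m2 m'" "m' tC [] = c"
    show "runs B I K (Seq (set_rows A tW0 (\<lambda>a. [label0 tR a, Reg tC]) (\<lambda>a. And (primaryE tR) (And (varE tR a) (excludesE a))))
           (set_rows A tW1 (\<lambda>a. [label1 tR a, Reg tC]) (\<lambda>a. And (varE tR a) (Or (excludesE a) (Get tW0 [label0 tR a, Reg tC])))))
      m' (2 * (np * (2 * A + 5))) (\<lambda>m''. (J (Z \<union> {c}) m'' \<and> agree {tR, tX, tC, tW0, tW1} m2 m'') \<and> m'' tX = m' tX)"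
      by (rule runs_weaken[OF body[of c Z m', OF a(1) conjunct1[OF a(2)] a(3)] order_refl]) (use a(2) in \<open>auto simp: agree_def\<close>)
  qed (auto simp: J_def agree_def)
  show ?thesis
    unfolding class_tables_def tables_time_def
  proof (rule runs_Seq'[OF H0])
    fix m1 assume m1: "m1 tH0 = tab {[l] |l. l \<in> labels0 L0 ?p} \<and> agree {tR, tH0} m m1"
    show "runs B I K (Seq (set_rows A tH1 (\<lambda>a. [label1 tR a]) (\<lambda>a. And (varE tR a) (Or posE (Get tH0 [label0 tR a]))))
      (for_consts (Seq (set_rows A tW0 (\<lambda>a. [label0 tR a, Reg tC]) (\<lambda>a. And (primaryE tR) (And (varE tR a) (excludesE a))))
           (set_rows A tW1 (\<lambda>a. [label1 tR a, Reg tC]) (\<lambda>a. And (varE tR a) (Or (excludesE a) (Get tW0 [label0 tR a, Reg tC])))))))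
      m1 (np * (2 * A + 5) + (card cs * (2 * (np * (2 * A + 5)) + 3) + 2))
      (\<lambda>m'. m' tH0 = tab {[l] |l. l \<in> labels0 L0 (\<lambda>r a. rtag r = 0)} \<and>
          m' tH1 = tab {[l] |l. l \<in> labels1 L0 L1 (\<lambda>r a. rtag r = 0)} \<and>
          m' tW0 = tab {[l, c] |l c. c \<in> cs \<and> l \<in> labels0 L0 (excludes X c)} \<and>
          m' tW1 = tab {[l, c] |l c. c \<in> cs \<and> l \<in> labels1 L0 L1 (excludes X c)} \<and>
          agree {tR, tX, tC, tH0, tH1, tW0, tW1} m m')"
    proof (rule runs_Seq'[OF H1[OF m1]])
      fix m2 assume m2: "m2 tH1 = tab {[l] |l. l \<in> labels1 L0 L1 ?p} \<and> agree {tR, tH1} m1 m2"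
      have ag: "agree {tR, tH0, tH1} m m2" using m1 m2 by (simp add: agree_def)
      have h0: "m2 tH0 = tab {[l] |l. l \<in> labels0 L0 ?p}" using m1 m2 by (simp add: agree_def)
      show "runs B I K (for_consts (Seq (set_rows A tW0 (\<lambda>a. [label0 tR a, Reg tC]) (\<lambda>a. And (primaryE tR) (And (varE tR a) (excludesE a))))
           (set_rows A tW1 (\<lambda>a. [label1 tR a, Reg tC]) (\<lambda>a. And (varE tR a) (Or (excludesE a) (Get tW0 [label0 tR a, Reg tC]))))))
        m2 (card cs * (2 * (np * (2 * A + 5)) + 3) + 2)
        (\<lambda>m'. m' tH0 = tab {[l] |l. l \<in> labels0 L0 (\<lambda>r a. rtag r = 0)} \<and>
          m' tH1 = tab {[l] |l. l \<in> labels1 L0 L1 (\<lambda>r a. rtag r = 0)} \<and>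
          m' tW0 = tab {[l, c] |l c. c \<in> cs \<and> l \<in> labels0 L0 (excludes X c)} \<and>
          m' tW1 = tab {[l, c] |l c. c \<in> cs \<and> l \<in> labels1 L0 L1 (excludes X c)} \<and>
          agree {tR, tX, tC, tH0, tH1, tW0, tW1} m m')"
        by (rule runs_weaken[OF loop[OF ag]])
          (use h0 m2 ag in \<open>auto simp: J_def agree_def\<close>)
    qed simp
  qed simp
qed

end

section \<open>Queries\<close>

definition If_exp :: "exp \<Rightarrow> exp \<Rightarrow> exp \<Rightarrow> exp" where
  "If_exp e f g = Or (And e f) (And (Not_exp e) g)"

lemma tr_If_exp [simp]: "2 < B \<Longrightarrow> tr B I m (If_exp e f g) \<longleftrightarrow> (if tr B I m e then tr B I m f else tr B I m g)"
  by (simp add: If_exp_def)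

text \<open>The second conjunct treats clauses that were never flagged. They keep their initial
  domains, so the common domain is empty as soon as some linked variable occurs in a relevant
  positive precondition. Otherwise only equations with constants restrict it, and these are part of
  the first conjunct.\<close>

definition queryE :: exp where
  "queryE =
     (let i = In (Const 0) (Const 0); j = In (Const 0) (Const 1); x = In (Const 0) (Const 2); c = In (Const 0) (Const 3);
          l0 = Get tL0 [i, x]; l1 = Get tL1 [i, j, l0]
      in And (Not_exp (If_exp l1 (Get tW1 [l1, c]) (Get tW0 [l0, c])))
             (Or (If_exp (Get tOWN [i, j]) (Get tFLAG [i, j]) (Get tFLAG [i, Const 0]))
                 (Not_exp (If_exp l1 (Get tH1 [l1]) (Get tH0 [l0])))))"

lemma ev_queryE:
  assumes "2 < B"
  shows "ev B [[i, j, x, c]] m queryE =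
    (let l0 = m tL0 [i, x]; l1 = m tL1 [i, j, l0] in
      if (if l1 \<noteq> 0 then m tW1 [l1, c] else m tW0 [l0, c]) = 0 \<and>
         ((if m tOWN [i, j] \<noteq> 0 then m tFLAG [i, j] else m tFLAG [i, 0]) \<noteq> 0 \<or>
          (if l1 \<noteq> 0 then m tH1 [l1] else m tH0 [l0]) = 0)
      then 1 else 0)"
proof -
  \<comment> \<open>The answer has to be exactly 1 and not merely nonzero; \<open>And\<close> ends
    in a comparison, which guarantees this.\<close>
  have ev_And: "ev B I m (And e f) = (if tr B I m (And e f) then 1 else 0)" for I e f
    by (simp add: And_def tr_def)
  have q: "ev B [[i, j, x, c]] m (In (Const 0) (Const k)) = [i, j, x, c] ! k" if "k < 4" for k
    using that by (simp add: input_word_def)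
  show ?thesis
    unfolding queryE_def Let_def ev_And using assms by (simp add: q del: ev.simps(2))
qed

context encoded
begin

lemma pre_row_ex:
  assumes "(i, j) \<in> clause_ids P" "b \<in> set (pre (the_clause P (i, j)))"
  shows "\<exists>r. prow r \<and> row_op P r = i \<and> row_clause P r = j \<and> row_cond P r = b"
proof -
  obtain l where "l < length (pre (the_clause P (i, j)))" "pre (the_clause P (i, j)) ! l = b"
    using assms(2) by (auto simp: in_set_conv_nth)
  then have q: "((i, j, l), b) \<in> set (pre_list P)" using assms(1) by (simp add: mem_pre_list)
  then obtain r' where r': "r' < num_pre P" "pre_list P ! r' = ((i, j, l), b)"
    by (auto simp: in_set_conv_nth length_pre_list)
  then have p: "prow (Suc r')" "pid (Suc r') = (i, j, l)" by (simp_all add: prow_def pid_def)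
  then have "row_cond P (Suc r') = b" using prow_pid(1)[OF p(1)] q pre_list_functional by metis
  then show ?thesis using p prow_pid(2,3)[OF p(1)] by (intro exI[of _ "Suc r'"]) simp
qed

lemma row_pre:
  assumes "prow r"
  shows "row_cond P r \<in> set (pre (the_clause P (row_op P r, row_clause P r)))"
proof -
  obtain i j l where q: "pid r = (i, j, l)" by (cases "pid r")
  then show ?thesis using prow_pid[OF assms] by (simp add: mem_pre_list) (metis nth_mem)
qed

lemma equations_rows:
  assumes k: "(i, j) \<in> clause_ids P"
  shows "(s, t) \<in> equations P (i, j) \<longleftrightarrow> (\<exists>r. prow r \<and> row_op P r = i \<and> (row_clause P r = 0 \<or> row_clause P r = j) \<and>
     (row_cond P r = EQ s t \<or> row_cond P r = EQ t s))"
proof -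
  have prim: "pre (primary (the_op P (i, j))) = pre (the_clause P (i, 0))"
    by (simp add: the_clause_def the_op_def clauses_def)
  have rows: "b \<in> set (pre (the_clause P (i, j'))) \<longleftrightarrow> (\<exists>r. prow r \<and> row_op P r = i \<and> row_clause P r = j' \<and> row_cond P r = b)"
    if "(i, j') \<in> clause_ids P" for b j'
    using pre_row_ex[OF that] row_pre by blast
  show ?thesis
    unfolding equations_def prim mem_Collect_eq case_prod_conv rows[OF k] rows[OF primary_clause[OF k]] by blast
qed

lemma eqrow_cond: "eqrow r \<longleftrightarrow> row_cond P r = EQ (Var (nam r 0)) (Var (nam r 1))"
proof (cases "row_cond P r" rule: cond_tag.cases)
  case (3 s t)
  then show ?thesis by (cases s; cases t) (simp_all add: eqrow_def isv_def nam_def)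
qed (simp_all add: eqrow_def)

lemma cond_nam: "row_cond P r = EQ (Var x) (Var y) \<Longrightarrow> nam r 0 = x \<and> nam r 1 = y"
  by (simp add: nam_def)

lemma linked_link:
  assumes "(i, j) \<in> clause_ids P"
  shows "linked P (i, j) = link i j"
proof -
  have "(Var x, Var y) \<in> equations P (i, j) \<longleftrightarrow> (x, y) \<in> var_eqs i j \<union> (var_eqs i j)\<inverse>" for x y
  proof -
    have "(x, y) \<in> var_eqs i j \<longleftrightarrow> (\<exists>r. prow r \<and> row_op P r = i \<and> (row_clause P r = 0 \<or> row_clause P r = j) \<and> row_cond P r = EQ (Var x) (Var y))" for x y
    proof
      assume "(x, y) \<in> var_eqs i j"
      then obtain r where "prow r" "row_op P r = i" "row_clause P r = 0 \<or> row_clause P r = j" "eqrow r" "x = nam r 0" "y = nam r 1"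
        unfolding var_eqs_def by blast
      then show "\<exists>r. prow r \<and> row_op P r = i \<and> (row_clause P r = 0 \<or> row_clause P r = j) \<and> row_cond P r = EQ (Var x) (Var y)"
        using eqrow_cond by blast
    next
      assume "\<exists>r. prow r \<and> row_op P r = i \<and> (row_clause P r = 0 \<or> row_clause P r = j) \<and> row_cond P r = EQ (Var x) (Var y)"
      then obtain r where r: "prow r" "row_op P r = i" "row_clause P r = 0 \<or> row_clause P r = j" "row_cond P r = EQ (Var x) (Var y)" by blast
      have "eqrow r" unfolding eqrow_cond using cond_nam[OF r(4)] r(4) by simp
      then show "(x, y) \<in> var_eqs i j" using r cond_nam[OF r(4)] unfolding var_eqs_def by blast
    qed
    then show ?thesis unfolding equations_rows[OF assms] Un_iff converse_iff by blast
  qed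
  then have "{(x, y). (Var x, Var y) \<in> equations P (i, j)} = var_eqs i j \<union> (var_eqs i j)\<inverse>" by auto
  then show ?thesis by (simp only: linked_def)
qed

definition item :: "nat \<Rightarrow> nat \<Rightarrow> nat \<Rightarrow> nat \<Rightarrow> nat \<Rightarrow> bool" where
  "item i j y r a \<longleftrightarrow> prow r \<and> a < A \<and> isv r a \<and> row_op P r = i \<and> (row_clause P r = 0 \<or> row_clause P r = j) \<and> nam r a = y"

lemma inters_at_items:
  assumes c: "c \<in> consts_of P"
  shows "c \<in> inters_at P t (i, j) y \<longleftrightarrow>
    (\<forall>r a. item i j y r a \<and> cond_tag (row_cond P r) = 0 \<longrightarrow> (i, j) \<in> flagged P t \<and> [r, y, c] \<in> X_at t)"
proof -
  let ?ind = "if (i, j) \<in> flagged P t then ind_at P t else (\<lambda>_ _. {})"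
  have v: "Var y \<in> set (args (ratom r)) \<longleftrightarrow> (\<exists>a<A. isv r a \<and> nam r a = y)" if "prow r" for r
    using Var_iff[OF prow_row[OF that]] by (simp add: ratom_def)
  have "c \<in> inters_at P t (i, j) y \<longleftrightarrow> (\<forall>q a. (q, a) \<in> relevant P (i, j) \<and> Var y \<in> set (args a) \<longrightarrow> c \<in> ?ind q y)"
    unfolding inters_at_eq mem_intersected using c by blast
  also have "\<dots> \<longleftrightarrow> (\<forall>r a. item i j y r a \<and> cond_tag (row_cond P r) = 0 \<longrightarrow> c \<in> ?ind (pid r) y)"
  proof (intro iffI allI impI)
    fix r a assume all: "\<forall>q a. (q, a) \<in> relevant P (i, j) \<and> Var y \<in> set (args a) \<longrightarrow> c \<in> ?ind q y"
      and r: "item i j y r a \<and> cond_tag (row_cond P r) = 0"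
    then have "pos r" by (simp add: item_def pos_def)
    then have "(pid r, ratom r) \<in> relevant P (i, j)"
      using pos_pre_row prow_pid(2,3) r unfolding mem_relevant item_def fst_conv snd_conv by metis
    moreover have "Var y \<in> set (args (ratom r))" using v[of r] r unfolding item_def by blast
    ultimately show "c \<in> ?ind (pid r) y" using all by blast
  next
    fix q a assume all: "\<forall>r a. item i j y r a \<and> cond_tag (row_cond P r) = 0 \<longrightarrow> c \<in> ?ind (pid r) y"
      and q: "(q, a) \<in> relevant P (i, j) \<and> Var y \<in> set (args a)"
    then obtain r where r: "pos r" "pid r = q" "ratom r = a" using pos_pre_ex unfolding mem_relevant by blast
    have p: "prow r" "cond_tag (row_cond P r) = 0" using r(1) by (simp_all add: pos_def)
    obtain b where "b < A" "isv r b" "nam r b = y" using v[OF p(1)] q r(3) by blast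
    then have "item i j y r b"
      using p(1) prow_pid(2,3)[OF p(1)] q r(2) unfolding item_def mem_relevant fst_conv snd_conv by auto
    then show "c \<in> ?ind q y" using all p(2) r(2) by blast
  qed
  also have "\<dots> \<longleftrightarrow> (\<forall>r a. item i j y r a \<and> cond_tag (row_cond P r) = 0 \<longrightarrow> (i, j) \<in> flagged P t \<and> [r, y, c] \<in> X_at t)"
    by (auto simp: mem_X_at item_def)
  finally show ?thesis .
qed

lemma const_equations_items:
  assumes k: "(i, j) \<in> clause_ids P"
  shows "(\<forall>c'. (Var y, Cst c') \<in> equations P (i, j) \<longrightarrow> c = c') \<longleftrightarrow>
    (\<forall>r a. item i j y r a \<and> cond_tag (row_cond P r) = 2 \<longrightarrow> (\<forall>b<2. isc r b \<longrightarrow> nam r b = c))"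
proof (intro iffI allI impI)
  fix r a b assume all: "\<forall>c'. (Var y, Cst c') \<in> equations P (i, j) \<longrightarrow> c = c'"
    and r: "item i j y r a \<and> cond_tag (row_cond P r) = 2" and b: "b < 2" "isc r b"
  obtain s t where st: "row_cond P r = EQ s t" using r by (cases "row_cond P r" rule: cond_tag.cases) auto
  have "a < 2" using r st by (auto simp: item_def isv_def)
  then have "a = 0 \<and> b = 1 \<or> a = 1 \<and> b = 0"
    using b r st unfolding item_def isv_def isc_def by (auto simp: less_2_cases_iff)
  then have "row_cond P r = EQ (Var y) (Cst (nam r b)) \<or> row_cond P r = EQ (Cst (nam r b)) (Var y)"
    using b(2) r st unfolding item_def isv_def isc_def by (auto simp: nam_def)
  then have "(Var y, Cst (nam r b)) \<in> equations P (i, j)"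
    unfolding equations_rows[OF k] using r unfolding item_def by blast
  then show "nam r b = c" using all by blast
next
  fix c' assume all: "\<forall>r a. item i j y r a \<and> cond_tag (row_cond P r) = 2 \<longrightarrow> (\<forall>b<2. isc r b \<longrightarrow> nam r b = c)"
    and "(Var y, Cst c') \<in> equations P (i, j)"
  then obtain r where r: "prow r" "row_op P r = i" "row_clause P r = 0 \<or> row_clause P r = j"
    "row_cond P r = EQ (Var y) (Cst c') \<or> row_cond P r = EQ (Cst c') (Var y)" unfolding equations_rows[OF k] by blast
  from r(4) show "c = c'"
  proof
    assume e: "row_cond P r = EQ (Var y) (Cst c')"
    then have "item i j y r 0" "isc r 1" "nam r 1 = c'" "cond_tag (row_cond P r) = 2"
      using r A by (simp_all add: item_def isv_def isc_def nam_def)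
    then show ?thesis using all[rule_format, of r 0 1] by simp
  next
    assume e: "row_cond P r = EQ (Cst c') (Var y)"
    then have "item i j y r 1" "isc r 0" "nam r 0 = c'" "cond_tag (row_cond P r) = 2"
      using r A by (simp_all add: item_def isv_def isc_def nam_def)
    then show ?thesis using all[rule_format, of r 1 0] by simp
  qed
qed

text \<open>Membership in all linked domains and the equations with constants both become conditions
  on single argument positions. This leaves two existential statements of the form that
  \<open>class_labels\<close> decides.\<close>

lemma eq_restrict_items:
  assumes k: "(i, j) \<in> clause_ids P" and c: "c \<in> consts_of P"
  shows "c \<in> eq_restrict P (inters_at P t) (i, j) x \<longleftrightarrow>
    \<not> (\<exists>r a. prow r \<and> a < A \<and> isv r a \<and> row_op P r = i \<and> (row_clause P r = 0 \<or> row_clause P r = j) \<and>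
             (x, nam r a) \<in> link i j \<and> excludes (X_at t) c r a) \<and>
    ((i, j) \<in> flagged P t \<or>
     \<not> (\<exists>r a. prow r \<and> a < A \<and> isv r a \<and> row_op P r = i \<and> (row_clause P r = 0 \<or> row_clause P r = j) \<and>
              (x, nam r a) \<in> link i j \<and> cond_tag (row_cond P r) = 0))" (is "?l \<longleftrightarrow> \<not> ?W \<and> (?F \<or> \<not> ?H)")
proof -
  have W: "?W \<longleftrightarrow> (\<exists>y r a. (x, y) \<in> link i j \<and> item i j y r a \<and> excludes (X_at t) c r a)"
    unfolding item_def by blast
  have H: "?H \<longleftrightarrow> (\<exists>y r a. (x, y) \<in> link i j \<and> item i j y r a \<and> cond_tag (row_cond P r) = 0)"
    unfolding item_def by blast
  have ex: "excludes (X_at t) c r a \<longleftrightarrow> cond_tag (row_cond P r) = 0 \<and> [r, y, c] \<notin> X_at t \<or>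
      cond_tag (row_cond P r) = 2 \<and> \<not> (\<forall>b<2. isc r b \<longrightarrow> nam r b = c)" if "item i j y r a" for y r a
    using that unfolding item_def excludes_def by blast
  have "?l \<longleftrightarrow> (\<forall>y. (x, y) \<in> link i j \<longrightarrow>
      (\<forall>r a. item i j y r a \<and> cond_tag (row_cond P r) = 0 \<longrightarrow> (i, j) \<in> flagged P t \<and> [r, y, c] \<in> X_at t) \<and>
      (\<forall>r a. item i j y r a \<and> cond_tag (row_cond P r) = 2 \<longrightarrow> (\<forall>b<2. isc r b \<longrightarrow> nam r b = c)))"
    unfolding eq_restrict_def mem_Collect_eq linked_link[OF k] inters_at_items[OF c] const_equations_items[OF k] by (rule refl)
  also have "\<dots> \<longleftrightarrow> (\<forall>y r a. (x, y) \<in> link i j \<longrightarrow> item i j y r a \<longrightarrow>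
      \<not> excludes (X_at t) c r a \<and> (cond_tag (row_cond P r) = 0 \<longrightarrow> (i, j) \<in> flagged P t))"
    using ex by (intro iff_allI) meson
  also have "\<dots> \<longleftrightarrow> \<not> ?W \<and> (?F \<or> \<not> ?H)" unfolding W H by meson
  finally show ?thesis .
qed

lemma flagged_own:
  assumes "(i, j) \<in> clause_ids P"
  shows "(i, j) \<in> flagged P t \<longleftrightarrow> (if [i, j] \<in> own then [i, j] \<in> F_at t else [i, 0] \<in> F_at t)"
  using flagged_not_own[OF _ assms, of t] flagged_primary_own[of i t] by (auto simp: F_at_def)

definition result_mem :: "nat \<Rightarrow> tmem \<Rightarrow> bool" where
  "result_mem t m \<longleftrightarrow> primary_labelling (m tL0) \<and> clause_labelling (m tL0) (m tL1) \<and>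
     m tFLAG = tab (F_at t) \<and> m tOWN = tab own \<and>
     m tH0 = tab {[l] |l. l \<in> labels0 (m tL0) (\<lambda>r a. cond_tag (row_cond P r) = 0)} \<and>
     m tH1 = tab {[l] |l. l \<in> labels1 (m tL0) (m tL1) (\<lambda>r a. cond_tag (row_cond P r) = 0)} \<and>
     m tW0 = tab {[l, c] |l c. c \<in> consts_of P \<and> l \<in> labels0 (m tL0) (excludes (X_at t) c)} \<and>
     m tW1 = tab {[l, c] |l c. c \<in> consts_of P \<and> l \<in> labels1 (m tL0) (m tL1) (excludes (X_at t) c)}"

lemma query_result:
  assumes m: "result_mem t m" and k: "(i, j) \<in> clause_ids P" and c: "c \<in> consts_of P"
  shows "ev B [[i, j, x, c]] m queryE = (if c \<in> eq_restrict P (inters_at P t) (i, j) x then 1 else 0)"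
proof -
  have L: "primary_labelling (m tL0)" "clause_labelling (m tL0) (m tL1)"
    and tabs: "m tFLAG = tab (F_at t)" "m tOWN = tab own"
     "m tH0 = tab {[l] |l. l \<in> labels0 (m tL0) (\<lambda>r a. cond_tag (row_cond P r) = 0)}"
     "m tH1 = tab {[l] |l. l \<in> labels1 (m tL0) (m tL1) (\<lambda>r a. cond_tag (row_cond P r) = 0)}"
     "m tW0 = tab {[l, c] |l c. c \<in> consts_of P \<and> l \<in> labels0 (m tL0) (excludes (X_at t) c)}"
     "m tW1 = tab {[l, c] |l c. c \<in> consts_of P \<and> l \<in> labels1 (m tL0) (m tL1) (excludes (X_at t) c)}"
    using m unfolding result_mem_def by blast+
  let ?l0 = "m tL0 [i, x]"
  let ?l1 = "m tL1 [i, j, ?l0]"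
  have w: "(if ?l1 \<noteq> 0 then m tW1 [?l1, c] else m tW0 [?l0, c]) = 0 \<longleftrightarrow>
    \<not> (if ?l1 \<noteq> 0 then ?l1 \<in> labels1 (m tL0) (m tL1) (excludes (X_at t) c) else ?l0 \<in> labels0 (m tL0) (excludes (X_at t) c))"
    using c unfolding tabs by simp
  have h: "(if ?l1 \<noteq> 0 then m tH1 [?l1] else m tH0 [?l0]) = 0 \<longleftrightarrow>
    \<not> (if ?l1 \<noteq> 0 then ?l1 \<in> labels1 (m tL0) (m tL1) (\<lambda>r a. cond_tag (row_cond P r) = 0) else ?l0 \<in> labels0 (m tL0) (\<lambda>r a. cond_tag (row_cond P r) = 0))"
    unfolding tabs by simp
  have f: "(if m tOWN [i, j] \<noteq> 0 then m tFLAG [i, j] else m tFLAG [i, 0]) \<noteq> 0 \<longleftrightarrow> (i, j) \<in> flagged P t"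
    unfolding tabs flagged_own[OF k] by simp
  show ?thesis
    unfolding ev_queryE[OF B(4)] Let_def w h f class_labels[OF L] eq_restrict_items[OF k c] by (rule refl)
qed

end

section \<open>The implementation\<close>

text \<open>The grouping follows the space argument: the admissible keys of the second half depend
  on labels that the first half has computed.\<close>

definition program :: "nat \<Rightarrow> com" where
  "program A = Seq (Seq (initialise A) (Seq (Loop (Reg tCH) (round A)) (primary_classes A)))
     (Seq (clause_classes A) (class_tables A))"

text \<open>The bracket is \<open>loop_const\<close> written out. Of the rest,
  \<open>2 * A + 1\<close> pays for the tests of the main loop and \<open>28 * A + 84\<close> for
  initialisation, classes and tables.\<close>

definition time_const :: "nat \<Rightarrow> nat" where
  "time_const A = ((4 * A + 8) * (2 * A * A + 2) + A * (4 * A + 11) + A * (6 * A + 18) + 2 * A * (16 * A + 41 + 10 + 15 * A))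
     + 30 * A + 85"

text \<open>32 tables with keys from \<open>base_keys\<close>, and at most \<open>np * A\<close>
  further keys for the second level of labels.\<close>

definition space_const :: "nat \<Rightarrow> nat" where
  "space_const A = 32 * (10 * A + 5) + A"

lemma labelling_bound: "labelling b N Z L \<Longrightarrow> L k < b"
  by (simp add: labelling_def)

lemma card_comprehension:
  assumes "finite {x. p x}" "card {x. p x} \<le> m"
  shows "finite {f x |x. p x} \<and> card {f x |x. p x} \<le> m"
  using assms card_image_le[of "{x. p x}" f] by (simp add: setcompr_eq_image)

lemma card_comprehension2:
  assumes "finite {x. p x}" "card {x. p x} \<le> m" "finite {y. q y}" "card {y. q y} \<le> n"
  shows "finite {f x y |x y. p x \<and> q y} \<and> card {f x y |x y. p x \<and> q y} \<le> m * n"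
proof -
  have eq: "{f x y |x y. p x \<and> q y} = (\<lambda>(x, y). f x y) ` ({x. p x} \<times> {y. q y})" by auto
  have fin: "finite ({x. p x} \<times> {y. q y})" using assms by simp
  have "card ({x. p x} \<times> {y. q y}) \<le> m * n"
    unfolding card_cartesian_product using assms by (intro mult_le_mono)
  then show ?thesis unfolding eq using fin card_image_le[OF fin, of "\<lambda>(x, y). f x y"] by (intro conjI) (simp, linarith)
qed

lemma card_comprehension3:
  assumes "finite {x. p x}" "card {x. p x} \<le> m" "finite {y. q y}" "card {y. q y} \<le> n" "finite {z. r z}" "card {z. r z} \<le> l"
  shows "finite {f x y z |x y z. p x \<and> q y \<and> r z} \<and> card {f x y z |x y z. p x \<and> q y \<and> r z} \<le> m * (n * l)"
proof -
  have eq: "{f x y z |x y z. p x \<and> q y \<and> r z} = (\<lambda>(x, y, z). f x y z) ` ({x. p x} \<times> {y. q y} \<times> {z. r z})" by force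
  have fin: "finite ({x. p x} \<times> {y. q y} \<times> {z. r z})" using assms by simp
  have "card ({x. p x} \<times> {y. q y} \<times> {z. r z}) \<le> m * (n * l)"
    unfolding card_cartesian_product using assms by (intro mult_le_mono)
  then show ?thesis unfolding eq using fin card_image_le[OF fin, of "\<lambda>(x, y, z). f x y z"] by (intro conjI) (simp, linarith)
qed

context encoded
begin

lemma total_time:
  "((np + ne) * (4 * A + 3) + np * (2 * A + 5) + mm * (np * (2 * A + 5) + 3) + 6) +
   ((loop_const + 2 * A + 1) * bound + classes_time) + (classes_time + tables_time) \<le> time_const A * bound"
proof -
  let ?b = bound
  have nn: "np * np \<le> ?b"
  proof -
    have "1 * (np * np) \<le> mm * (np * np)" using cs by (intro mult_le_mono1) (simp add: num_consts_def)
    then show ?thesis using bounds(2) unfolding mult_1_left mult.assoc by (rule order_trans)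
  qed
  have k: "A * np \<le> A * ?b" "A * ne \<le> A * ?b" "A * (np * np) \<le> A * ?b" "A * (mm * np) \<le> A * ?b"
    by (intro mult_le_mono2 bounds nn)+
  have "((np + ne) * (4 * A + 3) + np * (2 * A + 5) + mm * (np * (2 * A + 5) + 3) + 6) + 2 * classes_time + tables_time =
     14 * (A * np) + 4 * (A * ne) + 6 * (A * (mm * np)) + 4 * (A * (np * np)) + 42 * np + 3 * ne + 15 * (mm * np) + 10 * (np * np) + 6 * mm + 8"
    unfolding classes_time_def tables_time_def by (simp add: algebra_simps)
  also have "\<dots> \<le> 28 * (A * ?b) + 84 * ?b"
    using k bounds nn by linarith
  finally have "((np + ne) * (4 * A + 3) + np * (2 * A + 5) + mm * (np * (2 * A + 5) + 3) + 6) + 2 * classes_time + tables_time \<le> 28 * (A * ?b) + 84 * ?b" .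
  moreover have "time_const A * ?b = (loop_const + 2 * A + 1) * ?b + (28 * (A * ?b) + 84 * ?b)"
  proof -
    have "time_const A = (loop_const + 2 * A + 1) + (28 * A + 84)" by (simp add: time_const_def loop_const_def)
    then show ?thesis by (simp only: distrib_right mult.assoc)
  qed
  ultimately show ?thesis by linarith
qed

lemma card_base_keys: "finite base_keys" "card base_keys \<le> (10 * A + 5) * (mm * np)"
proof -
  define S where "S = [{[]}, {[i] |i. i < Suc np * A + mm \<or> i \<in> consts_of P},
     {[l, c] |l c. l < Suc np * A \<and> c \<in> consts_of P}, {[row_op P r, row_clause P r] |r. prow r},
     {[row_op P r, nam r a] |r a. prow r \<and> a < A}, {[row_op P r, row_clause P r, nam r a] |r a. prow r \<and> a < A},
     {[r, nam r a, c] |r a c. prow r \<and> a < A \<and> c \<in> consts_of P},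
     {[row_op P r, row_clause P r, nam r a, c] |r a c. prow r \<and> a < A \<and> c \<in> consts_of P}]"
  have base: "base_keys = \<Union>(set S)"
    unfolding base_keys_def S_def list.set Union_insert Union_empty Un_assoc Un_empty_right by (rule refl)
  have prow: "finite {r. prow r}" "card {r. prow r} \<le> np"
  proof -
    have "{r. prow r} = {1..np}" by (auto simp: prow_def)
    then show "finite {r. prow r}" "card {r. prow r} \<le> np" by simp_all
  qed
  have ids: "finite {i. i < Suc np * A + mm \<or> i \<in> consts_of P}"
    "card {i. i < Suc np * A + mm \<or> i \<in> consts_of P} \<le> Suc np * A + mm + mm"
    unfolding Collect_disj_eq using finite_consts card_Un_le[of "{i. i < Suc np * A + mm}" "consts_of P"] by simp_all
  have less: "finite {a. a < n}" "card {a. a < n} \<le> n" for n :: nat by simp_all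
  have con: "finite {c. c \<in> consts_of P}" "card {c. c \<in> consts_of P} \<le> mm" using finite_consts by simp_all
  have S: "list_all2 (\<lambda>X n. finite X \<and> card X \<le> n) S
      [1, Suc np * A + mm + mm, Suc np * A * mm, np, np * A, np * A, np * (A * mm), np * (A * mm)]"
    unfolding S_def list_all2_Cons list_all2_Nil
    by (intro conjI card_comprehension card_comprehension2 card_comprehension3 prow ids less con TrueI) simp_all
  have U: "list_all2 (\<lambda>X n. finite X \<and> card X \<le> n) Xs ns \<Longrightarrow> finite (\<Union>(set Xs)) \<and> card (\<Union>(set Xs)) \<le> sum_list ns"
    for Xs :: "nat list set list" and ns
  proof (induction rule: list_all2_induct)
    case (Cons X Xs n ns)
    then show ?case using card_Un_le[of X "\<Union>(set Xs)"] by simp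
  qed simp
  show "finite base_keys" using U[OF S] by (simp add: base)
  have "card base_keys \<le> sum_list [1, Suc np * A + mm + mm, Suc np * A * mm, np, np * A, np * A, np * (A * mm), np * (A * mm)]"
    using U[OF S] by (simp only: base)
  also have "\<dots> = 1 + A * np + A + 2 * mm + A * (mm * np) + A * mm + np + 2 * (A * np) + 2 * (A * (mm * np))"
    by (simp add: algebra_simps)
  also have "\<dots> \<le> (10 * A + 5) * (mm * np)"
  proof -
    have p: "1 \<le> mm * np" "np \<le> mm * np" "mm \<le> mm * np" using cs np by (auto simp: num_consts_def)
    have "A * 1 \<le> A * (mm * np)" "A * np \<le> A * (mm * np)" "A * mm \<le> A * (mm * np)"
      by (intro mult_le_mono2 p)+
    moreover have "(10 * A + 5) * (mm * np) = 10 * (A * (mm * np)) + 5 * (mm * np)" by (simp add: algebra_simps)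
    ultimately show ?thesis using p by linarith
  qed
  finally show "card base_keys \<le> (10 * A + 5) * (mm * np)" .
qed

lemma program_result:
  "\<exists>n M. exec B (encode P) (program A) Map.empty n M \<and> n \<le> time_const A * bound \<and> finite (dom M) \<and>
     card (dom M) \<le> space_const A * (mm * np) \<and> result_mem rounds (contents M)"
proof -
  let ?K0 = "{..<32::nat} \<times> base_keys"
  let ?I = "encode P"
  let ?t1 = "((np + ne) * (4 * A + 3) + np * (2 * A + 5) + mm * (np * (2 * A + 5) + 3) + 6) + ((loop_const + 2 * A + 1) * bound + classes_time)"
  interpret M0: encoded_mem P A B ?K0 by unfold_locales simp
  have "runs B ?I ?K0 (Seq (initialise A) (Seq (Loop (Reg tCH) (round A)) (primary_classes A))) (\<lambda>_ _. 0) ?t1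
    (\<lambda>m. primary_labelling (m tL0) \<and> (\<exists>m0. state_mem rounds m0 \<and> agree {tR, tS, tU, tV, tL0} m0 m))"
  proof (rule runs_Seq'[OF M0.runs_initialise])
    fix m1 assume "round_state {} {} {} {} {} {[]} {[]} m1"
    then have "state_mem 0 m1" by (rule state_mem_0)
    then show "runs B ?I ?K0 (Seq (Loop (Reg tCH) (round A)) (primary_classes A)) m1 ((loop_const + 2 * A + 1) * bound + classes_time)
      (\<lambda>m. primary_labelling (m tL0) \<and> (\<exists>m0. state_mem rounds m0 \<and> agree {tR, tS, tU, tV, tL0} m0 m))"
    proof (rule runs_Seq'[OF M0.runs_main_loop])
      fix m2 assume m2: "state_mem rounds m2"
      then have z: "m2 tL0 = (\<lambda>_. 0)" unfolding state_mem_def round_state_def by simp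
      show "runs B ?I ?K0 (primary_classes A) m2 classes_time
        (\<lambda>m. primary_labelling (m tL0) \<and> (\<exists>m0. state_mem rounds m0 \<and> agree {tR, tS, tU, tV, tL0} m0 m))"
        by (rule runs_weaken[OF M0.runs_primary_classes[where m = m2, OF z] order_refl]) (use m2 in blast)
    qed simp
  qed simp_all
  moreover have "contents Map.empty = (\<lambda>_ _. 0)" "dom Map.empty \<subseteq> ?K0" by (simp_all add: contents_empty)
  ultimately obtain n1 M1 m0 where 1: "exec B ?I (Seq (initialise A) (Seq (Loop (Reg tCH) (round A)) (primary_classes A))) Map.empty n1 M1"
      "n1 \<le> ?t1" "dom M1 \<subseteq> ?K0" "primary_labelling (contents M1 tL0)"
      "state_mem rounds m0" "agree {tR, tS, tU, tV, tL0} m0 (contents M1)"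
    unfolding runs_def by blast
  define m1 where "m1 = contents M1"
  define L0 where "L0 = m1 tL0"
  \<comment> \<open>The keys of the second level contain labels computed at the first level.\<close>
  define X where "X = (\<lambda>(r, a). (tL1, [row_op P r, row_clause P r, L0 [row_op P r, nam r a]])) ` ({1..np} \<times> {..<A})"
  let ?K1 = "?K0 \<union> X"
  have X: "(tL1, [row_op P r, row_clause P r, L0 [row_op P r, nam r a]]) \<in> ?K1" if "prow r" "a < A" for r a
    using that unfolding X_def prow_def by force
  interpret M1: encoded_mem P A B ?K1 by unfold_locales simp
  have m0: "m0 tIND = tab (X_at rounds)" "m0 tFLAG = tab (F_at rounds)" "m0 tOWN = tab own" "consts_ok m0"
      "\<And>t. t \<in> {22..30} \<Longrightarrow> m0 t = (\<lambda>_. 0)"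
    using 1(5) unfolding state_mem_def round_state_def by blast+
  have m1: "m1 tIND = tab (X_at rounds)" "m1 tFLAG = tab (F_at rounds)" "m1 tOWN = tab own" "consts_ok m1"
      "m1 tL1 = (\<lambda>_. 0)" "m1 tH0 = (\<lambda>_. 0)" "m1 tH1 = (\<lambda>_. 0)" "m1 tW0 = (\<lambda>_. 0)" "m1 tW1 = (\<lambda>_. 0)"
    using m0 1(6) unfolding m1_def by (simp_all add: agree_def consts_ok_def)
  have L0: "primary_labelling L0" using 1(4) by (simp add: L0_def m1_def)
  let ?t2 = "classes_time + tables_time"
  have "runs B ?I ?K1 (Seq (clause_classes A) (class_tables A)) m1 ?t2 (result_mem rounds)"
  proof (rule runs_Seq')
    show "runs B ?I ?K1 (clause_classes A) m1 classes_time
      (\<lambda>m'. clause_labelling L0 (m' tL1) \<and> agree {tR, tS, tU, tV, tL1} m1 m')"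
      by (rule M1.runs_clause_classes) (use m1 X in \<open>simp_all add: L0_def\<close>)
    fix m2 assume m2: "clause_labelling L0 (m2 tL1) \<and> agree {tR, tS, tU, tV, tL1} m1 m2"
    have eqs: "m2 tIND = tab (X_at rounds)" "m2 tFLAG = tab (F_at rounds)" "m2 tOWN = tab own" "consts_ok m2" "m2 tL0 = L0"
      "m2 tH0 = (\<lambda>_. 0)" "m2 tH1 = (\<lambda>_. 0)" "m2 tW0 = (\<lambda>_. 0)" "m2 tW1 = (\<lambda>_. 0)"
      using m1 m2 by (simp_all add: agree_def consts_ok_def L0_def)
    have bnd: "L0 k < Suc np * A" "m2 tL1 k < Suc np * A" for k
      by (rule labelling_bound[OF L0[unfolded primary_labelling_def]]
        labelling_bound[OF conjunct1[OF m2, unfolded clause_labelling_def]])+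
    show "runs B ?I ?K1 (class_tables A) m2 tables_time (result_mem rounds)"
      by (rule runs_weaken[OF M1.runs_class_tables[where m = m2 and X = "X_at rounds" and ?L0.0 = L0 and ?L1.0 = "m2 tL1", OF eqs(4,1,5) refl bnd eqs(6-9)] order_refl])
        (use eqs L0 m2 in \<open>simp add: result_mem_def agree_def\<close>)
  qed simp
  moreover have "dom M1 \<subseteq> ?K1" using 1(3) by blast
  ultimately obtain n2 M2 where 2: "exec B ?I (Seq (clause_classes A) (class_tables A)) M1 n2 M2" "n2 \<le> ?t2" "dom M2 \<subseteq> ?K1"
      "result_mem rounds (contents M2)"
    unfolding runs_def m1_def by blast
  have "exec B ?I (program A) Map.empty (n1 + n2) M2"
    unfolding program_def by (rule exec.Seq[OF 1(1) 2(1)])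
  moreover have "n1 + n2 \<le> time_const A * bound"
    by (rule order_trans[OF add_mono[OF 1(2) 2(2)] total_time])
  moreover have fX: "finite X" by (simp add: X_def)
  moreover have fK: "finite ?K1" using card_base_keys(1) fX by simp
  moreover have "card ?K1 \<le> space_const A * (mm * np)"
  proof -
    have "card ?K1 \<le> card ?K0 + card X" by (rule card_Un_le)
    moreover have "card ?K0 = 32 * card base_keys" by (simp add: card_cartesian_product)
    moreover have "card X \<le> np * A"
      unfolding X_def by (rule order_trans[OF card_image_le]) (simp_all add: card_cartesian_product)
    moreover have "np * A \<le> A * (mm * np)" using cs by (simp add: num_consts_def)
    moreover have "space_const A * (mm * np) = 32 * ((10 * A + 5) * (mm * np)) + A * (mm * np)"
      by (simp add: space_const_def distrib_right mult.assoc)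
    ultimately show ?thesis using card_base_keys(2) by linarith
  qed
  ultimately show ?thesis
    using 2(3,4) finite_subset[OF 2(3) fK] card_mono[OF fK 2(3)] by (intro exI[of _ "n1 + n2"] exI[of _ M2]) simp
qed

lemma query_represents:
  assumes "result_mem t (contents M)"
  shows "represents_domains B P (Put 0 [] queryE) 1 M (eq_restrict P (inters_at P t))"
  unfolding represents_domains_def
proof (intro ballI, unfold split_paired_all case_prod_conv, intro ballI)
  fix i j x c assume k: "(i, j) \<in> clause_ids P" and c: "c \<in> consts_of P"
  let ?I = "[[i, j, x, c]]"
  let ?M = "M((0, map (eval B ?I M) []) \<mapsto> eval B ?I M queryE)"
  have "exec B ?I (Put 0 [] queryE) M 1 ?M" by (rule exec.Put)
  moreover have "?M (0, []) = Some (if c \<in> eq_restrict P (inters_at P t) (i, j) x then 1 else 0)"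
    using query_result[OF assms k c] by (simp add: eval_eq_ev)
  ultimately show "\<exists>n M'. exec B ?I (Put 0 [] queryE) M n M' \<and> n \<le> 1 \<and>
      M' (0, []) = Some (if c \<in> eq_restrict P (inters_at P t) (i, j) x then 1 else 0)" by blast
qed

lemma domains_rounds: "find_parameter_domains P = Some (eq_restrict P (inters_at P rounds))"
proof -
  obtain t where "rounds = Suc t" using rounds(1) by (cases rounds) auto
  then show ?thesis using find_parameter_domains_eq[OF no_dirty] rounds(2) by simp
qed

end

lemma arity_bounded_mono: "arity_bounded A P \<Longrightarrow> A \<le> A' \<Longrightarrow> arity_bounded A' P"
  unfolding arity_bounded_def by (meson order_trans)

text \<open>The bound \<open>Suc np * A\<close> on labels decides the exponent. For the problem size
  \<open>s\<close> it is at most \<open>s * A\<close>, and \<open>A < 2 ^ A \<le> s ^ A\<close> puts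
  it below \<open>s * s ^ A\<close>; one more factor \<open>s\<close> makes the word size exceed
  \<open>s\<close> itself.\<close>

lemma encoded_word_size:
  assumes "wf_problem P" "arity_bounded A P" "2 \<le> A" "1 \<le> num_consts P" "1 \<le> num_pre P" "1 \<le> num_eff P"
  shows "encoded P A (word_size (A + 2) P)"
proof
  define s where "s = num_consts P + num_pre P + num_eff P"
  have s: "3 \<le> s" "Suc (num_pre P) \<le> s" "Suc (num_pre P + num_eff P) \<le> s" "num_consts P < s"
    using assms by (simp_all add: s_def)
  have w: "word_size (A + 2) P = s * (s * s ^ A)" by (simp add: word_size_def s_def)
  have "A < 2 ^ A" by (rule less_exp)
  also have "(2::nat) ^ A \<le> s ^ A" using s(1) by (intro power_mono) auto
  finally have A: "A < s ^ A" .
  then have 1: "s * 1 \<le> s * s ^ A" by (intro mult_le_mono2) simp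
  have "s * s \<le> s * (s * s ^ A)" using 1 by (intro mult_le_mono2) simp
  moreover have "s < s * s" using s(1) by simp
  ultimately have lt: "s < word_size (A + 2) P" unfolding w by linarith
  show "Suc (num_pre P + num_eff P) < word_size (A + 2) P" "num_consts P < word_size (A + 2) P" "2 < word_size (A + 2) P"
    using lt s by linarith+
  have "Suc (num_pre P) * A \<le> s * A" using s(2) by (rule mult_le_mono1)
  also have "s * A < s * s ^ A" using A s(1) by simp
  also have "\<dots> \<le> s * (s * s ^ A)" using s(1) by (intro mult_le_mono2) simp
  finally show "Suc (num_pre P) * A < word_size (A + 2) P" unfolding w .
qed (use assms in simp_all)

theorem theorem2:
  fixes A :: nat
  shows "\<exists>prog query w C. \<forall>P. wf_problem P \<longrightarrow> arity_bounded A P \<longrightarrow>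
           num_consts P \<ge> 1 \<longrightarrow> num_pre P \<ge> 1 \<longrightarrow> num_eff P \<ge> 1 \<longrightarrow>
           implements_fpd w prog query C P
             (C * (num_consts P * num_pre P * num_eff P * (num_pre P + num_eff P)))
             (C * (num_consts P * num_pre P))"
proof (intro exI allI impI)
  fix P assume P: "wf_problem P" "arity_bounded A P" "num_consts P \<ge> 1" "num_pre P \<ge> 1" "num_eff P \<ge> 1"
  \<comment> \<open>An equation has two terms even if the predicates have fewer arguments.\<close>
  let ?A = "max A 2"
  let ?w = "?A + 2" and ?C = "time_const ?A + space_const ?A + 1"
  interpret encoded P ?A "word_size ?w P"
    by (rule encoded_word_size) (use P arity_bounded_mono[OF P(2)] in simp_all)
  obtain n M where M: "exec (word_size ?w P) (encode P) (program ?A) Map.empty n M" "n \<le> time_const ?A * bound"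
      "finite (dom M)" "card (dom M) \<le> space_const ?A * (num_consts P * num_pre P)" "result_mem rounds (contents M)"
    using program_result unfolding num_consts_def by blast
  have "represents_domains (word_size ?w P) P (Put 0 [] queryE) ?C M (eq_restrict P (inters_at P rounds))"
    using query_represents[OF M(5)] unfolding represents_domains_def by fastforce
  moreover have "time_const ?A * bound \<le> ?C * (num_consts P * num_pre P * num_eff P * (num_pre P + num_eff P))"
    unfolding bound_def num_consts_def by (intro mult_le_mono1) simp
  moreover have "space_const ?A * (num_consts P * num_pre P) \<le> ?C * (num_consts P * num_pre P)"
    by (intro mult_le_mono1) simp
  ultimately show "implements_fpd ?w (program ?A) (Put 0 [] queryE) ?C P
      (?C * (num_consts P * num_pre P * num_eff P * (num_pre P + num_eff P))) (?C * (num_consts P * num_pre P))"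
    unfolding implements_fpd_def using domains_rounds M(1-4) order_trans by blast
qed

end
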